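(* Let $\kappa,\lambda$ be regular cardinals, $T$ a generalized $\kappa$-algebraic theory and $\mathcal{C}_T$ its syntactic category of contexts, seen as a clan. Then the assignment $\Gamma\mapsto\mathbb{L}^T_\lambda(\Gamma)$ (first-order formulas in context $\Gamma$ modulo provable equivalence) is a $\lambda$-boolean algebra over $\mathcal{C}_T$. Moreover it is an initial object of the category of $\lambda$-boolean algebras over $\mathcal{C}_T$.
   Context: **Generalized $\kappa$-algebraic theories.** Fix variables $\{x_\alpha\}_{\alpha<\kappa}$ and a set of symbols. Expressions are generated inductively: variables, symbols, and $F(e_\alpha)_{\alpha<\mu}$ for a symbol $F$, expressions $e_\alpha$, $\mu<\kappa$. A premise is a sequence $\{x_\alpha:\Delta_\alpha\}_{\alpha<\mu}$, $\mu<\kappa$, with $\Delta_\alpha$ expressions. Judgments are $\Gamma\vdash\Delta\ \mathsf{Type}$, $\Gamma\vdash t:\Delta$, $\Gamma\vdash\Delta\equiv\Delta'$, $\Gamma\vdash t\equiv_\Delta t'$, with $\Gamma$ a premise. A $\kappa$-pretheory consists of sort symbols $B$, each with an introductory judgment $\{x_\alpha:\Delta_\alpha\}_{\alpha<\mu}\vdash B(x_\alpha)_{\alpha<\mu}\ \mathsf{Type}$; operation symbols $F$, each with an introductory judgment $\{x_\alpha:\Delta_\alpha\}_{\alpha<\mu}\vdash F(x_\alpha)_{\alpha<\mu}:\Delta$; and a set of axioms, which are type or term equality judgments. A premise $\{x_\alpha:\Delta_\alpha\}_{\alpha<\mu}$ is a context if $\{x_\beta:\Delta_\beta\}_{\beta<\alpha}\vdash\Delta_\alpha\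 \mathsf{Type}$ is derived for all $\alpha<\mu$. Derived judgments are the smallest class closed under: reflexivity, symmetry and transitivity of both kinds of $\equiv$; conversion (from $\Gamma\vdash A_1\equiv A_2$ and $\Gamma\vdash t:A_1$, resp. $\Gamma\vdash t_1\equiv_{A_1}t_2$, infer $\Gamma\vdash t:A_2$, resp. $\Gamma\vdash t_1\equiv_{A_2}t_2$); variables ($\Gamma\vdash x_\alpha:\Delta_\alpha$ for $\Gamma=\{x_\alpha:\Delta_\alpha\}_\alpha$ a context); for a symbol with well-formed introductory judgment over $\{x_\alpha:\Delta_\alpha\}_{\alpha<\mu}$, a context $\Gamma$, and terms with $\Gamma\vdash t_\alpha:\Delta_\alpha[t_\beta|x_\beta]_{\beta<\alpha}$ for all $\alpha<\mu$, infer $\Gamma\vdash B(t_\alpha)_{\alpha<\mu}\ \mathsf{Type}$, resp. $\Gamma\vdash F(t_\alpha)_{\alpha<\mu}:\Delta[t_\alpha|x_\alpha]_{\alpha<\mu}$; congruence (from $\{x_\alpha:\Delta_\alpha\}_{\alpha<\mu}\vdash\Delta\equiv\Delta'$, resp. $\vdash t\equiv_\Delta t'$, and $\Gamma\vdash s_\alpha\equiv s'_\alpha$ in $\Delta_\alpha[s_\beta|x_\beta]_{\beta<\alpha}$ for all $\alpha$, with $\Gamma$ a context, infer $\Gamma\vdash\Delta[s|x]\equiv\Delta'[s'|x]$, resp. $\Gamma\vdash t[s|x]\equiv_{\Delta[s|x]}t'[s'|x]$); and each axiom, once both its sides are derived types, resp. derived terms of the stated type. A judgment $\Gamma\vdash\Delta\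 \mathsf{Type}$ is well-formed if $\Gamma$ is a context; $\Gamma\vdash t:\Delta$ is well-formed if $\Gamma\vdash\Delta\ \mathsf{Type}$ is derived; an equality judgment is well-formed if both sides are derived. A generalized $\kappa$-algebraic theory is a $\kappa$-pretheory all of whose introductory judgments and axioms are well-formed. **Syntactic category.** A morphism of contexts $\{x_\alpha:\Delta_\alpha\}_{\alpha<\mu}\to\{x_\beta:\Omega_\beta\}_{\beta<\nu}$ is a sequence $(t_\beta)_{\beta<\nu}$ with $\{x_\alpha:\Delta_\alpha\}_\alpha\vdash t_\beta:\Omega_\beta[t_\gamma|x_\gamma]_{\gamma<\beta}$ derived; composition is substitution. $\mathcal{C}_T$ has as objects contexts and as arrows morphisms of contexts, both modulo derivable componentwise equality $\equiv$ (contexts derivably equal in this sense are identified everywhere). For $\beta\le\alpha$ the projection from $\Gamma'=\{x_i:\Gamma_i\}_{i<\alpha}$ to its initial segment $\Gamma=\{x_i:\Gamma_i\}_{i<\beta}$ is called a generalized display map. $\mathcal{C}_T$ is a clan whose fibrations are, up to isomorphism, the generalized display maps; their pullbacks are given by substitution in types. **Clans.** A clan is a category with a class of fibrations such that there is a terminal object $1$ and every $X\to1$ is a fibration, isomorphisms are fibrations, fibrations compose, and pullbacks of fibrations along arbitrary maps exist and are fibrations. **Formulas.** The sets $\mathcal{L}^T_\lambda(\Gamma)$, for $\Gamma$ a context, are defined inductively: $\top,\bot\in\mathcal{L}^T_\lambda(\Gamma)$; closed under $\neg$ and under $\bigvee_{i\in I},\bigwedge_{i\in I}$ for $\lambda$-small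 $I$; and if $\Gamma'=\{x_\beta:\Gamma_\beta\}_{\beta<\alpha}$ is a context with initial segment $\Gamma$ of length $\gamma<\alpha<\kappa$ and $\Phi\in\mathcal{L}^T_\lambda(\Gamma')$, then $\exists\{x_\beta:\Gamma_\beta\}_{\gamma\le\beta<\alpha}\Phi$ and $\forall\{x_\beta:\Gamma_\beta\}_{\gamma\le\beta<\alpha}\Phi$ are in $\mathcal{L}^T_\lambda(\Gamma)$. There are no other atomic formulas (in particular no equality). For a context morphism $f:\Delta\to\Gamma$, $f^*:\mathcal{L}^T_\lambda(\Gamma)\to\mathcal{L}^T_\lambda(\Delta)$ is substitution: it commutes with $\top,\bot,\neg,\bigvee,\bigwedge$, and with quantifiers by substituting also in the types of the bound variables, i.e. $f^*(\exists\{x_\beta:\Gamma_\beta\}\Phi)=\exists\{x_\beta:f^*\Gamma_\beta\}f^*\Phi$ (on the right $f^*\Phi$ is pullback along the map from the canonical pullback context), and likewise for $\forall$. **Provability.** $(\vdash_\Gamma)_\Gamma$ is the smallest family of relations on the sets $\mathcal{L}^T_\lambda(\Gamma)$ such that: each is reflexive and transitive; $\Phi\vdash_\Gamma\top$, $\bot\vdash_\Gamma\Phi$; $\Phi\wedge\neg\Phi\vdash_\Gamma\bot$, $\top\vdash_\Gamma\Phi\vee\neg\Phi$; $\bigvee_i\Phi_i\vdash_\Gamma\Psi$ iff $\Phi_i\vdash_\Gamma\Psi$ for all $i$; $\Psi\vdash_\Gamma\bigwedge_i\Phi_i$ iff $\Psi\vdash_\Gamma\Phi_i$ for all $i$; and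 for a generalized display map $p:\Gamma'\to\Gamma$ forgetting $\{x_\beta:\Gamma_\beta\}_{\gamma\le\beta<\alpha}$, $\Psi\in\mathcal{L}^T_\lambda(\Gamma')$, $\Phi\in\mathcal{L}^T_\lambda(\Gamma)$: $\exists\{x_\beta:\Gamma_\beta\}\Psi\vdash_\Gamma\Phi$ iff $\Psi\vdash_{\Gamma'}p^*\Phi$, and $\Phi\vdash_\Gamma\forall\{x_\beta:\Gamma_\beta\}\Psi$ iff $p^*\Phi\vdash_{\Gamma'}\Psi$. $\mathbb{L}^T_\lambda(\Gamma)$ is the quotient of $\mathcal{L}^T_\lambda(\Gamma)$ by the relation "$\Phi\vdash_\Gamma\Psi$ and $\Psi\vdash_\Gamma\Phi$", with functoriality $f^*$. **Boolean algebras over a clan.** $\mathbf{Bool}_\lambda$ is the category of boolean algebras with joins of $\lambda$-small families, and boolean algebra morphisms preserving these joins. A $\lambda$-boolean algebra over a clan $\mathcal{C}$ is a functor $\mathcal{B}:\mathcal{C}^{op}\to\mathbf{Bool}_\lambda$ such that for each fibration $\pi:Z\to X$ the map $\pi^*$ has a left adjoint $\exists_\pi:\mathcal{B}(Z)\to\mathcal{B}(X)$, and for every pullback square of $\pi$ along $f:X'\to X$, with $\pi':Z'\to X'$ and $f':Z'\to Z$, one has $f^*\exists_\pi=\exists_{\pi'}f'^*$. Morphisms are natural transformations commuting with all $\exists_\pi$.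
   Formalization: Provability is additionally required to be stable under substitution f^* along context morphisms and to satisfy the distributive law; with only the listed rules, f^* need not be well defined on classes and the quotients need not be distributive, so the claim would fail. *)

theory Defs
  imports "HOL-Algebra.Galois_Connection" "HOL-Library.FuncSet"
begin

unbundle cardinal_syntax

section \<open>Regular cardinals and sequences\<close>

definition regular_cardinal :: "'a rel \<Rightarrow> bool" where
  "regular_cardinal r \<longleftrightarrow> Cinfinite r \<and> regularCard r"

text \<open>
  The cardinal \<open>\<kappa>\<close> is given by a well-ordered type \<open>'k\<close> whose order is required to be a regular
  cardinal. The ordinals below \<open>\<kappa>\<close> are the elements of \<open>'k\<close>, and \<open>\<mu>\<close> stands for the index set
  \<open>{..<\<mu>}\<close>. A sequence of length \<open>\<mu> < \<kappa>\<close> is a partial function with domain \<open>{..<\<mu>}\<close>.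
\<close>

definition type_order :: "'k::wellorder itself \<Rightarrow> 'k rel" where
  "type_order _ = {(\<alpha>, \<beta>). \<alpha> \<le> \<beta>}"

definition is_seq :: "('k::wellorder \<rightharpoonup> 'a) \<Rightarrow> bool" where
  "is_seq f \<longleftrightarrow> (\<exists>\<mu>. dom f = {..<\<mu>})"

definition len :: "('k::wellorder \<rightharpoonup> 'a) \<Rightarrow> 'k" where
  "len f = (LEAST \<alpha>. f \<alpha> = None)"

definition init_seg :: "'k::wellorder \<Rightarrow> ('k \<rightharpoonup> 'a) \<Rightarrow> ('k \<rightharpoonup> 'a)" where
  "init_seg \<gamma> f = f |` {..<\<gamma>}"

definition tail_seg :: "'k::wellorder \<Rightarrow> ('k \<rightharpoonup> 'a) \<Rightarrow> ('k \<rightharpoonup> 'a)" where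
  "tail_seg \<gamma> f = f |` {\<gamma>..}"

text \<open>
  For \<open>\<gamma> \<le> \<beta>\<close>, \<open>shift \<gamma> \<delta> \<beta>\<close> is the ordinal \<open>\<delta> + (\<beta> - \<gamma>)\<close>: the \<open>\<epsilon> \<ge> \<delta>\<close> for which
  \<open>{\<delta>..<\<epsilon>}\<close> is order isomorphic to \<open>{\<gamma>..<\<beta>}\<close>.
\<close>

definition shift :: "'k::wellorder \<Rightarrow> 'k \<Rightarrow> 'k \<Rightarrow> 'k" where
  "shift \<gamma> \<delta> \<beta> =
     (THE \<epsilon>. \<delta> \<le> \<epsilon> \<and>
        (\<exists>h. bij_betw h {\<gamma>..<\<beta>} {\<delta>..<\<epsilon>} \<and> strict_mono_on {\<gamma>..<\<beta>} h))"


section \<open>Generalized \<open>\<kappa>\<close>-algebraic theories\<close>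

subsection \<open>Expressions and judgments\<close>

text \<open>A symbol standing alone is the symbol applied to the empty sequence.\<close>

datatype ('s, 'k) expr =
    Var 'k
  | App 's "'k \<Rightarrow> ('s, 'k) expr option"

inductive is_expr :: "('s, 'k::wellorder) expr \<Rightarrow> bool" where
  "is_expr (Var \<alpha>)"
| "\<lbrakk>is_seq e; \<And>\<alpha> u. e \<alpha> = Some u \<Longrightarrow> is_expr u\<rbrakk> \<Longrightarrow> is_expr (App F e)"

text \<open>\<open>subst t e\<close> is \<open>e[t\<^sub>\<beta>|x\<^sub>\<beta>]\<close>, with \<open>\<beta>\<close> ranging over the domain of \<open>t\<close>.\<close>

primrec subst :: "('k \<rightharpoonup> ('s, 'k) expr) \<Rightarrow> ('s, 'k) expr \<Rightarrow> ('s, 'k) expr" where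
  "subst t (Var \<alpha>) = (case t \<alpha> of None \<Rightarrow> Var \<alpha> | Some u \<Rightarrow> u)"
| "subst t (App F e) = App F (map_option (subst t) \<circ> e)"

type_synonym ('s, 'k) premise = "'k \<rightharpoonup> ('s, 'k) expr"

definition is_premise :: "('s, 'k::wellorder) premise \<Rightarrow> bool" where
  "is_premise \<Gamma> \<longleftrightarrow> is_seq \<Gamma> \<and> (\<forall>A \<in> ran \<Gamma>. is_expr A)"

text \<open>The sequence \<open>(x\<^sub>\<alpha>)\<^sub>\<alpha>\<close> of the variables declared in a premise.\<close>

definition vars :: "('s, 'k) premise \<Rightarrow> ('k \<rightharpoonup> ('s, 'k) expr)" where
  "vars \<Gamma> = (\<lambda>\<alpha>. if \<alpha> \<in> dom \<Gamma> then Some (Var \<alpha>) else None)"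

text \<open>
  \<open>IsType \<Gamma> A\<close> is \<open>\<Gamma> \<turnstile> A Type\<close>, \<open>HasType \<Gamma> t A\<close> is \<open>\<Gamma> \<turnstile> t : A\<close>, \<open>TypeEq \<Gamma> A A'\<close> is
  \<open>\<Gamma> \<turnstile> A \<equiv> A'\<close>, and \<open>TermEq \<Gamma> t t' A\<close> is \<open>\<Gamma> \<turnstile> t \<equiv>\<^sub>A t'\<close>.
\<close>

datatype ('s, 'k) jdg =
    IsType "('s, 'k) premise" "('s, 'k) expr"
  | HasType "('s, 'k) premise" "('s, 'k) expr" "('s, 'k) expr"
  | TypeEq "('s, 'k) premise" "('s, 'k) expr" "('s, 'k) expr"
  | TermEq "('s, 'k) premise" "('s, 'k) expr" "('s, 'k) expr" "('s, 'k) expr"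

primrec is_jdg :: "('s, 'k::wellorder) jdg \<Rightarrow> bool" where
  "is_jdg (IsType \<Gamma> A) \<longleftrightarrow> is_premise \<Gamma> \<and> is_expr A"
| "is_jdg (HasType \<Gamma> t A) \<longleftrightarrow> is_premise \<Gamma> \<and> is_expr t \<and> is_expr A"
| "is_jdg (TypeEq \<Gamma> A A') \<longleftrightarrow> is_premise \<Gamma> \<and> is_expr A \<and> is_expr A'"
| "is_jdg (TermEq \<Gamma> t t' A) \<longleftrightarrow> is_premise \<Gamma> \<and> is_expr t \<and> is_expr t' \<and> is_expr A"

primrec is_equality :: "('s, 'k) jdg \<Rightarrow> bool" where
  "is_equality (IsType \<Gamma> A) \<longleftrightarrow> False"
| "is_equality (HasType \<Gamma> t A) \<longleftrightarrow> False"
| "is_equality (TypeEq \<Gamma> A A') \<longleftrightarrow> True"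
| "is_equality (TermEq \<Gamma> t t' A) \<longleftrightarrow> True"


subsection \<open>Pretheories\<close>

text \<open>
  A symbol in the domain of \<open>decl T\<close> is either a sort symbol or an operation symbol; its
  introductory judgment is recovered by \<open>intro_jdg\<close>.
\<close>

datatype ('s, 'k) symbol_decl =
    SortDecl "('s, 'k) premise"
  | OpDecl "('s, 'k) premise" "('s, 'k) expr"

primrec intro_jdg :: "'s \<Rightarrow> ('s, 'k) symbol_decl \<Rightarrow> ('s, 'k) jdg" where
  "intro_jdg B (SortDecl \<Delta>) = IsType \<Delta> (App B (vars \<Delta>))"
| "intro_jdg F (OpDecl \<Delta> A) = HasType \<Delta> (App F (vars \<Delta>)) A"

record ('s, 'k) pretheory =
  decl :: "'s \<rightharpoonup> ('s, 'k) symbol_decl"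
  axs :: "('s, 'k) jdg set"

definition is_pretheory :: "('s, 'k::wellorder) pretheory \<Rightarrow> bool" where
  "is_pretheory T \<longleftrightarrow>
     (\<forall>F d. decl T F = Some d \<longrightarrow> is_jdg (intro_jdg F d)) \<and>
     (\<forall>J \<in> axs T. is_jdg J \<and> is_equality J)"


subsection \<open>Derived judgments\<close>

text \<open>
  The following notions are relative to a class \<open>D\<close> of judgments, so that they can also be used
  while the class of derived judgments is being defined.
\<close>

definition context_wrt :: "(('s, 'k::wellorder) jdg \<Rightarrow> bool) \<Rightarrow> ('s, 'k) premise \<Rightarrow> bool" where
  "context_wrt D \<Gamma> \<longleftrightarrow>
     is_seq \<Gamma> \<and> (\<forall>\<alpha> A. \<Gamma> \<alpha> = Some A \<longrightarrow> D (IsType (init_seg \<alpha> \<Gamma>) A))"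

primrec wf_jdg_wrt :: "(('s, 'k::wellorder) jdg \<Rightarrow> bool) \<Rightarrow> ('s, 'k) jdg \<Rightarrow> bool" where
  "wf_jdg_wrt D (IsType \<Gamma> A) \<longleftrightarrow> context_wrt D \<Gamma>"
| "wf_jdg_wrt D (HasType \<Gamma> t A) \<longleftrightarrow> D (IsType \<Gamma> A)"
| "wf_jdg_wrt D (TypeEq \<Gamma> A A') \<longleftrightarrow> D (IsType \<Gamma> A) \<and> D (IsType \<Gamma> A')"
| "wf_jdg_wrt D (TermEq \<Gamma> t t' A) \<longleftrightarrow> D (HasType \<Gamma> t A) \<and> D (HasType \<Gamma> t' A)"

text \<open>\<open>terms_wrt D \<Gamma> t \<Delta>\<close>: \<open>\<Gamma> \<turnstile> t\<^sub>\<alpha> : \<Delta>\<^sub>\<alpha>[t\<^sub>\<beta>|x\<^sub>\<beta>]\<^bsub>\<beta><\<alpha>\<^esub>\<close> for all \<open>\<alpha>\<close>; similarly for equality.\<close>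

definition terms_wrt ::
  "(('s, 'k::wellorder) jdg \<Rightarrow> bool) \<Rightarrow> ('s, 'k) premise \<Rightarrow> ('k \<rightharpoonup> ('s, 'k) expr) \<Rightarrow>
    ('s, 'k) premise \<Rightarrow> bool" where
  "terms_wrt D \<Gamma> t \<Delta> \<longleftrightarrow>
     dom t = dom \<Delta> \<and>
     (\<forall>\<alpha> u A. t \<alpha> = Some u \<and> \<Delta> \<alpha> = Some A \<longrightarrow>
        D (HasType \<Gamma> u (subst (init_seg \<alpha> t) A)))"

definition terms_eq_wrt ::
  "(('s, 'k::wellorder) jdg \<Rightarrow> bool) \<Rightarrow> ('s, 'k) premise \<Rightarrow> ('k \<rightharpoonup> ('s, 'k) expr) \<Rightarrow>
    ('k \<rightharpoonup> ('s, 'k) expr) \<Rightarrow> ('s, 'k) premise \<Rightarrow> bool" where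
  "terms_eq_wrt D \<Gamma> s s' \<Delta> \<longleftrightarrow>
     dom s = dom \<Delta> \<and> dom s' = dom \<Delta> \<and>
     (\<forall>\<alpha> u u' A. s \<alpha> = Some u \<and> s' \<alpha> = Some u' \<and> \<Delta> \<alpha> = Some A \<longrightarrow>
        D (TermEq \<Gamma> u u' (subst (init_seg \<alpha> s) A)))"

lemma context_wrt_mono [mono]:
  "(\<And>J. D J \<longrightarrow> D' J) \<Longrightarrow> context_wrt D \<Gamma> \<longrightarrow> context_wrt D' \<Gamma>"
  unfolding context_wrt_def by blast

lemma wf_jdg_wrt_mono [mono]:
  "(\<And>J. D J \<longrightarrow> D' J) \<Longrightarrow> wf_jdg_wrt D J \<longrightarrow> wf_jdg_wrt D' J"
  by (cases J) (auto simp: context_wrt_def)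

lemma terms_wrt_mono [mono]:
  "(\<And>J. D J \<longrightarrow> D' J) \<Longrightarrow> terms_wrt D \<Gamma> t \<Delta> \<longrightarrow> terms_wrt D' \<Gamma> t \<Delta>"
  unfolding terms_wrt_def by blast

lemma terms_eq_wrt_mono [mono]:
  "(\<And>J. D J \<longrightarrow> D' J) \<Longrightarrow> terms_eq_wrt D \<Gamma> s s' \<Delta> \<longrightarrow> terms_eq_wrt D' \<Gamma> s s' \<Delta>"
  unfolding terms_eq_wrt_def by blast

inductive derived :: "('s, 'k::wellorder) pretheory \<Rightarrow> ('s, 'k) jdg \<Rightarrow> bool"
  for T :: "('s, 'k) pretheory" where
  type_refl: "derived T (IsType \<Gamma> A) \<Longrightarrow> derived T (TypeEq \<Gamma> A A)"
| type_sym: "derived T (TypeEq \<Gamma> A A') \<Longrightarrow> derived T (TypeEq \<Gamma> A' A)"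
| type_trans:
    "\<lbrakk>derived T (TypeEq \<Gamma> A A'); derived T (TypeEq \<Gamma> A' A'')\<rbrakk> \<Longrightarrow> derived T (TypeEq \<Gamma> A A'')"
| term_refl: "derived T (HasType \<Gamma> t A) \<Longrightarrow> derived T (TermEq \<Gamma> t t A)"
| term_sym: "derived T (TermEq \<Gamma> t t' A) \<Longrightarrow> derived T (TermEq \<Gamma> t' t A)"
| term_trans:
    "\<lbrakk>derived T (TermEq \<Gamma> t t' A); derived T (TermEq \<Gamma> t' t'' A)\<rbrakk> \<Longrightarrow>
      derived T (TermEq \<Gamma> t t'' A)"
| conv:
    "\<lbrakk>derived T (TypeEq \<Gamma> A\<^sub>1 A\<^sub>2); derived T (HasType \<Gamma> t A\<^sub>1)\<rbrakk> \<Longrightarrow> derived T (HasType \<Gamma> t A\<^sub>2)"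
| conv_eq:
    "\<lbrakk>derived T (TypeEq \<Gamma> A\<^sub>1 A\<^sub>2); derived T (TermEq \<Gamma> t\<^sub>1 t\<^sub>2 A\<^sub>1)\<rbrakk> \<Longrightarrow>
      derived T (TermEq \<Gamma> t\<^sub>1 t\<^sub>2 A\<^sub>2)"
| variable:
    "\<lbrakk>context_wrt (derived T) \<Gamma>; \<Gamma> \<alpha> = Some A\<rbrakk> \<Longrightarrow> derived T (HasType \<Gamma> (Var \<alpha>) A)"
| sort_symbol:
    "\<lbrakk>decl T B = Some (SortDecl \<Delta>); wf_jdg_wrt (derived T) (intro_jdg B (SortDecl \<Delta>));
      context_wrt (derived T) \<Gamma>; terms_wrt (derived T) \<Gamma> t \<Delta>\<rbrakk> \<Longrightarrow>
      derived T (IsType \<Gamma> (App B t))"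
| op_symbol:
    "\<lbrakk>decl T F = Some (OpDecl \<Delta> A); wf_jdg_wrt (derived T) (intro_jdg F (OpDecl \<Delta> A));
      context_wrt (derived T) \<Gamma>; terms_wrt (derived T) \<Gamma> t \<Delta>\<rbrakk> \<Longrightarrow>
      derived T (HasType \<Gamma> (App F t) (subst t A))"
| type_cong:
    "\<lbrakk>derived T (TypeEq \<Delta> A A'); context_wrt (derived T) \<Gamma>;
      terms_eq_wrt (derived T) \<Gamma> s s' \<Delta>\<rbrakk> \<Longrightarrow>
      derived T (TypeEq \<Gamma> (subst s A) (subst s' A'))"
| term_cong:
    "\<lbrakk>derived T (TermEq \<Delta> t t' A); context_wrt (derived T) \<Gamma>;
      terms_eq_wrt (derived T) \<Gamma> s s' \<Delta>\<rbrakk> \<Longrightarrow>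
      derived T (TermEq \<Gamma> (subst s t) (subst s' t') (subst s A))"
| axiom: "\<lbrakk>J \<in> axs T; wf_jdg_wrt (derived T) J\<rbrakk> \<Longrightarrow> derived T J"

definition generalized_algebraic_theory :: "('s, 'k::wellorder) pretheory \<Rightarrow> bool" where
  "generalized_algebraic_theory T \<longleftrightarrow>
     is_pretheory T \<and>
     (\<forall>F d. decl T F = Some d \<longrightarrow> wf_jdg_wrt (derived T) (intro_jdg F d)) \<and>
     (\<forall>J \<in> axs T. wf_jdg_wrt (derived T) J)"

definition is_context :: "('s, 'k::wellorder) pretheory \<Rightarrow> ('s, 'k) premise \<Rightarrow> bool" where
  "is_context T \<Gamma> \<longleftrightarrow> context_wrt (derived T) \<Gamma>"


section \<open>Categories and clans\<close>

record ('o, 'm) cat =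
  Obj :: "'o set"
  Arr :: "'m set"
  Dom :: "'m \<Rightarrow> 'o"
  Cod :: "'m \<Rightarrow> 'o"
  Ide :: "'o \<Rightarrow> 'm"
  Comp :: "'m \<Rightarrow> 'm \<Rightarrow> 'm"  \<comment> \<open>\<open>Comp C g f\<close> is \<open>g \<circ> f\<close>\<close>

definition Hom :: "('o, 'm) cat \<Rightarrow> 'o \<Rightarrow> 'o \<Rightarrow> 'm set" where
  "Hom C X Y = {f \<in> Arr C. Dom C f = X \<and> Cod C f = Y}"

locale category =
  fixes C :: "('o, 'm) cat"
  assumes dom_obj: "f \<in> Arr C \<Longrightarrow> Dom C f \<in> Obj C"
    and cod_obj: "f \<in> Arr C \<Longrightarrow> Cod C f \<in> Obj C"
    and ide_hom: "X \<in> Obj C \<Longrightarrow> Ide C X \<in> Hom C X X"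
    and comp_hom: "\<lbrakk>f \<in> Hom C X Y; g \<in> Hom C Y Z\<rbrakk> \<Longrightarrow> Comp C g f \<in> Hom C X Z"
    and comp_ide_right: "f \<in> Hom C X Y \<Longrightarrow> Comp C f (Ide C X) = f"
    and comp_ide_left: "f \<in> Hom C X Y \<Longrightarrow> Comp C (Ide C Y) f = f"
    and comp_assoc:
      "\<lbrakk>f \<in> Hom C X Y; g \<in> Hom C Y Z; h \<in> Hom C Z W\<rbrakk> \<Longrightarrow>
        Comp C (Comp C h g) f = Comp C h (Comp C g f)"

definition is_iso :: "('o, 'm) cat \<Rightarrow> 'm \<Rightarrow> bool" where
  "is_iso C f \<longleftrightarrow>
     f \<in> Arr C \<and>
     (\<exists>g \<in> Hom C (Cod C f) (Dom C f).
        Comp C g f = Ide C (Dom C f) \<and> Comp C f g = Ide C (Cod C f))"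

definition is_terminal :: "('o, 'm) cat \<Rightarrow> 'o \<Rightarrow> bool" where
  "is_terminal C X \<longleftrightarrow> X \<in> Obj C \<and> (\<forall>Y \<in> Obj C. \<exists>!f. f \<in> Hom C Y X)"

text \<open>\<open>pullback_square C \<pi> f \<pi>' f'\<close>: \<open>\<pi>'\<close> is the pullback of \<open>\<pi>\<close> along \<open>f\<close>, with \<open>f \<circ> \<pi>' = \<pi> \<circ> f'\<close>.\<close>

definition pullback_square :: "('o, 'm) cat \<Rightarrow> 'm \<Rightarrow> 'm \<Rightarrow> 'm \<Rightarrow> 'm \<Rightarrow> bool" where
  "pullback_square C \<pi> f \<pi>' f' \<longleftrightarrow>
     {\<pi>, f, \<pi>', f'} \<subseteq> Arr C \<and>
     Cod C \<pi> = Cod C f \<and> Dom C \<pi>' = Dom C f' \<and> Cod C \<pi>' = Dom C f \<and> Cod C f' = Dom C \<pi> \<and>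
     Comp C f \<pi>' = Comp C \<pi> f' \<and>
     (\<forall>W \<in> Obj C. \<forall>u \<in> Hom C W (Dom C f). \<forall>v \<in> Hom C W (Dom C \<pi>).
        Comp C f u = Comp C \<pi> v \<longrightarrow>
        (\<exists>!h. h \<in> Hom C W (Dom C \<pi>') \<and> Comp C \<pi>' h = u \<and> Comp C f' h = v))"

locale clan = category C for C :: "('o, 'm) cat" +
  fixes Fib :: "'m set"
  assumes fib_arr: "Fib \<subseteq> Arr C"
    and terminal_fib: "\<exists>X. is_terminal C X \<and> (\<forall>f \<in> Arr C. Cod C f = X \<longrightarrow> f \<in> Fib)"
    and iso_fib: "is_iso C f \<Longrightarrow> f \<in> Fib"
    and comp_fib: "\<lbrakk>f \<in> Fib; g \<in> Fib; Cod C f = Dom C g\<rbrakk> \<Longrightarrow> Comp C g f \<in> Fib"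
    and pullback_exists:
      "\<lbrakk>\<pi> \<in> Fib; f \<in> Arr C; Cod C f = Cod C \<pi>\<rbrakk> \<Longrightarrow> \<exists>\<pi>' f'. pullback_square C \<pi> f \<pi>' f'"
    and pullback_fib: "\<lbrakk>\<pi> \<in> Fib; pullback_square C \<pi> f \<pi>' f'\<rbrakk> \<Longrightarrow> \<pi>' \<in> Fib"


section \<open>The syntactic category\<close>

definition context_rel :: "('s, 'k::wellorder) pretheory \<Rightarrow> ('s, 'k) premise rel" where
  "context_rel T =
     {(\<Gamma>, \<Gamma>'). is_context T \<Gamma> \<and> is_context T \<Gamma>' \<and> dom \<Gamma> = dom \<Gamma>' \<and>
        (\<forall>\<alpha> A A'. \<Gamma> \<alpha> = Some A \<and> \<Gamma>' \<alpha> = Some A' \<longrightarrow> derived T (TypeEq (init_seg \<alpha> \<Gamma>) A A'))}"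

definition context_morphism ::
  "('s, 'k::wellorder) pretheory \<Rightarrow> ('s, 'k) premise \<Rightarrow> ('k \<rightharpoonup> ('s, 'k) expr) \<Rightarrow>
    ('s, 'k) premise \<Rightarrow> bool" where
  "context_morphism T \<Gamma> t \<Omega> \<longleftrightarrow>
     is_context T \<Gamma> \<and> is_context T \<Omega> \<and> terms_wrt (derived T) \<Gamma> t \<Omega>"

type_synonym ('s, 'k) arrow = "('s, 'k) premise \<times> ('k \<rightharpoonup> ('s, 'k) expr) \<times> ('s, 'k) premise"

definition raw_morphisms :: "('s, 'k::wellorder) pretheory \<Rightarrow> ('s, 'k) arrow set" where
  "raw_morphisms T = {(\<Gamma>, t, \<Omega>). context_morphism T \<Gamma> t \<Omega>}"

definition morphism_rel :: "('s, 'k::wellorder) pretheory \<Rightarrow> ('s, 'k) arrow rel" where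
  "morphism_rel T =
     {((\<Gamma>, t, \<Omega>), (\<Gamma>', t', \<Omega>')). (\<Gamma>, t, \<Omega>) \<in> raw_morphisms T \<and> (\<Gamma>', t', \<Omega>') \<in> raw_morphisms T \<and>
        (\<Gamma>, \<Gamma>') \<in> context_rel T \<and> (\<Omega>, \<Omega>') \<in> context_rel T \<and>
        terms_eq_wrt (derived T) \<Gamma> t t' \<Omega>}"

definition syntactic_category ::
  "('s, 'k::wellorder) pretheory \<Rightarrow> (('s, 'k) premise set, ('s, 'k) arrow set) cat" where
  "syntactic_category T =
     \<lparr> Obj = {\<Gamma>. is_context T \<Gamma>} // context_rel T,
       Arr = raw_morphisms T // morphism_rel T,
       Dom = (\<lambda>a. \<Union>(\<Gamma>, t, \<Omega>) \<in> a. context_rel T `` {\<Gamma>}),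
       Cod = (\<lambda>a. \<Union>(\<Gamma>, t, \<Omega>) \<in> a. context_rel T `` {\<Omega>}),
       Ide = (\<lambda>c. \<Union>\<Gamma> \<in> c. morphism_rel T `` {(\<Gamma>, vars \<Gamma>, \<Gamma>)}),
       Comp = (\<lambda>b a. \<Union>(\<Gamma>, t, \<Omega>) \<in> a. \<Union>(\<Omega>', s, \<Xi>) \<in> b.
                 morphism_rel T `` {(\<Gamma>, map_option (subst t) \<circ> s, \<Xi>)}) \<rparr>"

definition display_maps :: "('s, 'k::wellorder) pretheory \<Rightarrow> ('s, 'k) arrow set set" where
  "display_maps T =
     {morphism_rel T `` {(\<Gamma>', vars (init_seg \<beta> \<Gamma>'), init_seg \<beta> \<Gamma>')} | \<Gamma>' \<beta>.
        is_context T \<Gamma>' \<and> \<beta> \<le> len \<Gamma>'}"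

text \<open>Arrows isomorphic, in the arrow category, to a generalized display map.\<close>

definition syntactic_fibrations :: "('s, 'k::wellorder) pretheory \<Rightarrow> ('s, 'k) arrow set set" where
  "syntactic_fibrations T =
     (let C = syntactic_category T in
      {f \<in> Arr C. \<exists>p \<in> display_maps T. \<exists>i j.
         is_iso C i \<and> Dom C i = Dom C f \<and> Cod C i = Dom C p \<and>
         is_iso C j \<and> Dom C j = Cod C f \<and> Cod C j = Cod C p \<and>
         Comp C j f = Comp C p i})"


section \<open>Boolean algebras over a clan\<close>

text \<open>\<open>\<lambda>\<close>-small families are represented by subsets of cardinality less than \<open>\<lambda>\<close>.\<close>

definition lambda_boolean_algebra :: "'l rel \<Rightarrow> 'b gorder \<Rightarrow> bool" where
  "lambda_boolean_algebra l L \<longleftrightarrow>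
     bounded_lattice L \<and>
     (\<forall>x \<in> carrier L. \<forall>y \<in> carrier L. \<forall>z \<in> carrier L.
        x \<sqinter>\<^bsub>L\<^esub> (y \<squnion>\<^bsub>L\<^esub> z) = (x \<sqinter>\<^bsub>L\<^esub> y) \<squnion>\<^bsub>L\<^esub> (x \<sqinter>\<^bsub>L\<^esub> z)) \<and>
     (\<forall>x \<in> carrier L. \<exists>y \<in> carrier L. x \<sqinter>\<^bsub>L\<^esub> y = \<bottom>\<^bsub>L\<^esub> \<and> x \<squnion>\<^bsub>L\<^esub> y = \<top>\<^bsub>L\<^esub>) \<and>
     (\<forall>A \<subseteq> carrier L. |A| <o l \<longrightarrow> (\<exists>s. least L s (Upper L A)))"

definition lambda_boolean_hom ::
  "'l rel \<Rightarrow> 'b gorder \<Rightarrow> 'c gorder \<Rightarrow> ('b \<Rightarrow> 'c) \<Rightarrow> bool" where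
  "lambda_boolean_hom l L M h \<longleftrightarrow>
     h \<in> carrier L \<rightarrow> carrier M \<and>
     h \<top>\<^bsub>L\<^esub> = \<top>\<^bsub>M\<^esub> \<and> h \<bottom>\<^bsub>L\<^esub> = \<bottom>\<^bsub>M\<^esub> \<and>
     (\<forall>x \<in> carrier L. \<forall>y \<in> carrier L.
        h (x \<sqinter>\<^bsub>L\<^esub> y) = h x \<sqinter>\<^bsub>M\<^esub> h y \<and> h (x \<squnion>\<^bsub>L\<^esub> y) = h x \<squnion>\<^bsub>M\<^esub> h y) \<and>
     (\<forall>A \<subseteq> carrier L. |A| <o l \<longrightarrow> h (\<Squnion>\<^bsub>L\<^esub>A) = \<Squnion>\<^bsub>M\<^esub>(h ` A))"

record ('o, 'm, 'b) bool_functor =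
  Fibre :: "'o \<Rightarrow> 'b gorder"
  Pull :: "'m \<Rightarrow> 'b \<Rightarrow> 'b"

text \<open>
  \<open>exists_adjoint C B \<pi> e\<close> says that \<open>e\<close> is left adjoint to \<open>\<pi>\<^sup>*\<close>. Such an \<open>e\<close> is unique on the
  carrier, so that the choice in \<open>exists_along\<close> is immaterial there.
\<close>

definition exists_adjoint ::
  "('o, 'm) cat \<Rightarrow> ('o, 'm, 'b) bool_functor \<Rightarrow> 'm \<Rightarrow> ('b \<Rightarrow> 'b) \<Rightarrow> bool" where
  "exists_adjoint C B \<pi> e \<longleftrightarrow>
     galois_connection
       \<lparr> orderA = Fibre B (Dom C \<pi>), orderB = Fibre B (Cod C \<pi>), lower = e, upper = Pull B \<pi> \<rparr>"

definition exists_along ::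
  "('o, 'm) cat \<Rightarrow> ('o, 'm, 'b) bool_functor \<Rightarrow> 'm \<Rightarrow> 'b \<Rightarrow> 'b" where
  "exists_along C B \<pi> = (SOME e. exists_adjoint C B \<pi> e)"

locale boolean_algebra_over_clan = clan C Fib for C :: "('o, 'm) cat" and Fib +
  fixes l :: "'l rel" and B :: "('o, 'm, 'b) bool_functor"
  assumes fibre_boolean: "X \<in> Obj C \<Longrightarrow> lambda_boolean_algebra l (Fibre B X)"
    and pull_hom:
      "f \<in> Arr C \<Longrightarrow> lambda_boolean_hom l (Fibre B (Cod C f)) (Fibre B (Dom C f)) (Pull B f)"
    and pull_ide: "\<lbrakk>X \<in> Obj C; x \<in> carrier (Fibre B X)\<rbrakk> \<Longrightarrow> Pull B (Ide C X) x = x"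
    and pull_comp:
      "\<lbrakk>f \<in> Hom C X Y; g \<in> Hom C Y Z; x \<in> carrier (Fibre B Z)\<rbrakk> \<Longrightarrow>
        Pull B (Comp C g f) x = Pull B f (Pull B g x)"
    and has_exists: "\<pi> \<in> Fib \<Longrightarrow> \<exists>e. exists_adjoint C B \<pi> e"
    and beck_chevalley:
      "\<lbrakk>\<pi> \<in> Fib; pullback_square C \<pi> f \<pi>' f'; z \<in> carrier (Fibre B (Dom C \<pi>))\<rbrakk> \<Longrightarrow>
        Pull B f (exists_along C B \<pi> z) = exists_along C B \<pi>' (Pull B f' z)"

text \<open>
  Morphisms are required to be extensional (undefined outside the objects and the carriers), so
  that equality of morphisms is equality of functions.
\<close>

definition boolean_algebra_morphism ::
  "('o, 'm) cat \<Rightarrow> 'm set \<Rightarrow> 'l rel \<Rightarrow> ('o, 'm, 'b) bool_functor \<Rightarrow> ('o, 'm, 'c) bool_functor \<Rightarrow>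
    ('o \<Rightarrow> 'b \<Rightarrow> 'c) \<Rightarrow> bool" where
  "boolean_algebra_morphism C Fib l B B' h \<longleftrightarrow>
     h \<in> (\<Pi>\<^sub>E X \<in> Obj C. carrier (Fibre B X) \<rightarrow>\<^sub>E carrier (Fibre B' X)) \<and>
     (\<forall>X \<in> Obj C. lambda_boolean_hom l (Fibre B X) (Fibre B' X) (h X)) \<and>
     (\<forall>f \<in> Arr C. \<forall>x \<in> carrier (Fibre B (Cod C f)).
        h (Dom C f) (Pull B f x) = Pull B' f (h (Cod C f) x)) \<and>
     (\<forall>\<pi> \<in> Fib. \<forall>z \<in> carrier (Fibre B (Dom C \<pi>)).
        h (Cod C \<pi>) (exists_along C B \<pi> z) = exists_along C B' \<pi> (h (Dom C \<pi>) z))"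


section \<open>First-order formulas\<close>

text \<open>
  A family indexed by a set \<open>I\<close> is a partial function with domain \<open>I\<close>. As index sets it suffices
  to use subsets of the type underlying the cardinal \<open>\<lambda>\<close>. The binder in \<open>FEx E \<Phi>\<close> is the tail
  \<open>E = {x\<^sub>\<beta> : \<Gamma>\<^sub>\<beta>}\<^bsub>\<gamma>\<le>\<beta><\<alpha>\<^esub>\<close> of the context of \<open>\<Phi>\<close>.
\<close>

datatype ('s, 'k, 'l) fm =
    FTop
  | FBot
  | FNeg "('s, 'k, 'l) fm"
  | FDisj "'l \<Rightarrow> ('s, 'k, 'l) fm option"
  | FConj "'l \<Rightarrow> ('s, 'k, 'l) fm option"
  | FEx "('s, 'k) premise" "('s, 'k, 'l) fm"
  | FAll "('s, 'k) premise" "('s, 'k, 'l) fm"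

inductive formula ::
  "('s, 'k::wellorder) pretheory \<Rightarrow> 'l rel \<Rightarrow> ('s, 'k) premise \<Rightarrow> ('s, 'k, 'l) fm \<Rightarrow> bool"
  for T :: "('s, 'k) pretheory" and l :: "'l rel" where
  top: "is_context T \<Gamma> \<Longrightarrow> formula T l \<Gamma> FTop"
| bot: "is_context T \<Gamma> \<Longrightarrow> formula T l \<Gamma> FBot"
| neg: "formula T l \<Gamma> \<Phi> \<Longrightarrow> formula T l \<Gamma> (FNeg \<Phi>)"
| disj:
    "\<lbrakk>is_context T \<Gamma>; |dom \<Phi>| <o l; \<And>i \<phi>. \<Phi> i = Some \<phi> \<Longrightarrow> formula T l \<Gamma> \<phi>\<rbrakk> \<Longrightarrow>
      formula T l \<Gamma> (FDisj \<Phi>)"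
| conj:
    "\<lbrakk>is_context T \<Gamma>; |dom \<Phi>| <o l; \<And>i \<phi>. \<Phi> i = Some \<phi> \<Longrightarrow> formula T l \<Gamma> \<phi>\<rbrakk> \<Longrightarrow>
      formula T l \<Gamma> (FConj \<Phi>)"
| ex:
    "\<lbrakk>is_context T \<Gamma>'; \<gamma> < len \<Gamma>'; formula T l \<Gamma>' \<Phi>\<rbrakk> \<Longrightarrow>
      formula T l (init_seg \<gamma> \<Gamma>') (FEx (tail_seg \<gamma> \<Gamma>') \<Phi>)"
| all:
    "\<lbrakk>is_context T \<Gamma>'; \<gamma> < len \<Gamma>'; formula T l \<Gamma>' \<Phi>\<rbrakk> \<Longrightarrow>
      formula T l (init_seg \<gamma> \<Gamma>') (FAll (tail_seg \<gamma> \<Gamma>') \<Phi>)"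

text \<open>
  Let \<open>t : \<Delta> \<rightarrow> \<Gamma>\<close> with \<open>\<Delta>\<close> of length \<open>\<delta>\<close> and \<open>\<Gamma>\<close> of length \<open>\<gamma> = len t\<close>, and let \<open>E\<close> be a tail
  \<open>{x\<^sub>\<beta> : \<Gamma>\<^sub>\<beta>}\<^bsub>\<gamma>\<le>\<beta><\<alpha>\<^esub>\<close>. In the canonical pullback context the variables \<open>x\<^sub>\<beta>\<close> of \<open>E\<close> are renumbered to
  start at \<open>\<delta>\<close>; \<open>pull_tail \<delta> t E\<close> is its tail, and \<open>lift \<delta> t E\<close> is the map from it to \<open>\<Gamma>, E\<close>.
\<close>

definition lift ::
  "'k::wellorder \<Rightarrow> ('k \<rightharpoonup> ('s, 'k) expr) \<Rightarrow> ('s, 'k) premise \<Rightarrow> ('k \<rightharpoonup> ('s, 'k) expr)" where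
  "lift \<delta> t E =
     t ++ (\<lambda>\<beta>. if \<beta> \<in> dom E then Some (Var (shift (len t) \<delta> \<beta>)) else None)"

definition pull_tail ::
  "'k::wellorder \<Rightarrow> ('k \<rightharpoonup> ('s, 'k) expr) \<Rightarrow> ('s, 'k) premise \<Rightarrow> ('s, 'k) premise" where
  "pull_tail \<delta> t E =
     (\<lambda>\<epsilon>. if \<delta> \<le> \<epsilon> then map_option (subst (lift \<delta> t E)) (E (shift \<delta> (len t) \<epsilon>)) else None)"

text \<open>\<open>fsubst \<Phi> \<delta> t\<close> is \<open>t\<^sup>*\<Phi>\<close> for a context morphism \<open>t\<close> whose source has length \<open>\<delta>\<close>.\<close>

primrec fsubst ::
  "('s, 'k::wellorder, 'l) fm \<Rightarrow> 'k \<Rightarrow> ('k \<rightharpoonup> ('s, 'k) expr) \<Rightarrow> ('s, 'k, 'l) fm" where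
  "fsubst FTop \<delta> t = FTop"
| "fsubst FBot \<delta> t = FBot"
| "fsubst (FNeg \<Phi>) \<delta> t = FNeg (fsubst \<Phi> \<delta> t)"
| "fsubst (FDisj \<Phi>) \<delta> t = FDisj (map_option (\<lambda>\<phi>. fsubst \<phi> \<delta> t) \<circ> \<Phi>)"
| "fsubst (FConj \<Phi>) \<delta> t = FConj (map_option (\<lambda>\<phi>. fsubst \<phi> \<delta> t) \<circ> \<Phi>)"
| "fsubst (FEx E \<Phi>) \<delta> t =
     FEx (pull_tail \<delta> t E) (fsubst \<Phi> (shift (len t) \<delta> (len (lift \<delta> t E))) (lift \<delta> t E))"
| "fsubst (FAll E \<Phi>) \<delta> t =
     FAll (pull_tail \<delta> t E) (fsubst \<Phi> (shift (len t) \<delta> (len (lift \<delta> t E))) (lift \<delta> t E))"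

text \<open>Pullback along the generalized display map from \<open>\<Gamma>'\<close> to its initial segment of length \<open>\<gamma>\<close>.\<close>

definition weaken ::
  "('s, 'k::wellorder) premise \<Rightarrow> 'k \<Rightarrow> ('s, 'k, 'l) fm \<Rightarrow> ('s, 'k, 'l) fm" where
  "weaken \<Gamma>' \<gamma> \<Phi> = fsubst \<Phi> (len \<Gamma>') (vars (init_seg \<gamma> \<Gamma>'))"


section \<open>Provability\<close>

text \<open>
  Binary conjunctions and disjunctions are families indexed by a two-element set \<open>{i, j}\<close>.

  The relations are taken to be stable under the substitution functors \<open>f\<^sup>*\<close> (\<open>pv_subst\<close>) and to
  obey the distributive law of propositional logic (\<open>pv_distrib\<close>). Neither follows from the
  remaining rules: the lattice and complement rules alone admit non-distributive models, and the
  quantifier rules never instantiate a variable by a constant. Stability under \<open>f\<^sup>*\<close> is what makes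
  \<open>f\<^sup>*\<close> act on provable equivalence classes.
\<close>

inductive provable ::
  "('s, 'k::wellorder) pretheory \<Rightarrow> 'l rel \<Rightarrow> ('s, 'k) premise \<Rightarrow>
    ('s, 'k, 'l) fm \<Rightarrow> ('s, 'k, 'l) fm \<Rightarrow> bool"
  for T :: "('s, 'k) pretheory" and l :: "'l rel" where
  pv_refl: "formula T l \<Gamma> \<Phi> \<Longrightarrow> provable T l \<Gamma> \<Phi> \<Phi>"
| pv_trans: "\<lbrakk>provable T l \<Gamma> \<Phi> \<Psi>; provable T l \<Gamma> \<Psi> \<Theta>\<rbrakk> \<Longrightarrow> provable T l \<Gamma> \<Phi> \<Theta>"
| pv_top: "formula T l \<Gamma> \<Phi> \<Longrightarrow> provable T l \<Gamma> \<Phi> FTop"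
| pv_bot: "formula T l \<Gamma> \<Phi> \<Longrightarrow> provable T l \<Gamma> FBot \<Phi>"
| pv_contradiction:
    "\<lbrakk>formula T l \<Gamma> \<Phi>; i \<noteq> j\<rbrakk> \<Longrightarrow> provable T l \<Gamma> (FConj [i \<mapsto> \<Phi>, j \<mapsto> FNeg \<Phi>]) FBot"
| pv_excluded_middle:
    "\<lbrakk>formula T l \<Gamma> \<Phi>; i \<noteq> j\<rbrakk> \<Longrightarrow> provable T l \<Gamma> FTop (FDisj [i \<mapsto> \<Phi>, j \<mapsto> FNeg \<Phi>])"
| pv_distrib:
    "\<lbrakk>formula T l \<Gamma> \<Phi>; formula T l \<Gamma> \<Psi>; formula T l \<Gamma> \<Theta>; i \<noteq> j\<rbrakk> \<Longrightarrow>
      provable T l \<Gamma> (FConj [i \<mapsto> \<Phi>, j \<mapsto> FDisj [i \<mapsto> \<Psi>, j \<mapsto> \<Theta>]])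
        (FDisj [i \<mapsto> FConj [i \<mapsto> \<Phi>, j \<mapsto> \<Psi>], j \<mapsto> FConj [i \<mapsto> \<Phi>, j \<mapsto> \<Theta>]])"
| pv_disj_left:
    "\<lbrakk>formula T l \<Gamma> (FDisj \<Phi>); formula T l \<Gamma> \<Psi>;
      \<And>i \<phi>. \<Phi> i = Some \<phi> \<Longrightarrow> provable T l \<Gamma> \<phi> \<Psi>\<rbrakk> \<Longrightarrow> provable T l \<Gamma> (FDisj \<Phi>) \<Psi>"
| pv_disj_inv:
    "\<lbrakk>provable T l \<Gamma> (FDisj \<Phi>) \<Psi>; \<Phi> i = Some \<phi>\<rbrakk> \<Longrightarrow> provable T l \<Gamma> \<phi> \<Psi>"
| pv_conj_right:
    "\<lbrakk>formula T l \<Gamma> (FConj \<Phi>); formula T l \<Gamma> \<Psi>;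
      \<And>i \<phi>. \<Phi> i = Some \<phi> \<Longrightarrow> provable T l \<Gamma> \<Psi> \<phi>\<rbrakk> \<Longrightarrow> provable T l \<Gamma> \<Psi> (FConj \<Phi>)"
| pv_conj_inv:
    "\<lbrakk>provable T l \<Gamma> \<Psi> (FConj \<Phi>); \<Phi> i = Some \<phi>\<rbrakk> \<Longrightarrow> provable T l \<Gamma> \<Psi> \<phi>"
| pv_ex_left:
    "\<lbrakk>is_context T \<Gamma>'; \<gamma> < len \<Gamma>'; formula T l \<Gamma>' \<Psi>; formula T l (init_seg \<gamma> \<Gamma>') \<Phi>;
      provable T l \<Gamma>' \<Psi> (weaken \<Gamma>' \<gamma> \<Phi>)\<rbrakk> \<Longrightarrow>
      provable T l (init_seg \<gamma> \<Gamma>') (FEx (tail_seg \<gamma> \<Gamma>') \<Psi>) \<Phi>"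
| pv_ex_inv:
    "\<lbrakk>is_context T \<Gamma>'; \<gamma> < len \<Gamma>'; formula T l \<Gamma>' \<Psi>; formula T l (init_seg \<gamma> \<Gamma>') \<Phi>;
      provable T l (init_seg \<gamma> \<Gamma>') (FEx (tail_seg \<gamma> \<Gamma>') \<Psi>) \<Phi>\<rbrakk> \<Longrightarrow>
      provable T l \<Gamma>' \<Psi> (weaken \<Gamma>' \<gamma> \<Phi>)"
| pv_all_right:
    "\<lbrakk>is_context T \<Gamma>'; \<gamma> < len \<Gamma>'; formula T l \<Gamma>' \<Psi>; formula T l (init_seg \<gamma> \<Gamma>') \<Phi>;
      provable T l \<Gamma>' (weaken \<Gamma>' \<gamma> \<Phi>) \<Psi>\<rbrakk> \<Longrightarrow>
      provable T l (init_seg \<gamma> \<Gamma>') \<Phi> (FAll (tail_seg \<gamma> \<Gamma>') \<Psi>)"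
| pv_all_inv:
    "\<lbrakk>is_context T \<Gamma>'; \<gamma> < len \<Gamma>'; formula T l \<Gamma>' \<Psi>; formula T l (init_seg \<gamma> \<Gamma>') \<Phi>;
      provable T l (init_seg \<gamma> \<Gamma>') \<Phi> (FAll (tail_seg \<gamma> \<Gamma>') \<Psi>)\<rbrakk> \<Longrightarrow>
      provable T l \<Gamma>' (weaken \<Gamma>' \<gamma> \<Phi>) \<Psi>"
| pv_subst:
    "\<lbrakk>provable T l \<Gamma> \<Phi> \<Psi>; context_morphism T \<Delta> t \<Gamma>\<rbrakk> \<Longrightarrow>
      provable T l \<Delta> (fsubst \<Phi> (len \<Delta>) t) (fsubst \<Psi> (len \<Delta>) t)"


section \<open>The Lindenbaum algebras\<close>

text \<open>
  An object of the syntactic category is a class \<open>c\<close> of derivably equal contexts. Formulas and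
  provability over \<open>c\<close> are those over the members of \<open>c\<close>.
\<close>

definition formulas ::
  "('s, 'k::wellorder) pretheory \<Rightarrow> 'l rel \<Rightarrow> ('s, 'k) premise set \<Rightarrow> ('s, 'k, 'l) fm set" where
  "formulas T l c = {\<Phi>. \<exists>\<Gamma> \<in> c. formula T l \<Gamma> \<Phi>}"

definition equiprovable ::
  "('s, 'k::wellorder) pretheory \<Rightarrow> 'l rel \<Rightarrow> ('s, 'k) premise set \<Rightarrow> ('s, 'k, 'l) fm rel" where
  "equiprovable T l c = {(\<Phi>, \<Psi>). \<exists>\<Gamma> \<in> c. provable T l \<Gamma> \<Phi> \<Psi> \<and> provable T l \<Gamma> \<Psi> \<Phi>}"

definition lindenbaum ::
  "('s, 'k::wellorder) pretheory \<Rightarrow> 'l rel \<Rightarrow>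
    (('s, 'k) premise set, ('s, 'k) arrow set, ('s, 'k, 'l) fm set) bool_functor" where
  "lindenbaum T l =
     \<lparr> Fibre = (\<lambda>c.
         \<lparr> carrier = formulas T l c // equiprovable T l c,
           eq = (=),
           le = (\<lambda>x y. \<exists>\<Gamma> \<in> c. \<exists>\<Phi> \<in> x. \<exists>\<Psi> \<in> y. provable T l \<Gamma> \<Phi> \<Psi>) \<rparr>),
       Pull = (\<lambda>a x. \<Union>(\<Delta>, t, \<Gamma>) \<in> a. \<Union>\<Phi> \<in> x.
         equiprovable T l (context_rel T `` {\<Delta>}) `` {fsubst \<Phi> (len \<Delta>) t}) \<rparr>"

end

theory Submission
  imports Defs
begin

text \<open>
  The Lindenbaum algebras are interpreted in an arbitrary \<open>\<lambda>\<close>-boolean algebra \<open>B\<close> over the clan by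
  recursion on formulas, an existential quantifier over a display map \<open>p\<close> being sent to \<open>\<exists>\<^sub>p\<close> in \<open>B\<close>.
  Beck-Chevalley for the canonical pullback of a display map makes the interpretation compatible with
  substitution, and this gives soundness of the calculus; conversely every morphism out of the
  Lindenbaum algebras has to satisfy the recursion. That formulas modulo provability do form such a
  \<open>B\<close> rests on the fact that \<open>f\<^sup>*(\<exists>E. \<Phi>)\<close> is literally the formula \<open>\<exists>f\<^sup>*E. f\<^sup>*\<Phi>\<close> over the canonical
  pullback context. A general fibration is only isomorphic to a display map; adjoints,
  Beck-Chevalley and compatibility with \<open>\<exists>\<close> are transported along the isomorphisms.
\<close>

section \<open>Shifts of ordinals\<close>

text \<open>Three features of the encoding shape the proof. Variables are ordinals, so a pulled back
  tail must be renumbered to start at another ordinal. Regularity of the cardinal keeps the new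
  positions below it, and since renumberings compose strictly, canonical pullbacks are strictly
  functorial and formulas never have to be compared up to renaming. Secondly, objects and arrows are
  classes under derivable equality. Equal maps \<open>t\<close> and \<open>t'\<close> can produce
  different bound types in a substituted quantifier, so substitution is independent of
  representatives only up to provable equivalence, and the induction that shows this has to change
  the context along with the map. Thirdly, a morphism of algebras is asked to preserve small joins
  and existential quantifiers, while formulas also contain small conjunctions and universal
  quantifiers. Their values are nevertheless forced, because complements are unique in a
  distributive lattice and are therefore preserved.\<close>

lemma bounded_image_below:
  fixes h :: "'k::wellorder \<Rightarrow> 'k"
  assumes "regular_cardinal (type_order TYPE('k))"
  shows "\<exists>\<epsilon>. \<forall>x\<in>{\<gamma>..<\<beta>}. h x < \<epsilon>"
proof -
  let ?r = "type_order TYPE('k)"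
  have F: "Field ?r = UNIV"
    by (auto simp: type_order_def Field_def)
  have cinf: "Cinfinite ?r" and reg: "regularCard ?r"
    using assms by (auto simp: regular_cardinal_def)
  have "{\<gamma>..<\<beta>} \<subseteq> underS ?r \<beta>"
    by (auto simp: underS_def type_order_def)
  then have "|h ` {\<gamma>..<\<beta>}| \<le>o |underS ?r \<beta>|"
    using card_of_image card_of_mono1 ordLeq_transitive by blast
  then have "|h ` {\<gamma>..<\<beta>}| <o ?r"
    using card_of_underS[of ?r \<beta>] cinf F ordLeq_ordLess_trans by blast
  \<comment> \<open>In a regular cardinal every cofinal subset has full cardinality, which this
    image is too small to have.\<close>
  then have "\<not> cofinal (h ` {\<gamma>..<\<beta>}) ?r"
    using reg F not_ordLess_ordIso unfolding regularCard_def by (metis subset_UNIV)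
  then obtain a where "\<forall>b\<in>h ` {\<gamma>..<\<beta>}. \<not> (a \<noteq> b \<and> (a, b) \<in> ?r)"
    unfolding cofinal_def by blast
  then have a: "\<forall>b\<in>h ` {\<gamma>..<\<beta>}. b \<le> a"
    unfolding type_order_def by fastforce
  \<comment> \<open>The bound \<open>a\<close> need not be strict; an infinite cardinal has no
    greatest element, so there is room above it.\<close>
  obtain c where "a \<noteq> c" "(a, c) \<in> ?r"
    using infinite_Card_order_limit[of ?r a] cinf F by (auto simp: cinfinite_def)
  then have "a < c" by (auto simp: type_order_def)
  with a show ?thesis by (meson image_eqI le_less_trans)
qed

text \<open>
  The isomorphism sends \<open>\<beta>\<close> to the least ordinal \<open>\<ge> \<delta>\<close> above all values at smaller arguments; by
  regularity it exists.
\<close>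

lemma upper_segments_isomorphic:
  fixes \<gamma> \<delta> :: "'k::wellorder"
  assumes "regular_cardinal (type_order TYPE('k))"
  shows "\<exists>h. bij_betw h {\<gamma>..} {\<delta>..} \<and> strict_mono_on {\<gamma>..} h"
proof -
  define h where "h = wfrec {(x, y :: 'k). x < y}
      (\<lambda>f \<beta>. LEAST \<epsilon>. \<delta> \<le> \<epsilon> \<and> (\<forall>x\<in>{\<gamma>..<\<beta>}. f x < \<epsilon>))"
  have h: "h \<beta> = (LEAST \<epsilon>. \<delta> \<le> \<epsilon> \<and> (\<forall>x\<in>{\<gamma>..<\<beta>}. h x < \<epsilon>))" for \<beta>
    unfolding h_def
    by (subst wfrec[OF wf], intro arg_cong[of _ _ Least] ext) (auto simp: cut_def)
  have ex: "\<exists>\<epsilon>. \<delta> \<le> \<epsilon> \<and> (\<forall>x\<in>{\<gamma>..<\<beta>}. h x < \<epsilon>)" for \<beta>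
  proof -
    obtain \<epsilon> where "\<forall>x\<in>{\<gamma>..<\<beta>}. h x < \<epsilon>" using bounded_image_below[OF assms] by blast
    then show ?thesis by (intro exI[of _ "max \<delta> \<epsilon>"]) (auto simp: less_max_iff_disj)
  qed
  have P: "\<delta> \<le> h \<beta> \<and> (\<forall>x\<in>{\<gamma>..<\<beta>}. h x < h \<beta>)" for \<beta>
    unfolding h[of \<beta>] by (rule LeastI_ex[OF ex])
  have least: "h \<beta> \<le> \<epsilon>" if "\<delta> \<le> \<epsilon>" "\<And>x. \<gamma> \<le> x \<Longrightarrow> x < \<beta> \<Longrightarrow> h x < \<epsilon>" for \<beta> \<epsilon>
    unfolding h[of \<beta>] by (rule Least_le) (use that in auto)
  have mono: "strict_mono_on {\<gamma>..} h"
    using P by (auto simp: strict_mono_on_def)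
  \<comment> \<open>A counting argument: if all values stayed below one ordinal, \<open>h\<close>
    would inject an upper segment, which has full cardinality, into a proper initial segment, which
    has not.\<close>
  have le_h: "\<exists>\<beta>\<ge>\<gamma>. \<epsilon> \<le> h \<beta>" for \<epsilon>
  proof (rule ccontr)
    assume *: "\<not> ?thesis"
    then have lt: "h \<beta> < \<epsilon>" if "\<beta> \<ge> \<gamma>" for \<beta> using that not_le by blast
    let ?r = "type_order TYPE('k)"
    have F: "Field ?r = UNIV" by (auto simp: type_order_def Field_def)
    have cinf: "Cinfinite ?r" using assms by (auto simp: regular_cardinal_def)
    have inj: "inj_on h {\<gamma>..}" using mono strict_mono_on_imp_inj_on by blast
    have small: "|{..<x}| <o |UNIV :: 'k set|" for x :: 'k
    proof -
      have "{..<x} = underS ?r x" by (auto simp: underS_def type_order_def)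
      moreover have "?r =o |UNIV :: 'k set|"
        using cinf card_of_Field_ordIso[of ?r] F ordIso_symmetric by fastforce
      ultimately show ?thesis
        using card_of_underS[of ?r x] cinf F ordLess_ordIso_trans by fastforce
    qed
    have "|{\<gamma>..}| \<le>o |{..<\<epsilon>}|"
      using inj lt card_of_ordLeq[of "{\<gamma>..}" "{..<\<epsilon>}"] by blast
    then have a: "|{\<gamma>..}| <o |UNIV :: 'k set|" using small ordLeq_ordLess_trans by blast
    have "infinite (UNIV :: 'k set)" using cinf F by (simp add: cinfinite_def)
    then have "|{..<\<gamma>} \<union> {\<gamma>..}| <o |UNIV :: 'k set|"
      using a small card_of_Un_ordLess_infinite by blast
    moreover have "{..<\<gamma>} \<union> {\<gamma>..} = UNIV" by auto
    ultimately show False using ordLess_irreflexive by fastforce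
  qed
  have "{\<delta>..} \<subseteq> h ` {\<gamma>..}"
  proof
    fix \<epsilon> assume "\<epsilon> \<in> {\<delta>..}"
    then have e: "\<delta> \<le> \<epsilon>" by simp
    \<comment> \<open>At the first argument whose value reaches \<open>\<epsilon>\<close>, all
      earlier values are below \<open>\<epsilon>\<close>, so \<open>\<epsilon>\<close> is a
      candidate for the least element that defines \<open>h x\<close>, and equality follows.\<close>
    define x where "x = (LEAST x. \<gamma> \<le> x \<and> \<epsilon> \<le> h x)"
    have x: "\<gamma> \<le> x" "\<epsilon> \<le> h x"
      using LeastI_ex[OF le_h[of \<epsilon>, simplified]] unfolding x_def by auto
    have "h y < \<epsilon>" if "\<gamma> \<le> y" "y < x" for y
      using not_less_Least[of y "\<lambda>x. \<gamma> \<le> x \<and> \<epsilon> \<le> h x"] that unfolding x_def by auto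
    then have "h x \<le> \<epsilon>" using least e by blast
    then show "\<epsilon> \<in> h ` {\<gamma>..}" using x by auto
  qed
  then have "bij_betw h {\<gamma>..} {\<delta>..}"
    using P mono strict_mono_on_imp_inj_on by (auto simp: bij_betw_def)
  with mono show ?thesis by blast
qed

text \<open>At the first disagreement the smaller of the two values lies in the range of the other
  map, because that range is an interval starting at \<open>\<delta>\<close>. There it is attained
  at an earlier argument, where both maps agree, which contradicts injectivity.\<close>

lemma initial_embedding_unique:
  fixes h h' :: "'k::wellorder \<Rightarrow> 'k"
  assumes h: "bij_betw h {\<gamma>..<\<beta>} {\<delta>..<\<epsilon>}" "strict_mono_on {\<gamma>..<\<beta>} h"
    and h': "bij_betw h' {\<gamma>..<\<beta>'} {\<delta>..<\<epsilon>'}" "strict_mono_on {\<gamma>..<\<beta>'} h'"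
    and x: "\<gamma> \<le> x" "x < \<beta>" "x < \<beta>'"
  shows "h x = h' x"
  using x
proof (induction x rule: less_induct)
  case (less x)
  have IH: "h y = h' y" if "\<gamma> \<le> y" "y < x" for y using less that by auto
  have "h x \<le> h' x"
  proof (rule ccontr)
    assume n: "\<not> ?thesis"
    moreover have "h x < \<epsilon>" "\<delta> \<le> h' x"
      using less.prems bij_betwE[OF h(1)] bij_betwE[OF h'(1)] by auto
    ultimately have "h' x \<in> h ` {\<gamma>..<\<beta>}"
      using bij_betw_imp_surj_on[OF h(1)] by auto
    then obtain y where y: "\<gamma> \<le> y" "y < \<beta>" "h y = h' x" by auto
    have "h y < h x" using y n by simp
    then have "y < x" using h(2) y less.prems
      by (metis atLeastLessThan_iff linorder_neqE not_less_iff_gr_or_eq strict_mono_onD)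
    then have "h' y = h' x" using IH y by simp
    then show False using bij_betw_imp_inj_on[OF h'(1)] y less.prems \<open>y < x\<close>
      by (auto dest: inj_onD)
  qed
  moreover have "h' x \<le> h x"
  proof (rule ccontr)
    assume n: "\<not> ?thesis"
    moreover have "h' x < \<epsilon>'" "\<delta> \<le> h x"
      using less.prems bij_betwE[OF h(1)] bij_betwE[OF h'(1)] by auto
    ultimately have "h x \<in> h' ` {\<gamma>..<\<beta>'}"
      using bij_betw_imp_surj_on[OF h'(1)] by auto
    then obtain y where y: "\<gamma> \<le> y" "y < \<beta>'" "h' y = h x" by auto
    have "h' y < h' x" using y n by simp
    then have "y < x" using h'(2) y less.prems
      by (metis atLeastLessThan_iff linorder_neqE not_less_iff_gr_or_eq strict_mono_onD)
    then have "h y = h x" using IH y by simp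
    then show False using bij_betw_imp_inj_on[OF h(1)] y less.prems \<open>y < x\<close>
      by (auto dest: inj_onD)
  qed
  ultimately show ?case by simp
qed

text \<open>Passes from isomorphisms of whole upper segments, which are convenient to compose, to
  the bounded ones that the definition of \<open>shift\<close> speaks of.\<close>

lemma restrict_upper_iso:
  fixes h :: "'k::wellorder \<Rightarrow> 'k"
  assumes h: "bij_betw h {\<gamma>..} {\<delta>..}" "strict_mono_on {\<gamma>..} h" and "\<gamma> \<le> \<beta>"
  shows "bij_betw h {\<gamma>..<\<beta>} {\<delta>..<h \<beta>} \<and> strict_mono_on {\<gamma>..<\<beta>} h"
proof
  have less: "h x < h y \<longleftrightarrow> x < y" if "\<gamma> \<le> x" "\<gamma> \<le> y" for x y
    using h(2) that by (metis atLeast_iff linorder_neqE not_less_iff_gr_or_eq strict_mono_onD)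
  have "h ` {\<gamma>..<\<beta>} = {\<delta>..<h \<beta>}"
  proof (intro equalityI subsetI)
    fix y assume "y \<in> h ` {\<gamma>..<\<beta>}"
    then show "y \<in> {\<delta>..<h \<beta>}" using less assms bij_betwE[OF h(1)] by auto
  next
    fix y assume y: "y \<in> {\<delta>..<h \<beta>}"
    then obtain x where "\<gamma> \<le> x" "y = h x" using bij_betw_imp_surj_on[OF h(1)] by fastforce
    then show "y \<in> h ` {\<gamma>..<\<beta>}" using y less \<open>\<gamma> \<le> \<beta>\<close> by auto
  qed
  then show "bij_betw h {\<gamma>..<\<beta>} {\<delta>..<h \<beta>}"
    using bij_betw_imp_inj_on[OF h(1)] by (auto simp: bij_betw_def intro: inj_on_subset)
  show "strict_mono_on {\<gamma>..<\<beta>} h" using h(2) by (auto simp: strict_mono_on_def)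
qed

text \<open>Any isomorphism of upper segments computes \<open>shift\<close>: by uniqueness of
  interval embeddings all candidates have the same range, and the range determines its right
  end.\<close>

lemma shift_eqI:
  fixes h :: "'k::wellorder \<Rightarrow> 'k"
  assumes h: "bij_betw h {\<gamma>..} {\<delta>..}" "strict_mono_on {\<gamma>..} h" and "\<gamma> \<le> \<beta>"
  shows "shift \<gamma> \<delta> \<beta> = h \<beta>"
  unfolding shift_def
proof (rule the_equality)
  show "\<delta> \<le> h \<beta> \<and> (\<exists>h'. bij_betw h' {\<gamma>..<\<beta>} {\<delta>..<h \<beta>} \<and> strict_mono_on {\<gamma>..<\<beta>} h')"
    using restrict_upper_iso[OF assms] bij_betwE[OF h(1)] \<open>\<gamma> \<le> \<beta>\<close> by blast
next
  fix \<epsilon> assume "\<delta> \<le> \<epsilon> \<and> (\<exists>h'. bij_betw h' {\<gamma>..<\<beta>} {\<delta>..<\<epsilon>} \<and> strict_mono_on {\<gamma>..<\<beta>} h')"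
  then obtain h' where e: "\<delta> \<le> \<epsilon>" and h': "bij_betw h' {\<gamma>..<\<beta>} {\<delta>..<\<epsilon>}" "strict_mono_on {\<gamma>..<\<beta>} h'"
    by blast
  have r: "bij_betw h {\<gamma>..<\<beta>} {\<delta>..<h \<beta>}" "strict_mono_on {\<gamma>..<\<beta>} h"
    using restrict_upper_iso[OF assms] by auto
  have "h x = h' x" if "x \<in> {\<gamma>..<\<beta>}" for x
    using initial_embedding_unique[OF r h'] that by auto
  then have "h ` {\<gamma>..<\<beta>} = h' ` {\<gamma>..<\<beta>}" by auto
  then have "{\<delta>..<h \<beta>} = {\<delta>..<\<epsilon>}"
    using r(1) h'(1) by (simp add: bij_betw_def)
  moreover have "\<delta> \<le> h \<beta>" using bij_betwE[OF h(1)] \<open>\<gamma> \<le> \<beta>\<close> by auto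
  \<comment> \<open>For nonempty intervals the right ends coincide at once. If both are empty,
    neither right end exceeds \<open>\<delta>\<close>, and the lower bounds force both to be
    \<open>\<delta>\<close>.\<close>
  ultimately show "\<epsilon> = h \<beta>" using e
    by (metis atLeastLessThan_empty_iff atLeastLessThan_eq_iff order_le_less)
qed

context
  assumes regular: "regular_cardinal (type_order TYPE('k::wellorder))"
begin

lemma shift_iso:
  fixes \<gamma> \<delta> :: 'k
  shows "bij_betw (shift \<gamma> \<delta>) {\<gamma>..} {\<delta>..} \<and> strict_mono_on {\<gamma>..} (shift \<gamma> \<delta>)"
proof -
  obtain h where h: "bij_betw h {\<gamma>..} {\<delta>..}" "strict_mono_on {\<gamma>..} h"
    using upper_segments_isomorphic[OF regular] by blast
  have e: "shift \<gamma> \<delta> \<beta> = h \<beta>" if "\<beta> \<in> {\<gamma>..}" for \<beta>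
    using shift_eqI[OF h] that by auto
  have "bij_betw (shift \<gamma> \<delta>) {\<gamma>..} {\<delta>..}"     by (rule bij_betw_cong[THEN iffD2, OF _ h(1)]) (rule e)
  then show ?thesis using h(2) e by (simp add: strict_mono_on_def)
qed

lemma shift_ge: "(\<gamma> :: 'k) \<le> \<beta> \<Longrightarrow> \<delta> \<le> shift \<gamma> \<delta> \<beta>"
  using shift_iso bij_betwE by (metis atLeast_iff)

lemma shift_less_iff: "\<lbrakk>(\<gamma> :: 'k) \<le> \<alpha>; \<gamma> \<le> \<beta>\<rbrakk> \<Longrightarrow> shift \<gamma> \<delta> \<alpha> < shift \<gamma> \<delta> \<beta> \<longleftrightarrow> \<alpha> < \<beta>"
  using shift_iso[of \<gamma> \<delta>] by (metis atLeast_iff linorder_neqE not_less_iff_gr_or_eq strict_mono_onD)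

lemma shift_refl: "(\<gamma> :: 'k) \<le> \<beta> \<Longrightarrow> shift \<gamma> \<gamma> \<beta> = \<beta>"
  using shift_eqI[of id \<gamma> \<gamma> \<beta>] by (simp add: strict_mono_on_def)

text \<open>A composite of isomorphisms of upper segments is again one, and \<open>shift_eqI\<close>
  accepts any of them. Hence pulling back twice renumbers variables exactly as pulling back along
  the composite does.\<close>

lemma shift_shift: "(\<gamma> :: 'k) \<le> \<beta> \<Longrightarrow> shift \<delta> \<epsilon> (shift \<gamma> \<delta> \<beta>) = shift \<gamma> \<epsilon> \<beta>"
proof -
  assume "\<gamma> \<le> \<beta>"
  have "bij_betw (shift \<delta> \<epsilon> \<circ> shift \<gamma> \<delta>) {\<gamma>..} {\<epsilon>..}"
    using shift_iso bij_betw_trans by blast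
  moreover have "strict_mono_on {\<gamma>..} (shift \<delta> \<epsilon> \<circ> shift \<gamma> \<delta>)"
    by (auto simp: strict_mono_on_def shift_less_iff shift_ge)
  ultimately show ?thesis using shift_eqI \<open>\<gamma> \<le> \<beta>\<close> by fastforce
qed

lemma shift_inverse: "(\<gamma> :: 'k) \<le> \<beta> \<Longrightarrow> shift \<delta> \<gamma> (shift \<gamma> \<delta> \<beta>) = \<beta>"
  by (simp add: shift_shift shift_refl)

lemma shift_base: "shift \<gamma> \<delta> \<gamma> = (\<delta> :: 'k)"
proof (rule antisym)
  have "\<gamma> \<le> shift \<delta> \<gamma> \<delta>" by (simp add: shift_ge)
  then have "\<not> shift \<gamma> \<delta> (shift \<delta> \<gamma> \<delta>) < shift \<gamma> \<delta> \<gamma>" by (subst shift_less_iff) auto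
  then show "shift \<gamma> \<delta> \<gamma> \<le> \<delta>" by (simp add: shift_inverse)
qed (simp add: shift_ge)

end

section \<open>Sequences\<close>

lemma seq_dom: "is_seq f \<Longrightarrow> dom f = {..<len f}"
proof -
  assume "is_seq f"
  then obtain \<mu> where \<mu>: "dom f = {..<\<mu>}" by (auto simp: is_seq_def)
  have "len f = \<mu>" unfolding len_def
  proof (rule Least_equality)
    show "f \<mu> = None" using \<mu> by (metis domIff lessThan_iff less_irrefl)
    show "\<mu> \<le> y" if "f y = None" for y using \<mu> that by (metis domIff lessThan_iff not_le)
  qed
  with \<mu> show ?thesis by simp
qed

lemma seq_mem: "is_seq f \<Longrightarrow> \<alpha> \<in> dom f \<longleftrightarrow> \<alpha> < len f"
  by (simp add: seq_dom)

lemma is_seqI: "dom f = {..<\<mu>} \<Longrightarrow> is_seq f"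
  by (auto simp: is_seq_def)

lemma len_eqI: "dom f = {..<\<mu>} \<Longrightarrow> len f = \<mu>"
  using seq_dom[OF is_seqI] by (metis lessThan_eq_iff)

lemma len_cong: "dom f = dom g \<Longrightarrow> len f = len g"
  unfolding len_def by (metis domIff)

lemma init_seg_apply: "init_seg \<gamma> f \<alpha> = (if \<alpha> < \<gamma> then f \<alpha> else None)"
  by (simp add: init_seg_def restrict_map_def)

lemma tail_seg_apply: "tail_seg \<gamma> f \<alpha> = (if \<gamma> \<le> \<alpha> then f \<alpha> else None)"
  by (simp add: tail_seg_def restrict_map_def)

lemma dom_init_seg: "dom (init_seg \<gamma> f) = dom f \<inter> {..<\<gamma>}"
  by (auto simp: init_seg_apply split: if_splits)

lemma dom_tail_seg: "dom (tail_seg \<gamma> f) = dom f \<inter> {\<gamma>..}"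
  by (auto simp: tail_seg_apply split: if_splits)

lemma init_init: "init_seg \<alpha> (init_seg \<beta> f) = init_seg (min \<alpha> \<beta>) f"
  by (rule ext) (simp add: init_seg_apply)

lemma init_init_le: "\<alpha> \<le> \<beta> \<Longrightarrow> init_seg \<alpha> (init_seg \<beta> f) = init_seg \<alpha> f"
  by (simp add: init_init min_absorb1)

lemma is_seq_init: "is_seq f \<Longrightarrow> is_seq (init_seg \<gamma> f)"
  by (rule is_seqI[of _ "min \<gamma> (len f)"]) (auto simp: dom_init_seg seq_dom)

lemma len_init: "is_seq f \<Longrightarrow> \<gamma> \<le> len f \<Longrightarrow> len (init_seg \<gamma> f) = \<gamma>"
  by (rule len_eqI) (auto simp: dom_init_seg seq_dom)

lemma init_all: "is_seq f \<Longrightarrow> len f \<le> \<gamma> \<Longrightarrow> init_seg \<gamma> f = f"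
proof (rule ext)
  fix \<alpha> assume "is_seq f" "len f \<le> \<gamma>"
  then show "init_seg \<gamma> f \<alpha> = f \<alpha>"
    using seq_mem[of f \<alpha>] by (auto simp: init_seg_apply domIff)
qed

lemma init_tail: "init_seg \<gamma> f ++ tail_seg \<gamma> f = f"
  by (rule ext) (auto simp: map_add_def init_seg_apply tail_seg_apply split: option.splits)

lemma append_apply_right: "dom f \<subseteq> {..<\<gamma> :: 'k::wellorder} \<Longrightarrow> \<gamma> \<le> \<alpha> \<Longrightarrow> (f ++ e) \<alpha> = e \<alpha>"
proof -
  assume "dom f \<subseteq> {..<\<gamma>}" "\<gamma> \<le> \<alpha>"
  then have "\<alpha> \<notin> dom f" by (meson lessThan_iff not_le subsetD)
  then show ?thesis by (rule map_add_dom_app_simps(2))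
qed

lemma tail_append:
  assumes "dom f \<subseteq> {..<\<gamma>}" "dom e \<subseteq> {\<gamma>..}"
  shows "tail_seg \<gamma> (f ++ e) = e"
proof (rule ext)
  fix \<alpha>
  have "e \<alpha> = None" if "\<not> \<gamma> \<le> \<alpha>" using assms that by (auto simp: domIff[symmetric])
  then show "tail_seg \<gamma> (f ++ e) \<alpha> = e \<alpha>"
    using append_apply_right[OF assms(1), of \<alpha> e] by (simp add: tail_seg_apply)
qed

section \<open>Substitution\<close>

primrec fv :: "('s, 'k) expr \<Rightarrow> 'k set" where
  "fv (Var \<alpha>) = {\<alpha>}"
| "fv (App F e) = \<Union> (ran (map_option fv \<circ> e))"

abbreviation subst_seq ::
  "('k \<rightharpoonup> ('s, 'k) expr) \<Rightarrow> ('k \<rightharpoonup> ('s, 'k) expr) \<Rightarrow> ('k \<rightharpoonup> ('s, 'k) expr)" where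
  "subst_seq s t \<equiv> map_option (subst s) \<circ> t"

text \<open>Structural induction with the entries of the argument sequence as hypotheses, in place
  of the nested set operators of the function and option types.\<close>

lemma expr_induct [case_names Var App]:
  assumes "\<And>\<alpha>. P (Var \<alpha>)" and "\<And>F e. (\<And>\<alpha> u. e \<alpha> = Some u \<Longrightarrow> P u) \<Longrightarrow> P (App F e)"
  shows "P A"
proof (induction A)
  case (App F e)
  show ?case by (rule assms(2)) (metis App option.set_intros rangeI)
qed (rule assms(1))

lemma fv_App: "e \<alpha> = Some u \<Longrightarrow> fv u \<subseteq> fv (App F e)"
  by (fastforce simp: ran_def)

lemma fv_AppI: "(\<And>\<alpha> u. e \<alpha> = Some u \<Longrightarrow> fv u \<subseteq> S) \<Longrightarrow> fv (App F e) \<subseteq> S"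
  by (fastforce simp: ran_def)

lemma subst_cong: "(\<And>\<alpha>. \<alpha> \<in> fv A \<Longrightarrow> s \<alpha> = s' \<alpha>) \<Longrightarrow> subst s A = subst s' A"
proof (induction A rule: expr_induct)
  case (App F e)
  have "subst s u = subst s' u" if "e \<alpha> = Some u" for \<alpha> u
    using App.IH[OF that] App.prems fv_App[of e, OF that] by blast
  then show ?case by (auto simp: fun_eq_iff intro!: option.map_cong)
qed simp

text \<open>A variable outside \<open>dom t\<close> would be replaced by \<open>s\<close> on the
  left but left alone on the right, hence the condition on \<open>fv A\<close>.\<close>

lemma subst_subst: "fv A \<subseteq> dom t \<Longrightarrow> subst s (subst t A) = subst (subst_seq s t) A"
proof (induction A rule: expr_induct)
  case (App F e)
  have "subst s (subst t u) = subst (subst_seq s t) u" if "e \<alpha> = Some u" for \<alpha> u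
    using App.IH[OF that] App.prems fv_App[of e, OF that] by blast
  then show ?case by (auto simp: fun_eq_iff option.map_comp comp_def intro!: option.map_cong)
qed (auto split: option.splits)

lemma fv_subst: "\<lbrakk>fv A \<subseteq> dom t; \<And>\<alpha> u. t \<alpha> = Some u \<Longrightarrow> fv u \<subseteq> S\<rbrakk> \<Longrightarrow> fv (subst t A) \<subseteq> S"
proof (induction A rule: expr_induct)
  case (App F e)
  have "fv (subst t u) \<subseteq> S" if "e \<alpha> = Some u" for \<alpha> u
    using App.IH[OF that] App.prems fv_App[of e, OF that] by blast
  then show ?case unfolding subst.simps by (intro fv_AppI) auto
qed (auto split: option.splits)

lemma subst_ident: "(\<And>\<alpha> u. s \<alpha> = Some u \<Longrightarrow> u = Var \<alpha>) \<Longrightarrow> subst s A = A"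
proof (induction A rule: expr_induct)
  case (App F e)
  then show ?case by (auto simp: fun_eq_iff option.map_ident intro!: option.map_ident_strong)
qed (auto split: option.splits)

lemma subst_vars [simp]: "subst (vars \<Gamma>) A = A"
  by (rule subst_ident) (auto simp: vars_def split: if_splits)

lemma subst_init_vars [simp]: "subst (init_seg \<gamma> (vars \<Gamma>)) A = A"
  by (rule subst_ident) (auto simp: vars_def init_seg_apply split: if_splits)

lemma dom_vars [simp]: "dom (vars \<Gamma>) = dom \<Gamma>"
  by (auto simp: vars_def split: if_splits)

lemma init_vars: "init_seg \<gamma> (vars \<Gamma>) = vars (init_seg \<gamma> \<Gamma>)"
  by (rule ext) (auto simp: vars_def init_seg_apply domIff)

lemma vars_cong: "dom \<Gamma> = dom \<Gamma>' \<Longrightarrow> vars \<Gamma> = vars \<Gamma>'"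
  by (simp add: vars_def)

lemma dom_subst_seq [simp]: "dom (subst_seq s t) = dom t"
  by (auto simp: domIff)

lemma init_subst_seq: "init_seg \<gamma> (subst_seq s t) = subst_seq s (init_seg \<gamma> t)"
  by (rule ext) (simp add: init_seg_apply)

lemma subst_seq_assoc:
  "(\<And>\<alpha> u. t \<alpha> = Some u \<Longrightarrow> fv u \<subseteq> dom s) \<Longrightarrow>
    subst_seq r (subst_seq s t) = subst_seq (subst_seq r s) t"
proof (rule ext)
  fix \<alpha> assume "\<And>\<alpha> u. t \<alpha> = Some u \<Longrightarrow> fv u \<subseteq> dom s"
  then show "subst_seq r (subst_seq s t) \<alpha> = subst_seq (subst_seq r s) t \<alpha>"
    by (cases "t \<alpha>") (simp_all add: subst_subst)
qed

lemma subst_seq_vars_left [simp]: "subst_seq (vars \<Gamma>) t = t"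
  by (rule ext) (simp add: option.map_ident_strong)

lemma subst_seq_vars_right: "dom t = dom \<Gamma> \<Longrightarrow> subst_seq t (vars \<Gamma>) = t"
  by (rule ext) (auto simp: vars_def domIff split: option.splits)

lemma dom_eq_obtain:
  assumes "dom f = dom g" "f \<alpha> = Some x"
  obtains y where "g \<alpha> = Some y"
  using assms by (metis domD domI)

lemma terms_wrtE:
  assumes "terms_wrt D \<Gamma> s \<Delta>" "s \<alpha> = Some u"
  obtains A where "\<Delta> \<alpha> = Some A" "D (HasType \<Gamma> u (subst (init_seg \<alpha> s) A))"
proof -
  have "\<alpha> \<in> dom \<Delta>" using assms by (auto simp: terms_wrt_def)
  then show ?thesis using assms that by (auto simp: terms_wrt_def)
qed

lemma terms_eq_wrtE:
  assumes "terms_eq_wrt D \<Gamma> s s' \<Delta>" "\<alpha> \<in> dom \<Delta>"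
  obtains u u' A where "s \<alpha> = Some u" "s' \<alpha> = Some u'" "\<Delta> \<alpha> = Some A"
    "D (TermEq \<Gamma> u u' (subst (init_seg \<alpha> s) A))"
proof -
  obtain u u' A where "s \<alpha> = Some u" "s' \<alpha> = Some u'" "\<Delta> \<alpha> = Some A"
    using assms unfolding terms_eq_wrt_def by (metis domD)
  then show ?thesis using assms that by (auto simp: terms_eq_wrt_def)
qed

lemma terms_eq_wrtE_left:
  assumes "terms_eq_wrt D \<Gamma> s s' \<Delta>" "s \<alpha> = Some u"
  obtains u' A where "s' \<alpha> = Some u'" "\<Delta> \<alpha> = Some A" "D (TermEq \<Gamma> u u' (subst (init_seg \<alpha> s) A))"
proof -
  have "\<alpha> \<in> dom \<Delta>" using assms by (auto simp: terms_eq_wrt_def)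
  from terms_eq_wrtE[OF assms(1) this] assms(2) that show ?thesis by (metis option.inject)
qed

lemma terms_eq_wrtE_right:
  assumes "terms_eq_wrt D \<Gamma> s s' \<Delta>" "s' \<alpha> = Some u'"
  obtains u A where "s \<alpha> = Some u" "\<Delta> \<alpha> = Some A" "D (TermEq \<Gamma> u u' (subst (init_seg \<alpha> s) A))"
proof -
  have "\<alpha> \<in> dom \<Delta>" using assms by (auto simp: terms_eq_wrt_def)
  from terms_eq_wrtE[OF assms(1) this] assms(2) that show ?thesis by (metis option.inject)
qed

section \<open>Structural rules\<close>

locale algebraic_theory =
  fixes T :: "('s, 'k::wellorder) pretheory"
  assumes theory_wf: "generalized_algebraic_theory T"
begin

abbreviation "ctx \<equiv> context_wrt (derived T)"
abbreviation "ty \<Gamma> A \<equiv> derived T (IsType \<Gamma> A)"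
abbreviation "tm \<Gamma> t A \<equiv> derived T (HasType \<Gamma> t A)"
abbreviation "ty_eq \<Gamma> A A' \<equiv> derived T (TypeEq \<Gamma> A A')"
abbreviation "tm_eq \<Gamma> t t' A \<equiv> derived T (TermEq \<Gamma> t t' A)"
abbreviation "sub \<equiv> terms_wrt (derived T)"
abbreviation "sub_eq \<equiv> terms_eq_wrt (derived T)"

lemma ctx_seq: "ctx \<Gamma> \<Longrightarrow> is_seq \<Gamma>"
  by (simp add: context_wrt_def)

lemma ctx_ty: "ctx \<Gamma> \<Longrightarrow> \<Gamma> \<alpha> = Some A \<Longrightarrow> ty (init_seg \<alpha> \<Gamma>) A"
  by (simp add: context_wrt_def)

lemma ctx_init: "ctx \<Gamma> \<Longrightarrow> ctx (init_seg \<gamma> \<Gamma>)"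
  by (auto simp: context_wrt_def is_seq_init init_seg_apply init_init_le split: if_splits)

text \<open>
  Since \<open>subst\<close> leaves variables outside the domain of the substitution unchanged, the composition
  law \<open>subst_subst\<close> only holds for expressions whose variables are declared in the premise.
\<close>

primrec scoped :: "('s, 'k) jdg \<Rightarrow> bool" where
  "scoped (IsType \<Gamma> A) \<longleftrightarrow> ctx \<Gamma> \<and> fv A \<subseteq> dom \<Gamma>"
| "scoped (HasType \<Gamma> t A) \<longleftrightarrow> ctx \<Gamma> \<and> fv t \<subseteq> dom \<Gamma> \<and> fv A \<subseteq> dom \<Gamma>"
| "scoped (TypeEq \<Gamma> A A') \<longleftrightarrow> ctx \<Gamma> \<and> fv A \<subseteq> dom \<Gamma> \<and> fv A' \<subseteq> dom \<Gamma>"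
| "scoped (TermEq \<Gamma> t t' A) \<longleftrightarrow> ctx \<Gamma> \<and> fv t \<subseteq> dom \<Gamma> \<and> fv t' \<subseteq> dom \<Gamma> \<and> fv A \<subseteq> dom \<Gamma>"

lemma derived_scoped: "derived T J \<Longrightarrow> scoped J"
proof (induction rule: derived.induct)
  case (variable \<Gamma> \<alpha> A)
  \<comment> \<open>In this induction the premises state derivability and the induction hypothesis
    together, inside \<open>context_wrt\<close>, \<open>terms_wrt\<close> and the like; unfolding
    these separates the two.\<close>
  then have "ctx \<Gamma>" "fv A \<subseteq> dom (init_seg \<alpha> \<Gamma>)" by (auto simp: context_wrt_def)
  then show ?case using variable by (auto simp: dom_init_seg)
next
  case (sort_symbol B \<Delta> \<Gamma> t)
  have "ctx \<Gamma>" using sort_symbol by (auto simp: context_wrt_def)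
  moreover have "fv (App B t) \<subseteq> dom \<Gamma>"
    by (rule fv_AppI) (use sort_symbol(4) in \<open>fastforce elim: terms_wrtE\<close>)
  ultimately show ?case by simp
next
  case (op_symbol F \<Delta> A \<Gamma> t)
  have c: "ctx \<Gamma>" using op_symbol by (auto simp: context_wrt_def)
  have t: "fv u \<subseteq> dom \<Gamma>" if "t \<alpha> = Some u" for \<alpha> u
    using op_symbol(4) that by (fastforce elim: terms_wrtE)
  have "fv A \<subseteq> dom t" using op_symbol by (auto simp: terms_wrt_def)
  then have "fv (subst t A) \<subseteq> dom \<Gamma>" using t by (rule fv_subst)
  moreover have "fv (App F t) \<subseteq> dom \<Gamma>" using t by (rule fv_AppI)
  ultimately show ?case using c by simp
next
  case (type_cong \<Delta> A A' \<Gamma> s s')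
  have c: "ctx \<Gamma>" using type_cong by (auto simp: context_wrt_def)
  have "fv u \<subseteq> dom \<Gamma>" if "s \<alpha> = Some u" for \<alpha> u
    using type_cong(4) that by (fastforce elim: terms_eq_wrtE_left)
  moreover have "fv u \<subseteq> dom \<Gamma>" if "s' \<alpha> = Some u" for \<alpha> u
    using type_cong(4) that by (fastforce elim: terms_eq_wrtE_right)
  moreover have "fv A \<subseteq> dom s" "fv A' \<subseteq> dom s'"
    using type_cong by (auto simp: terms_eq_wrt_def)
  ultimately show ?case using c by (simp add: fv_subst)
next
  case (term_cong \<Delta> t t' A \<Gamma> s s')
  have c: "ctx \<Gamma>" using term_cong by (auto simp: context_wrt_def)
  have "fv u \<subseteq> dom \<Gamma>" if "s \<alpha> = Some u" for \<alpha> u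
    using term_cong(4) that by (fastforce elim: terms_eq_wrtE_left)
  moreover have "fv u \<subseteq> dom \<Gamma>" if "s' \<alpha> = Some u" for \<alpha> u
    using term_cong(4) that by (fastforce elim: terms_eq_wrtE_right)
  moreover have "fv A \<subseteq> dom s" "fv t \<subseteq> dom s" "fv t' \<subseteq> dom s'"
    using term_cong by (auto simp: terms_eq_wrt_def)
  ultimately show ?case using c by (simp add: fv_subst)
next
  case (axiom J)
  \<comment> \<open>Axioms are equalities, so the well-formedness premise of the axiom rule already
    contains the induction hypothesis for both sides.\<close>
  then have "is_equality J" using theory_wf
    by (auto simp: generalized_algebraic_theory_def is_pretheory_def)
  with axiom(2) show ?case by (cases J) auto
qed auto

lemma ty_ctx: "ty \<Gamma> A \<Longrightarrow> ctx \<Gamma>" and ty_fv: "ty \<Gamma> A \<Longrightarrow> fv A \<subseteq> dom \<Gamma>"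
  using derived_scoped by fastforce+

lemma tm_fv: "tm \<Gamma> t A \<Longrightarrow> fv t \<subseteq> dom \<Gamma>"
  using derived_scoped by fastforce+

lemma ty_eq_ctx: "ty_eq \<Gamma> A A' \<Longrightarrow> ctx \<Gamma>"
  using derived_scoped by fastforce

lemma tm_eq_ctx: "tm_eq \<Gamma> t t' A \<Longrightarrow> ctx \<Gamma>"
  using derived_scoped by fastforce

lemma ctx_fv: "ctx \<Gamma> \<Longrightarrow> \<Gamma> \<alpha> = Some A \<Longrightarrow> fv A \<subseteq> dom \<Gamma> \<inter> {..<\<alpha>}"
  using ty_fv[OF ctx_ty] by (simp add: dom_init_seg)

lemma sub_dom: "sub \<Gamma> s \<Delta> \<Longrightarrow> dom s = dom \<Delta>"
  by (simp add: terms_wrt_def)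

lemma sub_tm:
  "\<lbrakk>sub \<Gamma> s \<Delta>; s \<alpha> = Some u; \<Delta> \<alpha> = Some A\<rbrakk> \<Longrightarrow> tm \<Gamma> u (subst (init_seg \<alpha> s) A)"
  by (simp add: terms_wrt_def)

lemma sub_obtain:
  assumes "sub \<Gamma> s \<Delta>" "\<Delta> \<alpha> = Some A"
  obtains u where "s \<alpha> = Some u" "tm \<Gamma> u (subst (init_seg \<alpha> s) A)"
proof -
  have "dom \<Delta> = dom s" using assms by (simp add: terms_wrt_def)
  from dom_eq_obtain[OF this assms(2)] obtain u where "s \<alpha> = Some u" .
  then show ?thesis using assms that by (auto simp: terms_wrt_def)
qed

lemma sub_eq_obtain:
  assumes "sub_eq \<Gamma> s s' \<Delta>" "\<Delta> \<alpha> = Some A"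
  obtains u u' where "s \<alpha> = Some u" "s' \<alpha> = Some u'" "tm_eq \<Gamma> u u' (subst (init_seg \<alpha> s) A)"
  using terms_eq_wrtE[OF assms(1), of \<alpha>] assms(2) by (metis domI option.inject)

lemma subI:
  assumes "dom s = dom \<Delta>"
    and "\<And>\<alpha> u A. \<lbrakk>s \<alpha> = Some u; \<Delta> \<alpha> = Some A\<rbrakk> \<Longrightarrow> tm \<Gamma> u (subst (init_seg \<alpha> s) A)"
  shows "sub \<Gamma> s \<Delta>"
  using assms by (simp add: terms_wrt_def)

lemma sub_eqI:
  assumes "dom s = dom \<Delta>" "dom s' = dom \<Delta>"
    and "\<And>\<alpha> u u' A. \<lbrakk>s \<alpha> = Some u; s' \<alpha> = Some u'; \<Delta> \<alpha> = Some A\<rbrakk> \<Longrightarrow>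
      tm_eq \<Gamma> u u' (subst (init_seg \<alpha> s) A)"
  shows "sub_eq \<Gamma> s s' \<Delta>"
  using assms by (simp add: terms_eq_wrt_def)

lemma sub_fv: "sub \<Gamma> s \<Delta> \<Longrightarrow> s \<alpha> = Some u \<Longrightarrow> fv u \<subseteq> dom \<Gamma>"
  by (blast elim: terms_wrtE dest: tm_fv)

lemma sub_init: "sub \<Gamma> s \<Delta> \<Longrightarrow> sub \<Gamma> (init_seg \<gamma> s) (init_seg \<gamma> \<Delta>)"
  by (auto simp: terms_wrt_def dom_init_seg init_seg_apply init_init_le split: if_splits)

lemma sub_eq_init: "sub_eq \<Gamma> s s' \<Delta> \<Longrightarrow> sub_eq \<Gamma> (init_seg \<gamma> s) (init_seg \<gamma> s') (init_seg \<gamma> \<Delta>)"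
  by (auto simp: terms_eq_wrt_def dom_init_seg init_seg_apply init_init_le split: if_splits)

lemma sub_refl: "sub \<Gamma> s \<Delta> \<Longrightarrow> sub_eq \<Gamma> s s \<Delta>"
  by (rule sub_eqI) (auto simp: sub_dom intro: term_refl sub_tm)

text \<open>The type of \<open>x\<close> at position \<open>\<alpha>\<close> mentions only earlier
  variables, so the cut in the typing rules may be dropped or inserted at will.\<close>

lemma subst_init_type:
  "\<lbrakk>ctx \<Delta>; \<Delta> \<alpha> = Some A\<rbrakk> \<Longrightarrow> subst (init_seg \<alpha> s) A = subst s A"
  using ctx_fv by (fastforce intro: subst_cong simp: init_seg_apply)

lemma subst_subst_type:
  "\<lbrakk>ctx \<Delta>; \<Delta> \<alpha> = Some A; dom t = dom \<Delta>\<rbrakk> \<Longrightarrow>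
    subst s (subst (init_seg \<alpha> t) A) = subst (init_seg \<alpha> (subst_seq s t)) A"
  using ctx_fv[of \<Delta> \<alpha> A] by (simp add: subst_init_type subst_subst)

text \<open>For equality judgments, substitution is the congruence rule together with reflexivity.\<close>

lemma substitution_rule:
  "derived T J \<Longrightarrow> ctx \<Gamma> \<Longrightarrow>
    (\<forall>\<Delta> A s. J = IsType \<Delta> A \<longrightarrow> sub \<Gamma> s \<Delta> \<longrightarrow> ty \<Gamma> (subst s A)) \<and>
    (\<forall>\<Delta> t A s. J = HasType \<Delta> t A \<longrightarrow> sub \<Gamma> s \<Delta> \<longrightarrow> tm \<Gamma> (subst s t) (subst s A))"
proof (induction rule: derived.induct)
  case (conv \<Delta> A\<^sub>1 A\<^sub>2 t)
  then show ?case using type_cong[OF conv(1) conv.prems sub_refl] derived.conv by blast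
next
  case (variable \<Delta> \<alpha> A)
  have "ctx \<Delta>" using variable by (auto simp: context_wrt_def)
  with variable show ?case by (fastforce elim: sub_obtain simp: subst_init_type)
next
  case (sort_symbol B \<Theta> \<Delta> t)
  \<comment> \<open>The arity of \<open>B\<close> is a context because the theory is well-formed.
    Its types are therefore scoped, which is what lets the two substitutions be merged in
    them.\<close>
  have c: "ctx \<Theta>" using theory_wf sort_symbol(1)
    by (auto simp: generalized_algebraic_theory_def dest!: spec[of _ B])
  have "ty \<Gamma> (App B (subst_seq s t))" if s: "sub \<Gamma> s \<Delta>" for s
  proof (rule derived.sort_symbol[OF sort_symbol(1)])
    show "sub \<Gamma> (subst_seq s t) \<Theta>"
      using sort_symbol(4) s sort_symbol.prems subst_subst_type[OF c]
      by (fastforce simp: terms_wrt_def)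
  qed (use c sort_symbol.prems in auto)
  then show ?case by auto
next
  case (op_symbol F \<Theta> A \<Delta> t)
  have A: "ty \<Theta> A" using theory_wf op_symbol(1)
    by (auto simp: generalized_algebraic_theory_def dest!: spec[of _ F])
  note c = ty_ctx[OF A]
  have d: "dom t = dom \<Theta>" using op_symbol(4) by (simp add: terms_wrt_def)
  have "tm \<Gamma> (App F (subst_seq s t)) (subst (subst_seq s t) A)" if s: "sub \<Gamma> s \<Delta>" for s
  proof (rule derived.op_symbol[OF op_symbol(1)])
    show "sub \<Gamma> (subst_seq s t) \<Theta>"
      using op_symbol(4) s op_symbol.prems subst_subst_type[OF c]
      by (fastforce simp: terms_wrt_def)
  qed (use A op_symbol.prems in auto)
  then show ?case using subst_subst[of A t] ty_fv[OF A] d by auto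
next
  case (axiom J)
  then have "is_equality J" using theory_wf
    by (auto simp: generalized_algebraic_theory_def is_pretheory_def)
  then show ?case by (cases J) auto
qed auto

lemma ty_subst: "\<lbrakk>ty \<Delta> A; ctx \<Gamma>; sub \<Gamma> s \<Delta>\<rbrakk> \<Longrightarrow> ty \<Gamma> (subst s A)"
  and tm_subst: "\<lbrakk>tm \<Delta> t A; ctx \<Gamma>; sub \<Gamma> s \<Delta>\<rbrakk> \<Longrightarrow> tm \<Gamma> (subst s t) (subst s A)"
  using substitution_rule by blast+

lemma ty_eq_subst: "\<lbrakk>ty_eq \<Delta> A A'; ctx \<Gamma>; sub \<Gamma> s \<Delta>\<rbrakk> \<Longrightarrow> ty_eq \<Gamma> (subst s A) (subst s A')"
  by (blast intro: type_cong sub_refl)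

lemma tm_eq_subst:
  "\<lbrakk>tm_eq \<Delta> t t' A; ctx \<Gamma>; sub \<Gamma> s \<Delta>\<rbrakk> \<Longrightarrow> tm_eq \<Gamma> (subst s t) (subst s t') (subst s A)"
  by (blast intro: term_cong sub_refl)

lemma sub_comp:
  assumes "ctx \<Gamma>" "sub \<Gamma> s \<Delta>" "ctx \<Theta>" "sub \<Delta> t \<Theta>"
  shows "sub \<Gamma> (subst_seq s t) \<Theta>"
proof (rule subI)
  show "dom (subst_seq s t) = dom \<Theta>" using sub_dom[OF assms(4)] by simp
  fix \<alpha> u A assume u: "subst_seq s t \<alpha> = Some u" "\<Theta> \<alpha> = Some A"
  then obtain v where v: "t \<alpha> = Some v" "u = subst s v" by auto
  show "tm \<Gamma> u (subst (init_seg \<alpha> (subst_seq s t)) A)"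
    using tm_subst[OF sub_tm[OF assms(4) v(1) u(2)] assms(1,2)] v
      subst_subst_type[OF assms(3) u(2) sub_dom[OF assms(4)]] by simp
qed



lemma vars_sub: "ctx \<Gamma> \<Longrightarrow> sub \<Gamma> (vars \<Gamma>) \<Gamma>"
proof (rule subI)
  fix \<alpha> u A assume "ctx \<Gamma>" "vars \<Gamma> \<alpha> = Some u" "\<Gamma> \<alpha> = Some A"
  then show "tm \<Gamma> u (subst (init_seg \<alpha> (vars \<Gamma>)) A)"
    by (auto simp: vars_def[of \<Gamma>] intro: variable split: if_splits
        simp del: subst_init_vars simp: subst_init_vars[unfolded vars_def])
qed simp

lemma display_sub: "ctx \<Gamma> \<Longrightarrow> sub \<Gamma> (vars (init_seg \<gamma> \<Gamma>)) (init_seg \<gamma> \<Gamma>)"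
  using sub_init[OF vars_sub] by (simp add: init_vars)

text \<open>Weakening is not a rule of the calculus. It is substitution along a display map, which
  leaves expressions unchanged.\<close>

lemma weaken_ty: "\<lbrakk>ty (init_seg \<gamma> \<Gamma>) A; ctx \<Gamma>\<rbrakk> \<Longrightarrow> ty \<Gamma> A"
  using ty_subst[OF _ _ display_sub] by simp

lemma weaken_tm: "\<lbrakk>tm (init_seg \<gamma> \<Gamma>) t A; ctx \<Gamma>\<rbrakk> \<Longrightarrow> tm \<Gamma> t A"
  using tm_subst[OF _ _ display_sub] by simp

lemma weaken_tm_eq: "\<lbrakk>tm_eq (init_seg \<gamma> \<Gamma>) t t' A; ctx \<Gamma>\<rbrakk> \<Longrightarrow> tm_eq \<Gamma> t t' A"
  using tm_eq_subst[OF _ _ display_sub] by simp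

text \<open>Congruence applied to reflexivity of a type. It moves terms between the types obtained
  by substituting two equal sequences.\<close>

lemma type_along_sub_eq:
  assumes "ctx \<Gamma>" "ctx \<Delta>" "sub_eq \<Gamma> s s' \<Delta>" "\<Delta> \<alpha> = Some A"
  shows "ty_eq \<Gamma> (subst (init_seg \<alpha> s) A) (subst (init_seg \<alpha> s') A)"
  by (rule type_cong[OF type_refl[OF ctx_ty[OF assms(2,4)]] assms(1) sub_eq_init[OF assms(3)]])

text \<open>The components of \<open>s'\<close> come typed over initial segments of \<open>s\<close>
  and are converted to their own. Their typing is a separate hypothesis because the lemma serves
  inside the induction that proves presuppositions, where it comes from the induction
  hypothesis.\<close>

lemma sub_right:
  assumes "ctx \<Gamma>" "ctx \<Delta>" "sub_eq \<Gamma> s s' \<Delta>"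
    and "\<And>\<alpha> u A. \<lbrakk>s' \<alpha> = Some u; \<Delta> \<alpha> = Some A\<rbrakk> \<Longrightarrow> tm \<Gamma> u (subst (init_seg \<alpha> s) A)"
  shows "sub \<Gamma> s' \<Delta>"
proof (rule subI)
  show "dom s' = dom \<Delta>" using assms(3) by (simp add: terms_eq_wrt_def)
  fix \<alpha> u A assume "s' \<alpha> = Some u" "\<Delta> \<alpha> = Some A"
  then show "tm \<Gamma> u (subst (init_seg \<alpha> s') A)"
    using assms(4) type_along_sub_eq[OF assms(1-3)] conv by blast
qed

section \<open>Presuppositions of derived judgments\<close>

primrec presupposed :: "('s, 'k) jdg \<Rightarrow> bool" where
  "presupposed (IsType \<Gamma> A) \<longleftrightarrow> True"
| "presupposed (HasType \<Gamma> t A) \<longleftrightarrow> ty \<Gamma> A"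
| "presupposed (TypeEq \<Gamma> A A') \<longleftrightarrow> ty \<Gamma> A \<and> ty \<Gamma> A'"
| "presupposed (TermEq \<Gamma> t t' A) \<longleftrightarrow> tm \<Gamma> t A \<and> tm \<Gamma> t' A \<and> ty \<Gamma> A"

text \<open>The congruence rules need the work: their right-hand sides use \<open>s'\<close>, which
  must first be shown to be a substitution in its own right before the substitution rule applies to
  it.\<close>

lemma derived_presupposed: "derived T J \<Longrightarrow> presupposed J"
proof (induction rule: derived.induct)
  case (conv_eq \<Gamma> A\<^sub>1 A\<^sub>2 t\<^sub>1 t\<^sub>2)
  then show ?case by (auto intro: conv)
next
  case (variable \<Gamma> \<alpha> A)
  have "ctx \<Gamma>" using variable by (auto simp: context_wrt_def)
  then show ?case using variable by (auto intro: weaken_ty ctx_ty)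
next
  case (op_symbol F \<Delta> A \<Gamma> t)
  have "ctx \<Gamma>" using op_symbol by (auto simp: context_wrt_def)
  then show ?case using op_symbol by (auto simp: terms_wrt_def intro!: ty_subst)
next
  case (type_cong \<Delta> A A' \<Gamma> s s')
  have c: "ctx \<Gamma>" using type_cong by (auto simp: context_wrt_def)
  have se: "sub_eq \<Gamma> s s' \<Delta>" using type_cong(4) by (auto simp: terms_eq_wrt_def)
  have s: "sub \<Gamma> s \<Delta>"
    by (rule subI) (use type_cong(4) in \<open>auto simp: terms_eq_wrt_def domIff set_eq_iff, blast\<close>)
  have s': "sub \<Gamma> s' \<Delta>"
    by (rule sub_right[OF c ty_eq_ctx[OF type_cong(1)] se])
      (use type_cong(4) in \<open>auto simp: terms_eq_wrt_def domIff set_eq_iff, blast\<close>)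
  from type_cong.IH c s s' show ?case by (auto intro: ty_subst)
next
  case (term_cong \<Delta> t t' A \<Gamma> s s')
  have c: "ctx \<Gamma>" using term_cong by (auto simp: context_wrt_def)
  have se: "sub_eq \<Gamma> s s' \<Delta>" using term_cong(4) by (auto simp: terms_eq_wrt_def)
  have s: "sub \<Gamma> s \<Delta>"
    by (rule subI) (use term_cong(4) in \<open>auto simp: terms_eq_wrt_def domIff set_eq_iff, blast\<close>)
  have s': "sub \<Gamma> s' \<Delta>"
    by (rule sub_right[OF c tm_eq_ctx[OF term_cong(1)] se])
      (use term_cong(4) in \<open>auto simp: terms_eq_wrt_def domIff set_eq_iff, blast\<close>)
  have A: "ty \<Delta> A" using term_cong.IH by simp
  \<comment> \<open>The right-hand term is naturally typed in \<open>subst s' A\<close>, while the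
    judgment states \<open>subst s A\<close>; this equality performs the conversion.\<close>
  have "ty_eq \<Gamma> (subst s' A) (subst s A)"
    by (rule type_sym[OF derived.type_cong[OF type_refl[OF A] c se]])
  moreover have "tm \<Gamma> (subst s' t') (subst s' A)"
    using term_cong.IH c s' by (auto intro: tm_subst)
  ultimately show ?case using term_cong.IH c s A
    by (auto intro: ty_subst tm_subst conv)
next
  case (axiom J)
  then have "is_equality J" using theory_wf
    by (auto simp: generalized_algebraic_theory_def is_pretheory_def)
  with axiom(2) show ?case by (cases J) auto
qed auto

lemma tm_eq_left: "tm_eq \<Gamma> t t' A \<Longrightarrow> tm \<Gamma> t A" and tm_eq_right: "tm_eq \<Gamma> t t' A \<Longrightarrow> tm \<Gamma> t' A"
  using derived_presupposed by fastforce+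

lemma sub_eq_left: "sub_eq \<Gamma> s s' \<Delta> \<Longrightarrow> sub \<Gamma> s \<Delta>"
proof (rule subI)
  fix \<alpha> u A assume u: "sub_eq \<Gamma> s s' \<Delta>" "s \<alpha> = Some u" "\<Delta> \<alpha> = Some A"
  obtain v v' where "s \<alpha> = Some v" "tm_eq \<Gamma> v v' (subst (init_seg \<alpha> s) A)"
    using sub_eq_obtain[OF u(1,3)] .
  with u(2) show "tm \<Gamma> u (subst (init_seg \<alpha> s) A)" by (auto dest: tm_eq_left)
qed (simp add: terms_eq_wrt_def)

text \<open>Types in a componentwise equality are instantiated by the left sequence, so exchanging
  the sides costs a conversion in every component.\<close>

lemma sub_eq_sym:
  assumes "ctx \<Gamma>" "ctx \<Delta>" "sub_eq \<Gamma> s s' \<Delta>"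
  shows "sub_eq \<Gamma> s' s \<Delta>"
proof (rule sub_eqI)
  fix \<alpha> u u' A assume u: "s' \<alpha> = Some u" "s \<alpha> = Some u'" "\<Delta> \<alpha> = Some A"
  then have "tm_eq \<Gamma> u' u (subst (init_seg \<alpha> s) A)" using sub_eq_obtain[OF assms(3) u(3)] by auto
  with type_along_sub_eq[OF assms u(3)] show "tm_eq \<Gamma> u u' (subst (init_seg \<alpha> s') A)"
    by (blast intro: conv_eq term_sym)
qed (use assms(3) in \<open>auto simp: terms_eq_wrt_def\<close>)

lemma sub_eq_right: "\<lbrakk>ctx \<Gamma>; ctx \<Delta>; sub_eq \<Gamma> s s' \<Delta>\<rbrakk> \<Longrightarrow> sub \<Gamma> s' \<Delta>"
  by (blast intro: sub_eq_left sub_eq_sym)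

lemma sub_eq_trans:
  assumes "ctx \<Gamma>" "ctx \<Delta>" and s: "sub_eq \<Gamma> s s' \<Delta>" and s': "sub_eq \<Gamma> s' s'' \<Delta>"
  shows "sub_eq \<Gamma> s s'' \<Delta>"
proof (rule sub_eqI)
  fix \<alpha> u u'' A assume u: "s \<alpha> = Some u" "s'' \<alpha> = Some u''" "\<Delta> \<alpha> = Some A"
  obtain v where v: "s' \<alpha> = Some v" "tm_eq \<Gamma> u v (subst (init_seg \<alpha> s) A)"
    using sub_eq_obtain[OF s u(3)] u by auto
  have "tm_eq \<Gamma> v u'' (subst (init_seg \<alpha> s') A)"
    using sub_eq_obtain[OF s' u(3)] u v by auto
  then have "tm_eq \<Gamma> v u'' (subst (init_seg \<alpha> s) A)"
    using type_along_sub_eq[OF assms(1,2) s u(3)] by (blast intro: conv_eq type_sym)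
  with v(2) show "tm_eq \<Gamma> u u'' (subst (init_seg \<alpha> s) A)" by (rule term_trans)
qed (use s s' in \<open>auto simp: terms_eq_wrt_def\<close>)

lemma sub_eq_comp:
  assumes "ctx \<Gamma>" "sub_eq \<Gamma> s s' \<Delta>" "ctx \<Theta>" "sub_eq \<Delta> t t' \<Theta>"
  shows "sub_eq \<Gamma> (subst_seq s t) (subst_seq s' t') \<Theta>"
proof (rule sub_eqI)
  have d: "dom t = dom \<Theta>" "dom t' = dom \<Theta>" using assms(4) by (auto simp: terms_eq_wrt_def)
  then show "dom (subst_seq s t) = dom \<Theta>" "dom (subst_seq s' t') = dom \<Theta>" by simp_all
  fix \<alpha> u u' A
  assume u: "subst_seq s t \<alpha> = Some u" "subst_seq s' t' \<alpha> = Some u'" "\<Theta> \<alpha> = Some A"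
  then obtain v v' where v: "t \<alpha> = Some v" "u = subst s v" "t' \<alpha> = Some v'" "u' = subst s' v'"
    by auto
  then have "tm_eq \<Delta> v v' (subst (init_seg \<alpha> t) A)" using sub_eq_obtain[OF assms(4) u(3)] by auto
  from term_cong[OF this assms(1,2)] v subst_subst_type[OF assms(3) u(3) d(1)]
  show "tm_eq \<Gamma> u u' (subst (init_seg \<alpha> (subst_seq s t)) A)" by simp
qed

section \<open>Derivably equal contexts\<close>

lemma context_rel_iff:
  "(\<Gamma>, \<Gamma>') \<in> context_rel T \<longleftrightarrow> ctx \<Gamma> \<and> ctx \<Gamma>' \<and> dom \<Gamma> = dom \<Gamma>' \<and>
     (\<forall>\<alpha> A A'. \<Gamma> \<alpha> = Some A \<longrightarrow> \<Gamma>' \<alpha> = Some A' \<longrightarrow> ty_eq (init_seg \<alpha> \<Gamma>) A A')"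
  by (auto simp: context_rel_def is_context_def)

lemma context_rel_init:
  "(\<Gamma>, \<Gamma>') \<in> context_rel T \<Longrightarrow> (init_seg \<gamma> \<Gamma>, init_seg \<gamma> \<Gamma>') \<in> context_rel T"
  by (auto simp: context_rel_iff ctx_init dom_init_seg init_seg_apply init_init_le split: if_splits)

text \<open>The relation compares types over \<open>\<Gamma>\<close> only. To read the comparison at
  one position over \<open>\<Gamma>'\<close>, the substitution below that position is needed, so the
  proof is an induction over initial segments.\<close>

lemma context_rel_vars_sub:
  "(\<Gamma>, \<Gamma>') \<in> context_rel T \<Longrightarrow> sub \<Gamma>' (vars \<Gamma>) \<Gamma>"
proof -
  assume r: "(\<Gamma>, \<Gamma>') \<in> context_rel T"
  have "sub (init_seg \<alpha> \<Gamma>') (vars (init_seg \<alpha> \<Gamma>)) (init_seg \<alpha> \<Gamma>)" for \<alpha>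
  proof (induction \<alpha> rule: less_induct)
    case (less \<alpha>)
    have c: "ctx (init_seg \<alpha> \<Gamma>')" using r by (auto simp: context_rel_iff ctx_init)
    show ?case
    proof (rule subI)
      fix \<beta> u A assume "vars (init_seg \<alpha> \<Gamma>) \<beta> = Some u" and A: "init_seg \<alpha> \<Gamma> \<beta> = Some A"
      then have u: "u = Var \<beta>" and b: "\<beta> < \<alpha>" "\<Gamma> \<beta> = Some A"
        by (auto simp: vars_def init_seg_apply split: if_splits)
      have "dom \<Gamma> = dom \<Gamma>'" using r by (simp add: context_rel_iff)
      from dom_eq_obtain[OF this b(2)] obtain A' where A': "\<Gamma>' \<beta> = Some A'" .
      have "ty_eq (init_seg \<beta> \<Gamma>) A A'" using r b A' by (auto simp: context_rel_iff)
      from ty_eq_subst[OF this _ less.IH[OF b(1)]]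
      have "ty_eq (init_seg \<beta> \<Gamma>') A A'" using r by (auto simp: context_rel_iff ctx_init)
      moreover have "init_seg \<beta> (init_seg \<alpha> \<Gamma>') = init_seg \<beta> \<Gamma>'" using b by (simp add: init_init_le)
      ultimately have "ty_eq (init_seg \<alpha> \<Gamma>') A A'"
        using ty_eq_subst[OF _ c display_sub[OF c, of \<beta>]] by simp
      moreover have "tm (init_seg \<alpha> \<Gamma>') (Var \<beta>) A'"
        using c A' b by (auto intro: variable simp: init_seg_apply)
      ultimately show "tm (init_seg \<alpha> \<Gamma>') u (subst (init_seg \<beta> (vars (init_seg \<alpha> \<Gamma>))) A)"
        unfolding u by (simp, blast intro: conv type_sym)
    qed simp
  qed
  moreover have "init_seg (len \<Gamma>) \<Gamma> = \<Gamma>" "init_seg (len \<Gamma>) \<Gamma>' = \<Gamma>'"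
    using r len_cong[of \<Gamma> \<Gamma>'] by (auto simp: context_rel_iff ctx_seq init_all)
  ultimately show ?thesis by metis
qed

lemma context_rel_refl: "ctx \<Gamma> \<Longrightarrow> (\<Gamma>, \<Gamma>) \<in> context_rel T"
  by (auto simp: context_rel_iff intro: type_refl ctx_ty)

text \<open>The definition is one-sided, with all type equalities judged over the left context.
  Substituting variables for themselves moves them to the right one.\<close>

lemma context_rel_sym: "(\<Gamma>, \<Gamma>') \<in> context_rel T \<Longrightarrow> (\<Gamma>', \<Gamma>) \<in> context_rel T"
proof -
  assume r: "(\<Gamma>, \<Gamma>') \<in> context_rel T"
  have "ty_eq (init_seg \<alpha> \<Gamma>') A' A" if "\<Gamma> \<alpha> = Some A" "\<Gamma>' \<alpha> = Some A'" for \<alpha> A A'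
  proof -
    have "ty_eq (init_seg \<alpha> \<Gamma>) A A'" using r that by (auto simp: context_rel_iff)
    from ty_eq_subst[OF this _ context_rel_vars_sub[OF context_rel_init[OF r]]]
    show ?thesis using r by (auto simp: context_rel_iff ctx_init intro: type_sym)
  qed
  with r show ?thesis by (auto simp: context_rel_iff)
qed

lemma context_rel_vars_sub':
  "(\<Gamma>, \<Gamma>') \<in> context_rel T \<Longrightarrow> sub \<Gamma> (vars \<Gamma>) \<Gamma>'"
  using context_rel_vars_sub[OF context_rel_sym] vars_cong[of \<Gamma> \<Gamma>']
  by (simp add: context_rel_iff)

text \<open>Between derivably equal contexts, \<open>vars\<close> is a substitution that changes no
  expression, so judgments carry over word for word.\<close>

lemma convert_ty_eq: "\<lbrakk>ty_eq \<Gamma> A A'; (\<Gamma>, \<Gamma>') \<in> context_rel T\<rbrakk> \<Longrightarrow> ty_eq \<Gamma>' A A'"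
  using ty_eq_subst[OF _ _ context_rel_vars_sub] by (fastforce simp: context_rel_iff)

lemma convert_sub: "\<lbrakk>sub \<Gamma> s \<Delta>; (\<Gamma>, \<Gamma>') \<in> context_rel T; ctx \<Delta>\<rbrakk> \<Longrightarrow> sub \<Gamma>' s \<Delta>"
  using sub_comp[OF _ context_rel_vars_sub] by (fastforce simp: context_rel_iff)

lemma convert_sub_eq: "\<lbrakk>sub_eq \<Gamma> s s' \<Delta>; (\<Gamma>, \<Gamma>') \<in> context_rel T; ctx \<Delta>\<rbrakk> \<Longrightarrow> sub_eq \<Gamma>' s s' \<Delta>"
  using sub_eq_comp[OF _ sub_refl[OF context_rel_vars_sub]] by (fastforce simp: context_rel_iff)

lemma sub_eq_dom: "sub_eq \<Gamma> s s' \<Delta> \<Longrightarrow> dom s = dom \<Delta> \<and> dom s' = dom \<Delta>"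
  by (simp add: terms_eq_wrt_def)

lemma convert_sub_cod:
  assumes "ctx \<Gamma>" "sub \<Gamma> s \<Delta>" "(\<Delta>, \<Delta>') \<in> context_rel T" shows "sub \<Gamma> s \<Delta>'"
  using sub_comp[OF assms(1,2) _ context_rel_vars_sub'[OF assms(3)]] assms
  by (simp add: context_rel_iff subst_seq_vars_right sub_dom)

lemma convert_sub_eq_cod:
  assumes "ctx \<Gamma>" "sub_eq \<Gamma> s s' \<Delta>" "(\<Delta>, \<Delta>') \<in> context_rel T" shows "sub_eq \<Gamma> s s' \<Delta>'"
  using sub_eq_comp[OF assms(1,2) _ sub_refl[OF context_rel_vars_sub'[OF assms(3)]]] assms
    sub_eq_dom[OF assms(2)]
  by (simp add: context_rel_iff subst_seq_vars_right)

lemma context_rel_trans: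
  assumes "(\<Gamma>, \<Gamma>') \<in> context_rel T" "(\<Gamma>', \<Gamma>'') \<in> context_rel T"
  shows "(\<Gamma>, \<Gamma>'') \<in> context_rel T"
proof -
  have "ty_eq (init_seg \<alpha> \<Gamma>) A A''" if a: "\<Gamma> \<alpha> = Some A" "\<Gamma>'' \<alpha> = Some A''" for \<alpha> A A''
  proof -
    have "dom \<Gamma> = dom \<Gamma>'" using assms by (simp add: context_rel_iff)
    from dom_eq_obtain[OF this a(1)] obtain A' where A': "\<Gamma>' \<alpha> = Some A'" .
    have "ty_eq (init_seg \<alpha> \<Gamma>') A' A''" using assms(2) a A' by (auto simp: context_rel_iff)
    then have "ty_eq (init_seg \<alpha> \<Gamma>) A' A''"
      using convert_ty_eq context_rel_init[OF context_rel_sym[OF assms(1)]] by blast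
    moreover have "ty_eq (init_seg \<alpha> \<Gamma>) A A'" using assms(1) a A' by (auto simp: context_rel_iff)
    ultimately show ?thesis by (blast intro: type_trans)
  qed
  with assms show ?thesis by (auto simp: context_rel_iff)
qed

lemma context_rel_ctx:
  "(\<Gamma>, \<Gamma>') \<in> context_rel T \<Longrightarrow> ctx \<Gamma>" "(\<Gamma>, \<Gamma>') \<in> context_rel T \<Longrightarrow> ctx \<Gamma>'"
  "(\<Gamma>, \<Gamma>') \<in> context_rel T \<Longrightarrow> dom \<Gamma> = dom \<Gamma>'" "(\<Gamma>, \<Gamma>') \<in> context_rel T \<Longrightarrow> len \<Gamma> = len \<Gamma>'"
  by (auto simp: context_rel_iff intro: len_cong)

lemma equiv_context_rel: "equiv {\<Gamma>. is_context T \<Gamma>} (context_rel T)"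
proof (rule equivI)
  show "context_rel T \<subseteq> {\<Gamma>. is_context T \<Gamma>} \<times> {\<Gamma>. is_context T \<Gamma>}" by (auto simp: context_rel_def)
  show "refl_on {\<Gamma>. is_context T \<Gamma>} (context_rel T)"
    by (auto simp: refl_on_def is_context_def intro: context_rel_refl)
  show "sym (context_rel T)" by (auto simp: sym_def intro: context_rel_sym)
  show "trans (context_rel T)" by (blast intro: transI context_rel_trans)
qed

end

section \<open>Canonical pullbacks of contexts\<close>

text \<open>The context \<open>\<Delta>, t\<^sup>*E\<close>.\<close>

definition pullback_ctx ::
  "('s, 'k::wellorder) premise \<Rightarrow> ('k \<rightharpoonup> ('s, 'k) expr) \<Rightarrow> ('s, 'k) premise \<Rightarrow> ('s, 'k) premise" where
  "pullback_ctx \<Delta> t E = \<Delta> ++ pull_tail (len \<Delta>) t E"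

locale regular_theory = algebraic_theory T for T :: "('s, 'k::wellorder) pretheory" +
  assumes regular: "regular_cardinal (type_order TYPE('k))"
begin

lemmas shift_rules = shift_ge[OF regular] shift_less_iff[OF regular]
  shift_refl[OF regular] shift_inverse[OF regular] shift_base[OF regular]

lemma sub_len: "\<lbrakk>ctx \<Gamma>'; \<gamma> \<le> len \<Gamma>'; sub \<Delta> t (init_seg \<gamma> \<Gamma>')\<rbrakk> \<Longrightarrow> dom t = {..<\<gamma>} \<and> len t = \<gamma>"
  using seq_dom[OF is_seq_init[OF ctx_seq]] len_init[OF ctx_seq] sub_dom len_cong by metis

context
  fixes \<Gamma>' \<Delta> :: "('s, 'k) premise" and \<gamma> :: 'k and t :: "'k \<rightharpoonup> ('s, 'k) expr"
  assumes G': "ctx \<Gamma>'" and le: "\<gamma> \<le> len \<Gamma>'" and D: "ctx \<Delta>" and t: "sub \<Delta> t (init_seg \<gamma> \<Gamma>')"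
begin

private abbreviation (input) "E \<equiv> tail_seg \<gamma> \<Gamma>'"
private abbreviation (input) "P \<equiv> pullback_ctx \<Delta> t E"
private abbreviation (input) "L \<equiv> lift (len \<Delta>) t E"
private abbreviation (input) "sh \<equiv> shift \<gamma> (len \<Delta>)"

lemma lift_left: "\<beta> < \<gamma> \<Longrightarrow> L \<beta> = t \<beta>"
  by (auto simp: lift_def map_add_def dom_tail_seg)

lemma lift_right: "\<gamma> \<le> \<beta> \<Longrightarrow> L \<beta> = (if \<beta> \<in> dom \<Gamma>' then Some (Var (sh \<beta>)) else None)"
proof -
  assume b: "\<gamma> \<le> \<beta>"
  have "\<beta> \<notin> dom t" using sub_len[OF G' le t] b by auto
  then show ?thesis using sub_len[OF G' le t] b
    by (auto simp: lift_def map_add_def dom_tail_seg split: option.splits)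
qed

lemma dom_lift: "dom L = dom \<Gamma>'"
proof -
  have "\<beta> \<in> dom L \<longleftrightarrow> \<beta> \<in> dom \<Gamma>'" for \<beta>
  proof (cases "\<beta> < \<gamma>")
    case True
    then have "\<beta> \<in> dom L \<longleftrightarrow> \<beta> \<in> dom t" using lift_left by (simp add: domIff)
    then show ?thesis using True sub_len[OF G' le t] seq_mem[OF ctx_seq[OF G']] le by auto
  next
    case False
    then show ?thesis using lift_right[of \<beta>] by (auto simp: domIff split: if_splits)
  qed
  then show ?thesis by blast
qed

lemma len_lift: "len L = len \<Gamma>'"
  by (rule len_cong) (rule dom_lift)

lemma pullback_left: "\<epsilon> < len \<Delta> \<Longrightarrow> P \<epsilon> = \<Delta> \<epsilon>"
  by (auto simp: pullback_ctx_def pull_tail_def map_add_def)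

lemma pullback_right: "\<gamma> \<le> \<beta> \<Longrightarrow> P (sh \<beta>) = map_option (subst L) (\<Gamma>' \<beta>)"
proof -
  assume b: "\<gamma> \<le> \<beta>"
  have "\<Delta> (sh \<beta>) = None"
    using seq_mem[OF ctx_seq[OF D], of "sh \<beta>"] shift_rules(1)[OF b, of "len \<Delta>"] by (auto simp: domIff)
  then show ?thesis
    using b sub_len[OF G' le t] shift_rules
    by (auto simp: pullback_ctx_def map_add_def pull_tail_def tail_seg_apply split: option.splits)
qed

text \<open>Surjectivity of the renumbering: positions of the pullback context are either positions
  of \<open>\<Delta>\<close> or renumbered positions of the tail. The case distinctions below rest
  on this.\<close>

lemma above_len_shift: "\<not> \<epsilon> < len \<Delta> \<Longrightarrow> \<exists>\<beta>\<ge>\<gamma>. \<epsilon> = sh \<beta>"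
  using shift_rules(1,4)[of "len \<Delta>" \<epsilon> \<gamma>] by (metis not_less)

lemma init_pullback: "init_seg (len \<Delta>) P = \<Delta>"
  using pullback_left seq_mem[OF ctx_seq[OF D]] by (force simp: fun_eq_iff init_seg_apply domIff)

lemma dom_pullback: "dom P = {..<sh (len \<Gamma>')}"
proof -
  have "\<epsilon> \<in> dom P \<longleftrightarrow> \<epsilon> < sh (len \<Gamma>')" for \<epsilon>
  proof (cases "\<epsilon> < len \<Delta>")
    case True
    then have "\<epsilon> < sh (len \<Gamma>')" using shift_rules(1)[OF le, of "len \<Delta>"] by simp
    with True show ?thesis using pullback_left seq_mem[OF ctx_seq[OF D]] by (simp add: domIff)
  next
    case False
    then obtain \<beta> where "\<gamma> \<le> \<beta>" "\<epsilon> = sh \<beta>" using above_len_shift by blast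
    then show ?thesis using pullback_right seq_mem[OF ctx_seq[OF G']] shift_rules(2) le
      by (simp add: domIff)
  qed
  then show ?thesis by auto
qed

lemma len_pullback: "len P = sh (len \<Gamma>')"
  by (rule len_eqI) (rule dom_pullback)

lemma pullback_type:
  "\<lbrakk>\<gamma> \<le> \<beta>; \<Gamma>' \<beta> = Some A\<rbrakk> \<Longrightarrow> P (sh \<beta>) = Some (subst (init_seg \<beta> L) A)"
  using pullback_right subst_init_type[OF G'] by simp

text \<open>The two claims need each other. The type at \<open>sh \<beta>\<close> is a substitution
  instance along the lift below \<open>\<beta>\<close>, and the component of the lift at
  \<open>\<beta>\<close> is a variable declared with that type. Hence one simultaneous induction
  over initial segments.\<close>

lemma pullback_initial:
  assumes "\<gamma> \<le> \<alpha>"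
  shows "ctx (init_seg (sh \<alpha>) P) \<and> sub (init_seg (sh \<alpha>) P) (init_seg \<alpha> L) (init_seg \<alpha> \<Gamma>')"
  using assms
proof (induction \<alpha> rule: less_induct)
  case (less \<alpha>)
  have i: "init_seg (len \<Delta>) (init_seg (sh \<alpha>) P) = \<Delta>"
    using init_pullback shift_rules(1)[OF less.prems] by (simp add: init_init_le)
  have "ty (init_seg \<epsilon> P) A" if e: "\<epsilon> < sh \<alpha>" "P \<epsilon> = Some A" for \<epsilon> A
  proof (cases "\<epsilon> < len \<Delta>")
    case True
    then have "\<Delta> \<epsilon> = Some A" using e pullback_left by simp
    moreover have "init_seg \<epsilon> P = init_seg \<epsilon> \<Delta>"
      using True init_pullback init_init_le[of \<epsilon> "len \<Delta>" P] by simp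
    ultimately show ?thesis using ctx_ty[OF D] by simp
  next
    case False
    then obtain \<beta> where b: "\<gamma> \<le> \<beta>" "\<epsilon> = sh \<beta>" using above_len_shift by blast
    with e less.prems have "\<beta> < \<alpha>" by (simp add: shift_rules)
    obtain B where B: "\<Gamma>' \<beta> = Some B" "A = subst (init_seg \<beta> L) B"
      using e b pullback_right[OF b(1)] pullback_type[OF b(1)] by (auto split: option.splits)
    show ?thesis using less.IH[OF \<open>\<beta> < \<alpha>\<close> b(1)] ctx_ty[OF G' B(1)] B(2) b(2) ty_subst by blast
  qed
  moreover have "is_seq (init_seg (sh \<alpha>) P)" by (rule is_seq_init[OF is_seqI[OF dom_pullback]])
  ultimately have c: "ctx (init_seg (sh \<alpha>) P)"
    by (auto simp: context_wrt_def init_seg_apply init_init_le split: if_splits)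
  have "sub (init_seg (sh \<alpha>) P) (init_seg \<alpha> L) (init_seg \<alpha> \<Gamma>')"
  proof (rule subI)
    show "dom (init_seg \<alpha> L) = dom (init_seg \<alpha> \<Gamma>')" by (simp add: dom_init_seg dom_lift)
    fix \<beta> u A assume *: "init_seg \<alpha> L \<beta> = Some u" "init_seg \<alpha> \<Gamma>' \<beta> = Some A"
    then have b: "\<beta> < \<alpha>" "L \<beta> = Some u" "\<Gamma>' \<beta> = Some A" by (auto simp: init_seg_apply split: if_splits)
    show "tm (init_seg (sh \<alpha>) P) u (subst (init_seg \<beta> (init_seg \<alpha> L)) A)"
    proof (cases "\<beta> < \<gamma>")
      case True
      have "init_seg \<beta> L = init_seg \<beta> t" using True lift_left by (auto simp: init_seg_apply)
      moreover have "tm \<Delta> u (subst (init_seg \<beta> t) A)"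
        using sub_tm[OF t, of \<beta> u A] True b lift_left by (simp add: init_seg_apply)
      ultimately show ?thesis using weaken_tm[of "len \<Delta>", OF _ c] i b(1) by (simp add: init_init_le)
    next
      case False
      then have "u = Var (sh \<beta>)" using b lift_right[of \<beta>] by (auto split: if_splits)
      \<comment> \<open>By construction the renumbered variable is declared with exactly the type
        required of it, so the variable rule suffices.\<close>
      moreover have "init_seg (sh \<alpha>) P (sh \<beta>) = Some (subst (init_seg \<beta> L) A)"
        using False b pullback_type less.prems shift_rules by (simp add: init_seg_apply)
      ultimately show ?thesis using variable[OF c] b(1) by (simp add: init_init_le)
    qed
  qed
  with c show ?case by blast
qed

lemma pullback_ctx: "ctx P" and lift_sub: "sub P L \<Gamma>'"
proof -
  have "init_seg (sh (len \<Gamma>')) P = P" using len_pullback by (simp add: init_all is_seqI[OF dom_pullback])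
  moreover have "init_seg (len \<Gamma>') \<Gamma>' = \<Gamma>'" by (simp add: init_all ctx_seq[OF G'])
  moreover have "init_seg (len \<Gamma>') L = L"
    using len_lift dom_lift seq_dom[OF ctx_seq[OF G']] by (simp add: init_all is_seqI)
  ultimately show "ctx P" "sub P L \<Gamma>'" using pullback_initial[OF le] by auto
qed

lemma tail_pullback: "tail_seg (len \<Delta>) P = pull_tail (len \<Delta>) t E"
  unfolding pullback_ctx_def
  by (rule tail_append) (auto simp: seq_dom[OF ctx_seq[OF D]] pull_tail_def split: if_splits)

lemma len_le_pullback: "len \<Delta> \<le> len P"
  unfolding len_pullback using shift_rules(1)[OF le] .

lemma init_lift: "init_seg \<gamma> L = t"
proof (rule ext)
  fix \<alpha>
  have "t \<alpha> = None" if "\<not> \<alpha> < \<gamma>" using that sub_len[OF G' le t] by blast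
  then show "init_seg \<gamma> L \<alpha> = t \<alpha>" by (simp add: init_seg_apply lift_left)
qed

lemma display_pullback_sub: "sub P (vars \<Delta>) \<Delta>"
  using display_sub[OF pullback_ctx, of "len \<Delta>"] by (simp add: init_pullback)

lemma sub_lift_restrict:
  assumes "\<gamma> \<le> \<alpha>"
  shows "sub (init_seg (sh \<alpha>) P) (init_seg \<alpha> L) (init_seg \<alpha> \<Gamma>')"
  using pullback_initial[OF assms] by blast

text \<open>The map \<open>\<Theta> \<rightarrow> \<Delta>, t\<^sup>*E\<close> induced by \<open>u : \<Theta> \<rightarrow> \<Delta>\<close> and \<open>v : \<Theta> \<rightarrow> \<Gamma>, E\<close>.\<close>

definition mediating where
  "mediating u v = (\<lambda>\<epsilon>. if \<epsilon> < len \<Delta> then u \<epsilon> else v (shift (len \<Delta>) \<gamma> \<epsilon>))"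

context
  fixes \<Theta> u v
  assumes Th: "ctx \<Theta>" and u: "sub \<Theta> u \<Delta>" and v: "sub \<Theta> v \<Gamma>'"
    and eq: "sub_eq \<Theta> (subst_seq u t) (init_seg \<gamma> v) (init_seg \<gamma> \<Gamma>')"
begin

lemma mediating_left: "\<epsilon> < len \<Delta> \<Longrightarrow> mediating u v \<epsilon> = u \<epsilon>"
  by (simp add: mediating_def)

lemma mediating_right: "\<gamma> \<le> \<beta> \<Longrightarrow> mediating u v (sh \<beta>) = v \<beta>"
  using shift_rules by (auto simp: mediating_def dest: leD)

lemma mediating_init: "init_seg (len \<Delta>) (mediating u v) = u"
proof (rule ext)
  fix \<epsilon>
  have "u \<epsilon> = None" if "\<not> \<epsilon> < len \<Delta>"
    using that sub_dom[OF u] seq_mem[OF ctx_seq[OF D], of \<epsilon>] by blast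
  then show "init_seg (len \<Delta>) (mediating u v) \<epsilon> = u \<epsilon>" by (simp add: init_seg_apply mediating_left)
qed

lemma mediating_lift_left: "\<beta> < \<gamma> \<Longrightarrow> subst_seq (mediating u v) L \<beta> = subst_seq u t \<beta>"
proof (cases "t \<beta>")
  case (Some w)
  assume "\<beta> < \<gamma>"
  have "fv w \<subseteq> dom \<Delta>" by (rule sub_fv[OF t Some])
  then have "subst (mediating u v) w = subst u w"
    using seq_mem[OF ctx_seq[OF D]] mediating_left by (intro subst_cong) blast
  then show ?thesis using lift_left[OF \<open>\<beta> < \<gamma>\<close>] Some by simp
qed (simp add: lift_left)

lemma dom_mediating: "dom (mediating u v) = dom P"
proof -
  have "\<epsilon> \<in> dom (mediating u v) \<longleftrightarrow> \<epsilon> \<in> dom P" for \<epsilon>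
  proof (cases "\<epsilon> < len \<Delta>")
    case True
    then have "\<epsilon> \<in> dom (mediating u v) \<longleftrightarrow> \<epsilon> \<in> dom u" "\<epsilon> \<in> dom P \<longleftrightarrow> \<epsilon> \<in> dom \<Delta>"
      by (simp_all add: domIff mediating_left pullback_left)
    then show ?thesis using sub_dom[OF u] by blast
  next
    case False
    then obtain \<beta> where "\<gamma> \<le> \<beta>" "\<epsilon> = sh \<beta>" using above_len_shift by blast
    then have "\<epsilon> \<in> dom (mediating u v) \<longleftrightarrow> \<beta> \<in> dom v" "\<epsilon> \<in> dom P \<longleftrightarrow> \<beta> \<in> dom \<Gamma>'"
      by (simp_all add: domIff mediating_right pullback_right)
    then show ?thesis using sub_dom[OF v] by blast
  qed
  then show ?thesis by blast
qed

lemma mediating_lift_right: "\<gamma> \<le> \<beta> \<Longrightarrow> subst_seq (mediating u v) L \<beta> = v \<beta>"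
proof -
  assume b: "\<gamma> \<le> \<beta>"
  show ?thesis
  proof (cases "\<beta> \<in> dom \<Gamma>'")
    case True
    then obtain w where w: "v \<beta> = Some w" using sub_dom[OF v] by blast
    then have "mediating u v (sh \<beta>) = Some w" using mediating_right[OF b] by simp
    then show ?thesis using lift_right[OF b] True w by simp
  next
    case False
    then have "v \<beta> = None" using sub_dom[OF v] by blast
    then show ?thesis using lift_right[OF b] False by simp
  qed
qed

text \<open>From \<open>\<gamma>\<close> on the components are literally those of \<open>v\<close>.
  Below \<open>\<gamma>\<close> they come from \<open>u\<close> by way of \<open>t\<close>, and
  commutativity of the cone gives only derivable equality.\<close>

lemma mediating_lift_eq: "sub_eq \<Theta> v (subst_seq (mediating u v) L) \<Gamma>'"
proof (rule sub_eqI)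
  show "dom v = dom \<Gamma>'" by (rule sub_dom[OF v])
  show "dom (subst_seq (mediating u v) L) = dom \<Gamma>'" using dom_lift by simp
  fix \<beta> w w' A assume *: "v \<beta> = Some w" "subst_seq (mediating u v) L \<beta> = Some w'" "\<Gamma>' \<beta> = Some A"
  show "tm_eq \<Theta> w w' (subst (init_seg \<beta> v) A)"
  proof (cases "\<beta> < \<gamma>")
    case True
    have e: "sub_eq \<Theta> (init_seg \<gamma> v) (subst_seq u t) (init_seg \<gamma> \<Gamma>')"
      by (rule sub_eq_sym[OF Th ctx_init[OF G'] eq])
    have "init_seg \<gamma> \<Gamma>' \<beta> = Some A" using True * by (simp add: init_seg_apply)
    then obtain a a' where "init_seg \<gamma> v \<beta> = Some a" "subst_seq u t \<beta> = Some a'"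
      "tm_eq \<Theta> a a' (subst (init_seg \<beta> (init_seg \<gamma> v)) A)"
      using sub_eq_obtain[OF e] by blast
    then show ?thesis using True * mediating_lift_left[OF True]
      by (simp add: init_seg_apply init_init_le del: comp_apply)
  next
    case False
    then have "w' = w" using * mediating_lift_right[of \<beta>] by (simp del: comp_apply)
    then show ?thesis using * sub_tm[OF v] by (auto intro: term_refl)
  qed
qed

text \<open>On the renumbered tail the components of \<open>v\<close> have types instantiated by
  \<open>v\<close>, whereas the pullback context instantiates them by the composite with the lift;
  conversion bridges the two.\<close>

lemma mediating_sub: "sub \<Theta> (mediating u v) P"
proof (rule subI)
  show "dom (mediating u v) = dom P" by (rule dom_mediating)
  fix \<epsilon> w A assume *: "mediating u v \<epsilon> = Some w" "P \<epsilon> = Some A"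
  show "tm \<Theta> w (subst (init_seg \<epsilon> (mediating u v)) A)"
  proof (cases "\<epsilon> < len \<Delta>")
    case True
    then have "init_seg \<epsilon> (mediating u v) = init_seg \<epsilon> u"
      using mediating_left by (auto simp: init_seg_apply)
    then show ?thesis using sub_tm[OF u] * True by (simp add: mediating_left pullback_left)
  next
    case False
    then obtain \<beta> where b: "\<gamma> \<le> \<beta>" "\<epsilon> = sh \<beta>" using above_len_shift by blast
    obtain B where B: "\<Gamma>' \<beta> = Some B" using *(2) pullback_right[OF b(1)] b(2) by auto
    then have A: "A = subst (init_seg \<beta> L) B" using *(2) pullback_type[OF b(1) B] b(2) by simp
    have "subst (init_seg \<epsilon> (mediating u v)) A = subst (mediating u v) A"
      by (rule subst_init_type[OF pullback_ctx *(2)])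
    also have "\<dots> = subst (init_seg \<beta> (subst_seq (mediating u v) L)) B"
      unfolding A by (rule subst_subst_type[OF G' B dom_lift])
    finally have s: "subst (init_seg \<epsilon> (mediating u v)) A = subst (init_seg \<beta> (subst_seq (mediating u v) L)) B" .
    have "v \<beta> = Some w" using *(1) mediating_right[OF b(1)] b(2) by simp
    then have "tm \<Theta> w (subst (init_seg \<beta> v) B)" using sub_tm[OF v] B by blast
    then show ?thesis unfolding s
      using type_along_sub_eq[OF Th G' mediating_lift_eq B] by (blast intro: conv)
  qed
qed

text \<open>The two projections jointly see every component: the initial segment sees those of
  \<open>\<Delta>\<close>, and the lift, being a renumbered variable from \<open>\<gamma>\<close>
  on, sees those of the tail.\<close>

lemma mediating_unique:
  assumes h: "sub \<Theta> h P" and hu: "sub_eq \<Theta> (init_seg (len \<Delta>) h) u \<Delta>"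
    and hv: "sub_eq \<Theta> (subst_seq h L) v \<Gamma>'"
  shows "sub_eq \<Theta> h (mediating u v) P"
proof (rule sub_eqI)
  show "dom h = dom P" by (rule sub_dom[OF h])
  show "dom (mediating u v) = dom P" by (rule dom_mediating)
  fix \<epsilon> w w' A assume *: "h \<epsilon> = Some w" "mediating u v \<epsilon> = Some w'" "P \<epsilon> = Some A"
  show "tm_eq \<Theta> w w' (subst (init_seg \<epsilon> h) A)"
  proof (cases "\<epsilon> < len \<Delta>")
    case True
    then have "\<Delta> \<epsilon> = Some A" "u \<epsilon> = Some w'" using * by (simp_all add: mediating_left pullback_left)
    moreover have "init_seg (len \<Delta>) h \<epsilon> = Some w" using * True by (simp add: init_seg_apply)
    moreover have "init_seg \<epsilon> (init_seg (len \<Delta>) h) = init_seg \<epsilon> h" using True by (simp add: init_init_le)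
    ultimately show ?thesis using hu unfolding terms_eq_wrt_def by metis
  next
    case False
    then obtain \<beta> where b: "\<gamma> \<le> \<beta>" "\<epsilon> = sh \<beta>" using above_len_shift by blast
    obtain B where B: "\<Gamma>' \<beta> = Some B" using *(3) pullback_right[OF b(1)] b(2) by auto
    then have A: "A = subst (init_seg \<beta> L) B" using *(3) pullback_type[OF b(1) B] b(2) by simp
    have s: "subst (init_seg \<epsilon> h) A = subst (init_seg \<beta> (subst_seq h L)) B"
      using subst_init_type[OF pullback_ctx *(3)] subst_subst_type[OF G' B dom_lift] A by simp
    have "v \<beta> = Some w'" using *(2) mediating_right[OF b(1)] b(2) by simp
    moreover have "subst_seq h L \<beta> = Some w"
      using lift_right[OF b(1)] B *(1) b(2) by auto
    ultimately show ?thesis unfolding s using hv B unfolding terms_eq_wrt_def by blast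
  qed
qed

end

end

text \<open>Equal substitutions yield derivably equal pullback contexts, which are in general
  different as sequences of types. This discrepancy is what later makes substitution in formulas
  well defined only up to provable equivalence.\<close>

lemma pullback_cong:
  assumes G': "ctx \<Gamma>'" and le: "\<gamma> \<le> len \<Gamma>'" and D: "ctx \<Delta>"
    and tt': "sub_eq \<Delta> t t' (init_seg \<gamma> \<Gamma>')"
  shows "sub_eq (pullback_ctx \<Delta> t (tail_seg \<gamma> \<Gamma>')) (lift (len \<Delta>) t (tail_seg \<gamma> \<Gamma>'))
      (lift (len \<Delta>) t' (tail_seg \<gamma> \<Gamma>')) \<Gamma>'" (is "sub_eq ?P ?L ?L' \<Gamma>'")
    and "(pullback_ctx \<Delta> t (tail_seg \<gamma> \<Gamma>'), pullback_ctx \<Delta> t' (tail_seg \<gamma> \<Gamma>')) \<in> context_rel T"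
      (is "(_, ?P') \<in> _")
proof -
  have t: "sub \<Delta> t (init_seg \<gamma> \<Gamma>')" and t': "sub \<Delta> t' (init_seg \<gamma> \<Gamma>')"
    using tt' D G' by (auto intro: sub_eq_left sub_eq_right ctx_init)
  note X = G' le D
  show LL': "sub_eq ?P ?L ?L' \<Gamma>'"
  proof (rule sub_eqI)
    show "dom ?L = dom \<Gamma>'" "dom ?L' = dom \<Gamma>'" using dom_lift X t t' by auto
    fix \<beta> w w' A assume *: "?L \<beta> = Some w" "?L' \<beta> = Some w'" "\<Gamma>' \<beta> = Some A"
    show "tm_eq ?P w w' (subst (init_seg \<beta> ?L) A)"
    proof (cases "\<beta> < \<gamma>")
      case True
      have "init_seg \<beta> ?L = init_seg \<beta> t"
        using True lift_left[OF X t] by (auto simp: init_seg_apply)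
      moreover have "tm_eq \<Delta> w w' (subst (init_seg \<beta> t) A)"
      proof -
        have "t \<beta> = Some w" "t' \<beta> = Some w'" "init_seg \<gamma> \<Gamma>' \<beta> = Some A"
          using * True lift_left[OF X t True] lift_left[OF X t' True] by (simp_all add: init_seg_apply)
        then show ?thesis using tt' unfolding terms_eq_wrt_def by blast
      qed
      ultimately show ?thesis
        using weaken_tm_eq[of "len \<Delta>" ?P] init_pullback[OF X t] pullback_ctx[OF X t] by simp
    next
      case False
      \<comment> \<open>From \<open>\<gamma>\<close> on both lifts consist of the same renumbered
        variables.\<close>
      then have "w' = w" using * lift_right[OF X t, of \<beta>] lift_right[OF X t', of \<beta>] by (auto split: if_splits)
      then show ?thesis using sub_tm[OF lift_sub[OF X t]] * by (auto intro: term_refl)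
    qed
  qed
  have "ty_eq (init_seg \<epsilon> ?P) A A'" if e: "?P \<epsilon> = Some A" "?P' \<epsilon> = Some A'" for \<epsilon> A A'
  proof (cases "\<epsilon> < len \<Delta>")
    case True
    then have "A' = A" using e pullback_left[OF X t] pullback_left[OF X t'] by simp
    then show ?thesis using e ctx_ty[OF pullback_ctx[OF X t]] by (auto intro: type_refl)
  next
    case False
    then obtain \<beta> where b: "\<gamma> \<le> \<beta>" "\<epsilon> = shift \<gamma> (len \<Delta>) \<beta>" using above_len_shift[OF X t] by blast
    obtain B where B: "\<Gamma>' \<beta> = Some B" using e pullback_right[OF X t b(1)] b(2) by auto
    have A: "A = subst (init_seg \<beta> ?L) B" "A' = subst (init_seg \<beta> ?L') B"
      using e pullback_type[OF X t b(1) B] pullback_type[OF X t' b(1) B] b(2) by simp_all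
    \<comment> \<open>The equality of lifts over all of \<open>?P\<close> does not suffice: types at
      \<open>\<epsilon>\<close> are compared over the initial segment below
      \<open>\<epsilon>\<close>, so the comparison is repeated there.\<close>
    have "sub_eq (init_seg \<epsilon> ?P) (init_seg \<beta> ?L) (init_seg \<beta> ?L') (init_seg \<beta> \<Gamma>')"
    proof (rule sub_eqI)
      show "dom (init_seg \<beta> ?L) = dom (init_seg \<beta> \<Gamma>')" "dom (init_seg \<beta> ?L') = dom (init_seg \<beta> \<Gamma>')"
        using dom_lift[OF X t] dom_lift[OF X t'] by (simp_all add: dom_init_seg)
      fix \<alpha> w w' C assume *: "init_seg \<beta> ?L \<alpha> = Some w" "init_seg \<beta> ?L' \<alpha> = Some w'" "init_seg \<beta> \<Gamma>' \<alpha> = Some C"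
      show "tm_eq (init_seg \<epsilon> ?P) w w' (subst (init_seg \<alpha> (init_seg \<beta> ?L)) C)"
      proof (cases "\<alpha> < \<gamma>")
        case True
        have "init_seg \<alpha> (init_seg \<beta> ?L) = init_seg \<alpha> t"
          using True b lift_left[OF X t] by (auto simp: init_seg_apply fun_eq_iff)
        moreover have "tm_eq \<Delta> w w' (subst (init_seg \<alpha> t) C)"
        proof -
          have "t \<alpha> = Some w" "t' \<alpha> = Some w'" "init_seg \<gamma> \<Gamma>' \<alpha> = Some C"
            using * True lift_left[OF X t True] lift_left[OF X t' True]
            by (simp_all add: init_seg_apply split: if_splits)
          then show ?thesis using tt' unfolding terms_eq_wrt_def by blast
        qed
        moreover have "init_seg (len \<Delta>) (init_seg \<epsilon> ?P) = \<Delta>"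
          using False init_pullback[OF X t] by (simp add: init_init_le)
        ultimately show ?thesis
          using weaken_tm_eq[of "len \<Delta>" "init_seg \<epsilon> ?P"] ctx_init[OF pullback_ctx[OF X t]] by simp
      next
        case False
        then have "w' = w" using * lift_right[OF X t, of \<alpha>] lift_right[OF X t', of \<alpha>]
          by (auto simp: init_seg_apply split: if_splits)
        then show ?thesis using sub_tm[OF sub_lift_restrict[OF X t b(1)] *(1,3)] b(2)
          by (auto intro: term_refl)
      qed
    qed
    from type_cong[OF type_refl[OF ctx_ty[OF G' B]] ctx_init[OF pullback_ctx[OF X t]] this]
    show ?thesis unfolding A .
  qed
  moreover have "dom ?P = dom ?P'" using dom_pullback[OF X t] dom_pullback[OF X t'] by simp
  ultimately show "(?P, ?P') \<in> context_rel T"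
    using pullback_ctx[OF X t] pullback_ctx[OF X t'] by (auto simp: context_rel_iff)
qed

end

section \<open>Maps isomorphic to display maps\<close>

text \<open>The shape of \<open>syntactic_fibrations\<close> over an arbitrary category and class of
  maps, so that the clan axioms and the transport of adjoints can be proved free of syntax.\<close>

definition iso_closure :: "('o, 'm) cat \<Rightarrow> 'm set \<Rightarrow> 'm set" where
  "iso_closure C D =
     {f \<in> Arr C. \<exists>p \<in> D. \<exists>i j.
         is_iso C i \<and> Dom C i = Dom C f \<and> Cod C i = Dom C p \<and>
         is_iso C j \<and> Dom C j = Cod C f \<and> Cod C j = Cod C p \<and>
         Comp C j f = Comp C p i}"

section \<open>Isomorphisms and pullback squares\<close>

context category
begin

lemma HomD: "f \<in> Hom C X Y \<Longrightarrow> f \<in> Arr C" "f \<in> Hom C X Y \<Longrightarrow> Dom C f = X" "f \<in> Hom C X Y \<Longrightarrow> Cod C f = Y"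
  by (auto simp: Hom_def)

lemma Hom_obj: "f \<in> Hom C X Y \<Longrightarrow> X \<in> Obj C" "f \<in> Hom C X Y \<Longrightarrow> Y \<in> Obj C"
  using dom_obj cod_obj by (auto simp: Hom_def)

lemma arr_hom: "f \<in> Arr C \<Longrightarrow> f \<in> Hom C (Dom C f) (Cod C f)"
  by (auto simp: Hom_def)

lemma iso_obtain:
  assumes "is_iso C f" "f \<in> Hom C X Y"
  obtains g where "g \<in> Hom C Y X" "Comp C g f = Ide C X" "Comp C f g = Ide C Y" "is_iso C g"
proof -
  obtain g where g: "g \<in> Hom C Y X" "Comp C g f = Ide C X" "Comp C f g = Ide C Y"
    using assms by (auto simp: is_iso_def Hom_def)
  then have "is_iso C g" using assms(2) by (auto simp: is_iso_def Hom_def)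
  with g that show ?thesis by blast
qed

lemma isoI:
  assumes "f \<in> Hom C X Y" "g \<in> Hom C Y X" "Comp C g f = Ide C X" "Comp C f g = Ide C Y"
  shows "is_iso C f"
  using assms by (auto simp: is_iso_def Hom_def)

lemma iso_ide: "X \<in> Obj C \<Longrightarrow> is_iso C (Ide C X)"
  using ide_hom comp_ide_left by (blast intro: isoI)

lemma inverse_cancel:
  assumes "i \<in> Hom C X Y" "i' \<in> Hom C Y X" "Comp C i' i = Ide C X" "f \<in> Hom C W X"
  shows "Comp C i' (Comp C i f) = f"
  using assms comp_assoc comp_ide_left by metis

lemma iso_comp:
  assumes f: "is_iso C f" "f \<in> Hom C X Y" and g: "is_iso C g" "g \<in> Hom C Y Z"
  shows "is_iso C (Comp C g f)"
proof -
  obtain f' where f': "f' \<in> Hom C Y X" "Comp C f' f = Ide C X" "Comp C f f' = Ide C Y"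
    using iso_obtain[OF f] by blast
  obtain g' where g': "g' \<in> Hom C Z Y" "Comp C g' g = Ide C Y" "Comp C g g' = Ide C Z"
    using iso_obtain[OF g] by blast
  show ?thesis
  proof (rule isoI)
    show "Comp C g f \<in> Hom C X Z" "Comp C f' g' \<in> Hom C Z X" using f g f' g' comp_hom by auto
    show "Comp C (Comp C f' g') (Comp C g f) = Ide C X"
      using comp_assoc[OF comp_hom[OF f(2) g(2)] g'(1) f'(1)] inverse_cancel[OF g(2) g'(1,2) f(2)] f'(2)
      by simp
    show "Comp C (Comp C g f) (Comp C f' g') = Ide C Z"
      using comp_assoc[OF comp_hom[OF g'(1) f'(1)] f(2) g(2)] inverse_cancel[OF f'(1) f(2) f'(3) g'(1)] g'(3)
      by simp
  qed
qed

lemma iso_mono: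
  assumes "is_iso C j" "j \<in> Hom C X Y" "f \<in> Hom C W X" "g \<in> Hom C W X" "Comp C j f = Comp C j g"
  shows "f = g"
proof -
  obtain j' where "j' \<in> Hom C Y X" "Comp C j' j = Ide C X" using iso_obtain[OF assms(1,2)] by blast
  then show ?thesis using inverse_cancel assms by metis
qed

lemma pullback_squareI:
  assumes \<pi>: "\<pi> \<in> Hom C Z X" and f: "f \<in> Hom C X' X" and \<pi>': "\<pi>' \<in> Hom C Z' X'" and f': "f' \<in> Hom C Z' Z"
    and "Comp C f \<pi>' = Comp C \<pi> f'"
    and "\<And>W u v. \<lbrakk>W \<in> Obj C; u \<in> Hom C W X'; v \<in> Hom C W Z; Comp C f u = Comp C \<pi> v\<rbrakk> \<Longrightarrow>
      \<exists>h. h \<in> Hom C W Z' \<and> Comp C \<pi>' h = u \<and> Comp C f' h = v"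
    and "\<And>W h h'. \<lbrakk>h \<in> Hom C W Z'; h' \<in> Hom C W Z'; Comp C \<pi>' h = Comp C \<pi>' h'; Comp C f' h = Comp C f' h'\<rbrakk> \<Longrightarrow>
      h = h'"
  shows "pullback_square C \<pi> f \<pi>' f'"
proof -
  have "\<exists>!h. h \<in> Hom C W Z' \<and> Comp C \<pi>' h = u \<and> Comp C f' h = v"
    if "W \<in> Obj C" "u \<in> Hom C W X'" "v \<in> Hom C W Z" "Comp C f u = Comp C \<pi> v" for W u v
    using assms(6)[OF that] assms(7) by metis
  then show ?thesis
    using assms(5) HomD[OF \<pi>] HomD[OF f] HomD[OF \<pi>'] HomD[OF f'] unfolding pullback_square_def by simp
qed

lemma pullback_squareD:
  assumes "pullback_square C \<pi> f \<pi>' f'"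
  obtains X X' Z Z' where "\<pi> \<in> Hom C Z X" "f \<in> Hom C X' X" "\<pi>' \<in> Hom C Z' X'" "f' \<in> Hom C Z' Z"
    "Comp C f \<pi>' = Comp C \<pi> f'"
proof (rule that)
  show "\<pi> \<in> Hom C (Dom C \<pi>) (Cod C \<pi>)" "f \<in> Hom C (Dom C f) (Cod C \<pi>)"
    "\<pi>' \<in> Hom C (Dom C \<pi>') (Dom C f)" "f' \<in> Hom C (Dom C \<pi>') (Dom C \<pi>)"
    "Comp C f \<pi>' = Comp C \<pi> f'"
    using assms unfolding pullback_square_def Hom_def by auto
qed

lemma pullback_mediate:
  assumes "pullback_square C \<pi> f \<pi>' f'" "\<pi> \<in> Hom C Z X" "f \<in> Hom C X' X" "\<pi>' \<in> Hom C Z' X'"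
    "u \<in> Hom C W X'" "v \<in> Hom C W Z" "Comp C f u = Comp C \<pi> v"
  shows "\<exists>h. h \<in> Hom C W Z' \<and> Comp C \<pi>' h = u \<and> Comp C f' h = v"
proof -
  have "\<forall>W \<in> Obj C. \<forall>u \<in> Hom C W (Dom C f). \<forall>v \<in> Hom C W (Dom C \<pi>). Comp C f u = Comp C \<pi> v \<longrightarrow>
      (\<exists>h. h \<in> Hom C W (Dom C \<pi>') \<and> Comp C \<pi>' h = u \<and> Comp C f' h = v)"
    using assms(1) unfolding pullback_square_def by blast
  then show ?thesis
    unfolding HomD(2)[OF assms(2)] HomD(2)[OF assms(3)] HomD(2)[OF assms(4)]
    using assms(5-7) Hom_obj(1)[OF assms(5)] by blast
qed

lemma pullback_unique:
  assumes pb: "pullback_square C \<pi> f \<pi>' f'" and "\<pi>' \<in> Hom C Z' X'"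
    and h: "h \<in> Hom C W Z'" "h' \<in> Hom C W Z'" "Comp C \<pi>' h = Comp C \<pi>' h'" "Comp C f' h = Comp C f' h'"
  shows "h = h'"
proof -
  obtain X Y Z V where H: "\<pi> \<in> Hom C Z X" "f \<in> Hom C Y X" "\<pi>' \<in> Hom C V Y" "f' \<in> Hom C V Z"
    "Comp C f \<pi>' = Comp C \<pi> f'" using pullback_squareD[OF pb] .
  have V: "V = Z'" "Y = X'" using HomD[OF H(3)] HomD[OF assms(2)] by auto
  have hV: "h \<in> Hom C W V" using h(1) V by simp
  have "Comp C \<pi>' h \<in> Hom C W Y" "Comp C f' h \<in> Hom C W Z" using H h V comp_hom by auto
  moreover have "Comp C f (Comp C \<pi>' h) = Comp C \<pi> (Comp C f' h)"
    using comp_assoc[OF hV H(3,2)] comp_assoc[OF hV H(4,1)] H(5) by simp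
  moreover have "\<forall>W \<in> Obj C. \<forall>u \<in> Hom C W (Dom C f). \<forall>v \<in> Hom C W (Dom C \<pi>). Comp C f u = Comp C \<pi> v \<longrightarrow>
      (\<exists>!h. h \<in> Hom C W (Dom C \<pi>') \<and> Comp C \<pi>' h = u \<and> Comp C f' h = v)"
    using pb unfolding pullback_square_def by blast
  ultimately have "\<exists>!k. k \<in> Hom C W V \<and> Comp C \<pi>' k = Comp C \<pi>' h \<and> Comp C f' k = Comp C f' h"
    unfolding HomD(2)[OF H(1)] HomD(2)[OF H(2)] HomD(2)[OF H(3)]
    using Hom_obj(1)[OF h(1)] by blast
  with h hV V show ?thesis by auto
qed

text \<open>Cones over \<open>p\<close> and \<open>j f\<close> correspond to cones over
  \<open>\<pi>\<close> and \<open>f\<close>: compose the upper leg with the inverse of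
  \<open>i\<close>, then cancel the monomorphism \<open>j\<close>.\<close>

lemma pullback_transport:
  assumes pb: "pullback_square C \<pi> f \<pi>' f'" and \<pi>: "\<pi> \<in> Hom C Z X" and f: "f \<in> Hom C X' X"
    and i: "is_iso C i" "i \<in> Hom C Z A" and j: "is_iso C j" "j \<in> Hom C X B" and p: "p \<in> Hom C A B"
    and eq: "Comp C j \<pi> = Comp C p i"
  shows "pullback_square C p (Comp C j f) \<pi>' (Comp C i f')"
proof -
  obtain Z' where \<pi>': "\<pi>' \<in> Hom C Z' X'" and f': "f' \<in> Hom C Z' Z" and sq: "Comp C f \<pi>' = Comp C \<pi> f'"
    using pullback_squareD[OF pb] \<pi> f by (metis HomD(2))
  obtain i' where i': "i' \<in> Hom C A Z" "Comp C i' i = Ide C Z" "Comp C i i' = Ide C A"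
    using iso_obtain[OF i] by blast
  show ?thesis
  proof (rule pullback_squareI[OF p comp_hom[OF f j(2)] \<pi>' comp_hom[OF f' i(2)]])
    have "Comp C (Comp C j f) \<pi>' = Comp C j (Comp C \<pi> f')" using comp_assoc[OF \<pi>' f j(2)] sq by simp
    also have "\<dots> = Comp C (Comp C p i) f'" using comp_assoc[OF f' \<pi> j(2)] eq by simp
    also have "\<dots> = Comp C p (Comp C i f')" by (rule comp_assoc[OF f' i(2) p])
    finally show "Comp C (Comp C j f) \<pi>' = Comp C p (Comp C i f')" .
  next
    fix W u v assume u: "u \<in> Hom C W X'" and v: "v \<in> Hom C W A" and e: "Comp C (Comp C j f) u = Comp C p v"
    have iv: "Comp C i' v \<in> Hom C W Z" by (rule comp_hom[OF v i'(1)])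
    have iiv: "Comp C i (Comp C i' v) = v" by (rule inverse_cancel[OF i'(1) i(2) i'(3) v])
    have "Comp C j (Comp C f u) = Comp C p v" using e comp_assoc[OF u f j(2)] by simp
    also have "\<dots> = Comp C (Comp C p i) (Comp C i' v)" using comp_assoc[OF iv i(2) p] iiv by simp
    also have "\<dots> = Comp C j (Comp C \<pi> (Comp C i' v))" using comp_assoc[OF iv \<pi> j(2)] eq by simp
    finally have "Comp C f u = Comp C \<pi> (Comp C i' v)"
      using iso_mono[OF j comp_hom[OF u f] comp_hom[OF iv \<pi>]] by simp
    then obtain h where h: "h \<in> Hom C W Z'" "Comp C \<pi>' h = u" "Comp C f' h = Comp C i' v"
      using pullback_mediate[OF pb \<pi> f \<pi>' u iv] by blast
    then have "Comp C (Comp C i f') h = v" using comp_assoc[OF h(1) f' i(2)] iiv by simp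
    with h show "\<exists>h. h \<in> Hom C W Z' \<and> Comp C \<pi>' h = u \<and> Comp C (Comp C i f') h = v" by blast
  next
    fix W h h' assume h: "h \<in> Hom C W Z'" "h' \<in> Hom C W Z'" "Comp C \<pi>' h = Comp C \<pi>' h'"
      "Comp C (Comp C i f') h = Comp C (Comp C i f') h'"
    then have "Comp C i (Comp C f' h) = Comp C i (Comp C f' h')"
      using comp_assoc[OF h(1) f' i(2)] comp_assoc[OF h(2) f' i(2)] by simp
    then have "Comp C f' h = Comp C f' h'"
      using iso_mono[OF i comp_hom[OF h(1) f'] comp_hom[OF h(2) f']] by simp
    then show "h = h'" using pullback_unique[OF pb \<pi>' h(1,2,3)] by simp
  qed
qed

lemma pullback_comparison:
  assumes pb: "pullback_square C \<pi> f \<pi>' f'" and pb2: "pullback_square C \<pi> f \<pi>'' f''"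
    and \<pi>': "\<pi>' \<in> Hom C Z' X'" and \<pi>'': "\<pi>'' \<in> Hom C Z'' X'"
  shows "\<exists>k. is_iso C k \<and> k \<in> Hom C Z' Z'' \<and> Comp C \<pi>'' k = \<pi>' \<and> Comp C f'' k = f'"
proof -
  obtain Z X where H: "\<pi> \<in> Hom C Z X" "f \<in> Hom C X' X" "f' \<in> Hom C Z' Z" "Comp C f \<pi>' = Comp C \<pi> f'"
    using pullback_squareD[OF pb] \<pi>' by (metis HomD(2,3))
  have H2: "f'' \<in> Hom C Z'' Z" "Comp C f \<pi>'' = Comp C \<pi> f''"
    using pullback_squareD[OF pb2] \<pi>'' H by (metis HomD(2,3))+
  obtain k where k: "k \<in> Hom C Z' Z''" "Comp C \<pi>'' k = \<pi>'" "Comp C f'' k = f'"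
    using pullback_mediate[OF pb2 H(1,2) \<pi>'' \<pi>' H(3,4)] by blast
  obtain m where m: "m \<in> Hom C Z'' Z'" "Comp C \<pi>' m = \<pi>''" "Comp C f' m = f''"
    using pullback_mediate[OF pb H(1,2) \<pi>' \<pi>'' H2] by blast
  have i': "Ide C Z' \<in> Hom C Z' Z'" "Ide C Z'' \<in> Hom C Z'' Z''"
    using ide_hom Hom_obj \<pi>' \<pi>'' by blast+
  have "Comp C m k = Ide C Z'"
    by (rule pullback_unique[OF pb \<pi>' comp_hom[OF k(1) m(1)] i'(1)])
      (use comp_assoc[OF k(1) m(1) \<pi>'] comp_assoc[OF k(1) m(1) H(3)] comp_ide_right[OF \<pi>']
        comp_ide_right[OF H(3)] k m in auto)
  moreover have "Comp C k m = Ide C Z''"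
    by (rule pullback_unique[OF pb2 \<pi>'' comp_hom[OF m(1) k(1)] i'(2)])
      (use comp_assoc[OF m(1) k(1) \<pi>''] comp_assoc[OF m(1) k(1) H2(1)] comp_ide_right[OF \<pi>'']
        comp_ide_right[OF H2(1)] k m in auto)
  ultimately show ?thesis using isoI[OF k(1) m(1)] k by blast
qed

text \<open>Makes replacement by an isomorphic arrow an instance of base change, so that it can be
  compared with other pullbacks of \<open>p\<close>. The mediating map is the inverse of
  \<open>i\<close> after \<open>v\<close>.\<close>

lemma iso_square_pullback:
  assumes i: "is_iso C i" "i \<in> Hom C X A" and j: "is_iso C j" "j \<in> Hom C Y B"
    and f: "f \<in> Hom C X Y" and p: "p \<in> Hom C A B" and eq: "Comp C j f = Comp C p i"
  shows "pullback_square C p j f i"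
proof (rule pullback_squareI[OF p j(2) f i(2) eq])
  obtain i' where i': "i' \<in> Hom C A X" "Comp C i' i = Ide C X" "Comp C i i' = Ide C A"
    using iso_obtain[OF i] by blast
  fix W u v assume u: "u \<in> Hom C W Y" and v: "v \<in> Hom C W A" and e: "Comp C j u = Comp C p v"
  have h: "Comp C i' v \<in> Hom C W X" by (rule comp_hom[OF v i'(1)])
  have ih: "Comp C i (Comp C i' v) = v" by (rule inverse_cancel[OF i'(1) i(2) i'(3) v])
  have "Comp C j (Comp C f (Comp C i' v)) = Comp C p v"
    using comp_assoc[OF h f j(2)] comp_assoc[OF h i(2) p] eq ih by simp
  then have "Comp C f (Comp C i' v) = u" using e iso_mono[OF j comp_hom[OF h f] u] by simp
  with h ih show "\<exists>h. h \<in> Hom C W X \<and> Comp C f h = u \<and> Comp C i h = v" by blast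
next
  show "h = h'" if "h \<in> Hom C W X" "h' \<in> Hom C W X" "Comp C i h = Comp C i h'" for W h h'
    using iso_mono[OF i that] .
qed

lemma iso_closure_obtain:
  assumes "f \<in> iso_closure C D" "f \<in> Hom C X Y" "D \<subseteq> Arr C"
  obtains p i j A B where "p \<in> D" "p \<in> Hom C A B" "is_iso C i" "i \<in> Hom C X A" "is_iso C j" "j \<in> Hom C Y B"
    "Comp C j f = Comp C p i"
proof -
  from assms(1) obtain p i j where p: "p \<in> D" "is_iso C i" "Dom C i = Dom C f" "Cod C i = Dom C p"
    "is_iso C j" "Dom C j = Cod C f" "Cod C j = Cod C p" "Comp C j f = Comp C p i"
    unfolding iso_closure_def by blast
  show ?thesis
  proof (rule that[OF p(1) _ p(2) _ p(5) _ p(8)])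
    show "p \<in> Hom C (Dom C p) (Cod C p)" using p(1) assms(3) by (auto simp: Hom_def)
    show "i \<in> Hom C X (Dom C p)" "j \<in> Hom C Y (Cod C p)"
      using p HomD[OF assms(2)] by (auto simp: Hom_def is_iso_def)
  qed
qed

lemma iso_closureI:
  assumes "f \<in> Hom C X Y" "p \<in> D" "p \<in> Hom C A B" "is_iso C i" "i \<in> Hom C X A" "is_iso C j" "j \<in> Hom C Y B"
    "Comp C j f = Comp C p i"
  shows "f \<in> iso_closure C D"
proof -
  have "Dom C i = Dom C f" "Cod C i = Dom C p" "Dom C j = Cod C f" "Cod C j = Cod C p" "f \<in> Arr C"
    using HomD[OF assms(1)] HomD[OF assms(3)] HomD[OF assms(5)] HomD[OF assms(7)] by simp_all
  then show ?thesis using assms(2,4,6,8) unfolding iso_closure_def by blast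
qed

end

text \<open>The class \<open>D\<close> is not assumed closed under isomorphism, so one cannot ask
  that every pullback of a map in \<open>D\<close> lies in \<open>D\<close>;
  \<open>D_pullback\<close> asks for some pullback that does.\<close>

locale display_category = category C for C :: "('o, 'm) cat" +
  fixes D :: "'m set"
  assumes D_arr: "D \<subseteq> Arr C"
    and D_ide: "X \<in> Obj C \<Longrightarrow> Ide C X \<in> D"
    and D_comp: "\<lbrakk>f \<in> D; g \<in> D; Cod C f = Dom C g\<rbrakk> \<Longrightarrow> Comp C g f \<in> D"
    and D_pullback: "\<lbrakk>p \<in> D; f \<in> Arr C; Cod C f = Cod C p\<rbrakk> \<Longrightarrow> \<exists>p'\<in>D. \<exists>f'. pullback_square C p f p' f'"
    and D_terminal: "\<exists>X. is_terminal C X \<and> (\<forall>f \<in> Arr C. Cod C f = X \<longrightarrow> f \<in> D)"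
begin

lemma D_closure: "D \<subseteq> iso_closure C D"
proof
  fix p assume p: "p \<in> D"
  then have h: "p \<in> Hom C (Dom C p) (Cod C p)" using D_arr arr_hom by blast
  note o = Hom_obj[OF h]
  show "p \<in> iso_closure C D"
    by (rule iso_closureI[OF h p h iso_ide[OF o(1)] ide_hom[OF o(1)] iso_ide[OF o(2)] ide_hom[OF o(2)]])
      (simp add: comp_ide_left[OF h] comp_ide_right[OF h])
qed

text \<open>
  Pulling the first display map back along the isomorphism that connects it to the second one
  makes the two composable.
\<close>

lemma closure_comp:
  assumes f: "f \<in> iso_closure C D" and g: "g \<in> iso_closure C D" and c: "Cod C f = Dom C g"
  shows "Comp C g f \<in> iso_closure C D"
proof -
  have fH: "f \<in> Hom C (Dom C f) (Dom C g)" and gH: "g \<in> Hom C (Dom C g) (Cod C g)"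
    using f g c unfolding iso_closure_def Hom_def by auto
  obtain p i j A B where p: "p \<in> D" "p \<in> Hom C A B" "is_iso C i" "i \<in> Hom C (Dom C f) A"
    "is_iso C j" "j \<in> Hom C (Dom C g) B" "Comp C j f = Comp C p i"
    using iso_closure_obtain[OF f fH D_arr] .
  obtain q i' j' A' B' where q: "q \<in> D" "q \<in> Hom C A' B'" "is_iso C i'" "i' \<in> Hom C (Dom C g) A'"
    "is_iso C j'" "j' \<in> Hom C (Cod C g) B'" "Comp C j' g = Comp C q i'"
    using iso_closure_obtain[OF g gH D_arr] .
  obtain i'' where i'': "i'' \<in> Hom C A' (Dom C g)" "Comp C i'' i' = Ide C (Dom C g)" "is_iso C i''"
    using iso_obtain[OF q(3,4)] by blast
  have \<phi>: "Comp C j i'' \<in> Hom C A' B" "is_iso C (Comp C j i'')"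
    using comp_hom[OF i''(1) p(6)] iso_comp[OF i''(3,1) p(5,6)] by auto
  have if': "Comp C i' f \<in> Hom C (Dom C f) A'" by (rule comp_hom[OF fH q(4)])
  have "Comp C (Comp C j i'') (Comp C i' f) = Comp C j f"
    using comp_assoc[OF if' i''(1) p(6)] inverse_cancel[OF q(4) i''(1,2) fH] by simp
  then have sq: "pullback_square C p (Comp C j i'') (Comp C i' f) i"
    using iso_square_pullback[OF p(3,4) \<phi>(2,1) if' p(2)] p(7) by simp
  obtain p' f' where p': "p' \<in> D" "pullback_square C p (Comp C j i'') p' f'"
    using D_pullback[OF p(1) HomD(1)[OF \<phi>(1)]] HomD[OF \<phi>(1)] HomD[OF p(2)] by auto
  have p'H: "p' \<in> Hom C (Dom C p') A'"
    using p'(2) HomD[OF \<phi>(1)] unfolding pullback_square_def Hom_def by auto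
  \<comment> \<open>Both \<open>i' f\<close> and the display map \<open>p'\<close> are pullbacks of
    \<open>p\<close> along the same arrow. The comparison \<open>k\<close> replaces
    \<open>i' f\<close> by \<open>p'\<close>, whose codomain is literally the domain of
    \<open>q\<close>.\<close>
  obtain k where k: "is_iso C k" "k \<in> Hom C (Dom C f) (Dom C p')" "Comp C p' k = Comp C i' f"
    using pullback_comparison[OF sq p'(2) if' p'H] by blast
  have qp: "Comp C q p' \<in> D" using D_comp[OF p'(1) q(1)] HomD[OF p'H] HomD[OF q(2)] by simp
  show ?thesis
  proof (rule iso_closureI[OF comp_hom[OF fH gH] qp comp_hom[OF p'H q(2)] k(1,2) q(5,6)])
    have "Comp C j' (Comp C g f) = Comp C (Comp C q i') f"
      using comp_assoc[OF fH gH q(6)] q(7) by simp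
    also have "\<dots> = Comp C q (Comp C p' k)" using comp_assoc[OF fH q(4) q(2)] k(3) by simp
    finally show "Comp C j' (Comp C g f) = Comp C (Comp C q p') k"
      using comp_assoc[OF k(2) p'H q(2)] by simp
  qed
qed

text \<open>Pull the isomorphic display map back along \<open>j f\<close> and carry the square over
  to \<open>\<pi>\<close> along the inverses of \<open>i\<close> and \<open>j\<close>.\<close>

lemma closure_pullback:
  assumes \<pi>: "\<pi> \<in> iso_closure C D" and f: "f \<in> Arr C" "Cod C f = Cod C \<pi>"
  shows "\<exists>\<pi>' f'. pullback_square C \<pi> f \<pi>' f'"
proof -
  have \<pi>H: "\<pi> \<in> Hom C (Dom C \<pi>) (Cod C \<pi>)" and fH: "f \<in> Hom C (Dom C f) (Cod C \<pi>)"
    using \<pi> f arr_hom unfolding iso_closure_def by (auto simp: Hom_def)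
  obtain p i j A B where p: "p \<in> D" "p \<in> Hom C A B" "is_iso C i" "i \<in> Hom C (Dom C \<pi>) A"
    "is_iso C j" "j \<in> Hom C (Cod C \<pi>) B" "Comp C j \<pi> = Comp C p i"
    using iso_closure_obtain[OF \<pi> \<pi>H D_arr] .
  have jf: "Comp C j f \<in> Hom C (Dom C f) B" by (rule comp_hom[OF fH p(6)])
  obtain p' f' where p': "pullback_square C p (Comp C j f) p' f'"
    using D_pullback[OF p(1) HomD(1)[OF jf]] HomD[OF jf] HomD[OF p(2)] by auto
  obtain i' where i': "i' \<in> Hom C A (Dom C \<pi>)" "Comp C i i' = Ide C A" "is_iso C i'"
    using iso_obtain[OF p(3,4)] by blast
  obtain j' where j': "j' \<in> Hom C B (Cod C \<pi>)" "Comp C j' j = Ide C (Cod C \<pi>)" "is_iso C j'"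
    using iso_obtain[OF p(5,6)] by blast
  have "Comp C j' p = Comp C j' (Comp C p (Comp C i i'))" using i'(2) comp_ide_right[OF p(2)] by simp
  also have "\<dots> = Comp C j' (Comp C j (Comp C \<pi> i'))"
    using comp_assoc[OF i'(1) p(4) p(2)] comp_assoc[OF i'(1) \<pi>H p(6)] p(7) by simp
  also have "\<dots> = Comp C \<pi> i'" by (rule inverse_cancel[OF p(6) j'(1,2) comp_hom[OF i'(1) \<pi>H]])
  finally have "pullback_square C \<pi> (Comp C j' (Comp C j f)) p' (Comp C i' f')"
    using pullback_transport[OF p' p(2) jf i'(3,1) j'(3,1) \<pi>H] by simp
  moreover have "Comp C j' (Comp C j f) = f" by (rule inverse_cancel[OF p(6) j'(1,2) fH])
  ultimately show ?thesis by auto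
qed

text \<open>Once the given square has been carried over to \<open>p\<close>, it and the square
  supplied by \<open>D\<close> are pullbacks of the same cospan. Both stability of fibrations and
  Beck-Chevalley are read off from the comparison.\<close>

lemma closure_pullback_compare:
  assumes \<pi>H: "\<pi> \<in> Hom C Z X" and p: "p \<in> D" "p \<in> Hom C A B" "is_iso C i" "i \<in> Hom C Z A"
    "is_iso C j" "j \<in> Hom C X B" "Comp C j \<pi> = Comp C p i"
    and pb: "pullback_square C \<pi> f \<pi>' f'" and fH: "f \<in> Hom C X' X" and \<pi>'H: "\<pi>' \<in> Hom C Z' X'"
    and pb2: "pullback_square C p (Comp C j f) p' f''" and p'H: "p' \<in> Hom C Z'' X'"
  shows "\<exists>k. is_iso C k \<and> k \<in> Hom C Z' Z'' \<and> Comp C p' k = \<pi>' \<and> Comp C f'' k = Comp C i f'"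
  using pullback_comparison[OF pullback_transport[OF pb \<pi>H fH p(3-6) p(2) p(7)] pb2 \<pi>'H p'H] .

lemma closure_pullback_closed:
  assumes \<pi>: "\<pi> \<in> iso_closure C D" and pb: "pullback_square C \<pi> f \<pi>' f'"
  shows "\<pi>' \<in> iso_closure C D"
proof -
  obtain Z X X' Z' where H: "\<pi> \<in> Hom C Z X" "f \<in> Hom C X' X" "\<pi>' \<in> Hom C Z' X'"
    using pullback_squareD[OF pb] .
  obtain p i j A B where p: "p \<in> D" "p \<in> Hom C A B" "is_iso C i" "i \<in> Hom C Z A"
    "is_iso C j" "j \<in> Hom C X B" "Comp C j \<pi> = Comp C p i"
    using iso_closure_obtain[OF \<pi> H(1) D_arr] .
  have jf: "Comp C j f \<in> Hom C X' B" by (rule comp_hom[OF H(2) p(6)])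
  obtain p' f'' where p': "p' \<in> D" "pullback_square C p (Comp C j f) p' f''"
    using D_pullback[OF p(1) HomD(1)[OF jf]] HomD[OF jf] HomD[OF p(2)] by auto
  have p'H: "p' \<in> Hom C (Dom C p') X'"
    using p'(2) HomD[OF jf] unfolding pullback_square_def Hom_def by auto
  obtain k where k: "is_iso C k" "k \<in> Hom C Z' (Dom C p')" "Comp C p' k = \<pi>'"
    using closure_pullback_compare[OF H(1) p pb H(2,3) p'(2) p'H] by blast
  note o = Hom_obj(2)[OF H(3)]
  show ?thesis
    by (rule iso_closureI[OF H(3) p'(1) p'H k(1,2) iso_ide[OF o] ide_hom[OF o]])
      (simp add: comp_ide_left[OF H(3)] k(3))
qed

theorem iso_closure_clan: "clan C (iso_closure C D)"
proof
  show "iso_closure C D \<subseteq> Arr C" by (auto simp: iso_closure_def)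
  show "\<exists>X. is_terminal C X \<and> (\<forall>f\<in>Arr C. Cod C f = X \<longrightarrow> f \<in> iso_closure C D)"
    using D_terminal D_closure by blast
  fix f assume f: "is_iso C f"
  then have h: "f \<in> Hom C (Dom C f) (Cod C f)" using arr_hom by (simp add: is_iso_def)
  note o = Hom_obj(2)[OF h]
  \<comment> \<open>An isomorphism is connected to the identity display map of its codomain by
    itself on the domains and by the identity on the codomains.\<close>
  show "f \<in> iso_closure C D"
    by (rule iso_closureI[OF h D_ide[OF o] ide_hom[OF o] f h iso_ide[OF o] ide_hom[OF o]]) simp
next
  show "Comp C g f \<in> iso_closure C D" if "f \<in> iso_closure C D" "g \<in> iso_closure C D" "Cod C f = Dom C g" for f g
    using closure_comp that .
  show "\<exists>\<pi>' f'. pullback_square C \<pi> f \<pi>' f'" if "\<pi> \<in> iso_closure C D" "f \<in> Arr C" "Cod C f = Cod C \<pi>" for \<pi> f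
    using closure_pullback that .
  show "\<pi>' \<in> iso_closure C D" if "\<pi> \<in> iso_closure C D" "pullback_square C \<pi> f \<pi>' f'" for \<pi> f \<pi>' f'
    using closure_pullback_closed that .
qed

end

section \<open>Boolean functors and left adjoints\<close>

lemma lambda_boolean_lattice: "lambda_boolean_algebra l L \<Longrightarrow> bounded_lattice L"
  by (simp add: lambda_boolean_algebra_def)

lemma lambda_boolean_order: "lambda_boolean_algebra l L \<Longrightarrow> partial_order L"
  by (drule lambda_boolean_lattice)
    (simp add: bounded_lattice_def lattice_def upper_semilattice_def)

lemma lambda_boolean_hom_closed: "\<lbrakk>lambda_boolean_hom l L M h; x \<in> carrier L\<rbrakk> \<Longrightarrow> h x \<in> carrier M"
  by (auto simp: lambda_boolean_hom_def)

lemma lambda_boolean_hom_mono: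
  assumes L: "lambda_boolean_algebra l L" and M: "lambda_boolean_algebra l M"
    and h: "lambda_boolean_hom l L M h" and x: "x \<in> carrier L" "y \<in> carrier L" "x \<sqsubseteq>\<^bsub>L\<^esub> y"
  shows "h x \<sqsubseteq>\<^bsub>M\<^esub> h y"
proof -
  interpret L: bounded_lattice L by (rule lambda_boolean_lattice[OF L])
  interpret M: bounded_lattice M by (rule lambda_boolean_lattice[OF M])
  have "x \<squnion>\<^bsub>L\<^esub> y = y" using x L.le_iff_meet by metis
  then have "h x \<squnion>\<^bsub>M\<^esub> h y = h y" using h x unfolding lambda_boolean_hom_def by metis
  then show ?thesis using M.le_iff_meet lambda_boolean_hom_closed[OF h] x by metis
qed

text \<open>The part of a Boolean algebra over a clan that does not mention fibrations. Adjoints can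
  then be discussed one arrow at a time, before all fibrations are known to have them.\<close>

locale boolean_functor = category C for C :: "('o, 'm) cat" +
  fixes l :: "'l rel" and B :: "('o, 'm, 'b) bool_functor"
  assumes fibre_boolean: "X \<in> Obj C \<Longrightarrow> lambda_boolean_algebra l (Fibre B X)"
    and pull_hom:
      "f \<in> Arr C \<Longrightarrow> lambda_boolean_hom l (Fibre B (Cod C f)) (Fibre B (Dom C f)) (Pull B f)"
    and pull_ide: "\<lbrakk>X \<in> Obj C; x \<in> carrier (Fibre B X)\<rbrakk> \<Longrightarrow> Pull B (Ide C X) x = x"
    and pull_comp:
      "\<lbrakk>f \<in> Hom C X Y; g \<in> Hom C Y Z; x \<in> carrier (Fibre B Z)\<rbrakk> \<Longrightarrow>
        Pull B (Comp C g f) x = Pull B f (Pull B g x)"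
begin

lemma pull_closed: "\<lbrakk>f \<in> Hom C X Y; x \<in> carrier (Fibre B Y)\<rbrakk> \<Longrightarrow> Pull B f x \<in> carrier (Fibre B X)"
  using pull_hom lambda_boolean_hom_closed HomD by metis

lemma pull_mono:
  "\<lbrakk>f \<in> Hom C X Y; x \<in> carrier (Fibre B Y); y \<in> carrier (Fibre B Y); x \<sqsubseteq>\<^bsub>Fibre B Y\<^esub> y\<rbrakk> \<Longrightarrow>
    Pull B f x \<sqsubseteq>\<^bsub>Fibre B X\<^esub> Pull B f y"
  using lambda_boolean_hom_mono[OF fibre_boolean fibre_boolean pull_hom] HomD Hom_obj by metis

lemma fibre_order: "X \<in> Obj C \<Longrightarrow> partial_order (Fibre B X)"
  using fibre_boolean lambda_boolean_order by blast

lemma exists_adjoint_iff: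
  assumes "\<pi> \<in> Hom C Z X"
  shows "exists_adjoint C B \<pi> e \<longleftrightarrow>
    e \<in> carrier (Fibre B Z) \<rightarrow> carrier (Fibre B X) \<and>
    (\<forall>z \<in> carrier (Fibre B Z). \<forall>x \<in> carrier (Fibre B X).
      e z \<sqsubseteq>\<^bsub>Fibre B X\<^esub> x \<longleftrightarrow> z \<sqsubseteq>\<^bsub>Fibre B Z\<^esub> Pull B \<pi> x)"
  using HomD[OF assms] fibre_order[OF Hom_obj(1)[OF assms]] fibre_order[OF Hom_obj(2)[OF assms]]
    pull_closed[OF assms]
  unfolding exists_adjoint_def galois_connection_def connection_def galois_connection_axioms_def
  by auto

lemma exists_adjoint_unique:
  assumes "\<pi> \<in> Hom C Z X" "exists_adjoint C B \<pi> e" "exists_adjoint C B \<pi> e'" "z \<in> carrier (Fibre B Z)"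
  shows "e z = e' z"
proof -
  interpret X: partial_order "Fibre B X" by (rule fibre_order[OF Hom_obj(2)[OF assms(1)]])
  have c: "e z \<in> carrier (Fibre B X)" "e' z \<in> carrier (Fibre B X)"
    using assms by (auto simp: exists_adjoint_iff[OF assms(1)])
  have "e z \<sqsubseteq>\<^bsub>Fibre B X\<^esub> e' z" "e' z \<sqsubseteq>\<^bsub>Fibre B X\<^esub> e z"
    using assms(2-4) c unfolding exists_adjoint_iff[OF assms(1)] by (metis X.le_refl)+
  then show ?thesis using c X.le_antisym by blast
qed

lemma exists_along_adjoint: "exists_adjoint C B \<pi> e \<Longrightarrow> exists_adjoint C B \<pi> (exists_along C B \<pi>)"
  unfolding exists_along_def by (rule someI[where P = "exists_adjoint C B \<pi>"])

lemma exists_along_eq: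
  "\<lbrakk>\<pi> \<in> Hom C Z X; exists_adjoint C B \<pi> e; z \<in> carrier (Fibre B Z)\<rbrakk> \<Longrightarrow> exists_along C B \<pi> z = e z"
  using exists_adjoint_unique exists_along_adjoint by metis

lemma exists_along_closed:
  "\<lbrakk>\<pi> \<in> Hom C Z X; exists_adjoint C B \<pi> e; z \<in> carrier (Fibre B Z)\<rbrakk> \<Longrightarrow>
    exists_along C B \<pi> z \<in> carrier (Fibre B X)"
  using exists_along_adjoint exists_adjoint_iff by (metis PiE)

lemma exists_along_le:
  "\<lbrakk>\<pi> \<in> Hom C Z X; exists_adjoint C B \<pi> e; z \<in> carrier (Fibre B Z); x \<in> carrier (Fibre B X)\<rbrakk> \<Longrightarrow>
    exists_along C B \<pi> z \<sqsubseteq>\<^bsub>Fibre B X\<^esub> x \<longleftrightarrow> z \<sqsubseteq>\<^bsub>Fibre B Z\<^esub> Pull B \<pi> x"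
  using exists_along_adjoint exists_adjoint_iff by metis

lemma pull_inverse:
  "\<lbrakk>i \<in> Hom C X Y; i' \<in> Hom C Y X; Comp C i' i = Ide C X; x \<in> carrier (Fibre B X)\<rbrakk> \<Longrightarrow>
    Pull B i (Pull B i' x) = x"
  using pull_comp pull_ide Hom_obj by metis

text \<open>Pullbacks along mutually inverse arrows are mutually inverse order isomorphisms, so each
  is both left and right adjoint to the other.\<close>

lemma pull_inverse_le:
  assumes i: "i \<in> Hom C X Y" "i' \<in> Hom C Y X" "Comp C i' i = Ide C X" "Comp C i i' = Ide C Y"
    and y: "y \<in> carrier (Fibre B Y)" and x: "x \<in> carrier (Fibre B X)"
  shows "Pull B i y \<sqsubseteq>\<^bsub>Fibre B X\<^esub> x \<longleftrightarrow> y \<sqsubseteq>\<^bsub>Fibre B Y\<^esub> Pull B i' x"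
    and "x \<sqsubseteq>\<^bsub>Fibre B X\<^esub> Pull B i y \<longleftrightarrow> Pull B i' x \<sqsubseteq>\<^bsub>Fibre B Y\<^esub> y"
  using pull_mono[OF i(1)] pull_mono[OF i(2)] pull_inverse[OF i(1-3)] pull_inverse[OF i(2,1,4)]
    pull_closed[OF i(1)] pull_closed[OF i(2)] x y by metis+

text \<open>Up to the isomorphisms, pullback along \<open>\<pi>\<close> is pullback along
  \<open>p\<close> conjugated by \<open>i\<close> and \<open>j\<close>; conjugating the left adjoint
  \<open>e\<close> accordingly gives the formula.\<close>

lemma exists_adjoint_transport:
  assumes \<pi>: "\<pi> \<in> Hom C Z X" and p: "p \<in> Hom C A D"
    and i: "i \<in> Hom C Z A" "i' \<in> Hom C A Z" "Comp C i' i = Ide C Z" "Comp C i i' = Ide C A"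
    and j: "is_iso C j" "j \<in> Hom C X D" and eq: "Comp C j \<pi> = Comp C p i"
    and e: "exists_adjoint C B p e"
  shows "exists_adjoint C B \<pi> (\<lambda>z. Pull B j (e (Pull B i' z)))"
  unfolding exists_adjoint_iff[OF \<pi>]
proof (intro conjI ballI)
  obtain j' where j': "j' \<in> Hom C D X" "Comp C j' j = Ide C X" "Comp C j j' = Ide C D"
    using iso_obtain[OF j] by blast
  have ec: "e x \<in> carrier (Fibre B D)" if "x \<in> carrier (Fibre B A)" for x
    using e that by (auto simp: exists_adjoint_iff[OF p])
  then show "(\<lambda>z. Pull B j (e (Pull B i' z))) \<in> carrier (Fibre B Z) \<rightarrow> carrier (Fibre B X)"
    using pull_closed[OF j(2)] pull_closed[OF i(2)] by blast
  fix z x assume z: "z \<in> carrier (Fibre B Z)" and x: "x \<in> carrier (Fibre B X)"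
  have iz: "Pull B i' z \<in> carrier (Fibre B A)" by (rule pull_closed[OF i(2) z])
  have jx: "Pull B j' x \<in> carrier (Fibre B D)" by (rule pull_closed[OF j'(1) x])
  have "Pull B j (e (Pull B i' z)) \<sqsubseteq>\<^bsub>Fibre B X\<^esub> x \<longleftrightarrow> e (Pull B i' z) \<sqsubseteq>\<^bsub>Fibre B D\<^esub> Pull B j' x"
    by (rule pull_inverse_le[OF j(2) j' ec[OF iz] x])
  also have "\<dots> \<longleftrightarrow> Pull B i' z \<sqsubseteq>\<^bsub>Fibre B A\<^esub> Pull B p (Pull B j' x)"
    using e iz jx by (simp add: exists_adjoint_iff[OF p])
  also have "\<dots> \<longleftrightarrow> z \<sqsubseteq>\<^bsub>Fibre B Z\<^esub> Pull B i (Pull B p (Pull B j' x))"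
    by (rule pull_inverse_le(2)[symmetric, OF i pull_closed[OF p jx] z])
  also have "Pull B i (Pull B p (Pull B j' x)) = Pull B (Comp C j \<pi>) (Pull B j' x)"
    using pull_comp[OF i(1) p jx] eq by simp
  also have "\<dots> = Pull B \<pi> x"
    using pull_comp[OF \<pi> j(2) jx] pull_inverse[OF j(2) j'(1,2) x] by simp
  finally show "Pull B j (e (Pull B i' z)) \<sqsubseteq>\<^bsub>Fibre B X\<^esub> x \<longleftrightarrow> z \<sqsubseteq>\<^bsub>Fibre B Z\<^esub> Pull B \<pi> x" .
qed

end

text \<open>In the same spirit as \<open>D_pullback\<close>, Beck-Chevalley is assumed for one
  suitable square per cospan. All other squares are compared with that one.\<close>

locale display_boolean_functor = display_category C D + boolean_functor C l B
  for C :: "('o, 'm) cat" and D and l :: "'l rel" and B :: "('o, 'm, 'b) bool_functor" +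
  assumes D_exists: "p \<in> D \<Longrightarrow> \<exists>e. exists_adjoint C B p e"
    and D_beck_chevalley:
      "\<lbrakk>p \<in> D; f \<in> Arr C; Cod C f = Cod C p\<rbrakk> \<Longrightarrow> \<exists>p' \<in> D. \<exists>f'. pullback_square C p f p' f' \<and>
        (\<forall>z \<in> carrier (Fibre B (Dom C p)).
          Pull B f (exists_along C B p z) = exists_along C B p' (Pull B f' z))"
begin

lemma exists_along_transport:
  assumes "\<pi> \<in> Hom C Z X" "p \<in> D" "p \<in> Hom C A A'"
    and i: "i \<in> Hom C Z A" "i' \<in> Hom C A Z" "Comp C i' i = Ide C Z" "Comp C i i' = Ide C A"
    and "is_iso C j" "j \<in> Hom C X A'" "Comp C j \<pi> = Comp C p i" "z \<in> carrier (Fibre B Z)"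
  shows "exists_along C B \<pi> z = Pull B j (exists_along C B p (Pull B i' z))"
proof -
  obtain e where "exists_adjoint C B p e" using D_exists[OF assms(2)] by blast
  then have "exists_adjoint C B p (exists_along C B p)" by (rule exists_along_adjoint)
  from exists_along_eq[OF assms(1) exists_adjoint_transport[OF assms(1,3) i assms(8-10) this] assms(11)]
  show ?thesis .
qed

text \<open>For Beck-Chevalley, quantification along \<open>\<pi>\<close> is rewritten through
  \<open>p\<close>, and quantification along \<open>\<pi>'\<close> through the chosen pullback
  \<open>p'\<close> of \<open>p\<close>, using the comparison isomorphism \<open>k\<close> over the
  identity of the base. What remains is the assumed instance for \<open>p\<close> and
  \<open>j f\<close>.\<close>

theorem boolean_algebra_over_iso_closure: "boolean_algebra_over_clan C (iso_closure C D) l B"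
proof -
  interpret clan C "iso_closure C D" by (rule iso_closure_clan)
  show ?thesis
  proof
    fix \<pi> assume \<pi>: "\<pi> \<in> iso_closure C D"
    then have H: "\<pi> \<in> Hom C (Dom C \<pi>) (Cod C \<pi>)" using arr_hom by (auto simp: iso_closure_def)
    obtain p i j A A' where p: "p \<in> D" "p \<in> Hom C A A'" "is_iso C i" "i \<in> Hom C (Dom C \<pi>) A"
      "is_iso C j" "j \<in> Hom C (Cod C \<pi>) A'" "Comp C j \<pi> = Comp C p i"
      using iso_closure_obtain[OF \<pi> H D_arr] .
    obtain i' where i': "i' \<in> Hom C A (Dom C \<pi>)" "Comp C i' i = Ide C (Dom C \<pi>)" "Comp C i i' = Ide C A"
      using iso_obtain[OF p(3,4)] by blast
    show "\<exists>e. exists_adjoint C B \<pi> e"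
      using exists_adjoint_transport[OF H p(2,4) i' p(5-7)] D_exists[OF p(1)] by blast
  next
    fix \<pi> f \<pi>' f' z
    assume \<pi>: "\<pi> \<in> iso_closure C D" and pb: "pullback_square C \<pi> f \<pi>' f'"
      and z: "z \<in> carrier (Fibre B (Dom C \<pi>))"
    obtain Z X X' Z' where H: "\<pi> \<in> Hom C Z X" "f \<in> Hom C X' X" "\<pi>' \<in> Hom C Z' X'" "f' \<in> Hom C Z' Z"
      using pullback_squareD[OF pb] .
    have z: "z \<in> carrier (Fibre B Z)" using z HomD[OF H(1)] by simp
    obtain p i j A A' where p: "p \<in> D" "p \<in> Hom C A A'" "is_iso C i" "i \<in> Hom C Z A"
      "is_iso C j" "j \<in> Hom C X A'" "Comp C j \<pi> = Comp C p i"
      using iso_closure_obtain[OF \<pi> H(1) D_arr] .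
    obtain i' where i': "i' \<in> Hom C A Z" "Comp C i' i = Ide C Z" "Comp C i i' = Ide C A"
      using iso_obtain[OF p(3,4)] by blast
    have jf: "Comp C j f \<in> Hom C X' A'" by (rule comp_hom[OF H(2) p(6)])
    obtain p' f'' where p': "p' \<in> D" "pullback_square C p (Comp C j f) p' f''"
      and bc: "\<And>w. w \<in> carrier (Fibre B A) \<Longrightarrow>
        Pull B (Comp C j f) (exists_along C B p w) = exists_along C B p' (Pull B f'' w)"
      using D_beck_chevalley[OF p(1) HomD(1)[OF jf]] HomD[OF jf] HomD[OF p(2)] by auto
    have p'H: "p' \<in> Hom C (Dom C p') X'" and f''H: "f'' \<in> Hom C (Dom C p') A"
      using p'(2) HomD[OF jf] HomD[OF p(2)] unfolding pullback_square_def Hom_def by auto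
    obtain k where k: "is_iso C k" "k \<in> Hom C Z' (Dom C p')" "Comp C p' k = \<pi>'" "Comp C f'' k = Comp C i f'"
      using closure_pullback_compare[OF H(1) p pb H(2,3) p'(2) p'H] by blast
    obtain k' where k': "k' \<in> Hom C (Dom C p') Z'" "Comp C k' k = Ide C Z'" "Comp C k k' = Ide C (Dom C p')"
      using iso_obtain[OF k(1,2)] by blast
    obtain e where e: "exists_adjoint C B p e" using D_exists[OF p(1)] by blast
    have iz: "Pull B i' z \<in> carrier (Fibre B A)" by (rule pull_closed[OF i'(1) z])
    note o = Hom_obj(2)[OF H(3)]
    have fz: "Pull B f' z \<in> carrier (Fibre B Z')" by (rule pull_closed[OF H(4) z])
    have kf: "Pull B k' (Pull B f' z) \<in> carrier (Fibre B (Dom C p'))" by (rule pull_closed[OF k'(1) fz])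
    have "Comp C (Ide C X') \<pi>' = Comp C p' k" using comp_ide_left[OF H(3)] k(3) by simp
    from exists_along_transport[OF H(3) p'(1) p'H k(2) k' iso_ide[OF o] ide_hom[OF o] this fz]
    have r: "exists_along C B \<pi>' (Pull B f' z) = Pull B (Ide C X') (exists_along C B p' (Pull B k' (Pull B f' z)))" .
    obtain e' where "exists_adjoint C B p' e'" using D_exists[OF p'(1)] by blast
    then have r: "exists_along C B \<pi>' (Pull B f' z) = exists_along C B p' (Pull B k' (Pull B f' z))"
      using r pull_ide[OF o exists_along_closed[OF p'H _ kf]] by simp
    \<comment> \<open>The equation \<open>Comp C f'' k = Comp C i f'\<close> solved for the
      inverses. It shows that both routes bring \<open>z\<close> to the same element over the domain
      of \<open>p'\<close>.\<close>
    have "Comp C i' f'' = Comp C f' k'"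
    proof -
      have "f'' = Comp C f'' (Comp C k k')" using k'(3) comp_ide_right[OF f''H] by simp
      also have "\<dots> = Comp C (Comp C i f') k'" using comp_assoc[OF k'(1) k(2) f''H] k(4) by simp
      also have "\<dots> = Comp C i (Comp C f' k')" by (rule comp_assoc[OF k'(1) H(4) p(4)])
      finally show ?thesis using inverse_cancel[OF p(4) i'(1,2) comp_hom[OF k'(1) H(4)]] by simp
    qed
    then have s: "Pull B f'' (Pull B i' z) = Pull B k' (Pull B f' z)"
      using pull_comp[OF f''H i'(1) z] pull_comp[OF k'(1) H(4) z] by simp
    have "Pull B f (exists_along C B \<pi> z) = Pull B f (Pull B j (exists_along C B p (Pull B i' z)))"
      using exists_along_transport[OF H(1) p(1,2,4) i' p(5-7) z] by simp
    also have "\<dots> = Pull B (Comp C j f) (exists_along C B p (Pull B i' z))"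
      using pull_comp[OF H(2) p(6) exists_along_closed[OF p(2) e iz]] by simp
    also have "\<dots> = exists_along C B p' (Pull B k' (Pull B f' z))" using bc[OF iz] s by simp
    finally show "Pull B f (exists_along C B \<pi> z) = exists_along C B \<pi>' (Pull B f' z)" using r by simp
  qed (use fibre_boolean pull_hom pull_ide pull_comp in auto)
qed

end

lemma (in boolean_algebra_over_clan) boolean_functor: "boolean_functor C l B"
  by unfold_locales (use fibre_boolean pull_hom pull_ide pull_comp in auto)

text \<open>In both functors the quantifier along \<open>\<pi>\<close> is the same expression in the
  quantifier along \<open>p\<close> and two pullbacks. Naturality handles the pullbacks, so display
  maps decide the matter.\<close>

lemma (in display_boolean_functor) morphism_exists_along:
  assumes B': "boolean_algebra_over_clan C (iso_closure C D) l B'"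
    and maps: "\<And>X x. \<lbrakk>X \<in> Obj C; x \<in> carrier (Fibre B X)\<rbrakk> \<Longrightarrow> h X x \<in> carrier (Fibre B' X)"
    and nat: "\<And>f X Y x. \<lbrakk>f \<in> Hom C X Y; x \<in> carrier (Fibre B Y)\<rbrakk> \<Longrightarrow> h X (Pull B f x) = Pull B' f (h Y x)"
    and ex: "\<And>p A A' z. \<lbrakk>p \<in> D; p \<in> Hom C A A'; z \<in> carrier (Fibre B A)\<rbrakk> \<Longrightarrow>
      h A' (exists_along C B p z) = exists_along C B' p (h A z)"
    and \<pi>: "\<pi> \<in> iso_closure C D" and z: "z \<in> carrier (Fibre B (Dom C \<pi>))"
  shows "h (Cod C \<pi>) (exists_along C B \<pi> z) = exists_along C B' \<pi> (h (Dom C \<pi>) z)"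
proof -
  interpret B': boolean_algebra_over_clan C "iso_closure C D" l B' by (rule B')
  interpret F: boolean_functor C l B' by (rule B'.boolean_functor)
  have H: "\<pi> \<in> Hom C (Dom C \<pi>) (Cod C \<pi>)" using arr_hom \<pi> by (auto simp: iso_closure_def)
  obtain p i j A A' where p: "p \<in> D" "p \<in> Hom C A A'" "is_iso C i" "i \<in> Hom C (Dom C \<pi>) A"
    "is_iso C j" "j \<in> Hom C (Cod C \<pi>) A'" "Comp C j \<pi> = Comp C p i"
    using iso_closure_obtain[OF \<pi> H D_arr] .
  obtain i' where i': "i' \<in> Hom C A (Dom C \<pi>)" "Comp C i' i = Ide C (Dom C \<pi>)" "Comp C i i' = Ide C A"
    using iso_obtain[OF p(3,4)] by blast
  have iz: "Pull B i' z \<in> carrier (Fibre B A)" by (rule pull_closed[OF i'(1) z])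
  have hz: "h (Dom C \<pi>) z \<in> carrier (Fibre B' (Dom C \<pi>))" by (rule maps[OF Hom_obj(1)[OF H] z])
  obtain e where e: "exists_adjoint C B p e" using D_exists[OF p(1)] by blast
  obtain e' where e': "exists_adjoint C B' p e'" using B'.has_exists p(1) D_closure by blast
  have "h (Cod C \<pi>) (exists_along C B \<pi> z) = h (Cod C \<pi>) (Pull B j (exists_along C B p (Pull B i' z)))"
    using exists_along_transport[OF H p(1,2,4) i' p(5-7) z] by simp
  also have "\<dots> = Pull B' j (exists_along C B' p (Pull B' i' (h (Dom C \<pi>) z)))"
    using nat[OF p(6) exists_along_closed[OF p(2) e iz]] ex[OF p(1,2) iz] nat[OF i'(1) z] by simp
  also have "\<dots> = exists_along C B' \<pi> (h (Dom C \<pi>) z)"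
    using F.exists_along_eq[OF H F.exists_adjoint_transport[OF H p(2,4) i' p(5-7)
          F.exists_along_adjoint[OF e']] hz] by simp
  finally show ?thesis .
qed

section \<open>The syntactic category\<close>

text \<open>Operations on classes are defined as unions over representatives; this evaluates such a
  union once all representatives are known to give the same class.\<close>

lemma Union_const: "\<lbrakk>x \<in> a; \<And>y. y \<in> a \<Longrightarrow> f y = c\<rbrakk> \<Longrightarrow> (\<Union>y\<in>a. f y) = c"
  by auto

context regular_theory
begin

abbreviation "cls \<Gamma> \<equiv> context_rel T `` {\<Gamma>}"
abbreviation "arrow \<Gamma> t \<Omega> \<equiv> morphism_rel T `` {(\<Gamma>, t, \<Omega>)}"
abbreviation "display \<Gamma> \<gamma> \<equiv> arrow \<Gamma> (vars (init_seg \<gamma> \<Gamma>)) (init_seg \<gamma> \<Gamma>)"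
abbreviation "\<C> \<equiv> syntactic_category T"

lemma morphism_iff: "context_morphism T \<Gamma> t \<Omega> \<longleftrightarrow> ctx \<Gamma> \<and> ctx \<Omega> \<and> sub \<Gamma> t \<Omega>"
  by (simp add: context_morphism_def is_context_def)

lemma raw_iff: "(\<Gamma>, t, \<Omega>) \<in> raw_morphisms T \<longleftrightarrow> ctx \<Gamma> \<and> ctx \<Omega> \<and> sub \<Gamma> t \<Omega>"
  by (simp add: raw_morphisms_def morphism_iff)

text \<open>That both sides are typed morphisms follows from the componentwise equality by
  presupposition and conversion, so it need not be checked separately.\<close>

lemma morphism_rel_iff:
  "((\<Gamma>, t, \<Omega>), (\<Gamma>', t', \<Omega>')) \<in> morphism_rel T \<longleftrightarrow>
    (\<Gamma>, \<Gamma>') \<in> context_rel T \<and> (\<Omega>, \<Omega>') \<in> context_rel T \<and> sub_eq \<Gamma> t t' \<Omega>"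
proof
  show "(\<Gamma>, \<Gamma>') \<in> context_rel T \<and> (\<Omega>, \<Omega>') \<in> context_rel T \<and> sub_eq \<Gamma> t t' \<Omega>"
    if "((\<Gamma>, t, \<Omega>), (\<Gamma>', t', \<Omega>')) \<in> morphism_rel T"
    using that by (simp add: morphism_rel_def)
  assume r: "(\<Gamma>, \<Gamma>') \<in> context_rel T \<and> (\<Omega>, \<Omega>') \<in> context_rel T \<and> sub_eq \<Gamma> t t' \<Omega>"
  then have c: "ctx \<Gamma>" "ctx \<Gamma>'" "ctx \<Omega>" "ctx \<Omega>'" by (auto dest: context_rel_ctx)
  have "sub \<Gamma> t \<Omega>" "sub \<Gamma> t' \<Omega>" using r c sub_eq_left sub_eq_right by blast+
  moreover have "sub \<Gamma>' t' \<Omega>'"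
    using convert_sub_cod[OF c(1) \<open>sub \<Gamma> t' \<Omega>\<close>] convert_sub r c(4) by blast
  ultimately show "((\<Gamma>, t, \<Omega>), (\<Gamma>', t', \<Omega>')) \<in> morphism_rel T"
    using r c by (simp add: morphism_rel_def raw_iff)
qed

lemma equiv_morphism_rel: "equiv (raw_morphisms T) (morphism_rel T)"
proof (rule equivI)
  show "morphism_rel T \<subseteq> raw_morphisms T \<times> raw_morphisms T" by (auto simp: morphism_rel_def)
  show "refl_on (raw_morphisms T) (morphism_rel T)"
    by (auto simp: refl_on_def raw_iff morphism_rel_iff intro: context_rel_refl sub_refl)
  show "sym (morphism_rel T)"
  proof (rule symI)
    fix a b assume ab: "(a, b) \<in> morphism_rel T"
    obtain \<Gamma> t \<Omega> \<Gamma>' t' \<Omega>' where e: "a = (\<Gamma>, t, \<Omega>)" "b = (\<Gamma>', t', \<Omega>')" by (cases a, cases b)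
    then have r: "(\<Gamma>, \<Gamma>') \<in> context_rel T" "(\<Omega>, \<Omega>') \<in> context_rel T" "sub_eq \<Gamma> t t' \<Omega>"
      using ab by (auto simp: morphism_rel_iff)
    note c = context_rel_ctx[OF r(1)] context_rel_ctx[OF r(2)]
    have "sub_eq \<Gamma> t' t \<Omega>" by (rule sub_eq_sym[OF c(1,5) r(3)])
    then have "sub_eq \<Gamma>' t' t \<Omega>" by (rule convert_sub_eq[OF _ r(1) c(5)])
    then have "sub_eq \<Gamma>' t' t \<Omega>'" by (rule convert_sub_eq_cod[OF c(2) _ r(2)])
    then show "(b, a) \<in> morphism_rel T" using r by (auto simp: e morphism_rel_iff intro: context_rel_sym)
  qed
  show "trans (morphism_rel T)"
  proof (rule transI)
    fix a b d assume ab: "(a, b) \<in> morphism_rel T" and bd: "(b, d) \<in> morphism_rel T"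
    obtain \<Gamma> t \<Omega> \<Gamma>' t' \<Omega>' where e: "a = (\<Gamma>, t, \<Omega>)" "b = (\<Gamma>', t', \<Omega>')" by (cases a, cases b)
    obtain \<Gamma>'' t'' \<Omega>'' where e': "d = (\<Gamma>'', t'', \<Omega>'')" by (cases d)
    have r: "(\<Gamma>, \<Gamma>') \<in> context_rel T" "(\<Omega>, \<Omega>') \<in> context_rel T" "sub_eq \<Gamma> t t' \<Omega>"
      using ab by (auto simp: e morphism_rel_iff)
    have s: "(\<Gamma>', \<Gamma>'') \<in> context_rel T" "(\<Omega>', \<Omega>'') \<in> context_rel T" "sub_eq \<Gamma>' t' t'' \<Omega>'"
      using bd by (auto simp: e e' morphism_rel_iff)
    note c = context_rel_ctx[OF r(1)] context_rel_ctx[OF r(2)]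
    have "sub_eq \<Gamma> t' t'' \<Omega>'" by (rule convert_sub_eq[OF s(3) context_rel_sym[OF r(1)] c(6)])
    then have "sub_eq \<Gamma> t' t'' \<Omega>" by (rule convert_sub_eq_cod[OF c(1) _ context_rel_sym[OF r(2)]])
    then have "sub_eq \<Gamma> t t'' \<Omega>" by (rule sub_eq_trans[OF c(1,5) r(3)])
    then show "(a, d) \<in> morphism_rel T" using r s by (auto simp: e e' morphism_rel_iff intro: context_rel_trans)
  qed
qed

lemma cls_eq_iff: "\<lbrakk>ctx \<Gamma>; ctx \<Gamma>'\<rbrakk> \<Longrightarrow> cls \<Gamma> = cls \<Gamma>' \<longleftrightarrow> (\<Gamma>, \<Gamma>') \<in> context_rel T"
  using eq_equiv_class_iff[OF equiv_context_rel] by (simp add: is_context_def)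

lemma cls_eqI: "(\<Gamma>, \<Gamma>') \<in> context_rel T \<Longrightarrow> cls \<Gamma> = cls \<Gamma>'"
  using cls_eq_iff context_rel_ctx by blast

lemma cls_self: "ctx \<Gamma> \<Longrightarrow> \<Gamma> \<in> cls \<Gamma>"
  using context_rel_refl by blast

lemma arrow_eqI:
  "\<lbrakk>(\<Gamma>, \<Gamma>') \<in> context_rel T; (\<Omega>, \<Omega>') \<in> context_rel T; sub_eq \<Gamma> t t' \<Omega>\<rbrakk> \<Longrightarrow> arrow \<Gamma> t \<Omega> = arrow \<Gamma>' t' \<Omega>'"
  by (rule equiv_class_eq[OF equiv_morphism_rel]) (simp add: morphism_rel_iff)

lemma arrow_eq_iff:
  assumes "ctx \<Gamma>" "ctx \<Omega>" "sub \<Gamma> t \<Omega>" "sub \<Gamma> t' \<Omega>"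
  shows "arrow \<Gamma> t \<Omega> = arrow \<Gamma> t' \<Omega> \<longleftrightarrow> sub_eq \<Gamma> t t' \<Omega>"
  using eq_equiv_class_iff[OF equiv_morphism_rel, of "(\<Gamma>, t, \<Omega>)" "(\<Gamma>, t', \<Omega>)"] assms
  by (simp add: raw_iff morphism_rel_iff context_rel_refl)

lemma Obj_iff: "X \<in> Obj \<C> \<longleftrightarrow> (\<exists>\<Gamma>. ctx \<Gamma> \<and> X = cls \<Gamma>)"
  by (auto simp: syntactic_category_def quotient_def is_context_def)

lemma Arr_iff: "a \<in> Arr \<C> \<longleftrightarrow> (\<exists>\<Gamma> t \<Omega>. ctx \<Gamma> \<and> ctx \<Omega> \<and> sub \<Gamma> t \<Omega> \<and> a = arrow \<Gamma> t \<Omega>)"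
  unfolding syntactic_category_def quotient_def by (auto simp: raw_iff) (metis raw_iff prod_cases3)+

lemma arrow_self: "\<lbrakk>ctx \<Gamma>; ctx \<Omega>; sub \<Gamma> t \<Omega>\<rbrakk> \<Longrightarrow> (\<Gamma>, t, \<Omega>) \<in> arrow \<Gamma> t \<Omega>"
  by (simp add: morphism_rel_iff context_rel_refl sub_refl)

lemma
  assumes "ctx \<Gamma>" "ctx \<Omega>" "sub \<Gamma> t \<Omega>"
  shows Dom_arrow: "Dom \<C> (arrow \<Gamma> t \<Omega>) = cls \<Gamma>" and Cod_arrow: "Cod \<C> (arrow \<Gamma> t \<Omega>) = cls \<Omega>"
proof -
  have "cls \<Gamma>' = cls \<Gamma> \<and> cls \<Omega>' = cls \<Omega>" if "(\<Gamma>', t', \<Omega>') \<in> arrow \<Gamma> t \<Omega>" for \<Gamma>' t' \<Omega>'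
    using that cls_eqI[of \<Gamma> \<Gamma>'] cls_eqI[of \<Omega> \<Omega>'] unfolding Image_singleton_iff morphism_rel_iff by simp
  then have *: "(case y of (\<Gamma>', t', \<Omega>') \<Rightarrow> cls \<Gamma>') = cls \<Gamma>" "(case y of (\<Gamma>', t', \<Omega>') \<Rightarrow> cls \<Omega>') = cls \<Omega>"
    if "y \<in> arrow \<Gamma> t \<Omega>" for y
    using that by (cases y; simp)+
  show "Dom \<C> (arrow \<Gamma> t \<Omega>) = cls \<Gamma>"
    unfolding syntactic_category_def cat.simps
    by (rule Union_const[OF arrow_self[OF assms]]) (rule *(1))
  show "Cod \<C> (arrow \<Gamma> t \<Omega>) = cls \<Omega>"
    unfolding syntactic_category_def cat.simps
    by (rule Union_const[OF arrow_self[OF assms]]) (rule *(2))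
qed

lemma arrow_hom: "\<lbrakk>ctx \<Gamma>; ctx \<Omega>; sub \<Gamma> t \<Omega>\<rbrakk> \<Longrightarrow> arrow \<Gamma> t \<Omega> \<in> Hom \<C> (cls \<Gamma>) (cls \<Omega>)"
  unfolding Hom_def using Dom_arrow[of \<Gamma> \<Omega> t] Cod_arrow[of \<Gamma> \<Omega> t] Arr_iff[of "arrow \<Gamma> t \<Omega>"] by blast

text \<open>Representatives of the source and target may be prescribed: conversion retypes the
  underlying sequence of terms without altering it.\<close>

lemma hom_obtain:
  assumes "a \<in> Hom \<C> (cls \<Gamma>) (cls \<Omega>)" "ctx \<Gamma>" "ctx \<Omega>"
  obtains t where "sub \<Gamma> t \<Omega>" "a = arrow \<Gamma> t \<Omega>"
proof -
  obtain \<Gamma>' t \<Omega>' where a: "ctx \<Gamma>'" "ctx \<Omega>'" "sub \<Gamma>' t \<Omega>'" "a = arrow \<Gamma>' t \<Omega>'"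
    using assms(1) unfolding Hom_def Arr_iff by blast
  then have "cls \<Gamma>' = cls \<Gamma>" "cls \<Omega>' = cls \<Omega>"
    using assms(1) Dom_arrow[OF a(1-3)] Cod_arrow[OF a(1-3)] by (auto simp: Hom_def)
  then have r: "(\<Gamma>', \<Gamma>) \<in> context_rel T" "(\<Omega>', \<Omega>) \<in> context_rel T"
    using cls_eq_iff a assms by blast+
  have "sub \<Gamma> t \<Omega>" using convert_sub[OF convert_sub_cod[OF a(1,3) r(2)] r(1) assms(3)] .
  moreover have "a = arrow \<Gamma> t \<Omega>" unfolding a(4) by (rule arrow_eqI[OF r sub_refl[OF a(3)]])
  ultimately show ?thesis by (rule that)
qed

lemma Ide_cls: "ctx \<Gamma> \<Longrightarrow> Ide \<C> (cls \<Gamma>) = arrow \<Gamma> (vars \<Gamma>) \<Gamma>"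
  unfolding syntactic_category_def cat.simps
proof (rule Union_const[OF cls_self])
  fix \<Gamma>' assume "ctx \<Gamma>" "\<Gamma>' \<in> cls \<Gamma>"
  then have r: "(\<Gamma>', \<Gamma>) \<in> context_rel T" by (auto intro: context_rel_sym)
  have "vars \<Gamma> = vars \<Gamma>'" using context_rel_ctx(3)[OF r] vars_cong by metis
  then show "arrow \<Gamma>' (vars \<Gamma>') \<Gamma>' = arrow \<Gamma> (vars \<Gamma>) \<Gamma>"
    using arrow_eqI[OF r r sub_refl[OF vars_sub[OF context_rel_ctx(1)[OF r]]]] by simp
qed

lemma Comp_arrow:
  assumes "ctx \<Gamma>" "ctx \<Omega>" "ctx \<Xi>" and t: "sub \<Gamma> t \<Omega>" and s: "sub \<Omega> s \<Xi>"
  shows "Comp \<C> (arrow \<Omega> s \<Xi>) (arrow \<Gamma> t \<Omega>) = arrow \<Gamma> (subst_seq t s) \<Xi>"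
  unfolding syntactic_category_def cat.simps
proof (rule Union_const[OF arrow_self[OF assms(1,2) t]])
  fix a assume a: "a \<in> arrow \<Gamma> t \<Omega>"
  obtain \<Gamma>' t' \<Omega>' where e: "a = (\<Gamma>', t', \<Omega>')" by (cases a)
  have r: "(\<Gamma>, \<Gamma>') \<in> context_rel T" "(\<Omega>, \<Omega>') \<in> context_rel T" "sub_eq \<Gamma> t t' \<Omega>"
    using a by (auto simp: e morphism_rel_iff)
  show "(case a of (\<Gamma>\<^sub>1, t\<^sub>1, \<Omega>\<^sub>1) \<Rightarrow>
      \<Union>(\<Omega>\<^sub>2, s\<^sub>2, \<Xi>\<^sub>2)\<in>arrow \<Omega> s \<Xi>. arrow \<Gamma>\<^sub>1 (subst_seq t\<^sub>1 s\<^sub>2) \<Xi>\<^sub>2) = arrow \<Gamma> (subst_seq t s) \<Xi>"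
    unfolding e prod.case
  proof (rule Union_const[OF arrow_self[OF assms(2,3) s]])
    fix b assume b: "b \<in> arrow \<Omega> s \<Xi>"
    obtain \<Omega>'' s' \<Xi>' where e': "b = (\<Omega>'', s', \<Xi>')" by (cases b)
    have q: "(\<Omega>, \<Omega>'') \<in> context_rel T" "(\<Xi>, \<Xi>') \<in> context_rel T" "sub_eq \<Omega> s s' \<Xi>"
      using b by (auto simp: e' morphism_rel_iff)
    have "sub_eq \<Gamma> (subst_seq t s) (subst_seq t' s') \<Xi>"
      by (rule sub_eq_comp[OF assms(1) r(3) assms(3) q(3)])
    from arrow_eqI[OF r(1) q(2) this]
    show "(case b of (\<Omega>\<^sub>2, s\<^sub>2, \<Xi>\<^sub>2) \<Rightarrow> arrow \<Gamma>' (subst_seq t' s\<^sub>2) \<Xi>\<^sub>2) = arrow \<Gamma> (subst_seq t s) \<Xi>"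
      by (simp add: e')
  qed
qed

lemma Obj_cls: "ctx \<Gamma> \<Longrightarrow> cls \<Gamma> \<in> Obj \<C>"
  using Obj_iff by blast

lemma Hom_ctx:
  assumes "f \<in> Hom \<C> X Y"
  obtains \<Gamma> \<Omega> where "ctx \<Gamma>" "ctx \<Omega>" "X = cls \<Gamma>" "Y = cls \<Omega>"
proof -
  obtain \<Gamma> t \<Omega> where a: "ctx \<Gamma>" "ctx \<Omega>" "sub \<Gamma> t \<Omega>" "f = arrow \<Gamma> t \<Omega>"
    using assms unfolding Hom_def Arr_iff by blast
  then show ?thesis using that[OF a(1,2)] assms Dom_arrow[OF a(1-3)] Cod_arrow[OF a(1-3)]
    by (auto simp: Hom_def)
qed

lemma syntactic_category: "category \<C>"
proof
  show "Dom \<C> f \<in> Obj \<C>" "Cod \<C> f \<in> Obj \<C>" if "f \<in> Arr \<C>" for f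
    using that Dom_arrow Cod_arrow unfolding Arr_iff by (metis Obj_cls)+
  show "Ide \<C> X \<in> Hom \<C> X X" if "X \<in> Obj \<C>" for X
    using that arrow_hom vars_sub Ide_cls unfolding Obj_iff by metis
next
  fix f g X Y Z assume f: "f \<in> Hom \<C> X Y" and g: "g \<in> Hom \<C> Y Z"
  obtain \<Gamma> \<Omega> where o: "ctx \<Gamma>" "ctx \<Omega>" "X = cls \<Gamma>" "Y = cls \<Omega>" using Hom_ctx[OF f] .
  obtain \<Xi> where o': "ctx \<Xi>" "Z = cls \<Xi>" using Hom_ctx[OF g] by metis
  obtain t where t: "sub \<Gamma> t \<Omega>" "f = arrow \<Gamma> t \<Omega>" using hom_obtain f o by metis
  obtain s where s: "sub \<Omega> s \<Xi>" "g = arrow \<Omega> s \<Xi>" using hom_obtain g o o' by metis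
  show "Comp \<C> g f \<in> Hom \<C> X Z"
    unfolding t s o o' Comp_arrow[OF o(1,2) o'(1) t(1) s(1)]
    by (rule arrow_hom[OF o(1) o'(1) sub_comp[OF o(1) t(1) o'(1) s(1)]])
next
  fix f X Y assume f: "f \<in> Hom \<C> X Y"
  obtain \<Gamma> \<Omega> where o: "ctx \<Gamma>" "ctx \<Omega>" "X = cls \<Gamma>" "Y = cls \<Omega>" using Hom_ctx[OF f] .
  obtain t where t: "sub \<Gamma> t \<Omega>" "f = arrow \<Gamma> t \<Omega>" using hom_obtain f o by metis
  show "Comp \<C> f (Ide \<C> X) = f"
    unfolding t o Ide_cls[OF o(1)] Comp_arrow[OF o(1) o(1) o(2) vars_sub[OF o(1)] t(1)] by simp
  show "Comp \<C> (Ide \<C> Y) f = f"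
    unfolding t o Ide_cls[OF o(2)] Comp_arrow[OF o(1) o(2) o(2) t(1) vars_sub[OF o(2)]]
    using sub_dom[OF t(1)] by (simp add: subst_seq_vars_right)
next
  fix f g h X Y Z W assume f: "f \<in> Hom \<C> X Y" and g: "g \<in> Hom \<C> Y Z" and h: "h \<in> Hom \<C> Z W"
  obtain \<Gamma> \<Omega> where o: "ctx \<Gamma>" "ctx \<Omega>" "X = cls \<Gamma>" "Y = cls \<Omega>" using Hom_ctx[OF f] .
  obtain \<Xi> \<Theta> where o': "ctx \<Xi>" "ctx \<Theta>" "Z = cls \<Xi>" "W = cls \<Theta>" using Hom_ctx[OF h] by metis
  obtain t where t: "sub \<Gamma> t \<Omega>" "f = arrow \<Gamma> t \<Omega>" using hom_obtain f o by metis
  obtain s where s: "sub \<Omega> s \<Xi>" "g = arrow \<Omega> s \<Xi>" using hom_obtain g o o' by metis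
  obtain r where r: "sub \<Xi> r \<Theta>" "h = arrow \<Xi> r \<Theta>" using hom_obtain h o' by metis
  have "subst_seq t (subst_seq s r) = subst_seq (subst_seq t s) r"
    by (rule subst_seq_assoc) (use sub_fv[OF r(1)] sub_dom[OF s(1)] in blast)
  then show "Comp \<C> (Comp \<C> h g) f = Comp \<C> h (Comp \<C> g f)"
    unfolding t s r Comp_arrow[OF o(2) o'(1,2) s(1) r(1)] Comp_arrow[OF o(1,2) o'(1) t(1) s(1)]
      Comp_arrow[OF o(1,2) o'(2) t(1) sub_comp[OF o(2) s(1) o'(2) r(1)]]
      Comp_arrow[OF o(1) o'(1,2) sub_comp[OF o(1) t(1) o'(1) s(1)] r(1)] by simp
qed

lemma display_hom: "ctx \<Gamma>' \<Longrightarrow> display \<Gamma>' \<gamma> \<in> Hom \<C> (cls \<Gamma>') (cls (init_seg \<gamma> \<Gamma>'))"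
  by (rule arrow_hom[OF _ ctx_init display_sub])

lemma display_maps_iff: "p \<in> display_maps T \<longleftrightarrow> (\<exists>\<Gamma>' \<gamma>. ctx \<Gamma>' \<and> \<gamma> \<le> len \<Gamma>' \<and> p = display \<Gamma>' \<gamma>)"
  by (auto simp: display_maps_def is_context_def)

lemma display_mapsI: "\<lbrakk>ctx \<Gamma>'; \<gamma> \<le> len \<Gamma>'\<rbrakk> \<Longrightarrow> display \<Gamma>' \<gamma> \<in> display_maps T"
  using display_maps_iff by blast

lemma display_mapsE:
  assumes "p \<in> display_maps T"
  obtains \<Gamma>' \<gamma> where "ctx \<Gamma>'" "\<gamma> \<le> len \<Gamma>'" "p = display \<Gamma>' \<gamma>"
  using assms display_maps_iff by blast

lemma ObjE:
  assumes "X \<in> Obj \<C>"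
  obtains \<Gamma> where "ctx \<Gamma>" "X = cls \<Gamma>"
  using assms Obj_iff by blast

text \<open>In the quotient, equality of arrows is derivable equality of sequences. A commuting cone
  thus supplies exactly the hypothesis under which the mediating substitution was constructed, and
  uniqueness up to derivable equality becomes uniqueness.\<close>

lemma canonical_pullback:
  assumes G': "ctx \<Gamma>'" and le: "\<gamma> \<le> len \<Gamma>'" and D: "ctx \<Delta>" and t: "sub \<Delta> t (init_seg \<gamma> \<Gamma>')"
  defines "P \<equiv> pullback_ctx \<Delta> t (tail_seg \<gamma> \<Gamma>')" and "L \<equiv> lift (len \<Delta>) t (tail_seg \<gamma> \<Gamma>')"
  shows "pullback_square \<C> (display \<Gamma>' \<gamma>) (arrow \<Delta> t (init_seg \<gamma> \<Gamma>')) (display P (len \<Delta>)) (arrow P L \<Gamma>')"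
proof -
  note X = G' le D t
  interpret category \<C> by (rule syntactic_category)
  have P: "ctx P" and L: "sub P L \<Gamma>'" and i: "init_seg (len \<Delta>) P = \<Delta>" and d: "sub P (vars \<Delta>) \<Delta>"
    using pullback_ctx[OF X] lift_sub[OF X] init_pullback[OF X] display_pullback_sub[OF X]
    by (simp_all add: P_def L_def)
  have G: "ctx (init_seg \<gamma> \<Gamma>')" and dG: "sub \<Gamma>' (vars (init_seg \<gamma> \<Gamma>')) (init_seg \<gamma> \<Gamma>')"
    using ctx_init[OF G'] display_sub[OF G'] by blast+
  have dv: "subst_seq w (vars (init_seg \<gamma> \<Gamma>')) = init_seg \<gamma> w" if "dom w = dom \<Gamma>'" for w :: "'k \<rightharpoonup> ('s, 'k) expr"
    using subst_seq_vars_right[OF that] init_subst_seq[of \<gamma> w "vars \<Gamma>'"] by (simp add: init_vars)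
  have dw: "subst_seq w (vars \<Delta>) = init_seg (len \<Delta>) w" if "dom w = dom P" for w :: "'k \<rightharpoonup> ('s, 'k) expr"
    using subst_seq_vars_right[OF that] init_subst_seq[of "len \<Delta>" w "vars P"] i by (simp add: init_vars)
  show ?thesis unfolding i
  proof (rule pullback_squareI[OF display_hom[OF G'] arrow_hom[OF D G t] arrow_hom[OF P D d] arrow_hom[OF P G' L]])
    show "Comp \<C> (arrow \<Delta> t (init_seg \<gamma> \<Gamma>')) (arrow P (vars \<Delta>) \<Delta>) =
        Comp \<C> (display \<Gamma>' \<gamma>) (arrow P L \<Gamma>')"
      unfolding Comp_arrow[OF P D G d t] Comp_arrow[OF P G' G L dG]
      using dv[OF sub_dom[OF L]] init_lift[OF X] by (simp add: L_def)
  next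
    fix W u v assume W: "W \<in> Obj \<C>" and u: "u \<in> Hom \<C> W (cls \<Delta>)" and v: "v \<in> Hom \<C> W (cls \<Gamma>')"
      and e: "Comp \<C> (arrow \<Delta> t (init_seg \<gamma> \<Gamma>')) u = Comp \<C> (display \<Gamma>' \<gamma>) v"
    obtain \<Theta> where Th: "ctx \<Theta>" "W = cls \<Theta>" using W Obj_iff by blast
    obtain u' where u': "sub \<Theta> u' \<Delta>" "u = arrow \<Theta> u' \<Delta>" using hom_obtain u Th D by metis
    obtain v' where v': "sub \<Theta> v' \<Gamma>'" "v = arrow \<Theta> v' \<Gamma>'" using hom_obtain v Th G' by metis
    have tu: "sub \<Theta> (subst_seq u' t) (init_seg \<gamma> \<Gamma>')" by (rule sub_comp[OF Th(1) u'(1) G t])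
    have "arrow \<Theta> (subst_seq u' t) (init_seg \<gamma> \<Gamma>') = arrow \<Theta> (init_seg \<gamma> v') (init_seg \<gamma> \<Gamma>')"
      using e unfolding u' v' Comp_arrow[OF Th(1) D G u'(1) t] Comp_arrow[OF Th(1) G' G v'(1) dG]
      using dv[OF sub_dom[OF v'(1)]] by simp
    then have eq: "sub_eq \<Theta> (subst_seq u' t) (init_seg \<gamma> v') (init_seg \<gamma> \<Gamma>')"
      using arrow_eq_iff[OF Th(1) G tu sub_init[OF v'(1)]] by simp
    note M = X Th(1) u'(1) v'(1) eq
    let ?m = "mediating \<Delta> \<gamma> u' v'"
    have m: "sub \<Theta> ?m P" using mediating_sub[OF M] by (simp add: P_def)
    show "\<exists>h. h \<in> Hom \<C> W (cls P) \<and> Comp \<C> (arrow P (vars \<Delta>) \<Delta>) h = u \<and> Comp \<C> (arrow P L \<Gamma>') h = v"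
    proof (intro exI conjI)
      show "arrow \<Theta> ?m P \<in> Hom \<C> W (cls P)" unfolding Th(2) by (rule arrow_hom[OF Th(1) P m])
      show "Comp \<C> (arrow P (vars \<Delta>) \<Delta>) (arrow \<Theta> ?m P) = u"
        unfolding Comp_arrow[OF Th(1) P D m d] u' using dw[OF sub_dom[OF m]] mediating_init[OF M] by simp
      have "sub_eq \<Theta> (subst_seq ?m L) v' \<Gamma>'"
        using sub_eq_sym[OF Th(1) G' mediating_lift_eq[OF M]] by (simp add: L_def)
      then show "Comp \<C> (arrow P L \<Gamma>') (arrow \<Theta> ?m P) = v"
        unfolding Comp_arrow[OF Th(1) P G' m L] v'
        using arrow_eq_iff[OF Th(1) G' sub_comp[OF Th(1) m G' L] v'(1)] by simp
    qed
  next
    fix W h h' assume h: "h \<in> Hom \<C> W (cls P)" "h' \<in> Hom \<C> W (cls P)"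
      and e1: "Comp \<C> (arrow P (vars \<Delta>) \<Delta>) h = Comp \<C> (arrow P (vars \<Delta>) \<Delta>) h'"
      and e2: "Comp \<C> (arrow P L \<Gamma>') h = Comp \<C> (arrow P L \<Gamma>') h'"
    obtain \<Theta> where Th: "ctx \<Theta>" "W = cls \<Theta>" using Hom_ctx[OF h(1)] by metis
    obtain k where k: "sub \<Theta> k P" "h = arrow \<Theta> k P" using hom_obtain h(1) Th P by metis
    obtain k' where k': "sub \<Theta> k' P" "h' = arrow \<Theta> k' P" using hom_obtain h(2) Th P by metis
    \<comment> \<open>For uniqueness, \<open>k\<close> and \<open>k'\<close> are both compared with
      the substitution that mediates the two projections of \<open>k'\<close>. For that cone the
      square commutes even literally.\<close>
    let ?u = "init_seg (len \<Delta>) k'" and ?v = "subst_seq k' L"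
    have u: "sub \<Theta> ?u \<Delta>" using sub_init[OF k'(1), of "len \<Delta>"] i by simp
    have u2: "sub \<Theta> (init_seg (len \<Delta>) k) \<Delta>" using sub_init[OF k(1), of "len \<Delta>"] i by simp
    have v: "sub \<Theta> ?v \<Gamma>'" by (rule sub_comp[OF Th(1) k'(1) G' L])
    have v2: "sub \<Theta> (subst_seq k L) \<Gamma>'" by (rule sub_comp[OF Th(1) k(1) G' L])
    have tu: "subst_seq ?u t = init_seg \<gamma> ?v"
    proof -
      have "subst_seq k' t = subst_seq ?u t"
      proof (rule ext)
        fix \<alpha>
        have "subst k' w = subst ?u w" if "t \<alpha> = Some w" for w
          using sub_fv[OF t that] seq_mem[OF ctx_seq[OF D]] by (intro subst_cong) (auto simp: init_seg_apply)
        then show "subst_seq k' t \<alpha> = subst_seq ?u t \<alpha>" by (cases "t \<alpha>") auto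
      qed
      moreover have "init_seg \<gamma> ?v = subst_seq k' t"
        using init_lift[OF X] by (simp add: init_subst_seq L_def)
      ultimately show ?thesis by simp
    qed
    have eq: "sub_eq \<Theta> (subst_seq ?u t) (init_seg \<gamma> ?v) (init_seg \<gamma> \<Gamma>')"
      unfolding tu by (rule sub_refl[OF sub_init[OF v]])
    note M = X Th(1) u v eq
    have hu: "sub_eq \<Theta> (init_seg (len \<Delta>) k) ?u \<Delta>"
      using e1 unfolding k k' Comp_arrow[OF Th(1) P D k(1) d] Comp_arrow[OF Th(1) P D k'(1) d]
        dw[OF sub_dom[OF k(1)]] dw[OF sub_dom[OF k'(1)]] arrow_eq_iff[OF Th(1) D u2 u] .
    have hv: "sub_eq \<Theta> (subst_seq k L) ?v \<Gamma>'"
      using e2 unfolding k k' Comp_arrow[OF Th(1) P G' k(1) L] Comp_arrow[OF Th(1) P G' k'(1) L]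
        arrow_eq_iff[OF Th(1) G' v2 v] .
    have a: "sub_eq \<Theta> k (mediating \<Delta> \<gamma> ?u ?v) P"
      using mediating_unique[OF M, of k] k(1) hu hv by (simp add: P_def L_def)
    have b: "sub_eq \<Theta> k' (mediating \<Delta> \<gamma> ?u ?v) P"
      using mediating_unique[OF M, of k'] k'(1) sub_refl[OF u] sub_refl[OF v] by (simp add: P_def L_def)
    have "sub_eq \<Theta> k k' P"
      by (rule sub_eq_trans[OF Th(1) P a sub_eq_sym[OF Th(1) P b]])
    then show "h = h'" unfolding k k' using arrow_eq_iff[OF Th(1) P k(1) k'(1)] by simp
  qed
qed

text \<open>The middle object is given by two derivably equal contexts. Retyping the second
  projection over the first of them turns the composite into a single truncation of
  \<open>\<Gamma>\<close>.\<close>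

lemma display_comp:
  assumes G: "ctx \<Gamma>" and le: "\<beta> \<le> len \<Gamma>" and G2: "ctx \<Gamma>\<^sub>2" and le2: "\<gamma> \<le> len \<Gamma>\<^sub>2"
    and r: "(init_seg \<beta> \<Gamma>, \<Gamma>\<^sub>2) \<in> context_rel T"
  shows "Comp \<C> (display \<Gamma>\<^sub>2 \<gamma>) (display \<Gamma> \<beta>) = display \<Gamma> \<gamma>" and "\<gamma> \<le> len \<Gamma>"
proof -
  have b: "len \<Gamma>\<^sub>2 = \<beta>" using context_rel_ctx(4)[OF r] len_init[OF ctx_seq[OF G] le] by simp
  then show "\<gamma> \<le> len \<Gamma>" using le le2 by simp
  have r2: "(init_seg \<gamma> \<Gamma>, init_seg \<gamma> \<Gamma>\<^sub>2) \<in> context_rel T"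
    using context_rel_init[OF r, of \<gamma>] le2 b by (simp add: init_init_le)
  have v: "vars (init_seg \<gamma> \<Gamma>\<^sub>2) = vars (init_seg \<gamma> \<Gamma>)"
    using vars_cong context_rel_ctx(3)[OF r2] by metis
  have s: "sub \<Gamma>\<^sub>2 (vars (init_seg \<gamma> \<Gamma>\<^sub>2)) (init_seg \<gamma> \<Gamma>\<^sub>2)" by (rule display_sub[OF G2])
  have s': "sub (init_seg \<beta> \<Gamma>) (vars (init_seg \<gamma> \<Gamma>\<^sub>2)) (init_seg \<gamma> \<Gamma>\<^sub>2)"
    by (rule convert_sub[OF s context_rel_sym[OF r] ctx_init[OF G2]])
  have "display \<Gamma>\<^sub>2 \<gamma> = arrow (init_seg \<beta> \<Gamma>) (vars (init_seg \<gamma> \<Gamma>\<^sub>2)) (init_seg \<gamma> \<Gamma>\<^sub>2)"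
    by (rule arrow_eqI[OF context_rel_sym[OF r] context_rel_refl[OF ctx_init[OF G2]] sub_refl[OF s]])
  then have "Comp \<C> (display \<Gamma>\<^sub>2 \<gamma>) (display \<Gamma> \<beta>) = arrow \<Gamma> (vars (init_seg \<gamma> \<Gamma>)) (init_seg \<gamma> \<Gamma>\<^sub>2)"
    using Comp_arrow[OF G ctx_init[OF G] ctx_init[OF G2] display_sub[OF G] s'] v by simp
  also have "\<dots> = display \<Gamma> \<gamma>"
    by (rule arrow_eqI[OF context_rel_refl[OF G] context_rel_sym[OF r2]])
      (use sub_refl[OF display_sub[OF G]] convert_sub_eq_cod[OF G _ r2] in blast)
  finally show "Comp \<C> (display \<Gamma>\<^sub>2 \<gamma>) (display \<Gamma> \<beta>) = display \<Gamma> \<gamma>" .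
qed

lemma ctx_empty: "ctx Map.empty"
proof -
  have "is_seq (Map.empty :: 'k \<rightharpoonup> ('s, 'k) expr)"
    \<comment> \<open>\<open>LEAST x. True\<close> is the ordinal zero, whose set of predecessors is
      the empty domain.\<close>
    using not_less_Least[of _ "\<lambda>_. True"] by (intro is_seqI[of _ "LEAST x. True"]) auto
  then show ?thesis by (simp add: context_wrt_def)
qed

lemma display_category: "display_category \<C> (display_maps T)"
proof -
  interpret category \<C> by (rule syntactic_category)
  show ?thesis
  proof
    show "display_maps T \<subseteq> Arr \<C>"
    proof
      fix p assume "p \<in> display_maps T"
      then obtain \<Gamma> \<gamma> where "ctx \<Gamma>" "p = display \<Gamma> \<gamma>" by (rule display_mapsE)
      then show "p \<in> Arr \<C>" using HomD(1)[OF display_hom] by simp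
    qed
    show "Ide \<C> X \<in> display_maps T" if X: "X \<in> Obj \<C>" for X
    proof -
      obtain \<Gamma> where G: "ctx \<Gamma>" "X = cls \<Gamma>" by (rule ObjE[OF X])
      then have "Ide \<C> X = display \<Gamma> (len \<Gamma>)"
        using Ide_cls[of \<Gamma>] init_all[OF ctx_seq, of \<Gamma> "len \<Gamma>"] by simp
      then show ?thesis using display_mapsI[OF G(1)] by simp
    qed
  next
    fix f g assume f: "f \<in> display_maps T" and g: "g \<in> display_maps T" and c: "Cod \<C> f = Dom \<C> g"
    obtain \<Gamma> \<beta> where F: "ctx \<Gamma>" "\<beta> \<le> len \<Gamma>" "f = display \<Gamma> \<beta>" using f by (rule display_mapsE)
    obtain \<Gamma>\<^sub>2 \<gamma> where G: "ctx \<Gamma>\<^sub>2" "\<gamma> \<le> len \<Gamma>\<^sub>2" "g = display \<Gamma>\<^sub>2 \<gamma>" using g by (rule display_mapsE)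
    have "cls (init_seg \<beta> \<Gamma>) = cls \<Gamma>\<^sub>2"
      using c HomD(3)[OF display_hom[OF F(1)]] HomD(2)[OF display_hom[OF G(1)]] F(3) G(3) by simp
    then have "(init_seg \<beta> \<Gamma>, \<Gamma>\<^sub>2) \<in> context_rel T" using cls_eq_iff ctx_init F(1) G(1) by blast
    from display_comp[OF F(1,2) G(1,2) this] show "Comp \<C> g f \<in> display_maps T"
      using display_mapsI[OF F(1)] F(3) G(3) by simp
  next
    fix p f assume p: "p \<in> display_maps T" and f: "f \<in> Arr \<C>" and c: "Cod \<C> f = Cod \<C> p"
    obtain \<Gamma>' \<gamma> where P: "ctx \<Gamma>'" "\<gamma> \<le> len \<Gamma>'" "p = display \<Gamma>' \<gamma>" using p by (rule display_mapsE)
    have "Cod \<C> f = cls (init_seg \<gamma> \<Gamma>')" using c HomD(3)[OF display_hom[OF P(1)]] P(3) by simp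
    then obtain \<Delta> where D: "ctx \<Delta>" "f \<in> Hom \<C> (cls \<Delta>) (cls (init_seg \<gamma> \<Gamma>'))"
      using arr_hom[OF f] Hom_ctx by metis
    obtain t where t: "sub \<Delta> t (init_seg \<gamma> \<Gamma>')" "f = arrow \<Delta> t (init_seg \<gamma> \<Gamma>')"
      using hom_obtain[OF D(2,1) ctx_init[OF P(1)]] .
    show "\<exists>p'\<in>display_maps T. \<exists>f'. pullback_square \<C> p f p' f'"
      using canonical_pullback[OF P(1,2) D(1) t(1)]
        display_mapsI[OF pullback_ctx[OF P(1,2) D(1) t(1)] len_le_pullback[OF P(1,2) D(1) t(1)]]
      unfolding P(3) t(2) by (rule_tac bexI, rule_tac exI)
  next
    let ?E = "Map.empty :: ('s, 'k) premise"
    have e: "init_seg (len ?E) \<Gamma> = ?E" for \<Gamma> :: "('s, 'k) premise"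
      using seq_mem[OF ctx_seq[OF ctx_empty]] by (auto simp: init_seg_apply fun_eq_iff)
    have v: "vars ?E = Map.empty" by (simp add: vars_def)
    have s: "sub \<Gamma> t ?E \<longleftrightarrow> t = Map.empty" for \<Gamma> t by (auto simp: terms_wrt_def)
    show "\<exists>X. is_terminal \<C> X \<and> (\<forall>f\<in>Arr \<C>. Cod \<C> f = X \<longrightarrow> f \<in> display_maps T)"
    proof (intro exI conjI ballI impI)
      show "is_terminal \<C> (cls ?E)"
        unfolding is_terminal_def
      proof (intro conjI ballI)
        show "cls ?E \<in> Obj \<C>" by (rule Obj_cls[OF ctx_empty])
        fix Y assume "Y \<in> Obj \<C>"
        then obtain \<Gamma> where G: "ctx \<Gamma>" "Y = cls \<Gamma>" by (rule ObjE)
        show "\<exists>!f. f \<in> Hom \<C> Y (cls ?E)"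
        proof (rule ex1I)
          show "arrow \<Gamma> Map.empty ?E \<in> Hom \<C> Y (cls ?E)"
            unfolding G(2) by (rule arrow_hom[OF G(1) ctx_empty]) (simp add: s)
          fix f assume f: "f \<in> Hom \<C> Y (cls ?E)"
          obtain t where "sub \<Gamma> t ?E" "f = arrow \<Gamma> t ?E"
            using hom_obtain[OF f[unfolded G(2)] G(1) ctx_empty] .
          then show "f = arrow \<Gamma> Map.empty ?E" by (simp add: s)
        qed
      qed
      \<comment> \<open>An arrow into the empty context is the display map that forgets all
        variables, whence the cut at length zero.\<close>
      fix f assume f: "f \<in> Arr \<C>" "Cod \<C> f = cls ?E"
      then have h: "f \<in> Hom \<C> (Dom \<C> f) (cls ?E)" using arr_hom[OF f(1)] by simp
      obtain \<Gamma> where G: "ctx \<Gamma>" "Dom \<C> f = cls \<Gamma>" using Hom_ctx[OF h] .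
      then have G: "ctx \<Gamma>" "f \<in> Hom \<C> (cls \<Gamma>) (cls ?E)" using h by simp_all
      obtain t where "sub \<Gamma> t ?E" "f = arrow \<Gamma> t ?E" using hom_obtain[OF G(2,1) ctx_empty] .
      then have "f = arrow \<Gamma> Map.empty ?E" by (simp add: s)
      then have "f = display \<Gamma> (len ?E)" by (simp add: e v)
      moreover have "len ?E \<le> len \<Gamma>" unfolding len_def by (rule Least_le) simp
      ultimately show "f \<in> display_maps T" using display_mapsI[OF G(1)] by simp
    qed
  qed
qed

lemma syntactic_fibrations_eq: "syntactic_fibrations T = iso_closure \<C> (display_maps T)"
  by (simp add: syntactic_fibrations_def iso_closure_def Let_def)

lemma display_fibration: "\<lbrakk>ctx \<Gamma>'; \<gamma> \<le> len \<Gamma>'\<rbrakk> \<Longrightarrow> display \<Gamma>' \<gamma> \<in> syntactic_fibrations T"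
  unfolding syntactic_fibrations_eq
  by (rule subsetD[OF display_category.D_closure[OF display_category] display_mapsI])

end

section \<open>Substitution in formulas\<close>

context regular_theory
begin

text \<open>\<open>fsubst\<close> sees neither context, only a length and a lift. For a genuine
  substitution the binder it produces is the tail of the canonical pullback, and the length it
  passes on is that of the whole pullback context.\<close>

lemma fsubst_quantifier:
  assumes "ctx \<Gamma>'" "\<gamma> \<le> len \<Gamma>'" "ctx \<Delta>" "sub \<Delta> t (init_seg \<gamma> \<Gamma>')"
  shows "fsubst (FEx (tail_seg \<gamma> \<Gamma>') \<Phi>) (len \<Delta>) t =
      FEx (tail_seg (len \<Delta>) (pullback_ctx \<Delta> t (tail_seg \<gamma> \<Gamma>')))
        (fsubst \<Phi> (len (pullback_ctx \<Delta> t (tail_seg \<gamma> \<Gamma>'))) (lift (len \<Delta>) t (tail_seg \<gamma> \<Gamma>')))"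
    and "fsubst (FAll (tail_seg \<gamma> \<Gamma>') \<Phi>) (len \<Delta>) t =
      FAll (tail_seg (len \<Delta>) (pullback_ctx \<Delta> t (tail_seg \<gamma> \<Gamma>')))
        (fsubst \<Phi> (len (pullback_ctx \<Delta> t (tail_seg \<gamma> \<Gamma>'))) (lift (len \<Delta>) t (tail_seg \<gamma> \<Gamma>')))"
  using sub_len[OF assms(1,2,4)] len_lift[OF assms] len_pullback[OF assms] tail_pullback[OF assms]
  by simp_all

text \<open>Pulling back along an identity returns the context itself, not merely an isomorphic one,
  because \<open>shift\<close> from an ordinal to itself does nothing.\<close>

lemma lift_vars:
  assumes G': "ctx \<Gamma>'" and le: "\<gamma> \<le> len \<Gamma>'"
  shows "lift \<gamma> (vars (init_seg \<gamma> \<Gamma>')) (tail_seg \<gamma> \<Gamma>') = vars \<Gamma>'"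
    and "pullback_ctx (init_seg \<gamma> \<Gamma>') (vars (init_seg \<gamma> \<Gamma>')) (tail_seg \<gamma> \<Gamma>') = \<Gamma>'"
proof -
  have l: "len (init_seg \<gamma> \<Gamma>') = \<gamma>" by (rule len_init[OF ctx_seq[OF G'] le])
  note X = G' le ctx_init[OF G'] vars_sub[OF ctx_init[OF G']]
  show L: "lift \<gamma> (vars (init_seg \<gamma> \<Gamma>')) (tail_seg \<gamma> \<Gamma>') = vars \<Gamma>'"
  proof (rule ext)
    fix \<beta>
    show "lift \<gamma> (vars (init_seg \<gamma> \<Gamma>')) (tail_seg \<gamma> \<Gamma>') \<beta> = vars \<Gamma>' \<beta>"
    proof (cases "\<beta> < \<gamma>")
      case True
      then show ?thesis using lift_left[OF X True] unfolding l by (simp add: vars_def dom_init_seg)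
    next
      case False
      then show ?thesis using lift_right[OF X, of \<beta>] shift_rules(3)[of \<gamma> \<beta>]
        unfolding l by (simp add: vars_def not_less)
    qed
  qed
  show "pullback_ctx (init_seg \<gamma> \<Gamma>') (vars (init_seg \<gamma> \<Gamma>')) (tail_seg \<gamma> \<Gamma>') = \<Gamma>'" (is "?P = _")
  proof (rule ext)
    fix \<beta>
    show "?P \<beta> = \<Gamma>' \<beta>"
    proof (cases "\<beta> < \<gamma>")
      case True
      then show ?thesis using pullback_left[OF X, of \<beta>] unfolding l by (simp add: init_seg_apply)
    next
      case False
      then show ?thesis using pullback_right[OF X, of \<beta>] shift_rules(3)[of \<gamma> \<beta>]
        unfolding l L by (simp add: not_less option.map_ident_strong)
    qed
  qed
qed

text \<open>Canonical pullbacks compose on the nose: positions by \<open>shift_shift\<close>, types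
  by \<open>subst_subst\<close>. Hence substitution in formulas is strictly functorial.\<close>

lemma pullback_pullback:
  assumes X: "ctx \<Gamma>'" "\<gamma> \<le> len \<Gamma>'" "ctx \<Delta>" "sub \<Delta> t (init_seg \<gamma> \<Gamma>')"
    and Th: "ctx \<Theta>" and s: "sub \<Theta> s \<Delta>"
  defines "E \<equiv> tail_seg \<gamma> \<Gamma>'"
  defines "P \<equiv> pullback_ctx \<Delta> t E" and "L \<equiv> lift (len \<Delta>) t E"
  shows "lift (len \<Theta>) (subst_seq s t) E = subst_seq (lift (len \<Theta>) s (tail_seg (len \<Delta>) P)) L" (is "?M' = subst_seq ?M L")
    and "pullback_ctx \<Theta> (subst_seq s t) E = pullback_ctx \<Theta> s (tail_seg (len \<Delta>) P)" (is "?Q' = ?Q")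
proof -
  note D = X(3)
  have G: "ctx (init_seg \<gamma> \<Gamma>')" by (rule ctx_init[OF X(1)])
  have P: "ctx P" "len \<Delta> \<le> len P" "init_seg (len \<Delta>) P = \<Delta>"
    using pullback_ctx[OF X] len_le_pullback[OF X] init_pullback[OF X] by (simp_all add: P_def E_def)
  have Y: "ctx P" "len \<Delta> \<le> len P" "ctx \<Theta>" "sub \<Theta> s (init_seg (len \<Delta>) P)"
    using P Th s by simp_all
  have Z: "ctx \<Gamma>'" "\<gamma> \<le> len \<Gamma>'" "ctx \<Theta>" "sub \<Theta> (subst_seq s t) (init_seg \<gamma> \<Gamma>')"
    using X Th sub_comp[OF Th s G X(4)] by simp_all
  show L: "?M' = subst_seq ?M L"
  proof (rule ext)
    fix \<beta>
    show "?M' \<beta> = subst_seq ?M L \<beta>"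
    proof (cases "\<beta> < \<gamma>")
      case True
      have "subst ?M w = subst s w" if "t \<beta> = Some w" for w
        using sub_fv[OF X(4) that] seq_mem[OF ctx_seq[OF D]] lift_left[OF Y] by (intro subst_cong) auto
      then show ?thesis using lift_left[OF Z True] lift_left[OF X True]
        by (cases "t \<beta>") (simp_all add: E_def L_def)
    next
      case False
      then have b: "\<gamma> \<le> \<beta>" by simp
      have g: "len \<Delta> \<le> shift \<gamma> (len \<Delta>) \<beta>" by (rule shift_rules(1)[OF b])
      \<comment> \<open>The second lift is evaluated at the renumbered position, so it matters that
        this position is declared in \<open>P\<close> exactly when \<open>\<beta>\<close> is
        declared in the original context.\<close>
      have d: "shift \<gamma> (len \<Delta>) \<beta> \<in> dom P \<longleftrightarrow> \<beta> \<in> dom \<Gamma>'"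
        using pullback_right[OF X b] by (simp add: domIff P_def E_def)
      show ?thesis
        using lift_right[OF Z b] lift_right[OF X b] lift_right[OF Y g] d shift_shift[OF regular b]
        by (simp add: E_def L_def P_def del: domIff)
    qed
  qed
  show "?Q' = ?Q"
  proof (rule ext)
    fix \<epsilon>
    show "?Q' \<epsilon> = ?Q \<epsilon>"
    proof (cases "\<epsilon> < len \<Theta>")
      case True
      then show ?thesis using pullback_left[OF Z] pullback_left[OF Y] by (simp add: E_def)
    next
      case False
      obtain \<beta> where b: "\<gamma> \<le> \<beta>" "\<epsilon> = shift \<gamma> (len \<Theta>) \<beta>" using above_len_shift[OF Z False] by blast
      have g: "len \<Delta> \<le> shift \<gamma> (len \<Delta>) \<beta>" by (rule shift_rules(1)[OF b(1)])
      have "?Q' \<epsilon> = map_option (subst ?M') (\<Gamma>' \<beta>)"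
        unfolding b(2) using pullback_right[OF Z b(1)] by (simp add: E_def)
      moreover have "?Q \<epsilon> = map_option (subst ?M) (map_option (subst L) (\<Gamma>' \<beta>))"
        using pullback_right[OF Y g] pullback_right[OF X b(1)] shift_shift[OF regular b(1)]
        unfolding b(2) by (simp add: E_def P_def L_def)
      moreover have "subst ?M (subst L A) = subst ?M' A" if "\<Gamma>' \<beta> = Some A" for A
        unfolding L using ctx_fv[OF X(1) that] dom_lift[OF X]
        by (intro subst_subst) (auto simp: L_def E_def)
      ultimately show ?thesis by (cases "\<Gamma>' \<beta>") simp_all
    qed
  qed
qed

end

section \<open>Well-formed formulas and provability under change of context\<close>

locale formula_theory = regular_theory T for T :: "('s, 'k::wellorder) pretheory" +
  fixes l :: "'l rel"
  assumes regular_l: "regular_cardinal l"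
begin

abbreviation "form \<equiv> formula T l"
abbreviation "prov \<equiv> provable T l"

lemma is_context_iff: "is_context T \<Gamma> \<longleftrightarrow> ctx \<Gamma>"
  by (simp add: is_context_def)

lemma finite_less_l: "finite A \<Longrightarrow> |A| <o l"
proof (rule ordLess_ordLeq_trans)
  show "|A| <o natLeq" if "finite A" using that unfolding finite_iff_ordLess_natLeq .
  show "natLeq \<le>o l"
    by (rule natLeq_ordLeq_cinfinite) (use regular_l in \<open>simp add: regular_cardinal_def\<close>)
qed

lemma form_ctx: "form \<Gamma> \<Phi> \<Longrightarrow> ctx \<Gamma>"
  by (induction rule: formula.induct) (simp_all add: is_context_iff ctx_init)

lemma form_exI: "\<lbrakk>ctx \<Gamma>'; \<gamma> < len \<Gamma>'; form \<Gamma>' \<Phi>\<rbrakk> \<Longrightarrow> form (init_seg \<gamma> \<Gamma>') (FEx (tail_seg \<gamma> \<Gamma>') \<Phi>)"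
  and form_allI: "\<lbrakk>ctx \<Gamma>'; \<gamma> < len \<Gamma>'; form \<Gamma>' \<Phi>\<rbrakk> \<Longrightarrow> form (init_seg \<gamma> \<Gamma>') (FAll (tail_seg \<gamma> \<Gamma>') \<Phi>)"
  unfolding is_context_iff[symmetric] by (rule formula.ex, assumption+) (rule formula.all)

lemma fsubst_vars: "form \<Gamma> \<Phi> \<Longrightarrow> fsubst \<Phi> (len \<Gamma>) (vars \<Gamma>) = \<Phi>"
proof (induction rule: formula.induct)
  case (disj \<Gamma> \<Phi>)
  then show ?case by (auto simp: fun_eq_iff intro!: option.map_ident_strong)
next
  case (conj \<Gamma> \<Phi>)
  then show ?case by (auto simp: fun_eq_iff intro!: option.map_ident_strong)
next
  case (ex \<Gamma>' \<gamma> \<Phi>)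
  then have G: "ctx \<Gamma>'" "\<gamma> \<le> len \<Gamma>'" by (auto simp: is_context_iff)
  note X = G ctx_init[OF G(1)] vars_sub[OF ctx_init[OF G(1)]]
  have l: "len (init_seg \<gamma> \<Gamma>') = \<gamma>" by (rule len_init[OF ctx_seq[OF G(1)] G(2)])
  show ?case unfolding fsubst_quantifier(1)[OF X] unfolding l lift_vars[OF G] ex.IH by (rule refl)
next
  case (all \<Gamma>' \<gamma> \<Phi>)
  then have G: "ctx \<Gamma>'" "\<gamma> \<le> len \<Gamma>'" by (auto simp: is_context_iff)
  note X = G ctx_init[OF G(1)] vars_sub[OF ctx_init[OF G(1)]]
  have l: "len (init_seg \<gamma> \<Gamma>') = \<gamma>" by (rule len_init[OF ctx_seq[OF G(1)] G(2)])
  show ?case unfolding fsubst_quantifier(2)[OF X] unfolding l lift_vars[OF G] all.IH by (rule refl)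
qed simp_all

lemma fsubst_fsubst:
  "\<lbrakk>form \<Gamma> \<Phi>; ctx \<Delta>; sub \<Delta> t \<Gamma>; ctx \<Theta>; sub \<Theta> s \<Delta>\<rbrakk> \<Longrightarrow>
    fsubst (fsubst \<Phi> (len \<Delta>) t) (len \<Theta>) s = fsubst \<Phi> (len \<Theta>) (subst_seq s t)"
proof (induction arbitrary: \<Delta> \<Theta> t s rule: formula.induct)
  case (disj \<Gamma> \<Phi>)
  then show ?case
    by (auto simp: fun_eq_iff option.map_comp intro!: option.map_cong[OF refl])
next
  case (conj \<Gamma> \<Phi>)
  then show ?case
    by (auto simp: fun_eq_iff option.map_comp intro!: option.map_cong[OF refl])
next
  case (ex \<Gamma>' \<gamma> \<Phi>)
  then have X: "ctx \<Gamma>'" "\<gamma> \<le> len \<Gamma>'" "ctx \<Delta>" "sub \<Delta> t (init_seg \<gamma> \<Gamma>')" by (auto simp: is_context_iff)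
  let ?P = "pullback_ctx \<Delta> t (tail_seg \<gamma> \<Gamma>')" and ?L = "lift (len \<Delta>) t (tail_seg \<gamma> \<Gamma>')"
  have Y: "ctx ?P" "len \<Delta> \<le> len ?P" "ctx \<Theta>" "sub \<Theta> s (init_seg (len \<Delta>) ?P)"
    using ex.prems pullback_ctx[OF X] len_le_pullback[OF X] init_pullback[OF X] by simp_all
  have Z: "ctx \<Gamma>'" "\<gamma> \<le> len \<Gamma>'" "ctx \<Theta>" "sub \<Theta> (subst_seq s t) (init_seg \<gamma> \<Gamma>')"
    using X ex.prems sub_comp[OF Y(3) _ ctx_init[OF X(1)] X(4), of s] by simp_all
  note pp = pullback_pullback[OF X ex.prems(3,4)]
  show ?case
    unfolding fsubst_quantifier[OF X] fsubst_quantifier[OF Y] fsubst_quantifier[OF Z] pp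
      ex.IH[OF pullback_ctx[OF X] lift_sub[OF X] pullback_ctx[OF Y] lift_sub[OF Y]] by (rule refl)
next
  case (all \<Gamma>' \<gamma> \<Phi>)
  then have X: "ctx \<Gamma>'" "\<gamma> \<le> len \<Gamma>'" "ctx \<Delta>" "sub \<Delta> t (init_seg \<gamma> \<Gamma>')" by (auto simp: is_context_iff)
  let ?P = "pullback_ctx \<Delta> t (tail_seg \<gamma> \<Gamma>')" and ?L = "lift (len \<Delta>) t (tail_seg \<gamma> \<Gamma>')"
  have Y: "ctx ?P" "len \<Delta> \<le> len ?P" "ctx \<Theta>" "sub \<Theta> s (init_seg (len \<Delta>) ?P)"
    using all.prems pullback_ctx[OF X] len_le_pullback[OF X] init_pullback[OF X] by simp_all
  have Z: "ctx \<Gamma>'" "\<gamma> \<le> len \<Gamma>'" "ctx \<Theta>" "sub \<Theta> (subst_seq s t) (init_seg \<gamma> \<Gamma>')"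
    using X all.prems sub_comp[OF Y(3) _ ctx_init[OF X(1)] X(4), of s] by simp_all
  note pp = pullback_pullback[OF X all.prems(3,4)]
  show ?case
    unfolding fsubst_quantifier[OF X] fsubst_quantifier[OF Y] fsubst_quantifier[OF Z] pp
      all.IH[OF pullback_ctx[OF X] lift_sub[OF X] pullback_ctx[OF Y] lift_sub[OF Y]] by (rule refl)
qed simp_all

text \<open>Quantifiers bind nonempty tails. Nonemptiness survives substitution because
  \<open>shift\<close> is strictly increasing and takes \<open>\<gamma>\<close> to
  \<open>len \<Delta>\<close>.\<close>

lemma less_len_pullback:
  assumes "ctx \<Gamma>'" "\<gamma> < len \<Gamma>'" "ctx \<Delta>" "sub \<Delta> t (init_seg \<gamma> \<Gamma>')"
  shows "len \<Delta> < len (pullback_ctx \<Delta> t (tail_seg \<gamma> \<Gamma>'))"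
proof -
  have "shift \<gamma> (len \<Delta>) \<gamma> < shift \<gamma> (len \<Delta>) (len \<Gamma>')"
    by (subst shift_rules(2)) (use assms in auto)
  then show ?thesis using len_pullback[OF assms(1) _ assms(3,4)] assms(2) shift_rules(5) by simp
qed

lemma form_subst: "\<lbrakk>form \<Gamma> \<Phi>; ctx \<Delta>; sub \<Delta> t \<Gamma>\<rbrakk> \<Longrightarrow> form \<Delta> (fsubst \<Phi> (len \<Delta>) t)"
proof (induction arbitrary: \<Delta> t rule: formula.induct)
  case (top \<Gamma>)
  then show ?case by (simp add: formula.top is_context_iff)
next
  case (bot \<Gamma>)
  then show ?case by (simp add: formula.bot is_context_iff)
next
  case (neg \<Gamma> \<Phi>)
  then show ?case by (simp add: formula.neg)
next
  case (disj \<Gamma> \<Phi>)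
  have "dom (map_option (\<lambda>\<phi>. fsubst \<phi> (len \<Delta>) t) \<circ> \<Phi>) = dom \<Phi>" by (auto simp: domIff)
  with disj show ?case by (auto simp: is_context_iff intro!: formula.disj)
next
  case (conj \<Gamma> \<Phi>)
  have "dom (map_option (\<lambda>\<phi>. fsubst \<phi> (len \<Delta>) t) \<circ> \<Phi>) = dom \<Phi>" by (auto simp: domIff)
  with conj show ?case by (auto simp: is_context_iff intro!: formula.conj)
next
  case (ex \<Gamma>' \<gamma> \<Phi>)
  then have X: "ctx \<Gamma>'" "\<gamma> \<le> len \<Gamma>'" "ctx \<Delta>" "sub \<Delta> t (init_seg \<gamma> \<Gamma>')" by (auto simp: is_context_iff)
  show ?case unfolding fsubst_quantifier[OF X]
    using form_exI[OF pullback_ctx[OF X] less_len_pullback[OF X(1) ex.hyps(2) X(3,4)]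
        ex.IH[OF pullback_ctx[OF X] lift_sub[OF X]]]
    unfolding init_pullback[OF X] .
next
  case (all \<Gamma>' \<gamma> \<Phi>)
  then have X: "ctx \<Gamma>'" "\<gamma> \<le> len \<Gamma>'" "ctx \<Delta>" "sub \<Delta> t (init_seg \<gamma> \<Gamma>')" by (auto simp: is_context_iff)
  show ?case unfolding fsubst_quantifier[OF X]
    using form_allI[OF pullback_ctx[OF X] less_len_pullback[OF X(1) all.hyps(2) X(3,4)]
        all.IH[OF pullback_ctx[OF X] lift_sub[OF X]]]
    unfolding init_pullback[OF X] .
qed

text \<open>Substituting variables for themselves is a map between derivably equal contexts, and it
  fixes the formula.\<close>

lemma form_convert: "\<lbrakk>form \<Gamma> \<Phi>; (\<Gamma>, \<Gamma>') \<in> context_rel T\<rbrakk> \<Longrightarrow> form \<Gamma>' \<Phi>"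
  using form_subst[OF _ _ context_rel_vars_sub, of \<Gamma> \<Phi> \<Gamma>'] fsubst_vars[of \<Gamma> \<Phi>]
    context_rel_ctx(2,4)[of \<Gamma> \<Gamma>'] by simp

lemma form_weaken:
  "\<lbrakk>ctx \<Gamma>'; form (init_seg \<gamma> \<Gamma>') \<Phi>\<rbrakk> \<Longrightarrow> form \<Gamma>' (weaken \<Gamma>' \<gamma> \<Phi>)"
  unfolding weaken_def by (rule form_subst[OF _ _ display_sub])

lemma form_disj_iff: "form \<Gamma> (FDisj \<Phi>) \<longleftrightarrow> ctx \<Gamma> \<and> |dom \<Phi>| <o l \<and> (\<forall>i \<phi>. \<Phi> i = Some \<phi> \<longrightarrow> form \<Gamma> \<phi>)"
  by (auto simp: is_context_iff intro: formula.disj elim: formula.cases)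

lemma form_conj_iff: "form \<Gamma> (FConj \<Phi>) \<longleftrightarrow> ctx \<Gamma> \<and> |dom \<Phi>| <o l \<and> (\<forall>i \<phi>. \<Phi> i = Some \<phi> \<longrightarrow> form \<Gamma> \<phi>)"
  by (auto simp: is_context_iff intro: formula.conj elim: formula.cases)

lemma form_neg_iff: "form \<Gamma> (FNeg \<Phi>) \<longleftrightarrow> form \<Gamma> \<Phi>"
  by (auto intro: formula.neg elim: formula.cases)

lemma form_top: "ctx \<Gamma> \<Longrightarrow> form \<Gamma> FTop" and form_bot: "ctx \<Gamma> \<Longrightarrow> form \<Gamma> FBot"
  by (auto simp: is_context_iff intro: formula.top formula.bot)

lemma form_binary:
  assumes "form \<Gamma> \<Phi>" "form \<Gamma> \<Psi>"
  shows "form \<Gamma> (FConj [i \<mapsto> \<Phi>, j \<mapsto> \<Psi>])" "form \<Gamma> (FDisj [i \<mapsto> \<Phi>, j \<mapsto> \<Psi>])"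
  using assms form_ctx finite_less_l[of "dom [i \<mapsto> \<Phi>, j \<mapsto> \<Psi>]"]
  by (auto simp: form_conj_iff form_disj_iff split: if_splits)

lemma prov_form: "prov \<Gamma> \<Phi> \<Psi> \<Longrightarrow> form \<Gamma> \<Phi> \<and> form \<Gamma> \<Psi>"
proof (induction rule: provable.induct)
  case (pv_ex_left \<Gamma>' \<gamma> \<Psi> \<Phi>)
  then show ?case by (auto simp: is_context_iff intro: form_exI)
next
  case (pv_ex_inv \<Gamma>' \<gamma> \<Psi> \<Phi>)
  then show ?case by (auto simp: is_context_iff intro: form_weaken)
next
  case (pv_all_right \<Gamma>' \<gamma> \<Psi> \<Phi>)
  then show ?case by (auto simp: is_context_iff intro: form_allI)
next
  case (pv_all_inv \<Gamma>' \<gamma> \<Psi> \<Phi>)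
  then show ?case by (auto simp: is_context_iff intro: form_weaken)
next
  case (pv_subst \<Gamma> \<Phi> \<Psi> \<Delta> t)
  then show ?case by (auto simp: morphism_iff intro: form_subst)
next
  case (pv_distrib \<Gamma> \<Phi> \<Psi> \<Theta> i j)
  then show ?case by (intro conjI form_binary)
next
  case (pv_contradiction \<Gamma> \<Phi> i j)
  then show ?case by (auto intro: form_binary form_bot formula.neg form_ctx)
next
  case (pv_excluded_middle \<Gamma> \<Phi> i j)
  then show ?case by (auto intro: form_binary form_top formula.neg form_ctx)
qed (auto simp: form_disj_iff form_conj_iff intro: form_top form_bot form_ctx)

text \<open>An instance of stability under substitution, along a map that changes neither formula.
  It allows provability to be tested over any representative of a context class.\<close>

lemma prov_convert: "\<lbrakk>prov \<Gamma> \<Phi> \<Psi>; (\<Gamma>, \<Gamma>') \<in> context_rel T\<rbrakk> \<Longrightarrow> prov \<Gamma>' \<Phi> \<Psi>"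
proof -
  assume p: "prov \<Gamma> \<Phi> \<Psi>" and r: "(\<Gamma>, \<Gamma>') \<in> context_rel T"
  have "context_morphism T \<Gamma>' (vars \<Gamma>) \<Gamma>"
    using context_rel_ctx[OF r] context_rel_vars_sub[OF r] by (simp add: morphism_iff)
  from pv_subst[OF p this] show ?thesis
    unfolding context_rel_ctx(4)[OF r, symmetric] fsubst_vars[OF prov_form[OF p, THEN conjunct1]]
      fsubst_vars[OF prov_form[OF p, THEN conjunct2]] .
qed

section \<open>Propositional reasoning\<close>

text \<open>Binary connectives are families over two distinct indices, which exist because
  \<open>l\<close> is an infinite cardinal.\<close>

lemma two_indices: "\<exists>i j :: 'l. i \<noteq> j"
proof -
  have "infinite (Field l)" using regular_l by (simp add: regular_cardinal_def cinfinite_def)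
  then have "infinite (UNIV :: 'l set)" using finite_subset subset_UNIV by blast
  then show ?thesis by (metis (full_types) UNIV_eq_I finite.emptyI finite.insertI insertI1)
qed

lemma prov_conj_elim: "\<lbrakk>form \<Gamma> (FConj \<Phi>); \<Phi> i = Some \<phi>\<rbrakk> \<Longrightarrow> prov \<Gamma> (FConj \<Phi>) \<phi>"
  by (rule pv_conj_inv[OF pv_refl])

lemma prov_disj_intro: "\<lbrakk>form \<Gamma> (FDisj \<Phi>); \<Phi> i = Some \<phi>\<rbrakk> \<Longrightarrow> prov \<Gamma> \<phi> (FDisj \<Phi>)"
  by (rule pv_disj_inv[OF pv_refl])

lemma prov_conj_binary:
  assumes "prov \<Gamma> \<Theta> \<Phi>" "prov \<Gamma> \<Theta> \<Psi>"
  shows "prov \<Gamma> \<Theta> (FConj [i \<mapsto> \<Phi>, j \<mapsto> \<Psi>])"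
  using assms prov_form form_binary by (intro pv_conj_right) (auto split: if_splits)

lemma prov_disj_binary:
  assumes "prov \<Gamma> \<Phi> \<Theta>" "prov \<Gamma> \<Psi> \<Theta>"
  shows "prov \<Gamma> (FDisj [i \<mapsto> \<Phi>, j \<mapsto> \<Psi>]) \<Theta>"
  using assms prov_form form_binary by (intro pv_disj_left) (auto split: if_splits)

text \<open>Split \<open>\<Theta>\<close> by excluded middle for \<open>\<Phi>\<close> and
  distribute: one disjunct is contradictory, the other contains \<open>FNeg \<Phi>\<close>. This is
  where the calculus relies on \<open>pv_distrib\<close>.\<close>

lemma prov_neg_right:
  assumes ij: "i \<noteq> j" and p: "prov \<Gamma> (FConj [i \<mapsto> \<Theta>, j \<mapsto> \<Phi>]) FBot" and f: "form \<Gamma> \<Theta>" "form \<Gamma> \<Phi>"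
  shows "prov \<Gamma> \<Theta> (FNeg \<Phi>)"
proof -
  have n: "form \<Gamma> (FNeg \<Phi>)" using f by (simp add: form_neg_iff)
  have "prov \<Gamma> \<Theta> (FDisj [i \<mapsto> \<Phi>, j \<mapsto> FNeg \<Phi>])"
    by (rule pv_trans[OF pv_top[OF f(1)] pv_excluded_middle[OF f(2) ij]])
  then have "prov \<Gamma> \<Theta> (FConj [i \<mapsto> \<Theta>, j \<mapsto> FDisj [i \<mapsto> \<Phi>, j \<mapsto> FNeg \<Phi>]])"
    by (rule prov_conj_binary[OF pv_refl[OF f(1)]])
  moreover have "prov \<Gamma> (FConj [i \<mapsto> \<Theta>, j \<mapsto> FDisj [i \<mapsto> \<Phi>, j \<mapsto> FNeg \<Phi>]])
      (FDisj [i \<mapsto> FConj [i \<mapsto> \<Theta>, j \<mapsto> \<Phi>], j \<mapsto> FConj [i \<mapsto> \<Theta>, j \<mapsto> FNeg \<Phi>]])"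
    by (rule pv_distrib[OF f(1,2) n ij])
  moreover have "prov \<Gamma> (FDisj [i \<mapsto> FConj [i \<mapsto> \<Theta>, j \<mapsto> \<Phi>], j \<mapsto> FConj [i \<mapsto> \<Theta>, j \<mapsto> FNeg \<Phi>]]) (FNeg \<Phi>)"
  proof (rule prov_disj_binary)
    show "prov \<Gamma> (FConj [i \<mapsto> \<Theta>, j \<mapsto> \<Phi>]) (FNeg \<Phi>)" by (rule pv_trans[OF p pv_bot[OF n]])
    show "prov \<Gamma> (FConj [i \<mapsto> \<Theta>, j \<mapsto> FNeg \<Phi>]) (FNeg \<Phi>)"
      by (rule prov_conj_elim[where i = j, OF form_binary(1)[OF f(1) n]]) simp
  qed
  ultimately show ?thesis by (meson pv_trans)
qed

lemma prov_contrapos: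
  assumes p: "prov \<Gamma> \<Phi> \<Psi>" shows "prov \<Gamma> (FNeg \<Psi>) (FNeg \<Phi>)"
proof -
  obtain i j :: 'l where ij: "i \<noteq> j" using two_indices by blast
  have f: "form \<Gamma> \<Phi>" "form \<Gamma> \<Psi>" "form \<Gamma> (FNeg \<Psi>)" using prov_form[OF p] by (auto simp: form_neg_iff)
  have fc: "form \<Gamma> (FConj [i \<mapsto> FNeg \<Psi>, j \<mapsto> \<Phi>])" by (rule form_binary(1)[OF f(3,1)])
  have "prov \<Gamma> (FConj [i \<mapsto> FNeg \<Psi>, j \<mapsto> \<Phi>]) (FConj [i \<mapsto> \<Psi>, j \<mapsto> FNeg \<Psi>])"
  proof (rule prov_conj_binary)
    show "prov \<Gamma> (FConj [i \<mapsto> FNeg \<Psi>, j \<mapsto> \<Phi>]) \<Psi>"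
      by (rule pv_trans[OF prov_conj_elim[OF fc, of j] p]) simp
    show "prov \<Gamma> (FConj [i \<mapsto> FNeg \<Psi>, j \<mapsto> \<Phi>]) (FNeg \<Psi>)"
      by (rule prov_conj_elim[OF fc, of i]) (simp add: ij)
  qed
  then have "prov \<Gamma> (FConj [i \<mapsto> FNeg \<Psi>, j \<mapsto> \<Phi>]) FBot"
    by (rule pv_trans[OF _ pv_contradiction[OF f(2) ij]])
  then show ?thesis by (rule prov_neg_right[OF ij _ f(3,1)])
qed

text \<open>
  The two tails may differ by derivable equality of types, as the tails of \<open>t\<^sup>*E\<close> and \<open>t'\<^sup>*E\<close> do when
  \<open>t \<equiv> t'\<close>.
\<close>

lemma prov_ex_mono:
  assumes r: "(\<Gamma>\<^sub>1, \<Gamma>\<^sub>2) \<in> context_rel T" and i: "init_seg \<delta> \<Gamma>\<^sub>1 = init_seg \<delta> \<Gamma>\<^sub>2" and less: "\<delta> < len \<Gamma>\<^sub>1"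
    and p: "prov \<Gamma>\<^sub>1 \<Psi>\<^sub>1 \<Psi>\<^sub>2"
  shows "prov (init_seg \<delta> \<Gamma>\<^sub>1) (FEx (tail_seg \<delta> \<Gamma>\<^sub>1) \<Psi>\<^sub>1) (FEx (tail_seg \<delta> \<Gamma>\<^sub>2) \<Psi>\<^sub>2)"
    and "prov (init_seg \<delta> \<Gamma>\<^sub>1) (FAll (tail_seg \<delta> \<Gamma>\<^sub>1) \<Psi>\<^sub>1) (FAll (tail_seg \<delta> \<Gamma>\<^sub>2) \<Psi>\<^sub>2)"
proof -
  note c = context_rel_ctx[OF r]
  have l2: "\<delta> < len \<Gamma>\<^sub>2" using less c(4) by simp
  have w: "weaken \<Gamma>\<^sub>2 \<delta> \<Phi> = weaken \<Gamma>\<^sub>1 \<delta> \<Phi>" for \<Phi> :: "('s, 'k, 'l) fm"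
    using i c(4) by (simp add: weaken_def)
  have f1: "form \<Gamma>\<^sub>1 \<Psi>\<^sub>1" and f2: "form \<Gamma>\<^sub>2 \<Psi>\<^sub>2" using prov_form[OF p] form_convert[OF _ r] by auto
  let ?X = "FEx (tail_seg \<delta> \<Gamma>\<^sub>2) \<Psi>\<^sub>2" and ?A = "FAll (tail_seg \<delta> \<Gamma>\<^sub>1) \<Psi>\<^sub>1"
  have fX: "form (init_seg \<delta> \<Gamma>\<^sub>2) ?X" by (rule form_exI[OF c(2) l2 f2])
  have fA: "form (init_seg \<delta> \<Gamma>\<^sub>1) ?A" by (rule form_allI[OF c(1) less f1])
  have c': "is_context T \<Gamma>\<^sub>1" "is_context T \<Gamma>\<^sub>2" using c by (simp_all add: is_context_iff)
  have "prov \<Gamma>\<^sub>2 \<Psi>\<^sub>2 (weaken \<Gamma>\<^sub>2 \<delta> ?X)" by (rule pv_ex_inv[OF c'(2) l2 f2 fX pv_refl[OF fX]])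
  then have "prov \<Gamma>\<^sub>1 \<Psi>\<^sub>2 (weaken \<Gamma>\<^sub>1 \<delta> ?X)" unfolding w by (rule prov_convert[OF _ context_rel_sym[OF r]])
  then show "prov (init_seg \<delta> \<Gamma>\<^sub>1) (FEx (tail_seg \<delta> \<Gamma>\<^sub>1) \<Psi>\<^sub>1) ?X"
    by (intro pv_ex_left[OF c'(1) less f1] pv_trans[OF p]) (use fX i in simp_all)
  have "prov \<Gamma>\<^sub>1 (weaken \<Gamma>\<^sub>1 \<delta> ?A) \<Psi>\<^sub>1" by (rule pv_all_inv[OF c'(1) less f1 fA pv_refl[OF fA]])
  then have "prov \<Gamma>\<^sub>2 (weaken \<Gamma>\<^sub>2 \<delta> ?A) \<Psi>\<^sub>2" unfolding w by (rule prov_convert[OF pv_trans[OF _ p] r])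
  then show "prov (init_seg \<delta> \<Gamma>\<^sub>1) ?A (FAll (tail_seg \<delta> \<Gamma>\<^sub>2) \<Psi>\<^sub>2)"
    unfolding i by (intro pv_all_right[OF c'(2) l2 f2]) (use fA i in simp_all)
qed

text \<open>Provides independence of the representative of an arrow. The two formulas can differ
  literally, since \<open>t\<close> and \<open>t'\<close> enter the types of bound variables. The
  maps are kept arbitrary in the induction because negation exchanges them and quantifiers replace
  them by their lifts.\<close>

lemma fsubst_sub_eq:
  "\<lbrakk>form \<Gamma> \<Phi>; ctx \<Delta>; sub_eq \<Delta> t t' \<Gamma>\<rbrakk> \<Longrightarrow> prov \<Delta> (fsubst \<Phi> (len \<Delta>) t) (fsubst \<Phi> (len \<Delta>) t')"
proof (induction arbitrary: \<Delta> t t' rule: formula.induct)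
  case (top \<Gamma>)
  then show ?case by (simp add: pv_refl form_top)
next
  case (bot \<Gamma>)
  then show ?case by (simp add: pv_refl form_bot)
next
  case (neg \<Gamma> \<Phi>)
  then show ?case using sub_eq_sym[OF neg.prems(1) form_ctx[OF neg.hyps] neg.prems(2)]
    by (simp add: prov_contrapos)
next
  case (disj \<Gamma> \<Phi>)
  then have G: "ctx \<Gamma>" by (simp add: is_context_iff)
  have f: "form \<Gamma> (FDisj \<Phi>)" by (rule formula.disj[OF disj.hyps])
  have t: "sub \<Delta> t \<Gamma>" "sub \<Delta> t' \<Gamma>"
    using sub_eq_left[OF disj.prems(2)] sub_eq_right[OF disj.prems(1) G disj.prems(2)] .
  have fs: "form \<Delta> (fsubst (FDisj \<Phi>) (len \<Delta>) t)" "form \<Delta> (fsubst (FDisj \<Phi>) (len \<Delta>) t')"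
    using form_subst[OF f disj.prems(1)] t by blast+
  show ?case unfolding fsubst.simps
  proof (rule pv_disj_left)
    fix i \<phi> assume "(map_option (\<lambda>\<phi>. fsubst \<phi> (len \<Delta>) t) \<circ> \<Phi>) i = Some \<phi>"
    then obtain \<psi> where p: "\<Phi> i = Some \<psi>" "\<phi> = fsubst \<psi> (len \<Delta>) t" by auto
    have "prov \<Delta> \<phi> (fsubst \<psi> (len \<Delta>) t')" unfolding p(2) by (rule disj.IH[OF p(1) disj.prems])
    then show "prov \<Delta> \<phi> (FDisj (map_option (\<lambda>\<phi>. fsubst \<phi> (len \<Delta>) t') \<circ> \<Phi>))"
      by (rule pv_trans) (rule prov_disj_intro[of _ _ i], use fs p in simp_all)
  qed (use fs in simp_all)
next
  case (conj \<Gamma> \<Phi>)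
  then have G: "ctx \<Gamma>" by (simp add: is_context_iff)
  have f: "form \<Gamma> (FConj \<Phi>)" by (rule formula.conj[OF conj.hyps])
  have t: "sub \<Delta> t \<Gamma>" "sub \<Delta> t' \<Gamma>"
    using sub_eq_left[OF conj.prems(2)] sub_eq_right[OF conj.prems(1) G conj.prems(2)] .
  have fs: "form \<Delta> (fsubst (FConj \<Phi>) (len \<Delta>) t)" "form \<Delta> (fsubst (FConj \<Phi>) (len \<Delta>) t')"
    using form_subst[OF f conj.prems(1)] t by blast+
  show ?case unfolding fsubst.simps
  proof (rule pv_conj_right)
    fix i \<phi> assume "(map_option (\<lambda>\<phi>. fsubst \<phi> (len \<Delta>) t') \<circ> \<Phi>) i = Some \<phi>"
    then obtain \<psi> where p: "\<Phi> i = Some \<psi>" "\<phi> = fsubst \<psi> (len \<Delta>) t'" by auto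
    have "prov \<Delta> (fsubst \<psi> (len \<Delta>) t) \<phi>" unfolding p(2) by (rule conj.IH[OF p(1) conj.prems])
    then show "prov \<Delta> (FConj (map_option (\<lambda>\<phi>. fsubst \<phi> (len \<Delta>) t) \<circ> \<Phi>)) \<phi>"
      by (rule pv_trans[rotated]) (rule prov_conj_elim[of _ _ i], use fs p in simp_all)
  qed (use fs in simp_all)
next
  case (ex \<Gamma>' \<gamma> \<Phi>)
  then have G: "ctx \<Gamma>'" "\<gamma> \<le> len \<Gamma>'" "ctx \<Delta>" by (auto simp: is_context_iff)
  have t: "sub \<Delta> t (init_seg \<gamma> \<Gamma>')" by (rule sub_eq_left[OF ex.prems(2)])
  have t': "sub \<Delta> t' (init_seg \<gamma> \<Gamma>')" by (rule sub_eq_right[OF G(3) ctx_init[OF G(1)] ex.prems(2)])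
  note c = pullback_cong[OF G ex.prems(2)]
  note X = G t and Y = G t'
  note p = ex.IH[OF pullback_ctx[OF X] c(1)]
  show ?case unfolding fsubst_quantifier[OF X] fsubst_quantifier[OF Y]
    using prov_ex_mono(1)[OF c(2) _ less_len_pullback[OF X(1) ex.hyps(2) X(3,4)] p]
    unfolding init_pullback[OF X] init_pullback[OF Y] context_rel_ctx(4)[OF c(2)] by simp
next
  case (all \<Gamma>' \<gamma> \<Phi>)
  then have G: "ctx \<Gamma>'" "\<gamma> \<le> len \<Gamma>'" "ctx \<Delta>" by (auto simp: is_context_iff)
  have t: "sub \<Delta> t (init_seg \<gamma> \<Gamma>')" by (rule sub_eq_left[OF all.prems(2)])
  have t': "sub \<Delta> t' (init_seg \<gamma> \<Gamma>')" by (rule sub_eq_right[OF G(3) ctx_init[OF G(1)] all.prems(2)])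
  note c = pullback_cong[OF G all.prems(2)]
  note X = G t and Y = G t'
  note p = all.IH[OF pullback_ctx[OF X] c(1)]
  show ?case unfolding fsubst_quantifier[OF X] fsubst_quantifier[OF Y]
    using prov_ex_mono(2)[OF c(2) _ less_len_pullback[OF X(1) all.hyps(2) X(3,4)] p]
    unfolding init_pullback[OF X] init_pullback[OF Y] context_rel_ctx(4)[OF c(2)] by simp
qed

end

section \<open>Boolean algebras with small joins\<close>

lemma (in partial_order) sup_eqI: "least L s (Upper L A) \<Longrightarrow> \<Squnion>A = s"
  unfolding sup_def by (rule some_equality) (auto intro: least_unique)

lemma (in partial_order) inf_eqI: "greatest L s (Lower L A) \<Longrightarrow> \<Sqinter>A = s"
  unfolding inf_def by (rule some_equality) (auto intro: greatest_unique)

definition complement :: "'b gorder \<Rightarrow> 'b \<Rightarrow> 'b" where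
  "complement L x = (THE y. y \<in> carrier L \<and> x \<sqinter>\<^bsub>L\<^esub> y = \<bottom>\<^bsub>L\<^esub> \<and> x \<squnion>\<^bsub>L\<^esub> y = \<top>\<^bsub>L\<^esub>)"

locale lambda_boolean = bounded_lattice L for L :: "'b gorder" (structure) +
  fixes l :: "'l rel"
  assumes lba: "lambda_boolean_algebra l L"
begin

lemma distrib: "\<lbrakk>x \<in> carrier L; y \<in> carrier L; z \<in> carrier L\<rbrakk> \<Longrightarrow> x \<sqinter> (y \<squnion> z) = (x \<sqinter> y) \<squnion> (x \<sqinter> z)"
  using lba unfolding lambda_boolean_algebra_def by blast

lemma bot_join: "x \<in> carrier L \<Longrightarrow> \<bottom> \<squnion> x = x"
  by (metis bottom_closed bottom_lower le_iff_meet)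

lemma meet_top: "x \<in> carrier L \<Longrightarrow> x \<sqinter> \<top> = x"
  by (metis top_closed top_higher le_iff_join)

text \<open>Distributivity enters the treatment of complements here: meeting \<open>z\<close> with
  the cover leaves only its part in \<open>y\<close>.\<close>

lemma le_of_disjoint_cover:
  assumes "x \<in> carrier L" "y \<in> carrier L" "z \<in> carrier L" "z \<sqinter> x = \<bottom>" "x \<squnion> y = \<top>"
  shows "z \<sqsubseteq> y"
proof -
  have "z = z \<sqinter> (x \<squnion> y)" using assms meet_top by simp
  also have "\<dots> = z \<sqinter> y"
    unfolding distrib[OF assms(3,1,2)] assms(4) using assms by (simp add: bot_join)
  finally show ?thesis using assms le_iff_join by simp
qed

lemma complement:
  assumes x: "x \<in> carrier L"
  shows complement_closed: "complement L x \<in> carrier L"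
    and meet_complement: "x \<sqinter> complement L x = \<bottom>" and join_complement: "x \<squnion> complement L x = \<top>"
proof -
  obtain y where y: "y \<in> carrier L" "x \<sqinter> y = \<bottom>" "x \<squnion> y = \<top>"
    using lba x unfolding lambda_boolean_algebra_def by blast
  have "z = y" if "z \<in> carrier L \<and> x \<sqinter> z = \<bottom> \<and> x \<squnion> z = \<top>" for z
    using le_of_disjoint_cover[of x y z] le_of_disjoint_cover[of x z y] that x y
      meet_comm[of L x z] meet_comm[of L x y] by (intro le_antisym) simp_all
  then have "\<exists>!y. y \<in> carrier L \<and> x \<sqinter> y = \<bottom> \<and> x \<squnion> y = \<top>" using y by blast
  from theI'[OF this] show "complement L x \<in> carrier L" "x \<sqinter> complement L x = \<bottom>" "x \<squnion> complement L x = \<top>"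
    unfolding complement_def by blast+
qed

lemma complement_eqI:
  assumes "x \<in> carrier L" "y \<in> carrier L" "x \<sqinter> y = \<bottom>" "x \<squnion> y = \<top>"
  shows "complement L x = y"
proof (rule le_antisym)
  show "complement L x \<sqsubseteq> y"
    using le_of_disjoint_cover[of x y "complement L x"] complement[OF assms(1)] assms
      meet_comm[of L x "complement L x"] by simp
  show "y \<sqsubseteq> complement L x"
    using le_of_disjoint_cover[of x "complement L x" y] complement[OF assms(1)] assms
      meet_comm[of L x y] by simp
qed (use assms complement_closed in auto)

lemma complement_complement: "x \<in> carrier L \<Longrightarrow> complement L (complement L x) = x"
  by (rule complement_eqI)
    (use complement[of x] meet_comm[of L x "complement L x"] join_comm[of L x "complement L x"] in simp_all)

lemma complement_antitone:
  assumes "x \<in> carrier L" "y \<in> carrier L" "x \<sqsubseteq> y"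
  shows "complement L y \<sqsubseteq> complement L x"
proof (rule le_of_disjoint_cover[OF assms(1) complement_closed[OF assms(1)] complement_closed[OF assms(2)]
      _ join_complement[OF assms(1)]])
  note c = complement[OF assms(2)]
  have "complement L y \<sqinter> x \<sqsubseteq> \<bottom>"
    unfolding c(2)[symmetric]
    by (rule meet_le) (use assms c le_trans[OF meet_right[of "complement L y" x] assms(3)] meet_left in auto)
  then show "complement L y \<sqinter> x = \<bottom>" using assms c(1) by (intro le_antisym) auto
qed

lemma complement_le_iff:
  "\<lbrakk>x \<in> carrier L; y \<in> carrier L\<rbrakk> \<Longrightarrow> complement L x \<sqsubseteq> y \<longleftrightarrow> complement L y \<sqsubseteq> x"
  using complement_antitone[of "complement L x" y] complement_antitone[of "complement L y" x]
    complement_complement complement_closed by auto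

lemma sup_least:
  assumes "A \<subseteq> carrier L" "|A| <o l" shows "least L (\<Squnion>A) (Upper L A)"
proof -
  obtain s where "least L s (Upper L A)" using lba assms unfolding lambda_boolean_algebra_def by blast
  then show ?thesis using sup_eqI by metis
qed

lemma sup_carrier: "\<lbrakk>A \<subseteq> carrier L; |A| <o l\<rbrakk> \<Longrightarrow> \<Squnion>A \<in> carrier L"
  using sup_least least_closed by blast

lemma sup_upper: "\<lbrakk>A \<subseteq> carrier L; |A| <o l; x \<in> A\<rbrakk> \<Longrightarrow> x \<sqsubseteq> \<Squnion>A"
  using least_Upper_above[OF sup_least] by blast

lemma sup_le: "\<lbrakk>A \<subseteq> carrier L; |A| <o l; y \<in> carrier L; \<And>x. x \<in> A \<Longrightarrow> x \<sqsubseteq> y\<rbrakk> \<Longrightarrow> \<Squnion>A \<sqsubseteq> y"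
  using least_le[OF sup_least] Upper_memI by metis

lemma complement_image_small: "|A| <o l \<Longrightarrow> |complement L ` A| <o l"
  using card_of_image ordLeq_ordLess_trans by blast

text \<open>Only small joins are postulated, so small meets are obtained by De Morgan. In this form
  they are visibly preserved by homomorphisms.\<close>

definition small_meet where "small_meet A = complement L (\<Squnion>(complement L ` A))"

lemma
  assumes A: "A \<subseteq> carrier L" "|A| <o l"
  shows small_meet_closed: "small_meet A \<in> carrier L"
    and small_meet_lower: "x \<in> A \<Longrightarrow> small_meet A \<sqsubseteq> x"
    and small_meet_greatest: "\<lbrakk>y \<in> carrier L; \<And>x. x \<in> A \<Longrightarrow> y \<sqsubseteq> x\<rbrakk> \<Longrightarrow> y \<sqsubseteq> small_meet A"
proof -
  have C: "complement L ` A \<subseteq> carrier L" using A complement_closed by blast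
  note S = C complement_image_small[OF A(2)]
  have s: "\<Squnion>(complement L ` A) \<in> carrier L" by (rule sup_carrier[OF S])
  then show "small_meet A \<in> carrier L" unfolding small_meet_def by (rule complement_closed)
  show "small_meet A \<sqsubseteq> x" if "x \<in> A"
  proof -
    have "complement L x \<sqsubseteq> \<Squnion>(complement L ` A)" by (rule sup_upper[OF S]) (use that in blast)
    then show ?thesis unfolding small_meet_def using complement_le_iff[OF s, of x] that A(1) by blast
  qed
  show "y \<sqsubseteq> small_meet A" if y: "y \<in> carrier L" "\<And>x. x \<in> A \<Longrightarrow> y \<sqsubseteq> x"
  proof -
    have "\<Squnion>(complement L ` A) \<sqsubseteq> complement L y"
    proof (rule sup_le[OF S complement_closed[OF y(1)]])
      fix z assume "z \<in> complement L ` A"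
      then show "z \<sqsubseteq> complement L y" using complement_antitone[OF y(1)] y(2) A(1) by auto
    qed
    from complement_antitone[OF s complement_closed[OF y(1)] this] show ?thesis
      unfolding small_meet_def complement_complement[OF y(1)] .
  qed
qed

lemma small_meet_eqI:
  assumes A: "A \<subseteq> carrier L" "|A| <o l" and g: "greatest L s (Lower L A)"
  shows "small_meet A = s"
proof (rule le_antisym)
  have s: "s \<in> carrier L" using g by simp
  show "small_meet A \<sqsubseteq> s"
    by (rule greatest_le[OF g]) (use small_meet_closed[OF A] small_meet_lower[OF A] in \<open>auto intro: Lower_memI\<close>)
  show "s \<sqsubseteq> small_meet A"
    by (rule small_meet_greatest[OF A s]) (rule greatest_Lower_below[OF g _ A(1)])
qed (use g small_meet_closed[OF A] in auto)

end

lemma lambda_booleanI: "lambda_boolean_algebra l L \<Longrightarrow> lambda_boolean L l"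
  by (simp add: lambda_boolean_def lambda_boolean_axioms_def lambda_boolean_lattice)

lemma lambda_boolean_hom_complement:
  assumes L: "lambda_boolean_algebra l L" and M: "lambda_boolean_algebra l M"
    and h: "lambda_boolean_hom l L M h" and x: "x \<in> carrier L"
  shows "h (complement L x) = complement M (h x)"
proof -
  interpret L: lambda_boolean L l by (rule lambda_booleanI[OF L])
  interpret M: lambda_boolean M l by (rule lambda_booleanI[OF M])
  note c = L.complement[OF x]
  have "h x \<sqinter>\<^bsub>M\<^esub> h (complement L x) = \<bottom>\<^bsub>M\<^esub>" "h x \<squnion>\<^bsub>M\<^esub> h (complement L x) = \<top>\<^bsub>M\<^esub>"
    using h x c unfolding lambda_boolean_hom_def by metis+
  then show ?thesis
    using M.complement_eqI[of "h x" "h (complement L x)"] lambda_boolean_hom_closed[OF h] x c(1) by simp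
qed

lemma lambda_boolean_hom_small_meet:
  assumes L: "lambda_boolean_algebra l L" and M: "lambda_boolean_algebra l M"
    and h: "lambda_boolean_hom l L M h" and A: "A \<subseteq> carrier L" "|A| <o l"
  shows "h (complement L (\<Squnion>\<^bsub>L\<^esub>(complement L ` A))) = complement M (\<Squnion>\<^bsub>M\<^esub>(complement M ` h ` A))"
proof -
  interpret L: lambda_boolean L l by (rule lambda_booleanI[OF L])
  have C: "complement L ` A \<subseteq> carrier L" using A L.complement_closed by blast
  note S = C L.complement_image_small[OF A(2)]
  have "h ` complement L ` A = complement M ` h ` A"
    unfolding image_image using lambda_boolean_hom_complement[OF L M h] A(1) by (intro image_cong) auto
  moreover have "h (\<Squnion>\<^bsub>L\<^esub>(complement L ` A)) = \<Squnion>\<^bsub>M\<^esub>(h ` complement L ` A)"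
    using h S unfolding lambda_boolean_hom_def by blast
  ultimately show ?thesis
    using lambda_boolean_hom_complement[OF L M h L.sup_carrier[OF S]] by simp
qed

section \<open>The Lindenbaum algebras\<close>

context formula_theory
begin

abbreviation "fcls \<Gamma> \<Phi> \<equiv> equiprovable T l (cls \<Gamma>) `` {\<Phi>}"
abbreviation "\<L> \<equiv> lindenbaum T l"
abbreviation "Lind \<Gamma> \<equiv> Fibre \<L> (cls \<Gamma>)"

text \<open>The definition quantifies over representatives of the context class; by conversion any
  single one decides.\<close>

lemma equiprovable_iff:
  "ctx \<Gamma> \<Longrightarrow> (\<Phi>, \<Psi>) \<in> equiprovable T l (cls \<Gamma>) \<longleftrightarrow> prov \<Gamma> \<Phi> \<Psi> \<and> prov \<Gamma> \<Psi> \<Phi>"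
  using cls_self prov_convert context_rel_sym unfolding equiprovable_def by blast

lemma formulas_cls: "ctx \<Gamma> \<Longrightarrow> formulas T l (cls \<Gamma>) = {\<Phi>. form \<Gamma> \<Phi>}"
  using cls_self form_convert context_rel_sym unfolding formulas_def by blast

lemma equiv_equiprovable: "ctx \<Gamma> \<Longrightarrow> equiv {\<Phi>. form \<Gamma> \<Phi>} (equiprovable T l (cls \<Gamma>))"
  by (rule equivI)
    (auto simp: refl_on_def equiprovable_iff intro!: symI transI intro: pv_refl pv_trans dest: prov_form)

lemma fcls_eq_iff:
  "\<lbrakk>form \<Gamma> \<Phi>; form \<Gamma> \<Psi>\<rbrakk> \<Longrightarrow> fcls \<Gamma> \<Phi> = fcls \<Gamma> \<Psi> \<longleftrightarrow> prov \<Gamma> \<Phi> \<Psi> \<and> prov \<Gamma> \<Psi> \<Phi>"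
  using eq_equiv_class_iff[OF equiv_equiprovable[OF form_ctx]] by (simp add: equiprovable_iff[OF form_ctx])

lemma fcls_mem: "ctx \<Gamma> \<Longrightarrow> \<Psi> \<in> fcls \<Gamma> \<Phi> \<longleftrightarrow> prov \<Gamma> \<Phi> \<Psi> \<and> prov \<Gamma> \<Psi> \<Phi>"
  by (simp add: equiprovable_iff)

lemma fcls_self: "form \<Gamma> \<Phi> \<Longrightarrow> \<Phi> \<in> fcls \<Gamma> \<Phi>"
  using fcls_mem[OF form_ctx] pv_refl[of T l \<Gamma> \<Phi>] by blast

lemma carrier_Lind: "ctx \<Gamma> \<Longrightarrow> carrier (Lind \<Gamma>) = fcls \<Gamma> ` {\<Phi>. form \<Gamma> \<Phi>}"
  by (auto simp: lindenbaum_def formulas_cls quotient_def)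

lemma eq_Lind: "(.=\<^bsub>Lind \<Gamma>\<^esub>) = (=)"
  by (simp add: lindenbaum_def)

lemma le_Lind: "\<lbrakk>form \<Gamma> \<Phi>; form \<Gamma> \<Psi>\<rbrakk> \<Longrightarrow> fcls \<Gamma> \<Phi> \<sqsubseteq>\<^bsub>Lind \<Gamma>\<^esub> fcls \<Gamma> \<Psi> \<longleftrightarrow> prov \<Gamma> \<Phi> \<Psi>"
proof
  assume f: "form \<Gamma> \<Phi>" "form \<Gamma> \<Psi>"
  note c = form_ctx[OF f(1)]
  show "prov \<Gamma> \<Phi> \<Psi>" if "fcls \<Gamma> \<Phi> \<sqsubseteq>\<^bsub>Lind \<Gamma>\<^esub> fcls \<Gamma> \<Psi>"
  proof -
    have "\<exists>\<Gamma>' \<in> cls \<Gamma>. \<exists>\<Phi>' \<in> fcls \<Gamma> \<Phi>. \<exists>\<Psi>' \<in> fcls \<Gamma> \<Psi>. prov \<Gamma>' \<Phi>' \<Psi>'"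
      using that unfolding lindenbaum_def bool_functor.simps gorder.simps .
    then obtain \<Gamma>' \<Phi>' \<Psi>' where *: "\<Gamma>' \<in> cls \<Gamma>" "\<Phi>' \<in> fcls \<Gamma> \<Phi>" "\<Psi>' \<in> fcls \<Gamma> \<Psi>" "prov \<Gamma>' \<Phi>' \<Psi>'"
      by blast
    have "(\<Gamma>, \<Gamma>') \<in> context_rel T" using *(1) by blast
    then have "prov \<Gamma> \<Phi>' \<Psi>'" by (rule prov_convert[OF *(4) context_rel_sym])
    moreover have "prov \<Gamma> \<Phi> \<Phi>'" "prov \<Gamma> \<Psi>' \<Psi>" using *(2,3) unfolding fcls_mem[OF c] by auto
    ultimately show ?thesis by (meson pv_trans)
  qed
  show "fcls \<Gamma> \<Phi> \<sqsubseteq>\<^bsub>Lind \<Gamma>\<^esub> fcls \<Gamma> \<Psi>" if "prov \<Gamma> \<Phi> \<Psi>"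
    using that cls_self[OF c] fcls_self[OF f(1)] fcls_self[OF f(2)]
    unfolding lindenbaum_def bool_functor.simps gorder.simps by blast
qed

lemma LindE:
  assumes "x \<in> carrier (Lind \<Gamma>)" "ctx \<Gamma>"
  obtains \<Phi> where "form \<Gamma> \<Phi>" "x = fcls \<Gamma> \<Phi>"
  using assms carrier_Lind by blast

lemma LindI: "form \<Gamma> \<Phi> \<Longrightarrow> fcls \<Gamma> \<Phi> \<in> carrier (Lind \<Gamma>)"
  using carrier_Lind form_ctx by blast

lemma Lind_order: "ctx \<Gamma> \<Longrightarrow> partial_order (Lind \<Gamma>)"
proof -
  assume c: "ctx \<Gamma>"
  show ?thesis
  proof
    show "x .=\<^bsub>Lind \<Gamma>\<^esub> x" "x .=\<^bsub>Lind \<Gamma>\<^esub> y \<Longrightarrow> y .=\<^bsub>Lind \<Gamma>\<^esub> x"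
      "x .=\<^bsub>Lind \<Gamma>\<^esub> y \<Longrightarrow> y .=\<^bsub>Lind \<Gamma>\<^esub> z \<Longrightarrow> x .=\<^bsub>Lind \<Gamma>\<^esub> z"
      "(.=\<^bsub>Lind \<Gamma>\<^esub>) = (=)"
      "\<lbrakk>x .=\<^bsub>Lind \<Gamma>\<^esub> y; z .=\<^bsub>Lind \<Gamma>\<^esub> w\<rbrakk> \<Longrightarrow> x \<sqsubseteq>\<^bsub>Lind \<Gamma>\<^esub> z \<longleftrightarrow> y \<sqsubseteq>\<^bsub>Lind \<Gamma>\<^esub> w" for x y z w
      by (simp_all add: eq_Lind)
    fix x assume x: "x \<in> carrier (Lind \<Gamma>)"
    obtain \<Phi> where p: "form \<Gamma> \<Phi>" "x = fcls \<Gamma> \<Phi>" using x c by (rule LindE)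
    then show "x \<sqsubseteq>\<^bsub>Lind \<Gamma>\<^esub> x" by (simp add: le_Lind pv_refl)
    fix y assume y: "y \<in> carrier (Lind \<Gamma>)"
    obtain \<Psi> where q: "form \<Gamma> \<Psi>" "y = fcls \<Gamma> \<Psi>" using y c by (rule LindE)
    show "x .=\<^bsub>Lind \<Gamma>\<^esub> y" if "x \<sqsubseteq>\<^bsub>Lind \<Gamma>\<^esub> y" "y \<sqsubseteq>\<^bsub>Lind \<Gamma>\<^esub> x"
      using that p q fcls_eq_iff[OF p(1) q(1)] by (simp add: eq_Lind le_Lind)
    fix z assume z: "z \<in> carrier (Lind \<Gamma>)"
    obtain \<Theta> where r: "form \<Gamma> \<Theta>" "z = fcls \<Gamma> \<Theta>" using z c by (rule LindE)
    show "x \<sqsubseteq>\<^bsub>Lind \<Gamma>\<^esub> z" if "x \<sqsubseteq>\<^bsub>Lind \<Gamma>\<^esub> y" "y \<sqsubseteq>\<^bsub>Lind \<Gamma>\<^esub> z"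
      using that p q r by (auto simp: le_Lind intro: pv_trans)
  qed
qed

lemma image_ran_carrier:
  assumes "ctx \<Gamma>" "\<And>i \<phi>. \<Phi> i = Some \<phi> \<Longrightarrow> form \<Gamma> \<phi>" shows "fcls \<Gamma> ` ran \<Phi> \<subseteq> carrier (Lind \<Gamma>)"
  using assms LindI by (auto simp: ran_def)

lemma least_disj:
  assumes f: "form \<Gamma> (FDisj \<Phi>)"
  shows "least (Lind \<Gamma>) (fcls \<Gamma> (FDisj \<Phi>)) (Upper (Lind \<Gamma>) (fcls \<Gamma> ` ran \<Phi>))"
proof -
  note c = form_ctx[OF f]
  have fi: "form \<Gamma> \<phi>" if "\<Phi> i = Some \<phi>" for i \<phi> using f that by (auto simp: form_disj_iff)
  show ?thesis
  proof (rule least_UpperI)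
    fix x assume "x \<in> fcls \<Gamma> ` ran \<Phi>"
    then obtain i \<phi> where x: "\<Phi> i = Some \<phi>" "x = fcls \<Gamma> \<phi>" by (auto simp: ran_def)
    show "x \<sqsubseteq>\<^bsub>Lind \<Gamma>\<^esub> fcls \<Gamma> (FDisj \<Phi>)"
      unfolding x(2) le_Lind[OF fi[OF x(1)] f] by (rule prov_disj_intro[OF f x(1)])
  next
    fix y assume y: "y \<in> Upper (Lind \<Gamma>) (fcls \<Gamma> ` ran \<Phi>)"
    then have "y \<in> carrier (Lind \<Gamma>)" by (rule subsetD[OF Upper_closed])
    then obtain \<Psi> where q: "form \<Gamma> \<Psi>" "y = fcls \<Gamma> \<Psi>" using c by (rule LindE)
    show "fcls \<Gamma> (FDisj \<Phi>) \<sqsubseteq>\<^bsub>Lind \<Gamma>\<^esub> y"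
      unfolding q(2) le_Lind[OF f q(1)]
    proof (rule pv_disj_left[OF f q(1)])
      fix i \<phi> assume i: "\<Phi> i = Some \<phi>"
      have "fcls \<Gamma> \<phi> \<in> fcls \<Gamma> ` ran \<Phi>" by (rule imageI[OF ranI[of \<Phi>, OF i]])
      from Upper_memD[OF y this image_ran_carrier[OF c fi]]
      have "fcls \<Gamma> \<phi> \<sqsubseteq>\<^bsub>Lind \<Gamma>\<^esub> y" by (rule conjunct1)
      then show "prov \<Gamma> \<phi> \<Psi>" using le_Lind[OF fi[OF i] q(1)] q(2) by simp
    qed
  next
    show "fcls \<Gamma> ` ran \<Phi> \<subseteq> carrier (Lind \<Gamma>)" by (rule image_ran_carrier[OF c]) (rule fi)
  qed (rule LindI[OF f])
qed

lemma greatest_conj: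
  assumes f: "form \<Gamma> (FConj \<Phi>)"
  shows "greatest (Lind \<Gamma>) (fcls \<Gamma> (FConj \<Phi>)) (Lower (Lind \<Gamma>) (fcls \<Gamma> ` ran \<Phi>))"
proof -
  note c = form_ctx[OF f]
  have fi: "form \<Gamma> \<phi>" if "\<Phi> i = Some \<phi>" for i \<phi> using f that by (auto simp: form_conj_iff)
  show ?thesis
  proof (rule greatest_LowerI)
    fix x assume "x \<in> fcls \<Gamma> ` ran \<Phi>"
    then obtain i \<phi> where x: "\<Phi> i = Some \<phi>" "x = fcls \<Gamma> \<phi>" by (auto simp: ran_def)
    show "fcls \<Gamma> (FConj \<Phi>) \<sqsubseteq>\<^bsub>Lind \<Gamma>\<^esub> x"
      unfolding x(2) le_Lind[OF f fi[OF x(1)]] by (rule prov_conj_elim[OF f x(1)])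
  next
    fix y assume y: "y \<in> Lower (Lind \<Gamma>) (fcls \<Gamma> ` ran \<Phi>)"
    then have "y \<in> carrier (Lind \<Gamma>)" by (rule subsetD[OF Lower_closed])
    then obtain \<Psi> where q: "form \<Gamma> \<Psi>" "y = fcls \<Gamma> \<Psi>" using c by (rule LindE)
    show "y \<sqsubseteq>\<^bsub>Lind \<Gamma>\<^esub> fcls \<Gamma> (FConj \<Phi>)"
      unfolding q(2) le_Lind[OF q(1) f]
    proof (rule pv_conj_right[OF f q(1)])
      fix i \<phi> assume i: "\<Phi> i = Some \<phi>"
      have "fcls \<Gamma> \<phi> \<in> fcls \<Gamma> ` ran \<Phi>" by (rule imageI[OF ranI[of \<Phi>, OF i]])
      from Lower_memD[OF y this image_ran_carrier[OF c fi]]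
      have "y \<sqsubseteq>\<^bsub>Lind \<Gamma>\<^esub> fcls \<Gamma> \<phi>" by (rule conjunct1)
      then show "prov \<Gamma> \<Psi> \<phi>" using le_Lind[OF q(1) fi[OF i]] q(2) by simp
    qed
  next
    show "fcls \<Gamma> ` ran \<Phi> \<subseteq> carrier (Lind \<Gamma>)" by (rule image_ran_carrier[OF c]) (rule fi)
  qed (rule LindI[OF f])
qed

lemma sup_Lind: "form \<Gamma> (FDisj \<Phi>) \<Longrightarrow> \<Squnion>\<^bsub>Lind \<Gamma>\<^esub>(fcls \<Gamma> ` ran \<Phi>) = fcls \<Gamma> (FDisj \<Phi>)"
  by (rule partial_order.sup_eqI[OF Lind_order[OF form_ctx] least_disj])

lemma inf_Lind: "form \<Gamma> (FConj \<Phi>) \<Longrightarrow> \<Sqinter>\<^bsub>Lind \<Gamma>\<^esub>(fcls \<Gamma> ` ran \<Phi>) = fcls \<Gamma> (FConj \<Phi>)"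
  by (rule partial_order.inf_eqI[OF Lind_order[OF form_ctx] greatest_conj])

text \<open>Turns a small set of classes into an actual formula: choose a representative of each
  class, and use an injection of the set into \<open>Field l\<close> to index them, since families
  in formulas are indexed by the type of \<open>l\<close>.\<close>

lemma small_family:
  assumes A: "A \<subseteq> carrier (Lind \<Gamma>)" "|A| <o l" and c: "ctx \<Gamma>"
  obtains \<Phi> where "form \<Gamma> (FDisj \<Phi>)" "form \<Gamma> (FConj \<Phi>)" "fcls \<Gamma> ` ran \<Phi> = A"
proof -
  have "Card_order l" using regular_l by (simp add: regular_cardinal_def)
  from ordIso_symmetric[OF card_of_Field_ordIso[OF this]]
  have "|A| \<le>o |Field l|" by (rule ordLeq_ordIso_trans[OF ordLess_imp_ordLeq[OF A(2)]])
  then obtain g where g: "inj_on g A" "g ` A \<subseteq> Field l"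
    using card_of_ordLeq[of A "Field l"] by blast
  have "\<forall>x\<in>A. \<exists>\<phi>. form \<Gamma> \<phi> \<and> fcls \<Gamma> \<phi> = x"
  proof
    fix x assume "x \<in> A"
    then have "x \<in> carrier (Lind \<Gamma>)" using A(1) by (rule subsetD[rotated])
    then obtain \<phi> where "form \<Gamma> \<phi>" "x = fcls \<Gamma> \<phi>" using c by (rule LindE)
    then show "\<exists>\<phi>. form \<Gamma> \<phi> \<and> fcls \<Gamma> \<phi> = x" by (intro exI[of _ \<phi>]) simp
  qed
  from bchoice[OF this] obtain r where r: "\<And>x. x \<in> A \<Longrightarrow> form \<Gamma> (r x)" "\<And>x. x \<in> A \<Longrightarrow> fcls \<Gamma> (r x) = x"
    by blast
  define \<Phi> where "\<Phi> = (\<lambda>i. if i \<in> g ` A then Some (r (inv_into A g i)) else None)"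
  have d: "dom \<Phi> = g ` A" by (auto simp: \<Phi>_def split: if_splits)
  have ran: "ran \<Phi> = r ` A"
  proof -
    have "ran \<Phi> = (\<lambda>i. r (inv_into A g i)) ` g ` A" by (auto simp: ran_def \<Phi>_def)
    also have "\<dots> = r ` A" unfolding image_image by (rule image_cong) (simp_all add: inv_into_f_f[OF g(1)])
    finally show ?thesis .
  qed
  have "|dom \<Phi>| <o l" unfolding d using card_of_image A(2) by (rule ordLeq_ordLess_trans)
  moreover have "form \<Gamma> \<phi>" if "\<Phi> i = Some \<phi>" for i \<phi>
    using ranI[of \<Phi> i \<phi>] that r(1) unfolding ran by auto
  ultimately have "form \<Gamma> (FDisj \<Phi>)" "form \<Gamma> (FConj \<Phi>)" using c by (auto simp: form_disj_iff form_conj_iff)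
  moreover have "fcls \<Gamma> ` ran \<Phi> = A" unfolding ran image_image using r(2) by simp
  ultimately show ?thesis by (rule that)
qed

section \<open>Boolean operations on classes of formulas\<close>

lemma ran_pair: "i \<noteq> j \<Longrightarrow> ran [i \<mapsto> x, j \<mapsto> y] = {x, y}"
  by (auto simp: ran_def)

lemma join_Lind:
  assumes "form \<Gamma> \<Phi>" "form \<Gamma> \<Psi>" "i \<noteq> j"
  shows "fcls \<Gamma> \<Phi> \<squnion>\<^bsub>Lind \<Gamma>\<^esub> fcls \<Gamma> \<Psi> = fcls \<Gamma> (FDisj [i \<mapsto> \<Phi>, j \<mapsto> \<Psi>])"
  using sup_Lind[OF form_binary(2)[OF assms(1,2)], of i j] unfolding join_def ran_pair[OF assms(3)] by simp

lemma meet_Lind: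
  assumes "form \<Gamma> \<Phi>" "form \<Gamma> \<Psi>" "i \<noteq> j"
  shows "fcls \<Gamma> \<Phi> \<sqinter>\<^bsub>Lind \<Gamma>\<^esub> fcls \<Gamma> \<Psi> = fcls \<Gamma> (FConj [i \<mapsto> \<Phi>, j \<mapsto> \<Psi>])"
  using inf_Lind[OF form_binary(1)[OF assms(1,2)], of i j] unfolding meet_def ran_pair[OF assms(3)] by simp

lemma Lind_bounded_lattice:
  assumes c: "ctx \<Gamma>"
  shows "bounded_lattice (Lind \<Gamma>)"
proof -
  interpret partial_order "Lind \<Gamma>" by (rule Lind_order[OF c])
  have small: "|{x, y}| <o l" for x y :: "('s, 'k, 'l) fm set" by (rule finite_less_l) simp
  show ?thesis
  proof
    fix x y assume xy: "x \<in> carrier (Lind \<Gamma>)" "y \<in> carrier (Lind \<Gamma>)"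
    then have "{x, y} \<subseteq> carrier (Lind \<Gamma>)" by simp
    from small_family[OF this small c]
    obtain \<Phi> where \<Phi>: "form \<Gamma> (FDisj \<Phi>)" "form \<Gamma> (FConj \<Phi>)" "fcls \<Gamma> ` ran \<Phi> = {x, y}" .
    show "\<exists>s. least (Lind \<Gamma>) s (Upper (Lind \<Gamma>) {x, y})" using least_disj[OF \<Phi>(1)] \<Phi>(3) by auto
    show "\<exists>s. greatest (Lind \<Gamma>) s (Lower (Lind \<Gamma>) {x, y})" using greatest_conj[OF \<Phi>(2)] \<Phi>(3) by auto
  next
    have "least (Lind \<Gamma>) (fcls \<Gamma> FBot) (carrier (Lind \<Gamma>))"
      unfolding least_def
      using LindI[OF form_bot[OF c]] le_Lind[OF form_bot[OF c]] pv_bot by (auto elim!: LindE[OF _ c])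
    then show "\<exists>b. least (Lind \<Gamma>) b (carrier (Lind \<Gamma>))" by blast
    have "greatest (Lind \<Gamma>) (fcls \<Gamma> FTop) (carrier (Lind \<Gamma>))"
      unfolding greatest_def
      using LindI[OF form_top[OF c]] le_Lind[OF _ form_top[OF c]] pv_top by (auto elim!: LindE[OF _ c])
    then show "\<exists>t. greatest (Lind \<Gamma>) t (carrier (Lind \<Gamma>))" by blast
  qed
qed

lemma top_Lind: "ctx \<Gamma> \<Longrightarrow> \<top>\<^bsub>Lind \<Gamma>\<^esub> = fcls \<Gamma> FTop"
proof -
  assume c: "ctx \<Gamma>"
  interpret bounded_lattice "Lind \<Gamma>" by (rule Lind_bounded_lattice[OF c])
  show ?thesis
  proof (rule top_eq[symmetric])
    show "fcls \<Gamma> FTop \<in> carrier (Lind \<Gamma>)" by (rule LindI[OF form_top[OF c]])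
    fix x assume "x \<in> carrier (Lind \<Gamma>)"
    then obtain \<Phi> where "form \<Gamma> \<Phi>" "x = fcls \<Gamma> \<Phi>" using c by (rule LindE)
    then show "x \<sqsubseteq>\<^bsub>Lind \<Gamma>\<^esub> fcls \<Gamma> FTop" using le_Lind[OF _ form_top[OF c]] pv_top by simp
  qed
qed

lemma bot_Lind: "ctx \<Gamma> \<Longrightarrow> \<bottom>\<^bsub>Lind \<Gamma>\<^esub> = fcls \<Gamma> FBot"
proof -
  assume c: "ctx \<Gamma>"
  interpret bounded_lattice "Lind \<Gamma>" by (rule Lind_bounded_lattice[OF c])
  show ?thesis
  proof (rule bottom_eq[symmetric])
    show "fcls \<Gamma> FBot \<in> carrier (Lind \<Gamma>)" by (rule LindI[OF form_bot[OF c]])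
    fix x assume "x \<in> carrier (Lind \<Gamma>)"
    then obtain \<Phi> where "form \<Gamma> \<Phi>" "x = fcls \<Gamma> \<Phi>" using c by (rule LindE)
    then show "fcls \<Gamma> FBot \<sqsubseteq>\<^bsub>Lind \<Gamma>\<^esub> x" using le_Lind[OF form_bot[OF c]] pv_bot by simp
  qed
qed

lemma Lind_complement_law:
  assumes "form \<Gamma> \<Phi>"
  shows "fcls \<Gamma> \<Phi> \<sqinter>\<^bsub>Lind \<Gamma>\<^esub> fcls \<Gamma> (FNeg \<Phi>) = \<bottom>\<^bsub>Lind \<Gamma>\<^esub>"
    and "fcls \<Gamma> \<Phi> \<squnion>\<^bsub>Lind \<Gamma>\<^esub> fcls \<Gamma> (FNeg \<Phi>) = \<top>\<^bsub>Lind \<Gamma>\<^esub>"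
proof -
  obtain i j :: 'l where ij: "i \<noteq> j" using two_indices by blast
  note c = form_ctx[OF assms]
  have n: "form \<Gamma> (FNeg \<Phi>)" using assms by (simp add: form_neg_iff)
  note b = form_binary[OF assms n, of i j]
  show "fcls \<Gamma> \<Phi> \<sqinter>\<^bsub>Lind \<Gamma>\<^esub> fcls \<Gamma> (FNeg \<Phi>) = \<bottom>\<^bsub>Lind \<Gamma>\<^esub>"
    unfolding meet_Lind[OF assms n ij] bot_Lind[OF c] fcls_eq_iff[OF b(1) form_bot[OF c]]
    using pv_contradiction[OF assms ij] pv_bot[OF b(1)] by blast
  show "fcls \<Gamma> \<Phi> \<squnion>\<^bsub>Lind \<Gamma>\<^esub> fcls \<Gamma> (FNeg \<Phi>) = \<top>\<^bsub>Lind \<Gamma>\<^esub>"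
    unfolding join_Lind[OF assms n ij] top_Lind[OF c] fcls_eq_iff[OF b(2) form_top[OF c]]
    using pv_excluded_middle[OF assms ij] pv_top[OF b(2)] by blast
qed

lemma Lind_boolean:
  assumes c: "ctx \<Gamma>"
  shows "lambda_boolean_algebra l (Lind \<Gamma>)"
  unfolding lambda_boolean_algebra_def
proof (intro conjI ballI allI impI)
  interpret bounded_lattice "Lind \<Gamma>" by (rule Lind_bounded_lattice[OF c])
  show "bounded_lattice (Lind \<Gamma>)" by (rule Lind_bounded_lattice[OF c])
  obtain i j :: 'l where ij: "i \<noteq> j" using two_indices by blast
  show "\<exists>s. least (Lind \<Gamma>) s (Upper (Lind \<Gamma>) A)" if A: "A \<subseteq> carrier (Lind \<Gamma>)" "|A| <o l" for A
  proof -
    obtain \<Phi> where "form \<Gamma> (FDisj \<Phi>)" "fcls \<Gamma> ` ran \<Phi> = A" using small_family[OF A c] .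
    then show ?thesis using least_disj by blast
  qed
  fix x assume x: "x \<in> carrier (Lind \<Gamma>)"
  obtain \<Phi> where p: "form \<Gamma> \<Phi>" "x = fcls \<Gamma> \<Phi>" using x c by (rule LindE)
  show "\<exists>y\<in>carrier (Lind \<Gamma>). x \<sqinter>\<^bsub>Lind \<Gamma>\<^esub> y = \<bottom>\<^bsub>Lind \<Gamma>\<^esub> \<and> x \<squnion>\<^bsub>Lind \<Gamma>\<^esub> y = \<top>\<^bsub>Lind \<Gamma>\<^esub>"
    unfolding p(2)
    by (rule bexI[of _ "fcls \<Gamma> (FNeg \<Phi>)"])
      (use Lind_complement_law[OF p(1)] LindI[of \<Gamma> "FNeg \<Phi>"] p(1) in \<open>simp_all add: form_neg_iff\<close>)
  fix y z assume y: "y \<in> carrier (Lind \<Gamma>)" and z: "z \<in> carrier (Lind \<Gamma>)"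
  obtain \<Psi> where q: "form \<Gamma> \<Psi>" "y = fcls \<Gamma> \<Psi>" using y c by (rule LindE)
  obtain \<Theta> where r: "form \<Gamma> \<Theta>" "z = fcls \<Gamma> \<Theta>" using z c by (rule LindE)
  note f = form_binary(2)[OF q(1) r(1), of i j] form_binary(1)[OF p(1) q(1), of i j]
    form_binary(1)[OF p(1) r(1), of i j]
  show "x \<sqinter>\<^bsub>Lind \<Gamma>\<^esub> (y \<squnion>\<^bsub>Lind \<Gamma>\<^esub> z) = (x \<sqinter>\<^bsub>Lind \<Gamma>\<^esub> y) \<squnion>\<^bsub>Lind \<Gamma>\<^esub> (x \<sqinter>\<^bsub>Lind \<Gamma>\<^esub> z)"
  proof (rule le_antisym)
    show "x \<sqinter>\<^bsub>Lind \<Gamma>\<^esub> (y \<squnion>\<^bsub>Lind \<Gamma>\<^esub> z) \<sqsubseteq>\<^bsub>Lind \<Gamma>\<^esub> (x \<sqinter>\<^bsub>Lind \<Gamma>\<^esub> y) \<squnion>\<^bsub>Lind \<Gamma>\<^esub> (x \<sqinter>\<^bsub>Lind \<Gamma>\<^esub> z)"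
      unfolding p(2) q(2) r(2) join_Lind[OF q(1) r(1) ij] meet_Lind[OF p(1) q(1) ij] meet_Lind[OF p(1) r(1) ij]
        meet_Lind[OF p(1) f(1) ij] join_Lind[OF f(2,3) ij]
        le_Lind[OF form_binary(1)[OF p(1) f(1)] form_binary(2)[OF f(2,3)]]
      by (rule pv_distrib[OF p(1) q(1) r(1) ij])
    \<comment> \<open>This half holds in every lattice; the other one is the rule
      \<open>pv_distrib\<close>.\<close>
    show "(x \<sqinter>\<^bsub>Lind \<Gamma>\<^esub> y) \<squnion>\<^bsub>Lind \<Gamma>\<^esub> (x \<sqinter>\<^bsub>Lind \<Gamma>\<^esub> z) \<sqsubseteq>\<^bsub>Lind \<Gamma>\<^esub> x \<sqinter>\<^bsub>Lind \<Gamma>\<^esub> (y \<squnion>\<^bsub>Lind \<Gamma>\<^esub> z)"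
    proof (rule join_le; (rule meet_le)?)
      show "x \<sqinter>\<^bsub>Lind \<Gamma>\<^esub> y \<sqsubseteq>\<^bsub>Lind \<Gamma>\<^esub> y \<squnion>\<^bsub>Lind \<Gamma>\<^esub> z"
        by (rule le_trans[OF meet_right[OF x y] join_left[OF y z]]) (use x y z in simp_all)
      show "x \<sqinter>\<^bsub>Lind \<Gamma>\<^esub> z \<sqsubseteq>\<^bsub>Lind \<Gamma>\<^esub> y \<squnion>\<^bsub>Lind \<Gamma>\<^esub> z"
        by (rule le_trans[OF meet_right[OF x z] join_right[OF y z]]) (use x y z in simp_all)
    qed (use x y z meet_left in simp_all)
  qed (use x y z in simp_all)
qed

lemma complement_Lind: "form \<Gamma> \<Phi> \<Longrightarrow> complement (Lind \<Gamma>) (fcls \<Gamma> \<Phi>) = fcls \<Gamma> (FNeg \<Phi>)"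
  using lambda_boolean.complement_eqI[OF lambda_booleanI[OF Lind_boolean[OF form_ctx]]]
    Lind_complement_law LindI form_neg_iff by metis

text \<open>Two kinds of representatives have to be eliminated: changing the formula is harmless by
  stability of provability under substitution, changing the arrow by
  \<open>fsubst_sub_eq\<close>.\<close>

lemma Pull_Lind:
  assumes D: "ctx \<Delta>" and G: "ctx \<Gamma>" and t: "sub \<Delta> t \<Gamma>" and f: "form \<Gamma> \<Phi>"
  shows "Pull \<L> (arrow \<Delta> t \<Gamma>) (fcls \<Gamma> \<Phi>) = fcls \<Delta> (fsubst \<Phi> (len \<Delta>) t)"
proof -
  have "equiprovable T l (cls \<Delta>') `` {fsubst \<Psi> (len \<Delta>') t'} = fcls \<Delta> (fsubst \<Phi> (len \<Delta>) t)"
    if a: "(\<Delta>', t', \<Gamma>') \<in> arrow \<Delta> t \<Gamma>" and p: "\<Psi> \<in> fcls \<Gamma> \<Phi>" for \<Delta>' t' \<Gamma>' \<Psi>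
  proof -
    have r: "(\<Delta>, \<Delta>') \<in> context_rel T" "sub_eq \<Delta> t t' \<Gamma>" using a by (auto simp: morphism_rel_iff)
    have pp: "prov \<Gamma> \<Phi> \<Psi>" "prov \<Gamma> \<Psi> \<Phi>" using p unfolding fcls_mem[OF G] by auto
    have f': "form \<Gamma> \<Psi>" using prov_form[OF pp(1)] by blast
    have m: "context_morphism T \<Delta> t \<Gamma>" using D G t by (simp add: morphism_iff)
    note s = sub_eq_right[OF D G r(2)]
    note e = fsubst_sub_eq[OF f' D r(2)] fsubst_sub_eq[OF f' D sub_eq_sym[OF D G r(2)]]
    have "fcls \<Delta> (fsubst \<Psi> (len \<Delta>) t') = fcls \<Delta> (fsubst \<Phi> (len \<Delta>) t)"
      unfolding fcls_eq_iff[OF form_subst[OF f' D s] form_subst[OF f D t]]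
      using pv_subst[OF pp(1) m] pv_subst[OF pp(2) m] e by (blast intro: pv_trans)
    then show ?thesis using cls_eqI[OF r(1)] context_rel_ctx(4)[OF r(1)] by simp
  qed
  then have inner: "(\<Union>\<Psi> \<in> fcls \<Gamma> \<Phi>. equiprovable T l (cls \<Delta>') `` {fsubst \<Psi> (len \<Delta>') t'}) =
      fcls \<Delta> (fsubst \<Phi> (len \<Delta>) t)" if "(\<Delta>', t', \<Gamma>') \<in> arrow \<Delta> t \<Gamma>" for \<Delta>' t' \<Gamma>'
    using that by (intro Union_const[OF fcls_self[OF f]]) blast
  show ?thesis
    unfolding lindenbaum_def bool_functor.simps
  proof (rule Union_const[OF arrow_self[OF D G t]])
    fix a assume a: "a \<in> arrow \<Delta> t \<Gamma>"
    obtain \<Delta>' t' \<Gamma>' where e: "a = (\<Delta>', t', \<Gamma>')" by (cases a)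
    show "(case a of (\<Delta>\<^sub>1, t\<^sub>1, \<Gamma>\<^sub>1) \<Rightarrow> \<Union>\<Psi> \<in> fcls \<Gamma> \<Phi>. equiprovable T l (cls \<Delta>\<^sub>1) `` {fsubst \<Psi> (len \<Delta>\<^sub>1) t\<^sub>1}) =
      fcls \<Delta> (fsubst \<Phi> (len \<Delta>) t)" using inner a unfolding e by simp
  qed
qed

lemma Pull_Lind_hom:
  assumes D: "ctx \<Delta>" and G: "ctx \<Gamma>" and t: "sub \<Delta> t \<Gamma>"
  shows "lambda_boolean_hom l (Lind \<Gamma>) (Lind \<Delta>) (Pull \<L> (arrow \<Delta> t \<Gamma>))"
proof -
  let ?h = "Pull \<L> (arrow \<Delta> t \<Gamma>)" and ?s = "\<lambda>\<Phi>. fsubst \<Phi> (len \<Delta>) t"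
  note P = Pull_Lind[OF D G t]
  have fam: "?h ` fcls \<Gamma> ` ran \<Phi> = fcls \<Delta> ` ran (map_option ?s \<circ> \<Phi>)"
    if "form \<Gamma> (FDisj \<Phi>)" for \<Phi> :: "'l \<Rightarrow> ('s, 'k, 'l) fm option"
  proof -
    have "ran (map_option ?s \<circ> \<Phi>) = ?s ` ran \<Phi>" by (auto simp: ran_def)
    moreover have "?h (fcls \<Gamma> \<phi>) = fcls \<Delta> (?s \<phi>)" if "\<phi> \<in> ran \<Phi>" for \<phi>
      using P \<open>form \<Gamma> (FDisj \<Phi>)\<close> that by (auto simp: form_disj_iff ran_def)
    ultimately show ?thesis by (simp add: image_image)
  qed
  have sup: "?h (\<Squnion>\<^bsub>Lind \<Gamma>\<^esub>A) = \<Squnion>\<^bsub>Lind \<Delta>\<^esub>(?h ` A)"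
    and inf: "?h (\<Sqinter>\<^bsub>Lind \<Gamma>\<^esub>A) = \<Sqinter>\<^bsub>Lind \<Delta>\<^esub>(?h ` A)" if A: "A \<subseteq> carrier (Lind \<Gamma>)" "|A| <o l" for A
  proof -
    obtain \<Phi> where \<Phi>: "form \<Gamma> (FDisj \<Phi>)" "form \<Gamma> (FConj \<Phi>)" "fcls \<Gamma> ` ran \<Phi> = A" using small_family[OF A G] .
    note s = form_subst[OF \<Phi>(1) D t, unfolded fsubst.simps] form_subst[OF \<Phi>(2) D t, unfolded fsubst.simps]
    show "?h (\<Squnion>\<^bsub>Lind \<Gamma>\<^esub>A) = \<Squnion>\<^bsub>Lind \<Delta>\<^esub>(?h ` A)"
      unfolding \<Phi>(3)[symmetric] sup_Lind[OF \<Phi>(1)] P[OF \<Phi>(1)] fam[OF \<Phi>(1)] sup_Lind[OF s(1)] by simp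
    show "?h (\<Sqinter>\<^bsub>Lind \<Gamma>\<^esub>A) = \<Sqinter>\<^bsub>Lind \<Delta>\<^esub>(?h ` A)"
      unfolding \<Phi>(3)[symmetric] inf_Lind[OF \<Phi>(2)] P[OF \<Phi>(2)] fam[OF \<Phi>(1)] inf_Lind[OF s(2)] by simp
  qed
  have small: "|{x, y}| <o l" for x y :: "('s, 'k, 'l) fm set" by (rule finite_less_l) simp
  show ?thesis
    unfolding lambda_boolean_hom_def
  proof (intro conjI ballI allI impI)
    show "?h \<in> carrier (Lind \<Gamma>) \<rightarrow> carrier (Lind \<Delta>)"
      using P LindI[OF form_subst[OF _ D t]] by (auto elim!: LindE[OF _ G])
    show "?h \<top>\<^bsub>Lind \<Gamma>\<^esub> = \<top>\<^bsub>Lind \<Delta>\<^esub>" "?h \<bottom>\<^bsub>Lind \<Gamma>\<^esub> = \<bottom>\<^bsub>Lind \<Delta>\<^esub>"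
      using P[OF form_top[OF G]] P[OF form_bot[OF G]] by (simp_all add: top_Lind bot_Lind D G)
    show "?h (\<Squnion>\<^bsub>Lind \<Gamma>\<^esub>A) = \<Squnion>\<^bsub>Lind \<Delta>\<^esub>(?h ` A)" if "A \<subseteq> carrier (Lind \<Gamma>)" "|A| <o l" for A
      using sup[OF that] .
    fix x y assume "x \<in> carrier (Lind \<Gamma>)" "y \<in> carrier (Lind \<Gamma>)"
    then have "{x, y} \<subseteq> carrier (Lind \<Gamma>)" by simp
    from sup[OF this small] inf[OF this small]
    show "?h (x \<squnion>\<^bsub>Lind \<Gamma>\<^esub> y) = ?h x \<squnion>\<^bsub>Lind \<Delta>\<^esub> ?h y" "?h (x \<sqinter>\<^bsub>Lind \<Gamma>\<^esub> y) = ?h x \<sqinter>\<^bsub>Lind \<Delta>\<^esub> ?h y"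
      unfolding join_def meet_def by simp_all
  qed
qed

section \<open>The Lindenbaum functor and its existential quantifiers\<close>

lemma ArrE:
  assumes "f \<in> Arr \<C>"
  obtains \<Gamma> t \<Omega> where "ctx \<Gamma>" "ctx \<Omega>" "sub \<Gamma> t \<Omega>" "f = arrow \<Gamma> t \<Omega>"
  using assms Arr_iff by blast

lemma Lind_functor: "boolean_functor \<C> l \<L>"
proof -
  interpret category \<C> by (rule syntactic_category)
  show ?thesis
  proof
    fix X assume "X \<in> Obj \<C>"
    then obtain \<Gamma> where G: "ctx \<Gamma>" "X = cls \<Gamma>" by (rule ObjE)
    then show "lambda_boolean_algebra l (Fibre \<L> X)" using Lind_boolean by simp
    fix x assume "x \<in> carrier (Fibre \<L> X)"
    then obtain \<Phi> where p: "form \<Gamma> \<Phi>" "x = fcls \<Gamma> \<Phi>" unfolding G(2) using G(1) by (rule LindE)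
    show "Pull \<L> (Ide \<C> X) x = x"
      unfolding p(2) G(2) Ide_cls[OF G(1)] Pull_Lind[OF G(1,1) vars_sub[OF G(1)] p(1)] fsubst_vars[OF p(1)] ..
  next
    fix f assume "f \<in> Arr \<C>"
    then obtain \<Gamma> t \<Omega> where f: "ctx \<Gamma>" "ctx \<Omega>" "sub \<Gamma> t \<Omega>" "f = arrow \<Gamma> t \<Omega>" by (rule ArrE)
    show "lambda_boolean_hom l (Fibre \<L> (Cod \<C> f)) (Fibre \<L> (Dom \<C> f)) (Pull \<L> f)"
      unfolding f(4) Dom_arrow[OF f(1-3)] Cod_arrow[OF f(1-3)] by (rule Pull_Lind_hom[OF f(1-3)])
  next
    fix f g X Y Z x assume f: "f \<in> Hom \<C> X Y" and g: "g \<in> Hom \<C> Y Z" and x: "x \<in> carrier (Fibre \<L> Z)"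
    obtain \<Gamma> \<Omega> where o: "ctx \<Gamma>" "ctx \<Omega>" "X = cls \<Gamma>" "Y = cls \<Omega>" using Hom_ctx[OF f] .
    obtain \<Xi> where o': "ctx \<Xi>" "Z = cls \<Xi>" using Hom_ctx[OF g] by metis
    obtain t where t: "sub \<Gamma> t \<Omega>" "f = arrow \<Gamma> t \<Omega>" using hom_obtain[OF f[unfolded o(3,4)] o(1,2)] .
    obtain s where s: "sub \<Omega> s \<Xi>" "g = arrow \<Omega> s \<Xi>" using hom_obtain[OF g[unfolded o(4) o'(2)] o(2) o'(1)] .
    obtain \<Phi> where p: "form \<Xi> \<Phi>" "x = fcls \<Xi> \<Phi>" using x o'(1) unfolding o'(2) by (rule LindE)
    note st = sub_comp[OF o(1) t(1) o'(1) s(1)]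
    show "Pull \<L> (Comp \<C> g f) x = Pull \<L> f (Pull \<L> g x)"
      unfolding p(2) t(2) s(2) Comp_arrow[OF o(1,2) o'(1) t(1) s(1)] Pull_Lind[OF o(1) o'(1) st p(1)]
        Pull_Lind[OF o(2) o'(1) s(1) p(1)] Pull_Lind[OF o(1,2) t(1) form_subst[OF p(1) o(2) s(1)]]
        fsubst_fsubst[OF p(1) o(2) s(1) o(1) t(1)] ..
  qed
qed

text \<open>
  There is no quantifier over an empty tail, but the identity is a display map.
\<close>

definition quantify :: "'k \<Rightarrow> ('s, 'k) premise \<Rightarrow> ('s, 'k, 'l) fm \<Rightarrow> ('s, 'k, 'l) fm" where
  "quantify \<gamma> \<Gamma> \<Phi> = (if \<gamma> < len \<Gamma> then FEx (tail_seg \<gamma> \<Gamma>) \<Phi> else \<Phi>)"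

lemma form_quantify: "\<lbrakk>form \<Gamma>' \<Phi>; \<gamma> \<le> len \<Gamma>'\<rbrakk> \<Longrightarrow> form (init_seg \<gamma> \<Gamma>') (quantify \<gamma> \<Gamma>' \<Phi>)"
  using form_exI[OF form_ctx] init_all[OF ctx_seq[OF form_ctx]] by (auto simp: quantify_def)

text \<open>For a nonempty tail these are the two rules for the existential quantifier; for an empty
  one, weakening is substitution along the identity.\<close>

lemma quantify_adjoint:
  assumes f: "form \<Gamma>' \<Phi>" and le: "\<gamma> \<le> len \<Gamma>'" and g: "form (init_seg \<gamma> \<Gamma>') \<Psi>"
  shows "prov (init_seg \<gamma> \<Gamma>') (quantify \<gamma> \<Gamma>' \<Phi>) \<Psi> \<longleftrightarrow> prov \<Gamma>' \<Phi> (weaken \<Gamma>' \<gamma> \<Psi>)"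
proof (cases "\<gamma> < len \<Gamma>'")
  case True
  have c: "is_context T \<Gamma>'" using form_ctx[OF f] by (simp add: is_context_iff)
  show ?thesis
    using True pv_ex_left[OF c True f g] pv_ex_inv[OF c True f g] by (auto simp: quantify_def)
next
  case False
  then have "init_seg \<gamma> \<Gamma>' = \<Gamma>'" using init_all[OF ctx_seq[OF form_ctx[OF f]]] by simp
  then show ?thesis using False fsubst_vars[of \<Gamma>' \<Psi>] g by (simp add: quantify_def weaken_def)
qed

lemma display_Pull:
  "\<lbrakk>ctx \<Gamma>'; form (init_seg \<gamma> \<Gamma>') \<Psi>\<rbrakk> \<Longrightarrow>
    Pull \<L> (display \<Gamma>' \<gamma>) (fcls (init_seg \<gamma> \<Gamma>') \<Psi>) = fcls \<Gamma>' (weaken \<Gamma>' \<gamma> \<Psi>)"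
  unfolding weaken_def by (rule Pull_Lind[OF _ ctx_init display_sub])

lemma exists_display:
  assumes G: "ctx \<Gamma>'" and le: "\<gamma> \<le> len \<Gamma>'"
  shows "\<exists>e. exists_adjoint \<C> \<L> (display \<Gamma>' \<gamma>) e"
    and "form \<Gamma>' \<Phi> \<Longrightarrow> exists_along \<C> \<L> (display \<Gamma>' \<gamma>) (fcls \<Gamma>' \<Phi>) = fcls (init_seg \<gamma> \<Gamma>') (quantify \<gamma> \<Gamma>' \<Phi>)"
proof -
  interpret F: boolean_functor \<C> l \<L> by (rule Lind_functor)
  \<comment> \<open>An adjoint must act on classes, so a representative is chosen. That every
    representative gives the same result follows afterwards from the adjunction itself.\<close>
  let ?e = "\<lambda>x. fcls (init_seg \<gamma> \<Gamma>') (quantify \<gamma> \<Gamma>' (SOME \<Phi>. form \<Gamma>' \<Phi> \<and> x = fcls \<Gamma>' \<Phi>))"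
  have c: "ctx (init_seg \<gamma> \<Gamma>')" by (rule ctx_init[OF G])
  have some: "form \<Gamma>' (SOME \<Phi>. form \<Gamma>' \<Phi> \<and> x = fcls \<Gamma>' \<Phi>) \<and> x = fcls \<Gamma>' (SOME \<Phi>. form \<Gamma>' \<Phi> \<and> x = fcls \<Gamma>' \<Phi>)"
    if x: "x \<in> carrier (Lind \<Gamma>')" for x
  proof (rule someI_ex)
    show "\<exists>\<Phi>. form \<Gamma>' \<Phi> \<and> x = fcls \<Gamma>' \<Phi>" using LindE[OF x G] by blast
  qed
  have ex: "exists_adjoint \<C> \<L> (display \<Gamma>' \<gamma>) ?e"
    unfolding F.exists_adjoint_iff[OF display_hom[OF G]]
  proof (intro conjI ballI funcsetI)
    fix z assume z: "z \<in> carrier (Lind \<Gamma>')"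
    let ?\<Phi> = "SOME \<Phi>. form \<Gamma>' \<Phi> \<and> z = fcls \<Gamma>' \<Phi>"
    note s = some[OF z]
    note q = form_quantify[OF conjunct1[OF s] le]
    show "?e z \<in> carrier (Lind (init_seg \<gamma> \<Gamma>'))" by (rule LindI[OF q])
    fix x assume x: "x \<in> carrier (Lind (init_seg \<gamma> \<Gamma>'))"
    obtain \<Psi> where p: "form (init_seg \<gamma> \<Gamma>') \<Psi>" "x = fcls (init_seg \<gamma> \<Gamma>') \<Psi>" using x c by (rule LindE)
    have "?e z \<sqsubseteq>\<^bsub>Lind (init_seg \<gamma> \<Gamma>')\<^esub> x \<longleftrightarrow> prov \<Gamma>' ?\<Phi> (weaken \<Gamma>' \<gamma> \<Psi>)"
      unfolding p(2) le_Lind[OF q p(1)] by (rule quantify_adjoint[OF conjunct1[OF s] le p(1)])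
    also have "\<dots> \<longleftrightarrow> fcls \<Gamma>' ?\<Phi> \<sqsubseteq>\<^bsub>Lind \<Gamma>'\<^esub> Pull \<L> (display \<Gamma>' \<gamma>) x"
      unfolding p(2) display_Pull[OF G p(1)] le_Lind[OF conjunct1[OF s] form_weaken[OF G p(1)]] ..
    finally show "?e z \<sqsubseteq>\<^bsub>Lind (init_seg \<gamma> \<Gamma>')\<^esub> x \<longleftrightarrow> z \<sqsubseteq>\<^bsub>Lind \<Gamma>'\<^esub> Pull \<L> (display \<Gamma>' \<gamma>) x"
      using conjunct2[OF s] by simp
  qed
  then show "\<exists>e. exists_adjoint \<C> \<L> (display \<Gamma>' \<gamma>) e" by blast
  assume f: "form \<Gamma>' \<Phi>"
  let ?q = "quantify \<gamma> \<Gamma>' \<Phi>" and ?x = "exists_along \<C> \<L> (display \<Gamma>' \<gamma>) (fcls \<Gamma>' \<Phi>)"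
  note q = form_quantify[OF f le]
  interpret I: partial_order "Lind (init_seg \<gamma> \<Gamma>')" by (rule Lind_order[OF c])
  note H = display_hom[OF G]
  have xc: "?x \<in> carrier (Lind (init_seg \<gamma> \<Gamma>'))" by (rule F.exists_along_closed[OF H ex LindI[OF f]])
  \<comment> \<open>Both candidates lie below the same classes, so testing each against the other
    yields equality.\<close>
  have key: "?x \<sqsubseteq>\<^bsub>Lind (init_seg \<gamma> \<Gamma>')\<^esub> fcls (init_seg \<gamma> \<Gamma>') \<Psi> \<longleftrightarrow> prov (init_seg \<gamma> \<Gamma>') ?q \<Psi>"
    if p: "form (init_seg \<gamma> \<Gamma>') \<Psi>" for \<Psi>
    unfolding F.exists_along_le[OF H ex LindI[OF f] LindI[OF p]] display_Pull[OF G p]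
      le_Lind[OF f form_weaken[OF G p]] quantify_adjoint[OF f le p] ..
  obtain \<Psi> where p: "form (init_seg \<gamma> \<Gamma>') \<Psi>" "?x = fcls (init_seg \<gamma> \<Gamma>') \<Psi>" using xc c by (rule LindE)
  show "?x = fcls (init_seg \<gamma> \<Gamma>') ?q"
  proof (rule I.le_antisym[OF _ _ xc LindI[OF q]])
    show "?x \<sqsubseteq>\<^bsub>Lind (init_seg \<gamma> \<Gamma>')\<^esub> fcls (init_seg \<gamma> \<Gamma>') ?q" using key[OF q] pv_refl[OF q] by simp
    have "prov (init_seg \<gamma> \<Gamma>') ?q \<Psi>" using key[OF p(1)] I.le_refl[OF xc] p(2) by simp
    then show "fcls (init_seg \<gamma> \<Gamma>') ?q \<sqsubseteq>\<^bsub>Lind (init_seg \<gamma> \<Gamma>')\<^esub> ?x"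
      unfolding p(2) le_Lind[OF q p(1)] .
  qed
qed

text \<open>Adds the case of an empty tail, in which the pullback context has the length of
  \<open>\<Delta>\<close> and the lift is \<open>t\<close> itself.\<close>

lemma fsubst_quantify:
  assumes X: "ctx \<Gamma>'" "\<gamma> \<le> len \<Gamma>'" "ctx \<Delta>" "sub \<Delta> t (init_seg \<gamma> \<Gamma>')"
  defines "P \<equiv> pullback_ctx \<Delta> t (tail_seg \<gamma> \<Gamma>')" and "L \<equiv> lift (len \<Delta>) t (tail_seg \<gamma> \<Gamma>')"
  shows "fsubst (quantify \<gamma> \<Gamma>' \<Phi>) (len \<Delta>) t = quantify (len \<Delta>) P (fsubst \<Phi> (len P) L)"
proof (cases "\<gamma> < len \<Gamma>'")
  case True
  have "len \<Delta> < len P" using less_len_pullback[OF X(1) True X(3,4)] by (simp add: P_def)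
  then show ?thesis using True fsubst_quantifier(1)[OF X, of \<Phi>] by (simp add: quantify_def P_def L_def)
next
  case False
  then have g: "\<gamma> = len \<Gamma>'" using X(2) by simp
  have l: "len P = len \<Delta>" using len_pullback[OF X] shift_rules(5) g by (simp add: P_def)
  have "init_seg \<gamma> L = L"
    using len_lift[OF X] dom_lift[OF X] seq_dom[OF ctx_seq[OF X(1)]] g
    by (simp add: init_all is_seqI L_def)
  then have "L = t" using init_lift[OF X] by (simp add: L_def)
  then show ?thesis using False l by (simp add: quantify_def)
qed

lemma Lind_display_functor: "display_boolean_functor \<C> (display_maps T) l \<L>"
proof -
  interpret F: boolean_functor \<C> l \<L> by (rule Lind_functor)
  interpret D: display_category \<C> "display_maps T" by (rule display_category)
  show ?thesis
  proof
    fix p assume "p \<in> display_maps T"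
    then obtain \<Gamma>' \<gamma> where P: "ctx \<Gamma>'" "\<gamma> \<le> len \<Gamma>'" "p = display \<Gamma>' \<gamma>" by (rule display_mapsE)
    show "\<exists>e. exists_adjoint \<C> \<L> p e" unfolding P(3) by (rule exists_display(1)[OF P(1,2)])
    fix f assume f: "f \<in> Arr \<C>" "Cod \<C> f = Cod \<C> p"
    have "Cod \<C> f = cls (init_seg \<gamma> \<Gamma>')" using f(2) F.HomD(3)[OF display_hom[OF P(1)]] P(3) by simp
    then have fH: "f \<in> Hom \<C> (Dom \<C> f) (cls (init_seg \<gamma> \<Gamma>'))" using F.arr_hom[OF f(1)] by simp
    obtain \<Delta> where D: "ctx \<Delta>" "Dom \<C> f = cls \<Delta>" using Hom_ctx[OF fH] .
    obtain t where t: "sub \<Delta> t (init_seg \<gamma> \<Gamma>')" "f = arrow \<Delta> t (init_seg \<gamma> \<Gamma>')"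
      using hom_obtain[OF fH[unfolded D(2)] D(1) ctx_init[OF P(1)]] .
    note X = P(1,2) D(1) t(1)
    let ?P = "pullback_ctx \<Delta> t (tail_seg \<gamma> \<Gamma>')" and ?L = "lift (len \<Delta>) t (tail_seg \<gamma> \<Gamma>')"
    note PP = pullback_ctx[OF X] len_le_pullback[OF X]
    show "\<exists>p' \<in> display_maps T. \<exists>f'. pullback_square \<C> p f p' f' \<and>
        (\<forall>z \<in> carrier (Fibre \<L> (Dom \<C> p)).
          Pull \<L> f (exists_along \<C> \<L> p z) = exists_along \<C> \<L> p' (Pull \<L> f' z))"
    proof (intro bexI exI conjI ballI)
      show "display ?P (len \<Delta>) \<in> display_maps T" by (rule display_mapsI[OF PP])
      show "pullback_square \<C> p f (display ?P (len \<Delta>)) (arrow ?P ?L \<Gamma>')"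
        unfolding P(3) t(2) by (rule canonical_pullback[OF X])
      fix z assume "z \<in> carrier (Fibre \<L> (Dom \<C> p))"
      then have "z \<in> carrier (Lind \<Gamma>')" unfolding P(3) F.HomD(2)[OF display_hom[OF P(1)]] .
      then obtain \<Phi> where p: "form \<Gamma>' \<Phi>" "z = fcls \<Gamma>' \<Phi>" using P(1) by (rule LindE)
      note f' = form_subst[OF p(1) PP(1) lift_sub[OF X]]
      show "Pull \<L> f (exists_along \<C> \<L> p z) = exists_along \<C> \<L> (display ?P (len \<Delta>)) (Pull \<L> (arrow ?P ?L \<Gamma>') z)"
        unfolding p(2) P(3) t(2) exists_display(2)[OF P(1,2) p(1)]
          Pull_Lind[OF D(1) ctx_init[OF P(1)] t(1) form_quantify[OF p(1) P(2)]]
          Pull_Lind[OF PP(1) P(1) lift_sub[OF X] p(1)] fsubst_quantify[OF X] init_pullback[OF X]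
          exists_display(2)[OF PP f', unfolded init_pullback[OF X]] ..
    qed
  qed
qed

end

section \<open>Interpretation of formulas in a boolean algebra over the clan\<close>

context formula_theory
begin

text \<open>Double negation is computed in the Boolean algebra of classes, where taking complements
  is an involution, instead of being derived in the calculus.\<close>

lemma prov_neg_swap:
  assumes "form \<Gamma> \<Psi>" "prov \<Gamma> \<Phi> (FNeg \<Psi>)"
  shows "prov \<Gamma> \<Psi> (FNeg \<Phi>)"
proof -
  interpret lambda_boolean "Lind \<Gamma>" l by (rule lambda_booleanI[OF Lind_boolean[OF form_ctx[OF assms(1)]]])
  have f: "form \<Gamma> \<Phi>" using prov_form[OF assms(2)] by blast
  have n: "form \<Gamma> (FNeg \<Phi>)" "form \<Gamma> (FNeg \<Psi>)" "form \<Gamma> (FNeg (FNeg \<Psi>))"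
    using f assms(1) by (simp_all add: form_neg_iff)
  have "fcls \<Gamma> \<Psi> = fcls \<Gamma> (FNeg (FNeg \<Psi>))"
    using complement_complement[OF LindI[OF assms(1)]]
    unfolding complement_Lind[OF assms(1)] complement_Lind[OF n(2)] by simp
  then have "prov \<Gamma> \<Psi> (FNeg (FNeg \<Psi>))" unfolding fcls_eq_iff[OF assms(1) n(3)] by simp
  then show ?thesis using prov_contrapos[OF assms(2)] by (rule pv_trans)
qed

lemma prov_neg_neg: "form \<Gamma> \<Phi> \<Longrightarrow> prov \<Gamma> (FNeg (FNeg \<Phi>)) \<Phi>"
proof -
  assume f: "form \<Gamma> \<Phi>"
  interpret lambda_boolean "Lind \<Gamma>" l by (rule lambda_booleanI[OF Lind_boolean[OF form_ctx[OF f]]])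
  have n: "form \<Gamma> (FNeg \<Phi>)" "form \<Gamma> (FNeg (FNeg \<Phi>))" using f by (simp_all add: form_neg_iff)
  have "fcls \<Gamma> (FNeg (FNeg \<Phi>)) = fcls \<Gamma> \<Phi>"
    using complement_complement[OF LindI[OF f]] unfolding complement_Lind[OF f] complement_Lind[OF n(1)] .
  then show ?thesis unfolding fcls_eq_iff[OF n(2) f] by simp
qed

text \<open>Morphisms are not asked to respect universal quantifiers; this identity determines their
  values from complements and existential ones. Each direction is the adjunction of one quantifier
  combined with contraposition.\<close>

lemma forall_via_exists:
  assumes f: "form \<Gamma>' \<Phi>" and less: "\<gamma> < len \<Gamma>'"
  shows "fcls (init_seg \<gamma> \<Gamma>') (FAll (tail_seg \<gamma> \<Gamma>') \<Phi>) =
    fcls (init_seg \<gamma> \<Gamma>') (FNeg (FEx (tail_seg \<gamma> \<Gamma>') (FNeg \<Phi>)))"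
proof -
  let ?A = "FAll (tail_seg \<gamma> \<Gamma>') \<Phi>" and ?X = "FEx (tail_seg \<gamma> \<Gamma>') (FNeg \<Phi>)"
  have c: "ctx \<Gamma>'" "is_context T \<Gamma>'" using form_ctx[OF f] by (simp_all add: is_context_iff)
  have n: "form \<Gamma>' (FNeg \<Phi>)" using f by (simp add: form_neg_iff)
  have A: "form (init_seg \<gamma> \<Gamma>') ?A" by (rule form_allI[OF c(1) less f])
  have X: "form (init_seg \<gamma> \<Gamma>') ?X" by (rule form_exI[OF c(1) less n])
  have nX: "form (init_seg \<gamma> \<Gamma>') (FNeg ?X)" "form (init_seg \<gamma> \<Gamma>') (FNeg ?A)" using X A by (simp_all add: form_neg_iff)
  have w: "weaken \<Gamma>' \<gamma> (FNeg \<Psi>) = FNeg (weaken \<Gamma>' \<gamma> \<Psi>)" for \<Psi> :: "('s, 'k, 'l) fm" by (simp add: weaken_def)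
  have "prov \<Gamma>' (weaken \<Gamma>' \<gamma> ?A) \<Phi>" by (rule pv_all_inv[OF c(2) less f A pv_refl[OF A]])
  then have "prov \<Gamma>' (FNeg \<Phi>) (weaken \<Gamma>' \<gamma> (FNeg ?A))" unfolding w by (rule prov_contrapos)
  then have "prov (init_seg \<gamma> \<Gamma>') ?X (FNeg ?A)" by (rule pv_ex_left[OF c(2) less n nX(2)])
  then have 1: "prov (init_seg \<gamma> \<Gamma>') ?A (FNeg ?X)" by (rule prov_neg_swap[OF A])
  have "prov \<Gamma>' (FNeg \<Phi>) (weaken \<Gamma>' \<gamma> ?X)" by (rule pv_ex_inv[OF c(2) less n X pv_refl[OF X]])
  then have "prov \<Gamma>' (weaken \<Gamma>' \<gamma> (FNeg ?X)) (FNeg (FNeg \<Phi>))" unfolding w by (rule prov_contrapos)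
  then have "prov \<Gamma>' (weaken \<Gamma>' \<gamma> (FNeg ?X)) \<Phi>" using prov_neg_neg[OF f] by (rule pv_trans)
  then have "prov (init_seg \<gamma> \<Gamma>') (FNeg ?X) ?A" by (rule pv_all_right[OF c(2) less f nX(1)])
  with 1 show ?thesis unfolding fcls_eq_iff[OF A nX(1)] by blast
qed

end

lemma lambda_boolean_hom_sup:
  "\<lbrakk>lambda_boolean_hom l L M h; A \<subseteq> carrier L; |A| <o l\<rbrakk> \<Longrightarrow> h (\<Squnion>\<^bsub>L\<^esub>A) = \<Squnion>\<^bsub>M\<^esub>(h ` A)"
  unfolding lambda_boolean_hom_def by blast

locale clan_model = formula_theory T l
  for T :: "('s, 'k::wellorder) pretheory" and l :: "'l rel" +
  fixes B :: "(('s, 'k) premise set, ('s, 'k) arrow set, 'b) bool_functor"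
  assumes model: "boolean_algebra_over_clan (syntactic_category T) (syntactic_fibrations T) l B"
begin

sublocale M: boolean_algebra_over_clan \<C> "syntactic_fibrations T" l B
  by (rule model)

sublocale F: boolean_functor \<C> l B
  by (rule M.boolean_functor)

abbreviation "Fib \<Gamma> \<equiv> Fibre B (cls \<Gamma>)"

text \<open>
  Morphisms are only required to preserve joins and \<open>\<exists>\<close>, whence the De Morgan duals for conjunctions
  and \<open>\<forall>\<close>.
\<close>

primrec interp :: "('s, 'k, 'l) fm \<Rightarrow> ('s, 'k) premise \<Rightarrow> 'b" where
  "interp FTop \<Gamma> = \<top>\<^bsub>Fib \<Gamma>\<^esub>"
| "interp FBot \<Gamma> = \<bottom>\<^bsub>Fib \<Gamma>\<^esub>"
| "interp (FNeg \<Phi>) \<Gamma> = complement (Fib \<Gamma>) (interp \<Phi> \<Gamma>)"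
| "interp (FDisj \<Phi>) \<Gamma> = \<Squnion>\<^bsub>Fib \<Gamma>\<^esub>(ran (map_option (\<lambda>\<phi>. interp \<phi> \<Gamma>) \<circ> \<Phi>))"
| "interp (FConj \<Phi>) \<Gamma> = complement (Fib \<Gamma>)
     (\<Squnion>\<^bsub>Fib \<Gamma>\<^esub>(complement (Fib \<Gamma>) ` ran (map_option (\<lambda>\<phi>. interp \<phi> \<Gamma>) \<circ> \<Phi>)))"
| "interp (FEx E \<Phi>) \<Gamma> = exists_along \<C> B (display (\<Gamma> ++ E) (len \<Gamma>)) (interp \<Phi> (\<Gamma> ++ E))"
| "interp (FAll E \<Phi>) \<Gamma> = complement (Fib \<Gamma>) (exists_along \<C> B (display (\<Gamma> ++ E) (len \<Gamma>))
     (complement (Fib (\<Gamma> ++ E)) (interp \<Phi> (\<Gamma> ++ E))))"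

lemma Fib_boolean: "ctx \<Gamma> \<Longrightarrow> lambda_boolean_algebra l (Fib \<Gamma>)"
  by (rule F.fibre_boolean[OF Obj_cls])

lemma Fib_locale: "ctx \<Gamma> \<Longrightarrow> lambda_boolean (Fib \<Gamma>) l"
  by (rule lambda_booleanI[OF Fib_boolean])

section \<open>Values of formulas and their behaviour under substitution\<close>

lemma interp_quantifier:
  assumes "ctx \<Gamma>'" "\<gamma> < len \<Gamma>'"
  shows "interp (FEx (tail_seg \<gamma> \<Gamma>') \<Phi>) (init_seg \<gamma> \<Gamma>') = exists_along \<C> B (display \<Gamma>' \<gamma>) (interp \<Phi> \<Gamma>')"
    and "interp (FAll (tail_seg \<gamma> \<Gamma>') \<Phi>) (init_seg \<gamma> \<Gamma>') = complement (Fib (init_seg \<gamma> \<Gamma>'))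
      (exists_along \<C> B (display \<Gamma>' \<gamma>) (complement (Fib \<Gamma>') (interp \<Phi> \<Gamma>')))"
  using len_init[OF ctx_seq[OF assms(1)], of \<gamma>] assms(2) by (simp_all add: init_tail)

lemma display_adjoint:
  assumes "ctx \<Gamma>'" "\<gamma> \<le> len \<Gamma>'"
  obtains e where "exists_adjoint \<C> B (display \<Gamma>' \<gamma>) e"
proof -
  show ?thesis using M.has_exists[OF display_fibration[OF assms]] that by blast
qed

lemma exists_display_closed:
  assumes "ctx \<Gamma>'" "\<gamma> \<le> len \<Gamma>'" "x \<in> carrier (Fib \<Gamma>')"
  shows "exists_along \<C> B (display \<Gamma>' \<gamma>) x \<in> carrier (Fib (init_seg \<gamma> \<Gamma>'))"
proof -
  obtain e where "exists_adjoint \<C> B (display \<Gamma>' \<gamma>) e" using display_adjoint[OF assms(1,2)] .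
  from F.exists_along_closed[OF display_hom[OF assms(1)] this assms(3)] show ?thesis .
qed

lemma exists_display_le:
  assumes "ctx \<Gamma>'" "\<gamma> \<le> len \<Gamma>'" "x \<in> carrier (Fib \<Gamma>')" "y \<in> carrier (Fib (init_seg \<gamma> \<Gamma>'))"
  shows "exists_along \<C> B (display \<Gamma>' \<gamma>) x \<sqsubseteq>\<^bsub>Fib (init_seg \<gamma> \<Gamma>')\<^esub> y \<longleftrightarrow> x \<sqsubseteq>\<^bsub>Fib \<Gamma>'\<^esub> Pull B (display \<Gamma>' \<gamma>) y"
proof -
  obtain e where "exists_adjoint \<C> B (display \<Gamma>' \<gamma>) e" using display_adjoint[OF assms(1,2)] .
  from F.exists_along_le[OF display_hom[OF assms(1)] this assms(3,4)] show ?thesis .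
qed

lemma ran_interp: "ran (map_option (\<lambda>\<phi>. interp \<phi> \<Gamma>) \<circ> \<Phi>) = (\<lambda>\<phi>. interp \<phi> \<Gamma>) ` ran \<Phi>"
  by (auto simp: ran_def)

lemma card_ran: "|dom \<Phi>| <o l \<Longrightarrow> |f ` ran \<Phi>| <o l"
proof -
  assume d: "|dom \<Phi>| <o l"
  have "ran \<Phi> = (the \<circ> \<Phi>) ` dom \<Phi>" by (force simp: ran_def)
  then have "f ` ran \<Phi> = (f \<circ> (the \<circ> \<Phi>)) ` dom \<Phi>" by (simp only: image_comp)
  then have "|f ` ran \<Phi>| \<le>o |dom \<Phi>|" using card_of_image by metis
  then show ?thesis using d by (rule ordLeq_ordLess_trans)
qed

lemma interp_closed: "form \<Gamma> \<Phi> \<Longrightarrow> interp \<Phi> \<Gamma> \<in> carrier (Fib \<Gamma>)"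
proof (induction rule: formula.induct)
  case (top \<Gamma>)
  then interpret lambda_boolean "Fib \<Gamma>" l using Fib_locale is_context_iff by blast
  show ?case by simp
next
  case (bot \<Gamma>)
  then interpret lambda_boolean "Fib \<Gamma>" l using Fib_locale is_context_iff by blast
  show ?case by simp
next
  case (neg \<Gamma> \<Phi>)
  interpret lambda_boolean "Fib \<Gamma>" l by (rule Fib_locale[OF form_ctx[OF neg.hyps]])
  show ?case using neg.IH complement_closed by simp
next
  case (disj \<Gamma> \<Phi>)
  then interpret lambda_boolean "Fib \<Gamma>" l using Fib_locale is_context_iff by blast
  have "(\<lambda>\<phi>. interp \<phi> \<Gamma>) ` ran \<Phi> \<subseteq> carrier (Fib \<Gamma>)" using disj.IH by (auto simp: ran_def)
  then show ?case unfolding interp.simps ran_interp by (rule sup_carrier[OF _ card_ran[OF disj.hyps(2)]])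
next
  case (conj \<Gamma> \<Phi>)
  then interpret lambda_boolean "Fib \<Gamma>" l using Fib_locale is_context_iff by blast
  have "(\<lambda>\<phi>. interp \<phi> \<Gamma>) ` ran \<Phi> \<subseteq> carrier (Fib \<Gamma>)" using conj.IH by (auto simp: ran_def)
  then show ?case unfolding interp.simps ran_interp
    by (rule small_meet_closed[OF _ card_ran[OF conj.hyps(2)], unfolded small_meet_def])
next
  case (ex \<Gamma>' \<gamma> \<Phi>)
  then have c: "ctx \<Gamma>'" by (simp add: is_context_iff)
  show ?case unfolding interp_quantifier[OF c ex.hyps(2)]
    by (rule exists_display_closed[OF c less_imp_le[OF ex.hyps(2)] ex.IH])
next
  case (all \<Gamma>' \<gamma> \<Phi>)
  then have c: "ctx \<Gamma>'" by (simp add: is_context_iff)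
  interpret G: lambda_boolean "Fib \<Gamma>'" l by (rule Fib_locale[OF c])
  interpret I: lambda_boolean "Fib (init_seg \<gamma> \<Gamma>')" l by (rule Fib_locale[OF ctx_init[OF c]])
  show ?case unfolding interp_quantifier[OF c all.hyps(2)]
    by (rule I.complement_closed[OF exists_display_closed[OF c less_imp_le[OF all.hyps(2)]
            G.complement_closed[OF all.IH]]])
qed

lemma interp_image_carrier:
  assumes "\<And>i \<phi>. \<Phi> i = Some \<phi> \<Longrightarrow> form \<Gamma> \<phi>"
  shows "(\<lambda>\<phi>. interp \<phi> \<Gamma>) ` ran \<Phi> \<subseteq> carrier (Fib \<Gamma>)"
  using interp_closed assms by (auto simp: ran_def)

lemma beck_chevalley_display:
  assumes X: "ctx \<Gamma>'" "\<gamma> \<le> len \<Gamma>'" "ctx \<Delta>" "sub \<Delta> t (init_seg \<gamma> \<Gamma>')" and x: "x \<in> carrier (Fib \<Gamma>')"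
  defines "P \<equiv> pullback_ctx \<Delta> t (tail_seg \<gamma> \<Gamma>')" and "L \<equiv> lift (len \<Delta>) t (tail_seg \<gamma> \<Gamma>')"
  shows "Pull B (arrow \<Delta> t (init_seg \<gamma> \<Gamma>')) (exists_along \<C> B (display \<Gamma>' \<gamma>) x) =
    exists_along \<C> B (display P (len \<Delta>)) (Pull B (arrow P L \<Gamma>') x)"
  unfolding P_def L_def
proof (rule M.beck_chevalley[OF display_fibration[OF X(1,2)] canonical_pullback[OF X]])
  show "x \<in> carrier (Fibre B (Dom \<C> (display \<Gamma>' \<gamma>)))"
    unfolding M.HomD(2)[OF display_hom[OF X(1)]] by (rule x)
qed

lemma pull_arrow_hom:
  assumes "ctx \<Delta>" "ctx \<Gamma>" "sub \<Delta> t \<Gamma>"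
  shows "lambda_boolean_hom l (Fib \<Gamma>) (Fib \<Delta>) (Pull B (arrow \<Delta> t \<Gamma>))"
  using F.pull_hom[OF M.HomD(1)[OF arrow_hom[OF assms]]]
  unfolding Dom_arrow[OF assms] Cod_arrow[OF assms] .

lemma interp_fsubst:
  "\<lbrakk>form \<Gamma> \<Phi>; ctx \<Delta>; sub \<Delta> t \<Gamma>\<rbrakk> \<Longrightarrow>
    interp (fsubst \<Phi> (len \<Delta>) t) \<Delta> = Pull B (arrow \<Delta> t \<Gamma>) (interp \<Phi> \<Gamma>)"
proof (induction arbitrary: \<Delta> t rule: formula.induct)
  case (top \<Gamma>)
  then have "ctx \<Gamma>" by (simp add: is_context_iff)
  from pull_arrow_hom[OF top.prems(1) this top.prems(2)] show ?case by (simp add: lambda_boolean_hom_def)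
next
  case (bot \<Gamma>)
  then have "ctx \<Gamma>" by (simp add: is_context_iff)
  from pull_arrow_hom[OF bot.prems(1) this bot.prems(2)] show ?case by (simp add: lambda_boolean_hom_def)
next
  case (neg \<Gamma> \<Phi>)
  note c = form_ctx[OF neg.hyps]
  show ?case
    using lambda_boolean_hom_complement[OF Fib_boolean[OF c] Fib_boolean[OF neg.prems(1)]
        pull_arrow_hom[OF neg.prems(1) c neg.prems(2)] interp_closed[OF neg.hyps]] neg.IH[OF neg.prems] by simp
next
  case (disj \<Gamma> \<Phi>)
  then have c: "ctx \<Gamma>" by (simp add: is_context_iff)
  let ?A = "(\<lambda>\<phi>. interp \<phi> \<Gamma>) ` ran \<Phi>"
  have "ran (map_option (\<lambda>\<phi>. fsubst \<phi> (len \<Delta>) t) \<circ> \<Phi>) = (\<lambda>\<phi>. fsubst \<phi> (len \<Delta>) t) ` ran \<Phi>"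
    by (auto simp: ran_def)
  then have img: "(\<lambda>\<phi>. interp \<phi> \<Delta>) ` ran (map_option (\<lambda>\<phi>. fsubst \<phi> (len \<Delta>) t) \<circ> \<Phi>) = Pull B (arrow \<Delta> t \<Gamma>) ` ?A"
    using disj.IH[OF _ disj.prems] by (auto simp: image_image ran_def intro!: image_cong)
  have A: "?A \<subseteq> carrier (Fib \<Gamma>)" by (rule interp_image_carrier[OF disj.hyps(3)])
  show ?case unfolding fsubst.simps interp.simps ran_interp img
    by (rule lambda_boolean_hom_sup[OF pull_arrow_hom[OF disj.prems(1) c disj.prems(2)] A
          card_ran[OF disj.hyps(2)], symmetric])
next
  case (conj \<Gamma> \<Phi>)
  then have c: "ctx \<Gamma>" by (simp add: is_context_iff)
  let ?A = "(\<lambda>\<phi>. interp \<phi> \<Gamma>) ` ran \<Phi>"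
  have "ran (map_option (\<lambda>\<phi>. fsubst \<phi> (len \<Delta>) t) \<circ> \<Phi>) = (\<lambda>\<phi>. fsubst \<phi> (len \<Delta>) t) ` ran \<Phi>"
    by (auto simp: ran_def)
  then have img: "(\<lambda>\<phi>. interp \<phi> \<Delta>) ` ran (map_option (\<lambda>\<phi>. fsubst \<phi> (len \<Delta>) t) \<circ> \<Phi>) = Pull B (arrow \<Delta> t \<Gamma>) ` ?A"
    using conj.IH[OF _ conj.prems] by (auto simp: image_image ran_def intro!: image_cong)
  have A: "?A \<subseteq> carrier (Fib \<Gamma>)" by (rule interp_image_carrier[OF conj.hyps(3)])
  show ?case unfolding fsubst.simps interp.simps ran_interp img
    by (rule lambda_boolean_hom_small_meet[OF Fib_boolean[OF c] Fib_boolean[OF conj.prems(1)]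
        pull_arrow_hom[OF conj.prems(1) c conj.prems(2)] A card_ran[OF conj.hyps(2)], symmetric])
next
  case (ex \<Gamma>' \<gamma> \<Phi>)
  then have X: "ctx \<Gamma>'" "\<gamma> \<le> len \<Gamma>'" "ctx \<Delta>" "sub \<Delta> t (init_seg \<gamma> \<Gamma>')" by (auto simp: is_context_iff)
  note P = pullback_ctx[OF X] less_len_pullback[OF X(1) ex.hyps(2) X(3,4)]
  show ?case
    unfolding fsubst_quantifier[OF X] interp_quantifier[OF X(1) ex.hyps(2)]
      interp_quantifier[OF P, unfolded init_pullback[OF X]] ex.IH[OF P(1) lift_sub[OF X]]
    by (rule beck_chevalley_display[OF X interp_closed[OF ex.hyps(3)], unfolded init_pullback[OF X], symmetric])
next
  case (all \<Gamma>' \<gamma> \<Phi>)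
  then have X: "ctx \<Gamma>'" "\<gamma> \<le> len \<Gamma>'" "ctx \<Delta>" "sub \<Delta> t (init_seg \<gamma> \<Gamma>')" by (auto simp: is_context_iff)
  note P = pullback_ctx[OF X] less_len_pullback[OF X(1) all.hyps(2) X(3,4)]
  interpret G: lambda_boolean "Fib \<Gamma>'" l by (rule Fib_locale[OF X(1)])
  note ic = interp_closed[OF all.hyps(3)]
  note nc = G.complement_closed[OF ic]
  \<comment> \<open>Complements pass through both pullbacks, which reduces the claim to
    Beck-Chevalley for the complement of the value of the body.\<close>
  show ?case
    unfolding fsubst_quantifier[OF X] interp_quantifier[OF X(1) all.hyps(2)]
      interp_quantifier[OF P, unfolded init_pullback[OF X]] all.IH[OF P(1) lift_sub[OF X]]
      lambda_boolean_hom_complement[OF Fib_boolean[OF X(1)] Fib_boolean[OF P(1)]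
        pull_arrow_hom[OF P(1) X(1) lift_sub[OF X]] ic, symmetric]
      lambda_boolean_hom_complement[OF Fib_boolean[OF ctx_init[OF X(1)]] Fib_boolean[OF X(3)]
        pull_arrow_hom[OF X(3) ctx_init[OF X(1)] X(4)] exists_display_closed[OF X(1,2) nc]]
      beck_chevalley_display[OF X nc, unfolded init_pullback[OF X]] ..
qed

text \<open>The value is computed from a context, not from its class. Two representatives are
  connected by an arrow that is the identity of the class, and pulling back along it changes
  nothing.\<close>

lemma interp_convert:
  assumes f: "form \<Gamma> \<Phi>" and r: "(\<Gamma>, \<Gamma>') \<in> context_rel T"
  shows "interp \<Phi> \<Gamma>' = interp \<Phi> \<Gamma>"
proof -
  note c = context_rel_ctx[OF r]
  have "arrow \<Gamma>' (vars \<Gamma>) \<Gamma> = arrow \<Gamma> (vars \<Gamma>) \<Gamma>"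
    by (rule arrow_eqI[OF context_rel_sym[OF r] context_rel_refl[OF c(1)] sub_refl[OF context_rel_vars_sub[OF r]]])
  then have "arrow \<Gamma>' (vars \<Gamma>) \<Gamma> = Ide \<C> (cls \<Gamma>)" using Ide_cls[OF c(1)] by simp
  then show ?thesis
    using interp_fsubst[OF f c(2) context_rel_vars_sub[OF r]] fsubst_vars[OF f] c(4)
      F.pull_ide[OF Obj_cls[OF c(1)] interp_closed[OF f]] by simp
qed

lemma interp_weaken:
  "\<lbrakk>ctx \<Gamma>'; form (init_seg \<gamma> \<Gamma>') \<Phi>\<rbrakk> \<Longrightarrow>
    interp (weaken \<Gamma>' \<gamma> \<Phi>) \<Gamma>' = Pull B (display \<Gamma>' \<gamma>) (interp \<Phi> (init_seg \<gamma> \<Gamma>'))"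
  unfolding weaken_def by (rule interp_fsubst[OF _ _ display_sub])

lemma interp_binary:
  assumes f: "form \<Gamma> \<Phi>" "form \<Gamma> \<Psi>" and ij: "i \<noteq> j"
  shows "interp (FDisj [i \<mapsto> \<Phi>, j \<mapsto> \<Psi>]) \<Gamma> = interp \<Phi> \<Gamma> \<squnion>\<^bsub>Fib \<Gamma>\<^esub> interp \<Psi> \<Gamma>"
    and "interp (FConj [i \<mapsto> \<Phi>, j \<mapsto> \<Psi>]) \<Gamma> = interp \<Phi> \<Gamma> \<sqinter>\<^bsub>Fib \<Gamma>\<^esub> interp \<Psi> \<Gamma>"
proof -
  interpret lambda_boolean "Fib \<Gamma>" l by (rule Fib_locale[OF form_ctx[OF f(1)]])
  have img: "(\<lambda>\<phi>. interp \<phi> \<Gamma>) ` {\<Phi>, \<Psi>} = {interp \<Phi> \<Gamma>, interp \<Psi> \<Gamma>}" by simp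
  note i = interp_closed[OF f(1)] interp_closed[OF f(2)]
  show "interp (FDisj [i \<mapsto> \<Phi>, j \<mapsto> \<Psi>]) \<Gamma> = interp \<Phi> \<Gamma> \<squnion>\<^bsub>Fib \<Gamma>\<^esub> interp \<Psi> \<Gamma>"
    unfolding interp.simps ran_interp ran_pair[OF ij] img join_def ..
  have s: "{interp \<Phi> \<Gamma>, interp \<Psi> \<Gamma>} \<subseteq> carrier (Fib \<Gamma>)" using i by simp
  show "interp (FConj [i \<mapsto> \<Phi>, j \<mapsto> \<Psi>]) \<Gamma> = interp \<Phi> \<Gamma> \<sqinter>\<^bsub>Fib \<Gamma>\<^esub> interp \<Psi> \<Gamma>"
    unfolding interp.simps ran_interp ran_pair[OF ij] img meet_def
    by (rule small_meet_eqI[OF s finite_less_l inf_of_two_greatest[OF i], unfolded small_meet_def]) simp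
qed

text \<open>Complementation turns the left adjoint into a right adjoint: writing \<open>p\<close>
  for the pullback and - for complements, a \<le> -(\<exists>(-b)) iff \<exists>(-b) \<le> -a iff -b
  \<le> p(-a) = -p(a) iff p(a) \<le> b.\<close>

lemma interp_all_le_iff:
  assumes c: "ctx \<Gamma>'" and less: "\<gamma> < len \<Gamma>'" and f: "form \<Gamma>' \<Psi>" and g: "form (init_seg \<gamma> \<Gamma>') \<Phi>"
  shows "interp \<Phi> (init_seg \<gamma> \<Gamma>') \<sqsubseteq>\<^bsub>Fib (init_seg \<gamma> \<Gamma>')\<^esub> interp (FAll (tail_seg \<gamma> \<Gamma>') \<Psi>) (init_seg \<gamma> \<Gamma>') \<longleftrightarrow>
    interp (weaken \<Gamma>' \<gamma> \<Phi>) \<Gamma>' \<sqsubseteq>\<^bsub>Fib \<Gamma>'\<^esub> interp \<Psi> \<Gamma>'"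
proof -
  interpret G: lambda_boolean "Fib \<Gamma>'" l by (rule Fib_locale[OF c])
  interpret I: lambda_boolean "Fib (init_seg \<gamma> \<Gamma>')" l by (rule Fib_locale[OF ctx_init[OF c]])
  note le = less_imp_le[OF less]
  note i = interp_closed[OF f] interp_closed[OF g]
  let ?a = "interp \<Phi> (init_seg \<gamma> \<Gamma>')" and ?b = "interp \<Psi> \<Gamma>'"
  let ?p = "Pull B (display \<Gamma>' \<gamma>)" and ?X = "exists_along \<C> B (display \<Gamma>' \<gamma>) (complement (Fib \<Gamma>') ?b)"
  note nb = G.complement_closed[OF i(1)] and na = I.complement_closed[OF i(2)]
  note X = exists_display_closed[OF c le nb]
  have pa: "?p ?a \<in> carrier (Fib \<Gamma>')" by (rule F.pull_closed[OF display_hom[OF c] i(2)])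
  have pn: "?p (complement (Fib (init_seg \<gamma> \<Gamma>')) ?a) = complement (Fib \<Gamma>') (?p ?a)"
    by (rule lambda_boolean_hom_complement[OF Fib_boolean[OF ctx_init[OF c]] Fib_boolean[OF c]
        pull_arrow_hom[OF c ctx_init[OF c] display_sub[OF c]] i(2)])
  have "?a \<sqsubseteq>\<^bsub>Fib (init_seg \<gamma> \<Gamma>')\<^esub> complement (Fib (init_seg \<gamma> \<Gamma>')) ?X \<longleftrightarrow>
      ?X \<sqsubseteq>\<^bsub>Fib (init_seg \<gamma> \<Gamma>')\<^esub> complement (Fib (init_seg \<gamma> \<Gamma>')) ?a"
    using I.complement_antitone[OF i(2) I.complement_closed[OF X]] I.complement_antitone[OF X na]
      I.complement_complement[OF i(2)] I.complement_complement[OF X] by auto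
  also have "\<dots> \<longleftrightarrow> complement (Fib \<Gamma>') ?b \<sqsubseteq>\<^bsub>Fib \<Gamma>'\<^esub> complement (Fib \<Gamma>') (?p ?a)"
    unfolding pn[symmetric] by (rule exists_display_le[OF c le nb na])
  also have "\<dots> \<longleftrightarrow> ?p ?a \<sqsubseteq>\<^bsub>Fib \<Gamma>'\<^esub> ?b"
    using G.complement_antitone[OF nb G.complement_closed[OF pa]] G.complement_antitone[OF pa i(1)]
      G.complement_complement[OF i(1)] G.complement_complement[OF pa] by auto
  finally show ?thesis unfolding interp_quantifier[OF c less] interp_weaken[OF c g] .
qed

section \<open>Soundness of the calculus\<close>

theorem soundness: "prov \<Gamma> \<Phi> \<Psi> \<Longrightarrow> interp \<Phi> \<Gamma> \<sqsubseteq>\<^bsub>Fib \<Gamma>\<^esub> interp \<Psi> \<Gamma>"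
proof (induction rule: provable.induct)
  case (pv_refl \<Gamma> \<Phi>)
  interpret lambda_boolean "Fib \<Gamma>" l by (rule Fib_locale[OF form_ctx[OF pv_refl]])
  show ?case using interp_closed[OF pv_refl] by simp
next
  case (pv_trans \<Gamma> \<Phi> \<Psi> \<Theta>)
  note f = prov_form[OF pv_trans.hyps(1)] prov_form[OF pv_trans.hyps(2)]
  interpret lambda_boolean "Fib \<Gamma>" l by (rule Fib_locale[OF form_ctx]) (use f in blast)
  show ?case using le_trans[OF pv_trans.IH] interp_closed f by blast
next
  case (pv_top \<Gamma> \<Phi>)
  interpret lambda_boolean "Fib \<Gamma>" l by (rule Fib_locale[OF form_ctx[OF pv_top]])
  show ?case using interp_closed[OF pv_top] by simp
next
  case (pv_bot \<Gamma> \<Phi>)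
  interpret lambda_boolean "Fib \<Gamma>" l by (rule Fib_locale[OF form_ctx[OF pv_bot]])
  show ?case using interp_closed[OF pv_bot] by simp
next
  case (pv_contradiction \<Gamma> \<Phi> i j)
  note f = pv_contradiction(1)
  interpret lambda_boolean "Fib \<Gamma>" l by (rule Fib_locale[OF form_ctx[OF f]])
  have n: "form \<Gamma> (FNeg \<Phi>)" using f by (simp add: form_neg_iff)
  show ?case unfolding interp_binary(2)[OF f n pv_contradiction(2)]
    using meet_complement[OF interp_closed[OF f]] by simp
next
  case (pv_excluded_middle \<Gamma> \<Phi> i j)
  note f = pv_excluded_middle(1)
  interpret lambda_boolean "Fib \<Gamma>" l by (rule Fib_locale[OF form_ctx[OF f]])
  have n: "form \<Gamma> (FNeg \<Phi>)" using f by (simp add: form_neg_iff)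
  show ?case unfolding interp_binary(1)[OF f n pv_excluded_middle(2)]
    using join_complement[OF interp_closed[OF f]] by simp
next
  case (pv_distrib \<Gamma> \<Phi> \<Psi> \<Theta> i j)
  note f = pv_distrib(1-3) and ij = pv_distrib(4)
  interpret lambda_boolean "Fib \<Gamma>" l by (rule Fib_locale[OF form_ctx[OF f(1)]])
  note c = interp_closed[OF f(1)] interp_closed[OF f(2)] interp_closed[OF f(3)]
  show ?case
    unfolding interp_binary(2)[OF f(1) form_binary(2)[OF f(2,3)] ij] interp_binary(1)[OF f(2,3) ij]
      interp_binary(1)[OF form_binary(1)[OF f(1,2)] form_binary(1)[OF f(1,3)] ij]
      interp_binary(2)[OF f(1,2) ij] interp_binary(2)[OF f(1,3) ij] distrib[OF c]
    using c by simp
next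
  case (pv_disj_left \<Gamma> \<Phi> \<Psi>)
  interpret lambda_boolean "Fib \<Gamma>" l by (rule Fib_locale[OF form_ctx[OF pv_disj_left(2)]])
  have d: "|dom \<Phi>| <o l" and fi: "\<And>i \<phi>. \<Phi> i = Some \<phi> \<Longrightarrow> form \<Gamma> \<phi>"
    using pv_disj_left(1) by (auto simp: form_disj_iff)
  have A: "(\<lambda>\<phi>. interp \<phi> \<Gamma>) ` ran \<Phi> \<subseteq> carrier (Fib \<Gamma>)" by (rule interp_image_carrier) (rule fi)
  show ?case unfolding interp.simps ran_interp
    by (rule sup_le[OF A card_ran[OF d] interp_closed[OF pv_disj_left(2)]])
      (use pv_disj_left.IH in \<open>auto simp: ran_def\<close>)
next
  case (pv_disj_inv \<Gamma> \<Phi> \<Psi> i \<phi>)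
  have f: "form \<Gamma> (FDisj \<Phi>)" "form \<Gamma> \<Psi>" using prov_form[OF pv_disj_inv(1)] by auto
  interpret lambda_boolean "Fib \<Gamma>" l by (rule Fib_locale[OF form_ctx[OF f(1)]])
  have d: "|dom \<Phi>| <o l" and fi: "\<And>i \<phi>. \<Phi> i = Some \<phi> \<Longrightarrow> form \<Gamma> \<phi>"
    using f(1) by (auto simp: form_disj_iff)
  have A: "(\<lambda>\<phi>. interp \<phi> \<Gamma>) ` ran \<Phi> \<subseteq> carrier (Fib \<Gamma>)" by (rule interp_image_carrier) (rule fi)
  have "interp \<phi> \<Gamma> \<sqsubseteq>\<^bsub>Fib \<Gamma>\<^esub> interp (FDisj \<Phi>) \<Gamma>"
    unfolding interp.simps ran_interp
    by (rule sup_upper[OF A card_ran[OF d] imageI[OF ranI[of \<Phi>, OF pv_disj_inv(2)]]])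
  then show ?case
    by (rule le_trans[OF _ pv_disj_inv.IH interp_closed[OF fi[OF pv_disj_inv(2)]] interp_closed[OF f(1)]
          interp_closed[OF f(2)]])
next
  case (pv_conj_right \<Gamma> \<Phi> \<Psi>)
  interpret lambda_boolean "Fib \<Gamma>" l by (rule Fib_locale[OF form_ctx[OF pv_conj_right(2)]])
  have d: "|dom \<Phi>| <o l" and fi: "\<And>i \<phi>. \<Phi> i = Some \<phi> \<Longrightarrow> form \<Gamma> \<phi>"
    using pv_conj_right(1) by (auto simp: form_conj_iff)
  have A: "(\<lambda>\<phi>. interp \<phi> \<Gamma>) ` ran \<Phi> \<subseteq> carrier (Fib \<Gamma>)" by (rule interp_image_carrier) (rule fi)
  show ?case unfolding interp.simps ran_interp
    by (rule small_meet_greatest[OF A card_ran[OF d] interp_closed[OF pv_conj_right(2)], unfolded small_meet_def])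
      (use pv_conj_right.IH in \<open>auto simp: ran_def\<close>)
next
  case (pv_conj_inv \<Gamma> \<Psi> \<Phi> i \<phi>)
  have f: "form \<Gamma> (FConj \<Phi>)" "form \<Gamma> \<Psi>" using prov_form[OF pv_conj_inv(1)] by auto
  interpret lambda_boolean "Fib \<Gamma>" l by (rule Fib_locale[OF form_ctx[OF f(1)]])
  have d: "|dom \<Phi>| <o l" and fi: "\<And>i \<phi>. \<Phi> i = Some \<phi> \<Longrightarrow> form \<Gamma> \<phi>"
    using f(1) by (auto simp: form_conj_iff)
  have A: "(\<lambda>\<phi>. interp \<phi> \<Gamma>) ` ran \<Phi> \<subseteq> carrier (Fib \<Gamma>)" by (rule interp_image_carrier) (rule fi)
  have "interp (FConj \<Phi>) \<Gamma> \<sqsubseteq>\<^bsub>Fib \<Gamma>\<^esub> interp \<phi> \<Gamma>"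
    unfolding interp.simps ran_interp
    by (rule small_meet_lower[OF A card_ran[OF d] imageI[OF ranI[of \<Phi>, OF pv_conj_inv(2)]], unfolded small_meet_def])
  then show ?case
    by (rule le_trans[OF pv_conj_inv.IH _ interp_closed[OF f(2)] interp_closed[OF f(1)]
          interp_closed[OF fi[OF pv_conj_inv(2)]]])
next
  case (pv_ex_left \<Gamma>' \<gamma> \<Psi> \<Phi>)
  then have c: "ctx \<Gamma>'" by (simp add: is_context_iff)
  note f = pv_ex_left.hyps(3,4)
  show ?case
    using pv_ex_left.IH
    unfolding interp_quantifier[OF c pv_ex_left.hyps(2)] interp_weaken[OF c f(2)]
      exists_display_le[OF c less_imp_le[OF pv_ex_left.hyps(2)] interp_closed[OF f(1)] interp_closed[OF f(2)]] .
next
  case (pv_ex_inv \<Gamma>' \<gamma> \<Psi> \<Phi>)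
  then have c: "ctx \<Gamma>'" by (simp add: is_context_iff)
  note f = pv_ex_inv.hyps(3,4)
  show ?case
    using pv_ex_inv.IH
    unfolding interp_quantifier[OF c pv_ex_inv.hyps(2)] interp_weaken[OF c f(2)]
      exists_display_le[OF c less_imp_le[OF pv_ex_inv.hyps(2)] interp_closed[OF f(1)] interp_closed[OF f(2)]] .
next
  case (pv_all_right \<Gamma>' \<gamma> \<Psi> \<Phi>)
  then have c: "ctx \<Gamma>'" by (simp add: is_context_iff)
  show ?case using pv_all_right.IH unfolding interp_all_le_iff[OF c pv_all_right.hyps(2-4)] .
next
  case (pv_all_inv \<Gamma>' \<gamma> \<Psi> \<Phi>)
  then have c: "ctx \<Gamma>'" by (simp add: is_context_iff)
  show ?case using pv_all_inv.IH unfolding interp_all_le_iff[OF c pv_all_inv.hyps(2-4)] .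
next
  case (pv_subst \<Gamma> \<Phi> \<Psi> \<Delta> t)
  then have m: "ctx \<Delta>" "ctx \<Gamma>" "sub \<Delta> t \<Gamma>" by (auto simp: morphism_iff)
  have f: "form \<Gamma> \<Phi>" "form \<Gamma> \<Psi>" using prov_form[OF pv_subst(1)] by auto
  show ?case unfolding interp_fsubst[OF f(1) m(1,3)] interp_fsubst[OF f(2) m(1,3)]
    by (rule F.pull_mono[OF arrow_hom[OF m] interp_closed[OF f(1)] interp_closed[OF f(2)] pv_subst.IH])
qed

section \<open>Initiality\<close>

text \<open>Restricted in both arguments because morphisms are required to be extensional. The
  choice runs over representatives of the context class and of the formula class at once.\<close>

definition eval_class :: "('s, 'k) premise set \<Rightarrow> ('s, 'k, 'l) fm set \<Rightarrow> 'b" where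
  "eval_class = (\<lambda>X \<in> Obj \<C>. \<lambda>x \<in> carrier (Fibre \<L> X).
     SOME y. \<exists>\<Gamma> \<Phi>. X = cls \<Gamma> \<and> form \<Gamma> \<Phi> \<and> x = fcls \<Gamma> \<Phi> \<and> y = interp \<Phi> \<Gamma>)"

text \<open>The value does not depend on the formula by soundness in both directions, nor on the
  context by \<open>interp_convert\<close>.\<close>

lemma eval_class_fcls:
  assumes f: "form \<Gamma> \<Phi>"
  shows "eval_class (cls \<Gamma>) (fcls \<Gamma> \<Phi>) = interp \<Phi> \<Gamma>"
proof -
  note c = form_ctx[OF f]
  interpret lambda_boolean "Fib \<Gamma>" l by (rule Fib_locale[OF c])
  have "(SOME y. \<exists>\<Gamma>' \<Phi>'. cls \<Gamma> = cls \<Gamma>' \<and> form \<Gamma>' \<Phi>' \<and> fcls \<Gamma> \<Phi> = fcls \<Gamma>' \<Phi>' \<and> y = interp \<Phi>' \<Gamma>') = interp \<Phi> \<Gamma>"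
  proof (rule some_equality)
    show "\<exists>\<Gamma>' \<Phi>'. cls \<Gamma> = cls \<Gamma>' \<and> form \<Gamma>' \<Phi>' \<and> fcls \<Gamma> \<Phi> = fcls \<Gamma>' \<Phi>' \<and> interp \<Phi> \<Gamma> = interp \<Phi>' \<Gamma>'"
      by (rule exI[of _ \<Gamma>], rule exI[of _ \<Phi>]) (simp add: f)
  next
    fix y assume "\<exists>\<Gamma>' \<Phi>'. cls \<Gamma> = cls \<Gamma>' \<and> form \<Gamma>' \<Phi>' \<and> fcls \<Gamma> \<Phi> = fcls \<Gamma>' \<Phi>' \<and> y = interp \<Phi>' \<Gamma>'"
    then obtain \<Gamma>' \<Phi>' where *: "cls \<Gamma> = cls \<Gamma>'" "form \<Gamma>' \<Phi>'" "fcls \<Gamma> \<Phi> = fcls \<Gamma>' \<Phi>'" "y = interp \<Phi>' \<Gamma>'"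
      by (elim exE conjE)
    have r: "(\<Gamma>', \<Gamma>) \<in> context_rel T"
      using cls_eq_iff[OF form_ctx[OF *(2)] c] *(1) by simp
    have f': "form \<Gamma> \<Phi>'" by (rule form_convert[OF *(2) r])
    have "fcls \<Gamma> \<Phi> = fcls \<Gamma> \<Phi>'" using *(3) unfolding *(1)[symmetric] .
    then have p: "prov \<Gamma> \<Phi> \<Phi>'" "prov \<Gamma> \<Phi>' \<Phi>" unfolding fcls_eq_iff[OF f f'] by auto
    have "interp \<Phi>' \<Gamma> = interp \<Phi> \<Gamma>"
      by (rule le_antisym[OF soundness[OF p(2)] soundness[OF p(1)] interp_closed[OF f'] interp_closed[OF f]])
    then show "y = interp \<Phi> \<Gamma>" using interp_convert[OF *(2) r] *(4) by simp
  qed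
  then show ?thesis unfolding eval_class_def restrict_apply'[OF Obj_cls[OF c]] restrict_apply'[OF LindI[OF f]] .
qed

lemma eval_class_closed:
  assumes "X \<in> Obj \<C>" "x \<in> carrier (Fibre \<L> X)"
  shows "eval_class X x \<in> carrier (Fibre B X)"
proof -
  obtain \<Gamma> where G: "ctx \<Gamma>" "X = cls \<Gamma>" using assms(1) by (rule ObjE)
  obtain \<Phi> where p: "form \<Gamma> \<Phi>" "x = fcls \<Gamma> \<Phi>" using assms(2) G(1) unfolding G(2) by (rule LindE)
  show ?thesis unfolding G(2) p(2) eval_class_fcls[OF p(1)] by (rule interp_closed[OF p(1)])
qed

lemma eval_class_natural:
  assumes f: "f \<in> Hom \<C> X Y" and x: "x \<in> carrier (Fibre \<L> Y)"
  shows "eval_class X (Pull \<L> f x) = Pull B f (eval_class Y x)"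
proof -
  obtain \<Gamma> \<Omega> where o: "ctx \<Gamma>" "ctx \<Omega>" "X = cls \<Gamma>" "Y = cls \<Omega>" using Hom_ctx[OF f] .
  obtain t where t: "sub \<Gamma> t \<Omega>" "f = arrow \<Gamma> t \<Omega>" using hom_obtain[OF f[unfolded o(3,4)] o(1,2)] .
  obtain \<Phi> where p: "form \<Omega> \<Phi>" "x = fcls \<Omega> \<Phi>" using x o(2) unfolding o(4) by (rule LindE)
  show ?thesis
    unfolding o(3,4) t(2) p(2) Pull_Lind[OF o(1,2) t(1) p(1)] eval_class_fcls[OF p(1)]
      eval_class_fcls[OF form_subst[OF p(1) o(1) t(1)]] by (rule interp_fsubst[OF p(1) o(1) t(1)])
qed

lemma eval_class_hom:
  assumes c: "ctx \<Gamma>"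
  shows "lambda_boolean_hom l (Lind \<Gamma>) (Fib \<Gamma>) (eval_class (cls \<Gamma>))"
  unfolding lambda_boolean_hom_def
proof (intro conjI ballI allI impI)
  obtain i j :: 'l where ij: "i \<noteq> j" using two_indices by blast
  show "eval_class (cls \<Gamma>) \<in> carrier (Lind \<Gamma>) \<rightarrow> carrier (Fib \<Gamma>)"
    using eval_class_closed[OF Obj_cls[OF c]] by (rule funcsetI)
  show "eval_class (cls \<Gamma>) \<top>\<^bsub>Lind \<Gamma>\<^esub> = \<top>\<^bsub>Fib \<Gamma>\<^esub>"
    unfolding top_Lind[OF c] eval_class_fcls[OF form_top[OF c]] by simp
  show "eval_class (cls \<Gamma>) \<bottom>\<^bsub>Lind \<Gamma>\<^esub> = \<bottom>\<^bsub>Fib \<Gamma>\<^esub>"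
    unfolding bot_Lind[OF c] eval_class_fcls[OF form_bot[OF c]] by simp
  fix x y assume x: "x \<in> carrier (Lind \<Gamma>)" and y: "y \<in> carrier (Lind \<Gamma>)"
  obtain \<Phi> where p: "form \<Gamma> \<Phi>" "x = fcls \<Gamma> \<Phi>" using x c by (rule LindE)
  obtain \<Psi> where q: "form \<Gamma> \<Psi>" "y = fcls \<Gamma> \<Psi>" using y c by (rule LindE)
  show "eval_class (cls \<Gamma>) (x \<sqinter>\<^bsub>Lind \<Gamma>\<^esub> y) = eval_class (cls \<Gamma>) x \<sqinter>\<^bsub>Fib \<Gamma>\<^esub> eval_class (cls \<Gamma>) y"
    unfolding p(2) q(2) meet_Lind[OF p(1) q(1) ij] eval_class_fcls[OF p(1)] eval_class_fcls[OF q(1)]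
      eval_class_fcls[OF form_binary(1)[OF p(1) q(1)]] by (rule interp_binary(2)[OF p(1) q(1) ij])
  show "eval_class (cls \<Gamma>) (x \<squnion>\<^bsub>Lind \<Gamma>\<^esub> y) = eval_class (cls \<Gamma>) x \<squnion>\<^bsub>Fib \<Gamma>\<^esub> eval_class (cls \<Gamma>) y"
    unfolding p(2) q(2) join_Lind[OF p(1) q(1) ij] eval_class_fcls[OF p(1)] eval_class_fcls[OF q(1)]
      eval_class_fcls[OF form_binary(2)[OF p(1) q(1)]] by (rule interp_binary(1)[OF p(1) q(1) ij])
next
  fix A assume A: "A \<subseteq> carrier (Lind \<Gamma>)" "|A| <o l"
  obtain \<Phi> where \<Phi>: "form \<Gamma> (FDisj \<Phi>)" "fcls \<Gamma> ` ran \<Phi> = A" using small_family[OF A c] .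
  have "eval_class (cls \<Gamma>) (fcls \<Gamma> \<phi>) = interp \<phi> \<Gamma>" if "\<phi> \<in> ran \<Phi>" for \<phi>
    by (rule eval_class_fcls) (use \<Phi>(1) that in \<open>auto simp: form_disj_iff ran_def\<close>)
  then have "eval_class (cls \<Gamma>) ` fcls \<Gamma> ` ran \<Phi> = (\<lambda>\<phi>. interp \<phi> \<Gamma>) ` ran \<Phi>"
    unfolding image_image by (rule image_cong[OF refl])
  then show "eval_class (cls \<Gamma>) (\<Squnion>\<^bsub>Lind \<Gamma>\<^esub>A) = \<Squnion>\<^bsub>Fib \<Gamma>\<^esub>(eval_class (cls \<Gamma>) ` A)"
    unfolding \<Phi>(2)[symmetric] sup_Lind[OF \<Phi>(1)] eval_class_fcls[OF \<Phi>(1)] interp.simps ran_interp by simp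
qed

lemma interp_quantify:
  assumes f: "form \<Gamma>' \<Phi>" and le: "\<gamma> \<le> len \<Gamma>'"
  shows "interp (quantify \<gamma> \<Gamma>' \<Phi>) (init_seg \<gamma> \<Gamma>') = exists_along \<C> B (display \<Gamma>' \<gamma>) (interp \<Phi> \<Gamma>')"
proof (cases "\<gamma> < len \<Gamma>'")
  case True
  then show ?thesis using interp_quantifier(1)[OF form_ctx[OF f] True] by (simp add: quantify_def)
next
  case False
  note c = form_ctx[OF f]
  have i: "init_seg \<gamma> \<Gamma>' = \<Gamma>'" using False init_all[OF ctx_seq[OF c]] by simp
  have I: "arrow \<Gamma>' (vars \<Gamma>') \<Gamma>' = Ide \<C> (cls \<Gamma>')" by (rule Ide_cls[OF c, symmetric])
  note H = arrow_hom[OF c c vars_sub[OF c]]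
  \<comment> \<open>With an empty tail the display map is an identity, whose pullback has the
    identity function as left adjoint.\<close>
  have "exists_adjoint \<C> B (arrow \<Gamma>' (vars \<Gamma>') \<Gamma>') (\<lambda>z. z)"
    unfolding F.exists_adjoint_iff[OF H] using F.pull_ide[OF Obj_cls[OF c]] I by simp
  from F.exists_along_eq[OF H this interp_closed[OF f]] show ?thesis
    using False by (simp add: quantify_def i)
qed

lemma eval_class_morphism:
  "boolean_algebra_morphism \<C> (syntactic_fibrations T) l \<L> B eval_class"
  unfolding boolean_algebra_morphism_def
proof (intro conjI ballI)
  show "eval_class \<in> (\<Pi>\<^sub>E X \<in> Obj \<C>. carrier (Fibre \<L> X) \<rightarrow>\<^sub>E carrier (Fibre B X))"
  proof (rule PiE_I)
    fix X assume X: "X \<in> Obj \<C>"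
    show "eval_class X \<in> carrier (Fibre \<L> X) \<rightarrow>\<^sub>E carrier (Fibre B X)"
    proof (rule PiE_I)
      show "eval_class X x \<in> carrier (Fibre B X)" if "x \<in> carrier (Fibre \<L> X)" for x
        by (rule eval_class_closed[OF X that])
      show "eval_class X x = undefined" if "x \<notin> carrier (Fibre \<L> X)" for x
        unfolding eval_class_def restrict_apply'[OF X] using that by simp
    qed
  next
    show "eval_class X = undefined" if "X \<notin> Obj \<C>" for X using that by (simp add: eval_class_def)
  qed
  show "lambda_boolean_hom l (Fibre \<L> X) (Fibre B X) (eval_class X)" if "X \<in> Obj \<C>" for X
    using that eval_class_hom by (auto elim!: ObjE)
  show "eval_class (Dom \<C> f) (Pull \<L> f x) = Pull B f (eval_class (Cod \<C> f) x)"
    if "f \<in> Arr \<C>" "x \<in> carrier (Fibre \<L> (Cod \<C> f))" for f x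
    by (rule eval_class_natural[OF M.arr_hom[OF that(1)] that(2)])
  fix \<pi> z assume \<pi>: "\<pi> \<in> syntactic_fibrations T" and z: "z \<in> carrier (Fibre \<L> (Dom \<C> \<pi>))"
  show "eval_class (Cod \<C> \<pi>) (exists_along \<C> \<L> \<pi> z) = exists_along \<C> B \<pi> (eval_class (Dom \<C> \<pi>) z)"
  proof (rule display_boolean_functor.morphism_exists_along[OF Lind_display_functor model[unfolded syntactic_fibrations_eq]
        eval_class_closed eval_class_natural _ \<pi>[unfolded syntactic_fibrations_eq] z])
    fix p A A' z assume p: "p \<in> display_maps T" and H: "p \<in> Hom \<C> A A'" and z: "z \<in> carrier (Fibre \<L> A)"
    obtain \<Gamma>' \<gamma> where P: "ctx \<Gamma>'" "\<gamma> \<le> len \<Gamma>'" "p = display \<Gamma>' \<gamma>" using p by (rule display_mapsE)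
    have A: "A = cls \<Gamma>'" "A' = cls (init_seg \<gamma> \<Gamma>')"
      using M.HomD[OF H] M.HomD[OF display_hom[OF P(1)]] P(3) by simp_all
    obtain \<Phi> where q: "form \<Gamma>' \<Phi>" "z = fcls \<Gamma>' \<Phi>" using z P(1) unfolding A by (rule LindE)
    show "eval_class A' (exists_along \<C> \<L> p z) = exists_along \<C> B p (eval_class A z)"
      unfolding A P(3) q(2) exists_display(2)[OF P(1,2) q(1)] eval_class_fcls[OF q(1)]
        eval_class_fcls[OF form_quantify[OF q(1) P(2)]] by (rule interp_quantify[OF q(1) P(2)])
  qed
qed

text \<open>Each clause of \<open>interp\<close> is forced: joins and existential quantifiers by
  assumption, negation by uniqueness of complements, conjunctions and universal quantifiers by
  writing them through the former.\<close>

lemma morphism_unique: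
  assumes h: "boolean_algebra_morphism \<C> (syntactic_fibrations T) l \<L> B h" and f: "form \<Gamma> \<Phi>"
  shows "h (cls \<Gamma>) (fcls \<Gamma> \<Phi>) = interp \<Phi> \<Gamma>"
  using f
proof (induction rule: formula.induct)
  have hom: "lambda_boolean_hom l (Lind \<Gamma>) (Fib \<Gamma>) (h (cls \<Gamma>))" if "ctx \<Gamma>" for \<Gamma>
    using h Obj_cls[OF that] unfolding boolean_algebra_morphism_def by simp
  have exists_pres: "h (cls (init_seg \<gamma> \<Gamma>')) (exists_along \<C> \<L> (display \<Gamma>' \<gamma>) z) = exists_along \<C> B (display \<Gamma>' \<gamma>) (h (cls \<Gamma>') z)"
    if "ctx \<Gamma>'" "\<gamma> \<le> len \<Gamma>'" "z \<in> carrier (Lind \<Gamma>')" for \<Gamma>' \<gamma> z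
  proof -
    have b: "z \<in> carrier (Fibre \<L> (Dom \<C> (display \<Gamma>' \<gamma>)))"
      unfolding M.HomD(2)[OF display_hom[OF that(1)]] by (rule that(3))
    have k: "\<forall>\<pi> \<in> syntactic_fibrations T. \<forall>z \<in> carrier (Fibre \<L> (Dom \<C> \<pi>)).
        h (Cod \<C> \<pi>) (exists_along \<C> \<L> \<pi> z) = exists_along \<C> B \<pi> (h (Dom \<C> \<pi>) z)"
      using h unfolding boolean_algebra_morphism_def by blast
    from k[rule_format, OF display_fibration[OF that(1,2)] b] show ?thesis
      unfolding M.HomD(2)[OF display_hom[OF that(1)]] M.HomD(3)[OF display_hom[OF that(1)]] .
  qed
  {
    case (top \<Gamma>)
    then have c: "ctx \<Gamma>" by (simp add: is_context_iff)
    show ?case using hom[OF c] unfolding lambda_boolean_hom_def top_Lind[OF c] by simp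
  next
    case (bot \<Gamma>)
    then have c: "ctx \<Gamma>" by (simp add: is_context_iff)
    show ?case using hom[OF c] unfolding lambda_boolean_hom_def bot_Lind[OF c] by simp
  next
    case (neg \<Gamma> \<Phi>)
    note c = form_ctx[OF neg.hyps]
    show ?case
      using lambda_boolean_hom_complement[OF Lind_boolean[OF c] Fib_boolean[OF c] hom[OF c] LindI[OF neg.hyps]]
      unfolding complement_Lind[OF neg.hyps] neg.IH by simp
  next
    case (disj \<Gamma> \<Phi>)
    then have c: "ctx \<Gamma>" by (simp add: is_context_iff)
    have f: "form \<Gamma> (FDisj \<Phi>)" by (rule formula.disj[OF disj.hyps])
    have A: "fcls \<Gamma> ` ran \<Phi> \<subseteq> carrier (Lind \<Gamma>)" by (rule image_ran_carrier[OF c disj.hyps(3)])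
    have img: "h (cls \<Gamma>) ` fcls \<Gamma> ` ran \<Phi> = (\<lambda>\<phi>. interp \<phi> \<Gamma>) ` ran \<Phi>"
      unfolding image_image using disj.IH by (intro image_cong) (auto simp: ran_def)
    have "h (cls \<Gamma>) (\<Squnion>\<^bsub>Lind \<Gamma>\<^esub>(fcls \<Gamma> ` ran \<Phi>)) = \<Squnion>\<^bsub>Fib \<Gamma>\<^esub>(h (cls \<Gamma>) ` fcls \<Gamma> ` ran \<Phi>)"
      using hom[OF c] A card_ran[OF disj.hyps(2)] unfolding lambda_boolean_hom_def by blast
    then show ?case unfolding sup_Lind[OF f] img interp.simps ran_interp .
  next
    case (conj \<Gamma> \<Phi>)
    then have c: "ctx \<Gamma>" by (simp add: is_context_iff)
    have f: "form \<Gamma> (FConj \<Phi>)" by (rule formula.conj[OF conj.hyps])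
    interpret L: lambda_boolean "Lind \<Gamma>" l by (rule lambda_booleanI[OF Lind_boolean[OF c]])
    have A: "fcls \<Gamma> ` ran \<Phi> \<subseteq> carrier (Lind \<Gamma>)" by (rule image_ran_carrier[OF c conj.hyps(3)])
    have img: "h (cls \<Gamma>) ` fcls \<Gamma> ` ran \<Phi> = (\<lambda>\<phi>. interp \<phi> \<Gamma>) ` ran \<Phi>"
      unfolding image_image using conj.IH by (intro image_cong) (auto simp: ran_def)
    \<comment> \<open>The class of a conjunction is the greatest lower bound, hence the De Morgan
      expression, which a homomorphism preserves.\<close>
    note m = L.small_meet_eqI[OF A card_ran[OF conj.hyps(2)] greatest_conj[OF f], unfolded L.small_meet_def]
    show ?case
      using lambda_boolean_hom_small_meet[OF Lind_boolean[OF c] Fib_boolean[OF c] hom[OF c] A card_ran[OF conj.hyps(2)]]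
      unfolding m img interp.simps ran_interp .
  next
    case (ex \<Gamma>' \<gamma> \<Phi>)
    then have c: "ctx \<Gamma>'" by (simp add: is_context_iff)
    note less = ex.hyps(2) and le = less_imp_le[OF ex.hyps(2)]
    show ?case
      using exists_pres[OF c le LindI[OF ex.hyps(3)]]
      unfolding exists_display(2)[OF c le ex.hyps(3)] ex.IH interp_quantifier[OF c less]
      by (simp add: quantify_def less)
  next
    case (all \<Gamma>' \<gamma> \<Phi>)
    then have c: "ctx \<Gamma>'" by (simp add: is_context_iff)
    note less = all.hyps(2) and le = less_imp_le[OF all.hyps(2)]
    note i = ctx_init[OF c]
    have n: "form \<Gamma>' (FNeg \<Phi>)" using all.hyps(3) by (simp add: form_neg_iff)
    have X: "form (init_seg \<gamma> \<Gamma>') (FEx (tail_seg \<gamma> \<Gamma>') (FNeg \<Phi>))" by (rule form_exI[OF c less n])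
    have "h (cls \<Gamma>') (fcls \<Gamma>' (FNeg \<Phi>)) = complement (Fib \<Gamma>') (interp \<Phi> \<Gamma>')"
      using lambda_boolean_hom_complement[OF Lind_boolean[OF c] Fib_boolean[OF c] hom[OF c] LindI[OF all.hyps(3)]]
      unfolding complement_Lind[OF all.hyps(3)] all.IH .
    then have "h (cls (init_seg \<gamma> \<Gamma>')) (fcls (init_seg \<gamma> \<Gamma>') (FEx (tail_seg \<gamma> \<Gamma>') (FNeg \<Phi>))) =
        exists_along \<C> B (display \<Gamma>' \<gamma>) (complement (Fib \<Gamma>') (interp \<Phi> \<Gamma>'))"
      using exists_pres[OF c le LindI[OF n]] unfolding exists_display(2)[OF c le n] by (simp add: quantify_def less)
    then show ?case
      using lambda_boolean_hom_complement[OF Lind_boolean[OF i] Fib_boolean[OF i] hom[OF i] LindI[OF X]]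
      unfolding complement_Lind[OF X] forall_via_exists[OF all.hyps(3) less] interp_quantifier[OF c less] by simp
  }
qed

theorem unique_morphism: "\<exists>!h. boolean_algebra_morphism \<C> (syntactic_fibrations T) l \<L> B h"
proof (rule ex1I)
  show "boolean_algebra_morphism \<C> (syntactic_fibrations T) l \<L> B eval_class" by (rule eval_class_morphism)
  fix h assume h: "boolean_algebra_morphism \<C> (syntactic_fibrations T) l \<L> B h"
  have ext: "k \<in> (\<Pi>\<^sub>E X \<in> Obj \<C>. carrier (Fibre \<L> X) \<rightarrow>\<^sub>E carrier (Fibre B X))"
    if "boolean_algebra_morphism \<C> (syntactic_fibrations T) l \<L> B k" for k
    using that unfolding boolean_algebra_morphism_def by blast
  show "h = eval_class"
  \<comment> \<open>Extensionality makes it enough to compare the maps on objects and carriers,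
    where every element is the class of a formula.\<close>
  proof (rule PiE_ext[OF ext[OF h] ext[OF eval_class_morphism]])
    fix X assume X: "X \<in> Obj \<C>"
    obtain \<Gamma> where G: "ctx \<Gamma>" "X = cls \<Gamma>" using X by (rule ObjE)
    show "h X = eval_class X"
    proof (rule PiE_ext[OF PiE_mem[OF ext[OF h] X] PiE_mem[OF ext[OF eval_class_morphism] X]])
      fix x assume "x \<in> carrier (Fibre \<L> X)"
      then obtain \<Phi> where p: "form \<Gamma> \<Phi>" "x = fcls \<Gamma> \<Phi>" using G(1) unfolding G(2) by (rule LindE)
      show "h X x = eval_class X x"
        unfolding G(2) p(2) morphism_unique[OF h p(1)] eval_class_fcls[OF p(1)] ..
    qed
  qed
qed

end

theorem theorem2p23:
  fixes T :: "('s, 'k::wellorder) pretheory" and l :: "'l rel"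
  assumes "regular_cardinal (type_order TYPE('k))"
    and "regular_cardinal l"
    and "generalized_algebraic_theory T"
  shows "boolean_algebra_over_clan (syntactic_category T) (syntactic_fibrations T) l (lindenbaum T l) \<and>
    (\<forall>B :: (('s, 'k) premise set, ('s, 'k) arrow set, 'b) bool_functor.
       boolean_algebra_over_clan (syntactic_category T) (syntactic_fibrations T) l B \<longrightarrow>
       (\<exists>!h. boolean_algebra_morphism (syntactic_category T) (syntactic_fibrations T) l
               (lindenbaum T l) B h))"
proof (intro conjI allI impI)
  interpret formula_theory T l
    using assms by unfold_locales
  show "boolean_algebra_over_clan (syntactic_category T) (syntactic_fibrations T) l (lindenbaum T l)"
    unfolding syntactic_fibrations_eq
    by (rule display_boolean_functor.boolean_algebra_over_iso_closure[OF Lind_display_functor])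
  fix B :: "(('s, 'k) premise set, ('s, 'k) arrow set, 'b) bool_functor"
  assume "boolean_algebra_over_clan (syntactic_category T) (syntactic_fibrations T) l B"
  then interpret clan_model T l B
    by (intro clan_model.intro clan_model_axioms.intro formula_theory_axioms)
  show "\<exists>!h. boolean_algebra_morphism (syntactic_category T) (syntactic_fibrations T) l (lindenbaum T l) B h"
    by (rule unique_morphism)
qed

end
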